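(* Let $\Omega$ be a domain in $\mathbb{R}^N$, $N\ge 2$, and let $g\in C(\mathbb{R})$ be nondecreasing with $g(0)\ge 0$ and satisfying the Keller–Osserman condition. Assume in addition that the equation $-\Delta u+g(u)=0$ in $\Omega$ possesses a subsolution. Then for every nonnegative $f\in L^1_{loc}(\Omega)$ the equation $-\Delta u+g(u)=f$ in $\Omega$ possesses a maximal solution, i.e. a solution $\bar u$ such that $U\le \bar u$ a.e. for every solution $U$ of this equation in $\Omega$.
   Context: The Keller–Osserman condition: for every $a>0$, $\int_a^\infty\big(\int_0^t g(s)\,ds\big)^{-1/2}dt<\infty$. A solution of $-\Delta u+g(u)=f$ in $\Omega$ (with $f\in L^1_{loc}(\Omega)$) is a function $u\in L^1_{loc}(\Omega)$ with $g(u)\in L^1_{loc}(\Omega)$ such that the equation holds in the sense of distributions. A subsolution (resp. supersolution) is a $u\in L^1_{loc}(\Omega)$ with $g(u)\in L^1_{loc}(\Omega)$ such that $-\Delta u+g(u)-f\le 0$ (resp. $\ge 0$) in the sense of distributions. *)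

theory Defs
  imports "HOL-Analysis.Analysis"
begin

fun dderiv :: "('a::euclidean_space \<Rightarrow> real) \<Rightarrow> 'a list \<Rightarrow> 'a \<Rightarrow> real" where
  "dderiv \<phi> [] = \<phi>"
| "dderiv \<phi> (v # vs) = (\<lambda>x. frechet_derivative (dderiv \<phi> vs) (at x) v)"

definition smooth_fun :: "('a::euclidean_space \<Rightarrow> real) \<Rightarrow> bool" where
  "smooth_fun \<phi> \<longleftrightarrow> (\<forall>vs x. dderiv \<phi> vs differentiable (at x))"

definition laplacian :: "('a::euclidean_space \<Rightarrow> real) \<Rightarrow> 'a \<Rightarrow> real" where
  "laplacian \<phi> x = (\<Sum>i\<in>Basis. dderiv \<phi> [i, i] x)"

definition test_fun :: "'a::euclidean_space set \<Rightarrow> ('a \<Rightarrow> real) \<Rightarrow> bool" where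
  "test_fun \<Omega> \<phi> \<longleftrightarrow> smooth_fun \<phi> \<and> compact (closure {x. \<phi> x \<noteq> 0})
      \<and> closure {x. \<phi> x \<noteq> 0} \<subseteq> \<Omega>"

definition loc_integrable :: "'a::euclidean_space set \<Rightarrow> ('a \<Rightarrow> real) \<Rightarrow> bool" where
  "loc_integrable \<Omega> f \<longleftrightarrow> (\<forall>K. compact K \<and> K \<subseteq> \<Omega> \<longrightarrow> set_integrable lebesgue K f)"

text \<open>The distribution -Delta u + g(u) - f applied to a test function phi.\<close>
definition op_pair :: "(real \<Rightarrow> real) \<Rightarrow> ('a::euclidean_space \<Rightarrow> real) \<Rightarrow> ('a \<Rightarrow> real)
    \<Rightarrow> ('a \<Rightarrow> real) \<Rightarrow> real" where
  "op_pair g f u \<phi> = (\<integral>x. (- u x * laplacian \<phi> x + g (u x) * \<phi> x - f x * \<phi> x) \<partial>lebesgue)"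

definition admissible :: "'a::euclidean_space set \<Rightarrow> (real \<Rightarrow> real) \<Rightarrow> ('a \<Rightarrow> real) \<Rightarrow> bool" where
  "admissible \<Omega> g u \<longleftrightarrow> loc_integrable \<Omega> u \<and> loc_integrable \<Omega> (\<lambda>x. g (u x))"

definition is_solution :: "'a::euclidean_space set \<Rightarrow> (real \<Rightarrow> real) \<Rightarrow> ('a \<Rightarrow> real)
    \<Rightarrow> ('a \<Rightarrow> real) \<Rightarrow> bool" where
  "is_solution \<Omega> g f u \<longleftrightarrow> admissible \<Omega> g u \<and>
     (\<forall>\<phi>. test_fun \<Omega> \<phi> \<longrightarrow> op_pair g f u \<phi> = 0)"

definition is_subsolution :: "'a::euclidean_space set \<Rightarrow> (real \<Rightarrow> real) \<Rightarrow> ('a \<Rightarrow> real)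
    \<Rightarrow> ('a \<Rightarrow> real) \<Rightarrow> bool" where
  "is_subsolution \<Omega> g f u \<longleftrightarrow> admissible \<Omega> g u \<and>
     (\<forall>\<phi>. test_fun \<Omega> \<phi> \<and> (\<forall>x. \<phi> x \<ge> 0) \<longrightarrow> op_pair g f u \<phi> \<le> 0)"

definition is_supersolution :: "'a::euclidean_space set \<Rightarrow> (real \<Rightarrow> real) \<Rightarrow> ('a \<Rightarrow> real)
    \<Rightarrow> ('a \<Rightarrow> real) \<Rightarrow> bool" where
  "is_supersolution \<Omega> g f u \<longleftrightarrow> admissible \<Omega> g u \<and>
     (\<forall>\<phi>. test_fun \<Omega> \<phi> \<and> (\<forall>x. \<phi> x \<ge> 0) \<longrightarrow> op_pair g f u \<phi> \<ge> 0)"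

definition keller_osserman :: "(real \<Rightarrow> real) \<Rightarrow> bool" where
  "keller_osserman g \<longleftrightarrow> (\<forall>a>0.
     (\<integral>\<^sup>+ t. indicator {a..} t *
        (if integral {0..t} g > 0 then ennreal (1 / sqrt (integral {0..t} g)) else \<infinity>) \<partial>lborel)
       < \<infinity>)"

end

theory Submission
  imports Defs
begin

text \<open>The supremum \<open>u\<close> of all subsolutions is the only candidate. It is locally integrable by the
  Keller--Osserman estimate: in a ball every subsolution is bounded by a barrier that blows up on the
  boundary plus a potential of \<open>f\<close>. By Kato's inequality the maximum of two subsolutions is a
  subsolution, so \<open>u\<close> is the limit of an increasing sequence and again a subsolution.

  That \<open>u\<close> solves the equation is shown without a linear existence theory. If the nonlinearity is
  Lipschitz and the defect \<open>\<mu> = \<Delta>u - g(u) + f \<ge> 0\<close> does not vanish near a point, then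
  \<open>u + h\<close> is a larger subsolution, where \<open>h\<close> is the potential of a localisation of \<open>\<mu>\<close> for a kernel
  of small support: \<open>- \<Delta>h\<close> is the localised measure minus an average of it, and that average
  dominates \<open>h\<close> times the Lipschitz constant. For general \<open>g\<close> one replaces \<open>g\<close> by Lipschitz functions
  \<open>g_n\<close> increasing to \<open>g\<close> and takes the largest subsolutions \<open>v_n \<ge> u\<close> that agree with \<open>u\<close> off a
  relatively compact open set \<open>B\<close>. They solve the equation with \<open>g_n\<close> in \<open>B\<close> and decrease to a
  subsolution above \<open>u\<close>, hence to \<open>u\<close>; Kato's inequality for \<open>max v_n M\<close> makes \<open>g_n(v_n)\<close>
  equi-integrable, and the equation passes to the limit.

  All potentials are built from averages over balls: a function is subharmonic if and only if it lies
  below its averages, and in this form Kato's inequality becomes the monotonicity of averages.\<close>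

subsection \<open>Smooth functions\<close>

text \<open>Neither a fundamental solution nor a surface measure occurs. Averages are taken over
  displacements \<open>t y\<close> with a radius \<open>t\<close> and a smooth profile in
  \<open>y\<close>, so the mean value formula comes down to one-variable calculus and one
  integration by parts. The obstacle in the second half is the growth of \<open>g\<close>: for a
  subsolution \<open>u\<close> and a potential \<open>h\<close>, \<open>g (u + h)\<close> need not
  be locally integrable, so the largest subsolution cannot be enlarged directly. A Lipschitz
  nonlinearity satisfies \<open>g (v + h) \<le> g v + L * h\<close> for \<open>h \<ge> 0\<close>,
  and the term \<open>L * h\<close> is what the potential can pay for. The Lipschitz approximations
  are truncated below at the values of \<open>u\<close>. This keeps \<open>u\<close> a subsolution
  for each of them and supplies the locally integrable minorant \<open>g (u x)\<close> for Fatou's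
  lemma. Fatou's lemma alone yields only a subsolution in the limit, because part of the nonlinear
  term could concentrate; equi-integrability excludes exactly this loss. Everything is done for
  Borel functions and \<open>lborel\<close>; Lebesgue measurable functions enter at the very
  end.\<close>

definition dird :: "'a::euclidean_space \<Rightarrow> ('a \<Rightarrow> real) \<Rightarrow> 'a \<Rightarrow> real" where
  "dird v \<phi> = (\<lambda>x. frechet_derivative \<phi> (at x) v)"

text \<open>The recursion puts the last derivative taken at the head of the list, so the first one
  sits at the end. Splitting it off there passes smoothness on from \<open>\<phi>\<close> to
  \<open>dird v \<phi>\<close>.\<close>

lemma dderiv_append: "dderiv \<phi> (vs @ [v]) = dderiv (dird v \<phi>) vs"
  by (induction vs) (auto simp: dird_def)

lemma laplacian_dird: "laplacian \<phi> x = (\<Sum>i\<in>Basis. dird i (dird i \<phi>) x)"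
  by (simp add: laplacian_def dird_def)

lemma smooth_fun_differentiable: "smooth_fun \<phi> \<Longrightarrow> \<phi> differentiable (at x)"
  unfolding smooth_fun_def by (metis dderiv.simps(1))

lemma smooth_fun_dird: "smooth_fun \<phi> \<Longrightarrow> smooth_fun (dird v \<phi>)"
  unfolding smooth_fun_def by (metis dderiv_append)

text \<open>Smoothness is the largest property that implies differentiability and is inherited by
  all directional derivatives. Exhibiting a class closed under one derivative replaces induction
  over lists of directions.\<close>

lemma smooth_fun_coinduct:
  assumes "P \<phi>"
    and step: "\<And>\<psi>. P \<psi> \<Longrightarrow> (\<forall>x. \<psi> differentiable (at x)) \<and> (\<forall>v. P (dird v \<psi>))"
  shows "smooth_fun \<phi>"
proof -
  have "P (dderiv \<phi> vs)" for vs
    using \<open>P \<phi>\<close> by (induction vs) (auto simp: dird_def dest!: step)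
  then show ?thesis
    using step by (auto simp: smooth_fun_def)
qed

lemma has_derivative_dird:
  "\<phi> differentiable (at x) \<Longrightarrow> (\<phi> has_derivative (\<lambda>v. dird v \<phi> x)) (at x)"
  using frechet_derivative_works[of \<phi> "at x"] by (simp add: dird_def)

lemma dird_eqI: "(\<phi> has_derivative D) (at x) \<Longrightarrow> dird v \<phi> x = D v"
  unfolding dird_def using frechet_derivative_at by metis

section \<open>Flat functions and the algebra of smooth functions\<close>

definition flat :: "nat \<Rightarrow> real \<Rightarrow> real" where
  "flat k t = (if t > 0 then exp (- (1 / t)) / t ^ k else 0)"

lemma flat_nonneg: "flat k t \<ge> 0"
  by (simp add: flat_def)

lemma flat_pos: "t > 0 \<Longrightarrow> flat k t > 0"
  by (simp add: flat_def)

lemma flat_nonpos [simp]: "t \<le> 0 \<Longrightarrow> flat k t = 0"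
  by (simp add: flat_def)

text \<open>The term of order \<open>k + 2\<close> of the exponential series already bounds
  \<open>exp (1 / t)\<close> from below. Two powers of \<open>t\<close> are left over, and they make
  the derivative at \<open>0\<close> vanish.\<close>

lemma flat_le_square: "flat k t \<le> fact (k + 2) * t\<^sup>2"
proof (cases "t > 0")
  case True
  have "(1 / t) ^ (k + 2) / fact (k + 2) \<le> exp (1 / t)"
  proof -
    have "(\<Sum>i\<in>{k+2}. (1/t)^i /\<^sub>R fact i) \<le> (\<Sum>i. (1/t)^i /\<^sub>R fact i)"
      by (rule sum_le_suminf[OF summable_exp_generic]) (use True in auto)
    then show ?thesis
      by (simp add: exp_def scaleR_conv_of_real field_simps)
  qed
  then have "exp (- (1/t)) \<le> fact (k + 2) * t ^ (k + 2)"
  proof -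
    assume *: "(1 / t) ^ (k + 2) / fact (k + 2) \<le> exp (1 / t)"
    define F T E :: real where "F = fact (k + 2)" and "T = t ^ (k + 2)" and "E = exp (1 / t)"
    have "1 / T / F \<le> E" "F > 0" "T > 0" "E > 0"
      using * True by (auto simp: F_def T_def E_def power_one_over)
    then have "inverse E \<le> F * T"
      by (simp add: field_simps)
    then show ?thesis
      by (simp add: F_def T_def E_def exp_minus)
  qed
  then have "exp (- (1 / t)) / t ^ k \<le> fact (k + 2) * t ^ (k+2) / t ^ k"
    using True by (intro divide_right_mono) auto
  also have "\<dots> = fact (k + 2) * t\<^sup>2"
    using True by (simp only: power_add) simp
  finally show ?thesis
    using True by (simp add: flat_def)
qed (simp add: flat_def)

text \<open>The family over all \<open>k\<close> is closed under derivatives, which is the reason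
  for carrying the negative power of \<open>t\<close>. At \<open>0\<close> the difference quotient
  is at most a constant times \<open>\<bar>h\<bar>\<close> by \<open>flat_le_square\<close>.\<close>

lemma flat_has_real_derivative:
  "(flat k has_real_derivative (flat (k + 2) t - real k * flat (k + 1) t)) (at t)"
proof -
  consider "t > 0" | "t < 0" | "t = 0"
    by linarith
  then show ?thesis
  proof cases
    case 1
    have inv: "((\<lambda>s. 1 / s) has_real_derivative - (1 / t\<^sup>2)) (at t)"
      using DERIV_inverse[of t] 1 by (simp add: divide_inverse power2_eq_square)
    have "((\<lambda>s. exp (- (1 / s)) * (1 / s) ^ k) has_real_derivative
        exp (- (1 / t)) * (real k * (1 / t) ^ (k - 1) * - (1 / t\<^sup>2))
        + exp (- (1 / t)) * (1 / t\<^sup>2) * (1 / t) ^ k) (at t)"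
      using DERIV_mult[OF DERIV_fun_exp[OF DERIV_minus[OF inv]] DERIV_power[OF inv, of k]]
      by (simp add: mult_ac add_ac)
    moreover have "exp (- (1 / t)) * (real k * (1 / t) ^ (k - 1) * - (1 / t\<^sup>2))
        + exp (- (1 / t)) * (1 / t\<^sup>2) * (1 / t) ^ k = flat (k + 2) t - real k * flat (k + 1) t"
    proof -
      have "real k * (1 / t) ^ (k - 1) * (1 / t\<^sup>2) = real k / t ^ (k + 1)"
        using 1 by (cases k) (simp_all add: power_one_over power2_eq_square)
      then have "exp (- (1 / t)) * (real k * (1 / t) ^ (k - 1) * - (1 / t\<^sup>2))
          = - (real k * flat (k + 1) t)"
        using 1 by (simp add: flat_def)
      moreover have "exp (- (1 / t)) * (1 / t\<^sup>2) * (1 / t) ^ k = flat (k + 2) t"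
        using 1 by (simp add: flat_def power_one_over power_add power2_eq_square)
      ultimately show ?thesis
        by simp
    qed
    ultimately have "((\<lambda>s. exp (- (1 / s)) / s ^ k) has_real_derivative
            (flat (k + 2) t - real k * flat (k + 1) t)) (at t)"
      by (simp add: divide_inverse power_inverse)
    then show ?thesis
      by (rule has_field_derivative_transform_within_open[where S = "{0<..}"])
        (use 1 in \<open>auto simp: flat_def\<close>)
  next
    case 2
    have "((\<lambda>s. 0) has_real_derivative (flat (k + 2) t - real k * flat (k + 1) t)) (at t)"
      using 2 by simp
    then show ?thesis
      by (rule has_field_derivative_transform_within_open[where S = "{..<0}"])
        (use 2 in \<open>auto simp: flat_def\<close>)
  next
    case 3
    have "(\<lambda>h. flat k h / h) \<midarrow>0\<rightarrow> 0"
    proof (rule Lim_null_comparison)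
      show "\<forall>\<^sub>F h in at 0. norm (flat k h / h) \<le> fact (k + 2) * \<bar>h\<bar>"
      proof (rule always_eventually, rule allI)
        fix h :: real
        show "norm (flat k h / h) \<le> fact (k + 2) * \<bar>h\<bar>"
        proof (cases "h = 0")
          case False
          have "\<bar>flat k h\<bar> \<le> fact (k + 2) * \<bar>h\<bar> * \<bar>h\<bar>"
            using flat_le_square[of k h] flat_nonneg[of k h] abs_mult_self_eq[of h]
            by (metis abs_of_nonneg mult.assoc power2_eq_square)
          then show ?thesis
            using False by (simp add: divide_le_eq)
        qed simp
      qed
      have "((\<lambda>h. fact (k + 2) * \<bar>h\<bar>) \<longlongrightarrow> fact (k + 2) * \<bar>0::real\<bar>) (at 0)"
        by (intro tendsto_intros)
      then show "((\<lambda>h. fact (k + 2) * \<bar>h\<bar>) \<longlongrightarrow> (0::real)) (at 0)"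
        by simp
    qed
    then show ?thesis
      using 3 by (simp add: DERIV_def)
  qed
qed

text \<open>The derivative of each generating operation stays in the class. Since all smooth
  functions are generators, the class coincides with smoothness, and smoothness is closed under
  every operation without any computation of higher derivatives.\<close>

inductive smooth_alg :: "('a::euclidean_space \<Rightarrow> real) \<Rightarrow> bool" where
  smooth: "smooth_fun a \<Longrightarrow> smooth_alg a"
| const: "smooth_alg (\<lambda>x. c)"
| inner: "smooth_alg (\<lambda>x. x \<bullet> v)"
| add: "smooth_alg a \<Longrightarrow> smooth_alg b \<Longrightarrow> smooth_alg (\<lambda>x. a x + b x)"
| mult: "smooth_alg a \<Longrightarrow> smooth_alg b \<Longrightarrow> smooth_alg (\<lambda>x. a x * b x)"
| flat: "smooth_alg a \<Longrightarrow> smooth_alg (\<lambda>x. flat k (a x))"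
| inverse: "smooth_alg a \<Longrightarrow> (\<And>x. a x > 0) \<Longrightarrow> smooth_alg (\<lambda>x. inverse (a x))"

lemma smooth_alg_step:
  "smooth_alg \<psi> \<Longrightarrow> \<exists>D. (\<forall>x. (\<psi> has_derivative D x) (at x)) \<and> (\<forall>v. smooth_alg (\<lambda>x. D x v))"
proof (induction rule: smooth_alg.induct)
  case (smooth a)
  show ?case
    by (rule exI[of _ "\<lambda>x v. dird v a x"])
      (auto intro!: has_derivative_dird smooth_fun_differentiable smooth_alg.smooth
        smooth_fun_dird smooth)
next
  case (const c)
  show ?case
    by (rule exI[of _ "\<lambda>x v. 0"]) (auto intro: smooth_alg.const)
next
  case (inner w)
  show ?case
    by (rule exI[of _ "\<lambda>x v. v \<bullet> w"])
      (auto intro!: derivative_eq_intros smooth_alg.const)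
next
  case (add a b)
  then obtain A B where "\<forall>x. (a has_derivative A x) (at x)" "\<forall>v. smooth_alg (\<lambda>x. A x v)"
    "\<forall>x. (b has_derivative B x) (at x)" "\<forall>v. smooth_alg (\<lambda>x. B x v)"
    by blast
  then show ?case
    by (intro exI[of _ "\<lambda>x v. A x v + B x v"])
      (auto intro!: derivative_eq_intros smooth_alg.add)
next
  case (mult a b)
  then obtain A B where "\<forall>x. (a has_derivative A x) (at x)" "\<forall>v. smooth_alg (\<lambda>x. A x v)"
    "\<forall>x. (b has_derivative B x) (at x)" "\<forall>v. smooth_alg (\<lambda>x. B x v)"
    by blast
  then show ?case using mult.hyps
    by (intro exI[of _ "\<lambda>x v. a x * B x v + A x v * b x"])
      (auto intro!: has_derivative_mult smooth_alg.add smooth_alg.mult)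
next
  case (flat a k)
  then obtain A where A: "\<forall>x. (a has_derivative A x) (at x)" "\<forall>v. smooth_alg (\<lambda>x. A x v)"
    by blast
  let ?D = "\<lambda>x v. (flat (k + 2) (a x) + (- real k) * flat (k + 1) (a x)) * A x v"
  have "((\<lambda>x. flat k (a x)) has_derivative ?D x) (at x)" for x
    using DERIV_compose_FDERIV[OF flat_has_real_derivative[of k "a x"] A(1)[rule_format, of x]]
    by (simp add: mult_ac)
  moreover have "smooth_alg (\<lambda>x. ?D x v)" for v
    by (intro smooth_alg.intros flat.hyps A(2)[rule_format])
  ultimately show ?case
    by (intro exI[of _ ?D]) blast
next
  case (inverse a)
  then obtain A where A: "\<forall>x. (a has_derivative A x) (at x)" "\<forall>v. smooth_alg (\<lambda>x. A x v)"
    by blast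
  let ?D = "\<lambda>x v. (-1) * (inverse (a x) * (A x v * inverse (a x)))"
  have "((\<lambda>x. inverse (a x)) has_derivative ?D x) (at x)" for x
    using Deriv.has_derivative_inverse[OF _ A(1)[rule_format, of x]] inverse.hyps(2)[of x]
    by (simp add: mult_ac)
  moreover have "smooth_alg (\<lambda>x. ?D x v)" for v
    by (intro smooth_alg.intros inverse.hyps A(2)[rule_format])
  ultimately show ?case
    by (intro exI[of _ ?D]) blast
qed

lemma smooth_fun_iff_smooth_alg: "smooth_fun \<phi> \<longleftrightarrow> smooth_alg \<phi>"
proof
  assume "smooth_alg \<phi>"
  then show "smooth_fun \<phi>"
  proof (rule smooth_fun_coinduct)
    fix \<psi> :: "'a \<Rightarrow> real"
    assume "smooth_alg \<psi>"
    then obtain D where D: "\<And>x. (\<psi> has_derivative D x) (at x)" "\<And>v. smooth_alg (\<lambda>x. D x v)"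
      using smooth_alg_step by blast
    then have "dird v \<psi> = (\<lambda>x. D x v)" for v
      by (auto intro: dird_eqI)
    with D show "(\<forall>x. \<psi> differentiable (at x)) \<and> (\<forall>v. smooth_alg (dird v \<psi>))"
      by (auto simp: differentiable_def)
  qed
qed (rule smooth_alg.smooth)

lemmas smooth_fun_const = smooth_alg.const[folded smooth_fun_iff_smooth_alg]
  and smooth_fun_inner = smooth_alg.inner[folded smooth_fun_iff_smooth_alg]
  and smooth_fun_add = smooth_alg.add[folded smooth_fun_iff_smooth_alg]
  and smooth_fun_mult = smooth_alg.mult[folded smooth_fun_iff_smooth_alg]
  and smooth_fun_flat = smooth_alg.flat[folded smooth_fun_iff_smooth_alg]
  and smooth_fun_inverse = smooth_alg.inverse[folded smooth_fun_iff_smooth_alg]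

lemma smooth_fun_cmult: "smooth_fun a \<Longrightarrow> smooth_fun (\<lambda>x. c * a x)"
  by (intro smooth_fun_mult smooth_fun_const)

lemma smooth_fun_diff: "smooth_fun a \<Longrightarrow> smooth_fun b \<Longrightarrow> smooth_fun (\<lambda>x. a x - b x)"
  using smooth_fun_add[OF _ smooth_fun_cmult[where c = "-1"], of a b] by simp

lemma smooth_fun_sum:
  "(\<And>i. i \<in> I \<Longrightarrow> smooth_fun (a i)) \<Longrightarrow> smooth_fun (\<lambda>x. \<Sum>i\<in>I. a i x)"
  by (induction I rule: infinite_finite_induct) (auto intro: smooth_fun_const smooth_fun_add)

lemma smooth_fun_norm_diff_sq:
  fixes c :: "'a::euclidean_space"
  shows "smooth_fun (\<lambda>x. (norm (x - c))\<^sup>2)"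
proof -
  have "(norm (x - c))\<^sup>2 = (\<Sum>b\<in>Basis. (x \<bullet> b + - (c \<bullet> b)) * (x \<bullet> b + - (c \<bullet> b)))" for x
    unfolding dot_square_norm[symmetric] by (subst euclidean_inner) (simp add: inner_diff_left)
  then show ?thesis
    by (simp only:) (intro smooth_fun_sum smooth_fun_mult smooth_fun_add smooth_fun_inner smooth_fun_const)
qed

section \<open>Calculus rules for directional derivatives and the Laplacian\<close>

lemma smooth_fun_has_derivative:
  "smooth_fun \<phi> \<Longrightarrow> (\<phi> has_derivative (\<lambda>v. dird v \<phi> x)) (at x)"
  by (intro has_derivative_dird smooth_fun_differentiable)

lemma smooth_fun_continuous: "smooth_fun \<phi> \<Longrightarrow> continuous_on S \<phi>"
  by (meson continuous_at_imp_continuous_on differentiable_imp_continuous_within smooth_fun_differentiable)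

lemma smooth_fun_laplacian: "smooth_fun \<phi> \<Longrightarrow> smooth_fun (laplacian \<phi>)"
  unfolding laplacian_dird[abs_def] by (intro smooth_fun_sum smooth_fun_dird)

lemma dird_add:
  assumes "smooth_fun a" "smooth_fun b"
  shows "dird v (\<lambda>x. a x + b x) = (\<lambda>x. dird v a x + dird v b x)"
  by (rule ext, rule dird_eqI) (intro has_derivative_add smooth_fun_has_derivative assms)

lemma dird_mult:
  assumes "smooth_fun a" "smooth_fun b"
  shows "dird v (\<lambda>x. a x * b x) = (\<lambda>x. a x * dird v b x + dird v a x * b x)"
  by (rule ext, rule dird_eqI) (intro has_derivative_mult smooth_fun_has_derivative assms)

lemma dird_const: "dird v (\<lambda>x. c) = (\<lambda>x. 0)"
  by (rule ext, rule dird_eqI) (rule has_derivative_const)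

lemma dird_cmult: "smooth_fun a \<Longrightarrow> dird v (\<lambda>x. c * a x) = (\<lambda>x. c * dird v a x)"
  by (subst dird_mult) (auto simp: smooth_fun_const dird_const)

lemma laplacian_add:
  assumes "smooth_fun a" "smooth_fun b"
  shows "laplacian (\<lambda>x. a x + b x) = (\<lambda>x. laplacian a x + laplacian b x)"
  unfolding laplacian_dird[abs_def]
  by (simp add: dird_add assms smooth_fun_dird sum.distrib)

lemma laplacian_cmult: "smooth_fun a \<Longrightarrow> laplacian (\<lambda>x. c * a x) = (\<lambda>x. c * laplacian a x)"
  unfolding laplacian_dird[abs_def]
  by (simp add: dird_cmult smooth_fun_dird sum_distrib_left)

lemma laplacian_diff:
  assumes "smooth_fun a" "smooth_fun b"
  shows "laplacian (\<lambda>x. a x - b x) = (\<lambda>x. laplacian a x - laplacian b x)"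
  using laplacian_add[OF assms(1) smooth_fun_cmult[OF assms(2), where c = "-1"]]
  by (simp add: laplacian_cmult[OF assms(2), where c = "-1", simplified])

lemma laplacian_mult:
  assumes "smooth_fun a" "smooth_fun b"
  shows "laplacian (\<lambda>x. a x * b x) =
    (\<lambda>x. a x * laplacian b x + 2 * (\<Sum>i\<in>Basis. dird i a x * dird i b x) + laplacian a x * b x)"
  unfolding laplacian_dird[abs_def]
  by (simp add: dird_mult dird_add smooth_fun_mult assms smooth_fun_dird sum.distrib
      sum_distrib_left sum_distrib_right algebra_simps)

lemma laplacian_norm_sq:
  fixes c :: "'a::euclidean_space"
  shows "laplacian (\<lambda>x. (norm (x - c))\<^sup>2) = (\<lambda>x. 2 * DIM('a))"
proof -
  have 1: "dird i (\<lambda>x. (norm (x - c))\<^sup>2) = (\<lambda>x. 2 * ((x - c) \<bullet> i))" for i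
    unfolding dot_square_norm[symmetric]
    by (rule ext, rule dird_eqI) (auto intro!: derivative_eq_intros simp: inner_commute)
  have "dird i (\<lambda>x. 2 * ((x - c) \<bullet> i)) x = 2 * (i \<bullet> i)" for i x
    by (rule dird_eqI) (auto intro!: derivative_eq_intros)
  then show ?thesis
    by (simp add: laplacian_dird[abs_def] 1 inner_same_Basis mult.commute)
qed

subsection \<open>Test functions\<close>

lemma test_fun_smooth: "test_fun \<Omega> \<phi> \<Longrightarrow> smooth_fun \<phi>"
  by (simp add: test_fun_def)

lemma test_fun_mono: "test_fun \<Omega> \<phi> \<Longrightarrow> \<Omega> \<subseteq> \<Omega>' \<Longrightarrow> test_fun \<Omega>' \<phi>"
  by (auto simp: test_fun_def)

text \<open>Any compact set off which the function vanishes will do, so the support itself never has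
  to be computed.\<close>

lemma test_funI:
  assumes "smooth_fun \<phi>" "compact K" "K \<subseteq> \<Omega>" "\<And>x. x \<notin> K \<Longrightarrow> \<phi> x = 0"
  shows "test_fun \<Omega> \<phi>"
proof -
  have sub: "{x. \<phi> x \<noteq> 0} \<subseteq> K"
    using assms(4) by auto
  then have "closure {x. \<phi> x \<noteq> 0} \<subseteq> K"
    by (intro closure_minimal compact_imp_closed assms(2))
  moreover have "compact (closure {x. \<phi> x \<noteq> 0})"
    using bounded_subset[OF compact_imp_bounded[OF assms(2)] sub] by (simp add: compact_closure)
  ultimately show ?thesis
    unfolding test_fun_def using assms(1,3) by auto
qed

lemma test_funE:
  assumes "test_fun \<Omega> \<phi>"
  obtains K where "smooth_fun \<phi>" "compact K" "K \<subseteq> \<Omega>" "\<And>x. x \<notin> K \<Longrightarrow> \<phi> x = 0"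
proof
  show "smooth_fun \<phi>" "compact (closure {x. \<phi> x \<noteq> 0})" "closure {x. \<phi> x \<noteq> 0} \<subseteq> \<Omega>"
    using assms by (auto simp: test_fun_def)
  show "\<phi> x = 0" if "x \<notin> closure {x. \<phi> x \<noteq> 0}" for x
    using that closure_subset[of "{x. \<phi> x \<noteq> 0}"] by blast
qed

lemma dird_eq_0:
  assumes "closed K" "\<And>x. x \<notin> K \<Longrightarrow> \<phi> x = 0" "x \<notin> K"
  shows "dird v \<phi> x = 0"
proof -
  have "(\<phi> has_derivative (\<lambda>_. 0)) (at x)"
    by (rule has_derivative_transform_within_open[OF has_derivative_const[of 0], where s = "- K"])
      (use assms in auto)
  then show ?thesis
    by (rule dird_eqI)
qed

lemma laplacian_eq_0:
  assumes "closed K" "\<And>x. x \<notin> K \<Longrightarrow> \<phi> x = 0" "x \<notin> K"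
  shows "laplacian \<phi> x = 0"
  unfolding laplacian_dird using assms by (auto intro!: sum.neutral dird_eq_0)

lemma test_fun_dird: "test_fun \<Omega> \<phi> \<Longrightarrow> test_fun \<Omega> (dird v \<phi>)"
  by (elim test_funE, rule test_funI) (auto intro: smooth_fun_dird dird_eq_0 compact_imp_closed)

lemma test_fun_laplacian: "test_fun \<Omega> \<phi> \<Longrightarrow> test_fun \<Omega> (laplacian \<phi>)"
  by (elim test_funE, rule test_funI)
    (auto intro: smooth_fun_laplacian laplacian_eq_0 compact_imp_closed)

lemma test_fun_mult:
  "smooth_fun \<kappa> \<Longrightarrow> test_fun \<Omega> \<phi> \<Longrightarrow> test_fun \<Omega> (\<lambda>x. \<kappa> x * \<phi> x)"
  by (elim test_funE, rule test_funI) (auto intro: smooth_fun_mult)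

lemma test_fun_mult_right:
  "smooth_fun \<kappa> \<Longrightarrow> test_fun \<Omega> \<phi> \<Longrightarrow> test_fun \<Omega> (\<lambda>x. \<phi> x * \<kappa> x)"
  by (elim test_funE, rule test_funI) (auto intro: smooth_fun_mult)

lemma test_fun_cmult: "test_fun \<Omega> \<phi> \<Longrightarrow> test_fun \<Omega> (\<lambda>x. c * \<phi> x)"
  by (intro test_fun_mult smooth_fun_const)

lemma test_fun_add:
  assumes "test_fun \<Omega> \<phi>" "test_fun \<Omega> \<psi>"
  shows "test_fun \<Omega> (\<lambda>x. \<phi> x + \<psi> x)"
proof -
  obtain K where K: "smooth_fun \<phi>" "compact K" "K \<subseteq> \<Omega>" "\<And>x. x \<notin> K \<Longrightarrow> \<phi> x = 0"
    using assms(1) by (rule test_funE) blast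
  obtain L where L: "smooth_fun \<psi>" "compact L" "L \<subseteq> \<Omega>" "\<And>x. x \<notin> L \<Longrightarrow> \<psi> x = 0"
    using assms(2) by (rule test_funE) blast
  show ?thesis
    by (rule test_funI[where K = "K \<union> L"]) (use K L in \<open>auto intro: smooth_fun_add\<close>)
qed

lemma test_fun_diff:
  assumes "test_fun \<Omega> \<phi>" "test_fun \<Omega> \<psi>"
  shows "test_fun \<Omega> (\<lambda>x. \<phi> x - \<psi> x)"
  using test_fun_add[OF assms(1) test_fun_cmult[OF assms(2), of "-1"]] by simp

lemma test_fun_bounded:
  assumes "test_fun \<Omega> \<phi>"
  obtains C where "C > 0" "\<And>x. \<bar>\<phi> x\<bar> \<le> C"
proof -
  obtain K where K: "smooth_fun \<phi>" "compact K" "\<And>x. x \<notin> K \<Longrightarrow> \<phi> x = 0"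
    using assms by (rule test_funE) blast
  then have "bounded (\<phi> ` K)"
    by (intro compact_imp_bounded compact_continuous_image smooth_fun_continuous)
  then obtain C where "C > 0" "\<forall>x\<in>K. \<bar>\<phi> x\<bar> \<le> C"
    by (auto simp: bounded_pos)
  then have "\<bar>\<phi> x\<bar> \<le> C" for x
    by (cases "x \<in> K") (auto simp: K(3))
  with \<open>C > 0\<close> show thesis
    by (rule that)
qed

lemma compact_inflate:
  fixes K :: "'a::euclidean_space set"
  assumes "compact K" "open \<Omega>" "K \<subseteq> \<Omega>"
  obtains r where "r > 0" "(\<Union>x\<in>K. cball x r) \<subseteq> \<Omega>"
proof -
  obtain e where "e > 0" "(\<Union>x\<in>K. ball x e) \<subseteq> \<Omega>"
    using compact_subset_open_imp_ball_epsilon_subset[OF assms] by blast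
  moreover have "(\<Union>x\<in>K. cball x (e/2)) \<subseteq> (\<Union>x\<in>K. ball x e)"
    using \<open>e > 0\<close> by (intro UN_mono) auto
  ultimately show thesis
    by (intro that[of "e/2"]) auto
qed

text \<open>The closed neighbourhood is the Minkowski sum of \<open>K\<close> and a ball, hence
  compact.\<close>

lemma compact_UN_cball:
  fixes K :: "'a::euclidean_space set"
  assumes "compact K"
  shows "compact (\<Union>x\<in>K. cball x r)"
proof -
  have "(\<Union>x\<in>K. cball x r) = {x + y | x y. x \<in> K \<and> y \<in> cball 0 r}"
  proof (intro subset_antisym subsetI)
    fix z assume "z \<in> (\<Union>x\<in>K. cball x r)"
    then obtain x where "x \<in> K" "norm (z - x) \<le> r"
      by (auto simp: dist_norm norm_minus_commute)
    then show "z \<in> {x + y | x y. x \<in> K \<and> y \<in> cball 0 r}"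
      by (intro CollectI exI[of _ x] exI[of _ "z - x"]) auto
  next
    fix z assume "z \<in> {x + y | x y. x \<in> K \<and> y \<in> cball 0 r}"
    then obtain x y where "z = x + y" "x \<in> K" "norm y \<le> r"
      by auto
    then show "z \<in> (\<Union>x\<in>K. cball x r)"
      by (auto intro!: bexI[of _ x] simp: dist_norm)
  qed
  then show ?thesis
    using compact_sums[OF assms compact_cball[of 0 r]] by simp
qed

text \<open>The bump is a quotient \<open>a / (a + b)\<close> of flat functions: \<open>a\<close>
  vanishes off a neighbourhood of \<open>K\<close>, \<open>b\<close> vanishes on \<open>K\<close>,
  and the two never vanish together.\<close>

lemma test_fun_bump:
  fixes K :: "'a::euclidean_space set"
  assumes "compact K" "open \<Omega>" "K \<subseteq> \<Omega>"
  obtains \<kappa> where "test_fun \<Omega> \<kappa>" "\<And>x. 0 \<le> \<kappa> x" "\<And>x. \<kappa> x \<le> 1" "\<And>x. x \<in> K \<Longrightarrow> \<kappa> x = 1"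
proof -
  obtain r where r: "r > 0" "(\<Union>x\<in>K. cball x r) \<subseteq> \<Omega>"
    using compact_inflate[OF assms] .
  obtain X where X: "finite X" "X \<subseteq> K" "K \<subseteq> (\<Union>c\<in>X. ball c r)"
    using compactE_image[OF assms(1), of K "\<lambda>c. ball c r"] r(1) by (metis UN_I centre_in_ball open_ball subsetI)
  define s where "s = (\<lambda>x. \<Sum>c\<in>X. flat 0 (r\<^sup>2 - (norm (x - c))\<^sup>2))"
  have s_smooth: "smooth_fun s"
    unfolding s_def
    by (intro smooth_fun_sum smooth_fun_flat smooth_fun_diff smooth_fun_const smooth_fun_norm_diff_sq)
  have s_nonneg: "s x \<ge> 0" for x
    unfolding s_def by (intro sum_nonneg flat_nonneg)
  have s_pos: "s x > 0" if "x \<in> K" for x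
  proof -
    obtain c where "c \<in> X" "x \<in> ball c r"
      using X(3) \<open>x \<in> K\<close> by blast
    then have c: "c \<in> X" "norm (x - c) < r"
      by (auto simp: dist_norm norm_minus_commute)
    then have "flat 0 (r\<^sup>2 - (norm (x - c))\<^sup>2) > 0"
      using r(1) by (intro flat_pos) (simp add: power_strict_mono)
    then show ?thesis
      unfolding s_def using X(1) c(1) by (intro sum_pos2) (auto intro: flat_nonneg)
  qed
  \<comment> \<open>The minimum of \<open>s\<close> on \<open>K\<close> is the level from which the
    quotient equals \<open>1\<close>; for empty \<open>K\<close> any positive number serves.\<close>
  obtain d where d: "d > 0" "\<And>x. x \<in> K \<Longrightarrow> d \<le> s x"
  proof (cases "K = {}")
    case False
    then obtain x where "x \<in> K" "\<forall>y\<in>K. s x \<le> s y"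
      using continuous_attains_inf[OF assms(1) False smooth_fun_continuous[OF s_smooth]] by blast
    then show thesis
      by (intro that[of "s x"]) (auto intro: s_pos)
  qed (auto intro: that[of 1])
  define p where "p = (\<lambda>x. flat 0 (s x) + flat 0 (d - s x))"
  have p_pos: "p x > 0" for x
    unfolding p_def using d(1) s_nonneg[of x]
    by (cases "s x > 0") (simp_all add: add_pos_nonneg flat_pos flat_nonneg add_nonneg_pos)
  have supp: "s x = 0" if "x \<notin> (\<Union>c\<in>K. cball c r)" for x
    unfolding s_def
  proof (intro sum.neutral ballI flat_nonpos)
    fix c assume "c \<in> X"
    then have "norm (x - c) > r"
      using that X(2) by (auto simp: dist_norm norm_minus_commute not_le subset_iff)
    then show "r\<^sup>2 - (norm (x - c))\<^sup>2 \<le> 0"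
      using r(1) by (simp add: power_mono)
  qed
  show thesis
  proof
    show "test_fun \<Omega> (\<lambda>x. flat 0 (s x) * inverse (p x))"
    proof (rule test_funI[OF _ compact_UN_cball[OF assms(1)] r(2)])
      show "smooth_fun (\<lambda>x. flat 0 (s x) * inverse (p x))"
        unfolding p_def
        by (intro smooth_fun_mult smooth_fun_inverse smooth_fun_add smooth_fun_flat smooth_fun_diff
            s_smooth smooth_fun_const) (use p_pos in \<open>simp add: p_def\<close>)
    qed (simp add: supp)
    show "0 \<le> flat 0 (s x) * inverse (p x)" for x
      using p_pos[of x] flat_nonneg[of 0 "s x"] by simp
    show "flat 0 (s x) * inverse (p x) \<le> 1" for x
      using p_pos[of x] flat_nonneg[of 0 "d - s x"] by (simp add: p_def field_simps)
    show "flat 0 (s x) * inverse (p x) = 1" if "x \<in> K" for x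
      using p_pos[of x] d(2)[OF that] by (simp add: p_def)
  qed
qed

subsection \<open>Integration by parts and integrals against test functions\<close>

lemma integrable_mult_bounded:
  fixes u \<phi> :: "'a \<Rightarrow> real"
  assumes "integrable M u" "\<phi> \<in> borel_measurable M" "\<And>x. \<bar>\<phi> x\<bar> \<le> C"
  shows "integrable M (\<lambda>x. u x * \<phi> x)"
proof (rule Bochner_Integration.integrable_bound)
  show "integrable M (\<lambda>x. C * u x)"
    using assms(1) by simp
  have "\<bar>u x\<bar> * \<bar>\<phi> x\<bar> \<le> \<bar>C\<bar> * \<bar>u x\<bar>" for x
  proof -
    have "\<bar>u x\<bar> * \<bar>\<phi> x\<bar> \<le> \<bar>u x\<bar> * \<bar>C\<bar>"
      using assms(3)[of x] by (intro mult_left_mono) auto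
    then show ?thesis
      by (simp add: mult.commute)
  qed
  then show "AE x in M. norm (u x * \<phi> x) \<le> norm (C * u x)"
    by (simp add: abs_mult)
qed (use assms borel_measurable_integrable in measurable)

lemma integrable_bounded_support:
  fixes f :: "'a::euclidean_space \<Rightarrow> real"
  assumes "f \<in> borel_measurable borel" "bounded S" "\<And>x. x \<notin> S \<Longrightarrow> f x = 0" "\<And>x. \<bar>f x\<bar> \<le> C"
  shows "integrable lborel f"
proof -
  obtain r where r: "S \<subseteq> cball 0 r"
    using assms(2) by (meson bounded_subset_ballD ball_subset_cball order_trans)
  show ?thesis
  proof (rule integrableI_bounded_set[where A = "cball 0 r" and B = C])
    show "emeasure lborel (cball (0::'a) r) < \<infinity>"
      by (rule emeasure_bounded_finite) simp
  qed (use assms r in \<open>auto intro!: AE_I2 simp: subset_iff\<close>)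
qed

lemma test_fun_eq_0: "test_fun \<Omega> \<phi> \<Longrightarrow> x \<notin> \<Omega> \<Longrightarrow> \<phi> x = 0"
  using closure_subset[of "{x. \<phi> x \<noteq> 0}"] by (auto simp: test_fun_def)

lemma test_fun_borel: "test_fun \<Omega> \<phi> \<Longrightarrow> \<phi> \<in> borel_measurable borel"
  by (intro borel_measurable_continuous_onI smooth_fun_continuous) (rule test_fun_smooth)

lemma test_fun_integrable:
  assumes "test_fun \<Omega> \<phi>"
  shows "integrable lborel \<phi>"
proof -
  obtain K where "compact K" "\<And>x. x \<notin> K \<Longrightarrow> \<phi> x = 0"
    using assms by (rule test_funE) blast
  moreover obtain C where "\<And>x. \<bar>\<phi> x\<bar> \<le> C"
    using assms by (rule test_fun_bounded) blast
  ultimately show ?thesis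
    using assms by (intro integrable_bounded_support[of \<phi> K C])
      (auto intro: compact_imp_bounded test_fun_borel)
qed

lemma integrable_mult_test:
  assumes "integrable lborel u" "test_fun \<Omega> \<phi>"
  shows "integrable lborel (\<lambda>x. u x * \<phi> x)"
  using assms(2) by (rule test_fun_bounded)
    (auto intro!: integrable_mult_bounded[OF assms(1)] simp: test_fun_borel[OF assms(2)])

lemma lborel_translation:
  fixes f :: "'a::euclidean_space \<Rightarrow> real"
  assumes [measurable]: "f \<in> borel_measurable borel"
  shows "integral\<^sup>L lborel (\<lambda>x. f (x + a)) = integral\<^sup>L lborel f"
    and "integrable lborel (\<lambda>x. f (x + a)) \<longleftrightarrow> integrable lborel f"
proof -
  have "integral\<^sup>L lborel f = integral\<^sup>L (distr lborel borel ((+) a)) f"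
    by (simp add: lborel_distr_plus)
  then show "integral\<^sup>L lborel (\<lambda>x. f (x + a)) = integral\<^sup>L lborel f"
    by (simp add: integral_distr add.commute)
  have "integrable lborel f \<longleftrightarrow> integrable (distr lborel borel ((+) a)) f"
    by (simp add: lborel_distr_plus)
  then show "integrable lborel (\<lambda>x. f (x + a)) \<longleftrightarrow> integrable lborel f"
    by (simp add: integrable_distr_eq add.commute)
qed

text \<open>The derivative is integrated over \<open>x\<close> and along the segments from
  \<open>x\<close> to \<open>x + v\<close>. Integrating along the segment first gives
  \<open>\<psi> (x + v) - \<psi> x\<close>, whose integral is zero by translation invariance.
  Integrating over \<open>x\<close> first gives the integral in question, again by translation
  invariance.\<close>

lemma integral_derivative_eq_0:
  fixes \<psi> :: "'a::euclidean_space \<Rightarrow> real"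
  assumes deriv: "\<And>x. (\<psi> has_derivative D x) (at x)"
    and cont: "continuous_on UNIV (\<lambda>x. D x v)"
    and K: "compact K" "\<And>x. x \<notin> K \<Longrightarrow> \<psi> x = 0"
  shows "integral\<^sup>L lborel (\<lambda>x. D x v) = 0"
proof -
  let ?d = "\<lambda>x. D x v"
  have d0: "?d x = 0" if "x \<notin> K" for x
    using dird_eq_0[OF compact_imp_closed[OF K(1)] K(2) that, where v = v] dird_eqI[OF deriv[of x], where v = v]
    by simp
  have "bounded (?d ` K)"
    by (intro compact_imp_bounded compact_continuous_image K(1) continuous_on_subset[OF cont]) auto
  then obtain C where "\<forall>x\<in>K. \<bar>?d x\<bar> \<le> C" "C > 0"
    by (auto simp: bounded_pos)
  then have C: "\<bar>?d x\<bar> \<le> C" for x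
    by (cases "x \<in> K") (auto simp: d0)
  have meas[measurable]: "?d \<in> borel_measurable borel"
    by (intro borel_measurable_continuous_onI cont)
  have psi_cont: "continuous_on UNIV \<psi>"
    using deriv by (meson continuous_at_imp_continuous_on has_derivative_continuous)
  then have psi_meas: "\<psi> \<in> borel_measurable borel"
    by (rule borel_measurable_continuous_onI)
  have "bounded (\<psi> ` K)"
    by (intro compact_imp_bounded compact_continuous_image K(1) continuous_on_subset[OF psi_cont]) auto
  then obtain C' where "\<forall>x\<in>K. \<bar>\<psi> x\<bar> \<le> C'" "C' > 0"
    by (auto simp: bounded_pos)
  then have C': "\<bar>\<psi> x\<bar> \<le> C'" for x
    by (cases "x \<in> K") (auto simp: K(2))
  have psi_int: "integrable lborel \<psi>"
    by (rule integrable_bounded_support[OF psi_meas compact_imp_bounded[OF K(1)] K(2) C'])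
  define F where "F = (\<lambda>t x. indicator {0..1::real} t * ?d (x + t *\<^sub>R v))"
  have F_int: "integrable (lborel \<Otimes>\<^sub>M lborel) (case_prod F)"
  proof -
    obtain r where r: "K \<subseteq> cball 0 r"
      using compact_imp_bounded[OF K(1)] by (meson bounded_subset_ballD ball_subset_cball order_trans)
    have "case_prod F p = 0" if "p \<notin> {0..1} \<times> cball 0 (r + norm v)" for p
    proof (rule ccontr)
      assume "case_prod F p \<noteq> 0"
      then obtain t x where p: "p = (t, x)" "0 \<le> t" "t \<le> 1" "?d (x + t *\<^sub>R v) \<noteq> 0"
        by (cases p) (auto simp: F_def indicator_def split: if_splits)
      then have "norm (x + t *\<^sub>R v) \<le> r"
        using d0 r by (meson mem_cball_0 subsetD)
      moreover have "norm x \<le> norm (x + t *\<^sub>R v) + norm (t *\<^sub>R v)"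
        by (metis add_diff_cancel_right' norm_triangle_ineq4)
      moreover have "norm (t *\<^sub>R v) \<le> norm v"
        using p(2,3) by (simp add: mult_left_le_one_le)
      ultimately show False
        using that p by auto
    qed
    moreover have "\<bar>case_prod F p\<bar> \<le> C" for p
      using C \<open>C > 0\<close> by (cases p) (auto simp: F_def indicator_def)
    moreover have "case_prod F \<in> borel_measurable borel"
      unfolding F_def by (simp add: split_beta' borel_prod[symmetric])
    ultimately show ?thesis
      unfolding lborel_prod
      by (intro integrable_bounded_support[of _ "{0..1} \<times> cball 0 (r + norm v)"])
        (auto intro: bounded_Times bounded_closed_interval)
  qed
  have "(\<integral>x. (\<integral>t. F t x \<partial>lborel) \<partial>lborel) = (\<integral>t. (\<integral>x. F t x \<partial>lborel) \<partial>lborel)"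
    by (rule lborel_pair.Fubini_integral[OF F_int])
  moreover have "(\<integral>t. F t x \<partial>lborel) = \<psi> (x + v) - \<psi> x" for x
  proof -
    have 1: "((\<lambda>t. \<psi> (x + t *\<^sub>R v)) has_real_derivative ?d (x + t *\<^sub>R v)) (at t)" for t
    proof -
      have "((\<lambda>t. \<psi> (x + t *\<^sub>R v)) has_derivative (\<lambda>s. D (x + t *\<^sub>R v) (s *\<^sub>R v))) (at t)"
        by (rule has_derivative_compose[OF _ deriv]) (auto intro!: derivative_eq_intros)
      moreover have "D (x + t *\<^sub>R v) (s *\<^sub>R v) = ?d (x + t *\<^sub>R v) * s" for s
        using linear_scale[OF has_derivative_linear[OF deriv]] by (simp add: mult.commute)
      ultimately show ?thesis
        by (simp add: has_field_derivative_def fun_eq_iff)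
    qed
    have 2: "isCont (\<lambda>t. ?d (x + t *\<^sub>R v)) t" for t
      using continuous_on_compose2[OF cont, of UNIV "\<lambda>t. x + t *\<^sub>R v"]
      by (auto intro!: continuous_intros simp: continuous_on_eq_continuous_at)
    have "(\<integral>t. ?d (x + t *\<^sub>R v) * indicator {0..1} t \<partial>lborel) = \<psi> (x + 1 *\<^sub>R v) - \<psi> (x + 0 *\<^sub>R v)"
      by (rule integral_FTC_Icc_real) (use 1 2 in auto)
    then show ?thesis
      by (simp add: F_def mult.commute)
  qed
  moreover have "(\<integral>x. \<psi> (x + v) - \<psi> x \<partial>lborel) = 0"
    using psi_int psi_meas by (simp add: lborel_translation)
  moreover have "(\<integral>x. F t x \<partial>lborel) = indicator {0..1} t * integral\<^sup>L lborel ?d" for t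
    unfolding F_def using lborel_translation(1)[OF meas, of "t *\<^sub>R v"] by simp
  ultimately show ?thesis
    by simp
qed

lemma integral_dird_eq_0:
  assumes "test_fun \<Omega> \<psi>"
  shows "integral\<^sup>L lborel (dird v \<psi>) = 0"
proof -
  obtain K where K: "smooth_fun \<psi>" "compact K" "\<And>x. x \<notin> K \<Longrightarrow> \<psi> x = 0"
    using assms by (rule test_funE) blast
  show ?thesis
    by (rule integral_derivative_eq_0[where D = "\<lambda>x w. dird w \<psi> x" and \<psi> = \<psi> and K = K])
      (use K in \<open>auto intro: smooth_fun_has_derivative smooth_fun_continuous smooth_fun_dird\<close>)
qed

lemma integral_laplacian_eq_0:
  assumes "test_fun \<Omega> \<psi>"
  shows "integral\<^sup>L lborel (laplacian \<psi>) = 0"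
  unfolding laplacian_dird[abs_def]
  by (subst Bochner_Integration.integral_sum)
    (auto intro!: sum.neutral integral_dird_eq_0[where \<Omega> = \<Omega>] test_fun_integrable[where \<Omega> = \<Omega>]
      test_fun_dird assms)

text \<open>Bumps for shrinking neighbourhoods of \<open>K\<close>. They all live in one compact set
  \<open>L\<close>, so that limits can be taken by dominated convergence.\<close>

lemma test_fun_approx_indicator:
  fixes K :: "'a::euclidean_space set"
  assumes "compact K" "open \<Omega>" "K \<subseteq> \<Omega>"
  obtains \<kappa> L where "\<And>n::nat. test_fun \<Omega> (\<kappa> n)" "\<And>n x. 0 \<le> \<kappa> n x" "\<And>n x. \<kappa> n x \<le> 1"
    "\<And>x. (\<lambda>n. \<kappa> n x) \<longlonglongrightarrow> indicator K x" "compact L" "L \<subseteq> \<Omega>" "\<And>n x. x \<notin> L \<Longrightarrow> \<kappa> n x = 0"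
proof -
  obtain r where r: "r > 0" "(\<Union>x\<in>K. cball x r) \<subseteq> \<Omega>"
    using compact_inflate[OF assms] .
  define U where "U = (\<lambda>n. \<Union>x\<in>K. ball x (r / real (Suc n)))"
  have "\<exists>\<kappa>. test_fun (U n) \<kappa> \<and> (\<forall>x. 0 \<le> \<kappa> x \<and> \<kappa> x \<le> 1) \<and> (\<forall>x\<in>K. \<kappa> x = 1)" for n
  proof -
    have "open (U n)" "K \<subseteq> U n"
      using r(1) by (auto simp: U_def)
    from test_fun_bump[OF assms(1) this] show ?thesis
      by metis
  qed
  then obtain \<kappa> where \<kappa>: "\<And>n. test_fun (U n) (\<kappa> n)" "\<And>n x. 0 \<le> \<kappa> n x" "\<And>n x. \<kappa> n x \<le> 1"
    "\<And>n x. x \<in> K \<Longrightarrow> \<kappa> n x = 1"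
    by metis
  have \<kappa>0: "\<kappa> n x = 0" if "x \<notin> U n" for n x
    using test_fun_eq_0[OF \<kappa>(1) that] .
  have U_sub: "U n \<subseteq> (\<Union>x\<in>K. cball x r)" for n
  proof -
    have "r / real (Suc n) \<le> r"
      using r(1) by (simp add: divide_le_eq)
    then show ?thesis
      unfolding U_def by (intro UN_mono) auto
  qed
  show thesis
  proof
    show "test_fun \<Omega> (\<kappa> n)" for n
      using test_fun_mono[OF \<kappa>(1)] U_sub r(2) by blast
    show "compact (\<Union>x\<in>K. cball x r)" "(\<Union>x\<in>K. cball x r) \<subseteq> \<Omega>"
      using compact_UN_cball[OF assms(1)] r(2) by auto
    show "\<kappa> n x = 0" if "x \<notin> (\<Union>x\<in>K. cball x r)" for n x
      using \<kappa>0 that U_sub by blast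
    show "(\<lambda>n. \<kappa> n x) \<longlonglongrightarrow> indicator K x" for x
    proof (cases "x \<in> K")
      case False
      then obtain e where e: "e > 0" "\<And>y. y \<in> K \<Longrightarrow> e \<le> dist y x"
        using separate_point_closed[OF compact_imp_closed[OF assms(1)]] by (metis dist_commute)
      obtain N where N: "real N > r / e"
        using reals_Archimedean2 by blast
      have "\<kappa> n x = 0" if "n \<ge> N" for n
      proof (rule \<kappa>0)
        have "r / e < real (Suc n)"
          using N that by linarith
        then have "r / real (Suc n) < e"
          using e(1) r(1) by (simp add: field_simps)
        then show "x \<notin> U n"
          using e(2) by (fastforce simp: U_def)
      qed
      then have "(\<lambda>n. \<kappa> n x) \<longlonglongrightarrow> 0"
        by (intro tendsto_eventually) (auto simp: eventually_sequentially)
      with False show ?thesis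
        by simp
    qed (simp add: \<kappa>(4))
  qed (use \<kappa> in auto)
qed

text \<open>A closed subset of nearly full measure is cut off by a large ball; each of the two steps
  costs less than \<open>e / 2\<close>.\<close>

lemma borel_inner_compact:
  fixes A :: "'a::euclidean_space set"
  assumes A: "A \<in> sets borel" "emeasure lborel A < \<infinity>" and "e > (0::real)"
  obtains K where "compact K" "K \<subseteq> A" "measure lborel (A - K) < e"
proof -
  have "A \<in> sets lebesgue"
    using A(1) by (simp add: sets_completionI_sets)
  then obtain T where T: "closed T" "T \<subseteq> A" "emeasure lebesgue (A - T) < ennreal (e/2)"
    by (rule sets_lebesgue_inner_closed[of A "e/2"]) (use \<open>e > 0\<close> in auto)
  have T_borel: "T \<in> sets borel"
    using T(1) by auto
  have fin: "emeasure lborel B \<noteq> \<infinity>" if "B \<subseteq> A" for B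
    using emeasure_mono[OF that, of lborel] A by (auto simp: less_top[symmetric] top_unique)
  have "emeasure lborel (A - T) < ennreal (e/2)"
    using T(3) A(1) T_borel by simp
  then have 1: "measure lborel (A - T) < e/2"
    using fin[of "A - T"] by (subst (asm) emeasure_eq_ennreal_measure) (auto simp: ennreal_less_iff)
  have "(\<lambda>n. measure lborel (T \<inter> cball 0 (real n))) \<longlonglongrightarrow> measure lborel (\<Union>n. T \<inter> cball 0 (real n))"
  proof (rule Lim_measure_incseq)
    show "emeasure lborel (\<Union>n. T \<inter> cball 0 (real n)) \<noteq> \<infinity>"
      using T(2) by (intro fin) auto
  qed (use T in \<open>auto simp: incseq_def\<close>)
  moreover have "(\<Union>n. T \<inter> cball 0 (real n)) = T"
    by (auto simp: real_arch_simple)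
  ultimately have "\<forall>\<^sub>F n in sequentially. measure lborel T - e/2 < measure lborel (T \<inter> cball 0 (real n))"
    using \<open>e > 0\<close> by (intro order_tendstoD(1)[where a = "measure lborel T - e/2"]) auto
  then obtain n where n: "measure lborel T - e/2 < measure lborel (T \<inter> cball 0 (real n))"
    by (auto simp: eventually_sequentially)
  let ?K = "T \<inter> cball 0 (real n)"
  have "measure lborel (A - T) = measure lborel A - measure lborel T"
    by (rule measure_Diff) (use A T T_borel fin in auto)
  moreover have "measure lborel (A - ?K) = measure lborel A - measure lborel ?K"
    by (rule measure_Diff) (use A T T_borel fin in auto)
  ultimately have "measure lborel (A - ?K) < e"
    using 1 n by linarith
  then show thesis
    using T by (intro that[of ?K]) (auto intro: closed_Int_compact)
qed

text \<open>Dominated convergence carries the hypothesis from test functions to indicators of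
  compact sets. If \<open>H < 0\<close> on a set of positive measure, that set would contain a
  compact set of positive measure, on which the integral of \<open>H\<close> is negative.\<close>

lemma AE_nonneg_if_test_nonneg:
  fixes H :: "'a::euclidean_space \<Rightarrow> real"
  assumes H: "integrable lborel H" and "open \<Omega>"
    and test: "\<And>\<phi>. test_fun \<Omega> \<phi> \<Longrightarrow> (\<And>x. 0 \<le> \<phi> x) \<Longrightarrow> 0 \<le> (\<integral>x. H x * \<phi> x \<partial>lborel)"
  shows "AE x in lborel. x \<in> \<Omega> \<longrightarrow> 0 \<le> H x"
proof -
  have [measurable]: "H \<in> borel_measurable borel"
    using borel_measurable_integrable[OF H] by simp
  have compact_nonneg: "0 \<le> (\<integral>x. H x * indicator K x \<partial>lborel)" if K: "compact K" "K \<subseteq> \<Omega>" for K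
  proof -
    obtain \<kappa> where \<kappa>: "\<And>n::nat. test_fun \<Omega> (\<kappa> n)" "\<And>n x. 0 \<le> \<kappa> n x" "\<And>n x. \<kappa> n x \<le> 1"
      "\<And>x. (\<lambda>n. \<kappa> n x) \<longlonglongrightarrow> indicator K x"
      using test_fun_approx_indicator[OF K(1) assms(2) K(2)] by metis
    have [measurable]: "\<kappa> n \<in> borel_measurable borel" for n
      by (rule test_fun_borel[OF \<kappa>(1)])
    have "(\<lambda>n. \<integral>x. H x * \<kappa> n x \<partial>lborel) \<longlonglongrightarrow> (\<integral>x. H x * indicator K x \<partial>lborel)"
    proof (rule integral_dominated_convergence[where w = "\<lambda>x. \<bar>H x\<bar>"])
      show "(\<lambda>x. H x * indicator K x) \<in> borel_measurable lborel"
        by (auto intro!: borel_measurable_times borel_measurable_indicator borel_closed compact_imp_closed K(1))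
      show "AE x in lborel. norm (H x * \<kappa> n x) \<le> \<bar>H x\<bar>" for n
        using \<kappa>(2,3) by (auto simp: abs_mult intro!: mult_left_le)
    qed (use H \<kappa>(4) in \<open>auto intro!: tendsto_intros\<close>)
    moreover have "0 \<le> (\<integral>x. H x * \<kappa> n x \<partial>lborel)" for n
      by (rule test[OF \<kappa>(1,2)])
    ultimately show ?thesis
      by (meson LIMSEQ_le_const)
  qed
  \<comment> \<open>The balls provide the finite measure that inner regularity asks for.\<close>
  define A where "A = (\<lambda>n::nat. {x. x \<in> \<Omega> \<and> H x < 0} \<inter> cball 0 (real n))"
  have A_borel: "A n \<in> sets borel" for n
    unfolding A_def using assms(2) by measurable
  have A_fin: "emeasure lborel (A n) < \<infinity>" for n
    by (intro emeasure_bounded_finite) (auto simp: A_def)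
  have "measure lborel (A n) = 0" for n
  proof (rule ccontr)
    assume "measure lborel (A n) \<noteq> 0"
    then have pos: "measure lborel (A n) > 0"
      using zero_less_measure_iff by blast
    obtain K where K: "compact K" "K \<subseteq> A n" "measure lborel (A n - K) < measure lborel (A n)"
      using borel_inner_compact[OF A_borel A_fin pos] .
    have K_borel: "K \<in> sets borel"
      using compact_imp_closed[OF K(1)] by auto
    have int: "integrable lborel (\<lambda>x. - (H x * indicator K x))"
      using H K_borel by (auto intro!: integrable_mult_bounded[where C = 1] simp: indicator_def)
    have "0 \<le> - (\<integral>x. - (H x * indicator K x) \<partial>lborel)"
      using compact_nonneg[OF K(1)] K(2) by (auto simp: A_def)
    moreover have "0 \<le> (\<integral>x. - (H x * indicator K x) \<partial>lborel)"
      using K(2) by (intro Bochner_Integration.integral_nonneg)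
        (auto simp: A_def indicator_def)
    ultimately have "(\<integral>x. - (H x * indicator K x) \<partial>lborel) = 0"
      by simp
    then have "AE x in lborel. - (H x * indicator K x) = 0"
    proof (subst (asm) integral_nonneg_eq_0_iff_AE[OF int])
      show "AE x in lborel. 0 \<le> - (H x * indicator K x)"
        using K(2) by (intro AE_I2) (auto simp: A_def indicator_def subset_iff)
    qed
    then have "AE x in lborel. x \<notin> K"
      by eventually_elim (use K(2) in \<open>auto simp: A_def indicator_def split: if_splits\<close>)
    then have "emeasure lborel K = 0"
      using AE_iff_null_sets[of K lborel] K_borel by auto
    then have "measure lborel K = 0"
      by (simp add: measure_def)
    moreover have "measure lborel (A n - K) = measure lborel (A n) - measure lborel K"
      by (rule measure_Diff) (use A_borel A_fin[of n] K K_borel in auto)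
    ultimately show False
      using K(3) by simp
  qed
  then have "A n \<in> null_sets lborel" for n
    using A_borel A_fin[of n] by (auto simp: null_sets_def emeasure_eq_ennreal_measure)
  then have "(\<Union>n. A n) \<in> null_sets lborel"
    by (intro null_sets_UN) auto
  then have "AE x in lborel. x \<notin> (\<Union>n. A n)"
    by (rule AE_not_in)
  then show ?thesis
  proof eventually_elim
    case (elim x)
    obtain n where "norm x \<le> real n"
      using real_arch_simple by blast
    with elim show ?case
      by (force simp: A_def)
  qed
qed

text \<open>Induction along the construction of the integral: indicators are reached through compact
  subsets and bumps, sums and dominated limits by halving the error.\<close>

lemma test_fun_dense_L1:
  fixes F :: "'a::euclidean_space \<Rightarrow> real"
  assumes "integrable lborel F" "e > 0"
  shows "\<exists>\<phi>. test_fun UNIV \<phi> \<and> (\<integral>x. \<bar>F x - \<phi> x\<bar> \<partial>lborel) < e"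
  using assms
proof (induction arbitrary: e rule: integrable_induct)
  case (base A c)
  \<comment> \<open>The \<open>+ 1\<close> keeps the quotient meaningful for \<open>c = 0\<close>,
    and \<open>\<bar>c\<bar> * e'\<close> stays below \<open>e\<close>.\<close>
  define e' where "e' = e / (2 * (\<bar>c\<bar> + 1))"
  have "e' > 0"
    using base(3) by (simp add: e'_def add_nonneg_pos)
  obtain K where K: "compact K" "K \<subseteq> A" "measure lborel (A - K) < e'"
    using borel_inner_compact[OF _ base(2) \<open>e' > 0\<close>] base(1) by auto
  have [measurable]: "K \<in> sets borel" "A \<in> sets borel"
    using compact_imp_closed[OF K(1)] base(1) by auto
  obtain \<kappa> L where \<kappa>: "\<And>n::nat. test_fun UNIV (\<kappa> n)" "\<And>n x. 0 \<le> \<kappa> n x" "\<And>n x. \<kappa> n x \<le> 1"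
    "\<And>x. (\<lambda>n. \<kappa> n x) \<longlonglongrightarrow> indicator K x" "compact L" "\<And>n x. x \<notin> L \<Longrightarrow> \<kappa> n x = 0"
    using test_fun_approx_indicator[OF K(1), of UNIV] by auto
  have [measurable]: "\<kappa> n \<in> borel_measurable borel" for n
    by (rule test_fun_borel[OF \<kappa>(1)])
  have L_int: "integrable lborel (\<lambda>x. indicator L x :: real)"
    using \<kappa>(5) by (intro integrable_bounded_support[of _ L 1])
      (auto simp: compact_imp_bounded compact_imp_closed)
  have A_int: "integrable lborel (\<lambda>x. indicator A x :: real)"
    using base(1,2) by (auto simp: integrable_indicator_iff)
  have "(\<lambda>n. \<integral>x. \<bar>indicator A x - \<kappa> n x\<bar> \<partial>lborel) \<longlonglongrightarrow> (\<integral>x. \<bar>indicator A x - indicator K x\<bar> \<partial>lborel)"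
  proof (rule integral_dominated_convergence[where w = "\<lambda>x. indicator A x + indicator L x"])
    show "AE x in lborel. norm \<bar>indicator A x - \<kappa> n x\<bar> \<le> indicator A x + indicator L x" for n
    proof (rule AE_I2)
      fix x show "norm \<bar>indicator A x - \<kappa> n x\<bar> \<le> indicator A x + indicator L x"
        using \<kappa>(2,3)[of n x] \<kappa>(6)[of x n] by (auto simp: indicator_def)
    qed
    show "AE x in lborel. (\<lambda>n. \<bar>indicator A x - \<kappa> n x\<bar>) \<longlonglongrightarrow> \<bar>indicator A x - indicator K x\<bar>"
      by (auto intro!: tendsto_intros \<kappa>(4))
  qed (use A_int L_int in auto)
  moreover have "(\<integral>x. \<bar>indicator A x - indicator K x\<bar> \<partial>lborel) = measure lborel (A - K)"
  proof -
    have "(\<lambda>x. \<bar>indicator A x - indicator K x\<bar> :: real) = indicator (A - K)"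
      using K(2) by (auto simp: indicator_def fun_eq_iff)
    then show ?thesis
      by simp
  qed
  ultimately have "\<forall>\<^sub>F n in sequentially. (\<integral>x. \<bar>indicator A x - \<kappa> n x\<bar> \<partial>lborel) < e'"
    using K(3) by (intro order_tendstoD(2)) auto
  then obtain n where n: "(\<integral>x. \<bar>indicator A x - \<kappa> n x\<bar> \<partial>lborel) < e'"
    by (auto simp: eventually_sequentially)
  have "(\<integral>x. \<bar>indicator A x *\<^sub>R c - c * \<kappa> n x\<bar> \<partial>lborel)
      = (\<integral>x. \<bar>c\<bar> * \<bar>indicator A x - \<kappa> n x\<bar> \<partial>lborel)"
    by (simp add: abs_mult[symmetric] algebra_simps)
  also have "\<dots> \<le> \<bar>c\<bar> * e'"
    using n by (simp add: mult_left_mono)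
  also have "\<dots> < e"
    using base(3) by (simp add: e'_def field_simps add_nonneg_pos)
  finally show ?case
    using test_fun_cmult[OF \<kappa>(1)] by blast
next
  case (add f g)
  obtain \<phi> where \<phi>: "test_fun UNIV \<phi>" "(\<integral>x. \<bar>f x - \<phi> x\<bar> \<partial>lborel) < e/2"
    using add.IH(1)[of "e/2"] add.prems by auto
  obtain \<psi> where \<psi>: "test_fun UNIV \<psi>" "(\<integral>x. \<bar>g x - \<psi> x\<bar> \<partial>lborel) < e/2"
    using add.IH(2)[of "e/2"] add.prems by auto
  have int: "integrable lborel (\<lambda>x. \<bar>f x - \<phi> x\<bar>)" "integrable lborel (\<lambda>x. \<bar>g x - \<psi> x\<bar>)"
    using add.hyps test_fun_integrable[OF \<phi>(1)] test_fun_integrable[OF \<psi>(1)]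
    by (auto intro!: integrable_abs)
  have "(\<integral>x. \<bar>f x + g x - (\<phi> x + \<psi> x)\<bar> \<partial>lborel) \<le> (\<integral>x. \<bar>f x - \<phi> x\<bar> + \<bar>g x - \<psi> x\<bar> \<partial>lborel)"
    using add.hyps test_fun_integrable[OF \<phi>(1)] test_fun_integrable[OF \<psi>(1)] int
    by (intro integral_mono integrable_abs Bochner_Integration.integrable_diff
        Bochner_Integration.integrable_add) auto
  also have "\<dots> < e"
    using \<phi>(2) \<psi>(2) int by simp
  finally show ?case
    using test_fun_add[OF \<phi>(1) \<psi>(1)] by blast
next
  case (lim f s)
  have [measurable]: "f \<in> borel_measurable borel" "\<And>i. s i \<in> borel_measurable borel"
    using lim.hyps(1,4) borel_measurable_integrable by auto
  have "(\<lambda>i. \<integral>x. \<bar>f x - s i x\<bar> \<partial>lborel) \<longlonglongrightarrow> (\<integral>x. \<bar>f x - f x\<bar> \<partial>lborel)"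
  proof (rule integral_dominated_convergence[where w = "\<lambda>x. 3 * \<bar>f x\<bar>"])
    show "AE x in lborel. norm \<bar>f x - s i x\<bar> \<le> 3 * \<bar>f x\<bar>" for i
    proof (rule AE_I2)
      fix x show "norm \<bar>f x - s i x\<bar> \<le> 3 * \<bar>f x\<bar>"
        using lim.hyps(3)[of x i] by simp
    qed
    show "AE x in lborel. (\<lambda>i. \<bar>f x - s i x\<bar>) \<longlonglongrightarrow> \<bar>f x - f x\<bar>"
      using lim.hyps(2) by (intro AE_I2 tendsto_rabs tendsto_diff tendsto_const) simp
  qed (use lim.hyps in auto)
  then have "\<forall>\<^sub>F i in sequentially. (\<integral>x. \<bar>f x - s i x\<bar> \<partial>lborel) < e/2"
    using lim.prems by (intro order_tendstoD(2)) auto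
  then obtain i where i: "(\<integral>x. \<bar>f x - s i x\<bar> \<partial>lborel) < e/2"
    by (auto simp: eventually_sequentially)
  obtain \<phi> where \<phi>: "test_fun UNIV \<phi>" "(\<integral>x. \<bar>s i x - \<phi> x\<bar> \<partial>lborel) < e/2"
    using lim.IH[where e = "e/2" and i = i] lim.prems by auto
  have int: "integrable lborel (\<lambda>x. \<bar>f x - s i x\<bar>)" "integrable lborel (\<lambda>x. \<bar>s i x - \<phi> x\<bar>)"
    using lim.hyps(1,4) test_fun_integrable[OF \<phi>(1)] by (auto intro!: integrable_abs)
  have "(\<integral>x. \<bar>f x - \<phi> x\<bar> \<partial>lborel) \<le> (\<integral>x. \<bar>f x - s i x\<bar> + \<bar>s i x - \<phi> x\<bar> \<partial>lborel)"
    using lim.hyps(1,4) test_fun_integrable[OF \<phi>(1)] int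
    by (intro integral_mono integrable_abs Bochner_Integration.integrable_diff
        Bochner_Integration.integrable_add) auto
  also have "\<dots> < e"
    using \<phi>(2) i int by simp
  finally show ?case
    using \<phi>(1) by blast
qed

subsection \<open>Averaging operators\<close>

lemma smooth_fun_mvt:
  assumes "smooth_fun \<phi>"
  shows "\<exists>s. 0 < s \<and> s < 1 \<and> \<phi> (x + h) - \<phi> x = dird h \<phi> (x + s *\<^sub>R h)"
proof -
  have "((\<lambda>t. \<phi> (x + t *\<^sub>R h)) has_derivative (\<lambda>r. dird (r *\<^sub>R h) \<phi> (x + t *\<^sub>R h))) (at t within {0..1})" for t
    by (rule has_derivative_compose[OF _ smooth_fun_has_derivative[OF assms]])
      (auto intro!: derivative_eq_intros)
  then have "\<exists>t\<in>{0<..<1}. \<phi> (x + 1 *\<^sub>R h) - \<phi> (x + 0 *\<^sub>R h) = dird ((1 - 0) *\<^sub>R h) \<phi> (x + t *\<^sub>R h)"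
    by (intro mvt_simple) auto
  then show ?thesis
    by auto
qed

lemma dird_expand:
  assumes "smooth_fun \<phi>"
  shows "dird h \<phi> x = (\<Sum>i\<in>Basis. (h \<bullet> i) * dird i \<phi> x)"
proof -
  interpret linear "\<lambda>v. dird v \<phi> x"
    by (rule has_derivative_linear[OF smooth_fun_has_derivative[OF assms]])
  have "dird (\<Sum>i\<in>Basis. (h \<bullet> i) *\<^sub>R i) \<phi> x = (\<Sum>i\<in>Basis. (h \<bullet> i) * dird i \<phi> x)"
    by (simp only: sum scale real_scaleR_def)
  then show ?thesis
    by (simp only: euclidean_representation)
qed

lemma test_fun_dird_bound:
  assumes "test_fun \<Omega> \<phi>"
  obtains L where "L > 0" "\<And>x h. \<bar>dird h \<phi> x\<bar> \<le> L * norm h"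
proof -
  have "\<exists>C>0. \<forall>x. \<bar>dird i \<phi> x\<bar> \<le> C" for i
    using test_fun_bounded[OF test_fun_dird[OF assms]] by metis
  then obtain C where C: "\<And>i. C i > 0" "\<And>i x. \<bar>dird i \<phi> x\<bar> \<le> C i"
    by metis
  have "\<bar>dird h \<phi> x\<bar> \<le> (\<Sum>i\<in>Basis. C i) * norm h" for x h
  proof -
    have "\<bar>dird h \<phi> x\<bar> \<le> (\<Sum>i\<in>Basis. \<bar>(h \<bullet> i) * dird i \<phi> x\<bar>)"
      by (subst dird_expand[OF test_fun_smooth[OF assms]]) (rule sum_abs)
    also have "\<dots> \<le> (\<Sum>i\<in>Basis. norm h * C i)"
      by (intro sum_mono) (auto simp: abs_mult intro!: mult_mono Basis_le_norm C(2))
    finally show ?thesis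
      by (simp add: sum_distrib_left mult.commute)
  qed
  then show thesis
    using C(1) by (intro that[of "\<Sum>i\<in>Basis. C i"]) (auto intro!: sum_pos)
qed

lemma test_fun_lipschitz:
  assumes "test_fun \<Omega> \<phi>"
  obtains L where "L > 0" "\<And>x h. \<bar>\<phi> (x + h) - \<phi> x\<bar> \<le> L * norm h"
proof -
  obtain L where L: "L > 0" "\<And>x h. \<bar>dird h \<phi> x\<bar> \<le> L * norm h"
    using test_fun_dird_bound[OF assms] by blast
  have "\<bar>\<phi> (x + h) - \<phi> x\<bar> \<le> L * norm h" for x h
    using smooth_fun_mvt[OF test_fun_smooth[OF assms], of x h] L(2) by metis
  with L(1) show thesis
    by (rule that)
qed

text \<open>The mean value theorem moves the derivative to an intermediate point, and first
  derivatives are Lipschitz. The bound is uniform in \<open>x\<close>, which allows differentiation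
  under averages.\<close>

lemma test_fun_taylor:
  assumes "test_fun \<Omega> \<phi>"
  obtains L where "L > 0" "\<And>x h. \<bar>\<phi> (x + h) - \<phi> x - dird h \<phi> x\<bar> \<le> L * (norm h)\<^sup>2"
proof -
  have "\<exists>C>0. \<forall>x h. \<bar>dird i \<phi> (x + h) - dird i \<phi> x\<bar> \<le> C * norm h" for i
    using test_fun_lipschitz[OF test_fun_dird[OF assms]] by metis
  then obtain C where C: "\<And>i. C i > 0" "\<And>i x h. \<bar>dird i \<phi> (x + h) - dird i \<phi> x\<bar> \<le> C i * norm h"
    by metis
  have sm: "smooth_fun \<phi>"
    by (rule test_fun_smooth[OF assms])
  have "\<bar>\<phi> (x + h) - \<phi> x - dird h \<phi> x\<bar> \<le> (\<Sum>i\<in>Basis. C i) * (norm h)\<^sup>2" for x h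
  proof -
    obtain s where s: "0 < s" "s < 1" "\<phi> (x + h) - \<phi> x = dird h \<phi> (x + s *\<^sub>R h)"
      using smooth_fun_mvt[OF sm] by blast
    have "\<bar>\<phi> (x + h) - \<phi> x - dird h \<phi> x\<bar>
        = \<bar>\<Sum>i\<in>Basis. (h \<bullet> i) * (dird i \<phi> (x + s *\<^sub>R h) - dird i \<phi> x)\<bar>"
      unfolding s(3) dird_expand[OF sm, where h = h] by (simp add: sum_subtractf right_diff_distrib)
    also have "\<dots> \<le> (\<Sum>i\<in>Basis. \<bar>(h \<bullet> i) * (dird i \<phi> (x + s *\<^sub>R h) - dird i \<phi> x)\<bar>)"
      by (rule sum_abs)
    also have "\<dots> \<le> (\<Sum>i\<in>Basis. norm h * (C i * norm h))"
    proof (intro sum_mono)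
      fix i :: 'a assume "i \<in> Basis"
      have "\<bar>dird i \<phi> (x + s *\<^sub>R h) - dird i \<phi> x\<bar> \<le> C i * norm (s *\<^sub>R h)"
        by (rule C(2))
      also have "\<dots> \<le> C i * norm h"
        using C(1)[of i] s by (intro mult_left_mono) (auto simp: mult_left_le_one_le)
      finally show "\<bar>(h \<bullet> i) * (dird i \<phi> (x + s *\<^sub>R h) - dird i \<phi> x)\<bar> \<le> norm h * (C i * norm h)"
        using \<open>i \<in> Basis\<close> by (auto simp: abs_mult intro!: mult_mono Basis_le_norm)
    qed
    finally show ?thesis
      by (simp add: sum_distrib_left sum_distrib_right power2_eq_square mult_ac)
  qed
  then show thesis
    using C(1) by (intro that[of "\<Sum>i\<in>Basis. C i"]) (auto intro!: sum_pos)
qed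

text \<open>A kernel lives on pairs \<open>(t, y)\<close>, which stand for the displacement \<open>t y\<close>. The operators with
  \<open>s = 1\<close> act on test functions, those with \<open>s = - 1\<close> are their adjoints.\<close>

definition kernel :: "real \<Rightarrow> (real \<times> 'a::euclidean_space \<Rightarrow> real) \<Rightarrow> bool" where
  "kernel R w \<longleftrightarrow> w \<in> borel_measurable borel \<and> (\<exists>C. \<forall>p. \<bar>w p\<bar> \<le> C) \<and>
    (\<forall>p. w p \<noteq> 0 \<longrightarrow> 0 \<le> fst p \<and> fst p \<le> R \<and> norm (snd p) \<le> 1)"

definition avg :: "real \<Rightarrow> (real \<times> 'a::euclidean_space \<Rightarrow> real) \<Rightarrow> ('a \<Rightarrow> real) \<Rightarrow> 'a \<Rightarrow> real" where
  "avg s w \<phi> x = (\<integral>p. w p * \<phi> (x + (s * fst p) *\<^sub>R snd p) \<partial>lborel)"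

lemma kernel_borel: "kernel R w \<Longrightarrow> w \<in> borel_measurable borel"
  by (simp add: kernel_def)

lemma kernel_integrable:
  fixes w :: "real \<times> 'a::euclidean_space \<Rightarrow> real"
  assumes "kernel R w"
  shows "integrable lborel w"
proof -
  obtain C where "\<And>p. \<bar>w p\<bar> \<le> C"
    using assms by (auto simp: kernel_def)
  moreover have "w p = 0" if "p \<notin> {0..R} \<times> cball 0 1" for p
  proof (rule ccontr)
    assume "w p \<noteq> 0"
    then have "0 \<le> fst p" "fst p \<le> R" "norm (snd p) \<le> 1"
      using assms unfolding kernel_def by blast+
    then show False
      using that by (cases p) auto
  qed
  ultimately show ?thesis
    by (intro integrable_bounded_support[of w "{0..R} \<times> cball 0 1" C] kernel_borel[OF assms]
        bounded_Times bounded_closed_interval bounded_cball)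
qed

lemma kernel_displacement:
  assumes "kernel R w" "\<bar>s\<bar> \<le> 1" "w p \<noteq> 0"
  shows "norm ((s * fst p) *\<^sub>R snd p) \<le> R"
proof -
  have "0 \<le> fst p" "fst p \<le> R" "norm (snd p) \<le> 1"
    using assms(1,3) unfolding kernel_def by blast+
  then have "\<bar>s\<bar> * \<bar>fst p\<bar> * norm (snd p) \<le> 1 * R * 1"
    using assms(2) by (intro mult_mono) auto
  then show ?thesis
    by (simp add: abs_mult)
qed

lemma avg_integrand_borel:
  fixes w :: "real \<times> 'a::euclidean_space \<Rightarrow> real"
  assumes [measurable]: "w \<in> borel_measurable borel" "\<phi> \<in> borel_measurable borel"
  shows "(\<lambda>p. w p * \<phi> (x + (s * fst p) *\<^sub>R snd p)) \<in> borel_measurable borel"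
proof -
  have "(\<lambda>p::real \<times> 'a. x + (s * fst p) *\<^sub>R snd p) \<in> borel_measurable borel"
    by (intro borel_measurable_continuous_onI continuous_intros)
  then show ?thesis
    by measurable
qed

lemma avg_integrand_integrable:
  fixes w :: "real \<times> 'a::euclidean_space \<Rightarrow> real"
  assumes "kernel R w" "\<phi> \<in> borel_measurable borel" "\<And>x. \<bar>\<phi> x\<bar> \<le> C"
  shows "integrable lborel (\<lambda>p. w p * \<phi> (x + (s * fst p) *\<^sub>R snd p))"
proof (rule integrable_mult_bounded[OF kernel_integrable[OF assms(1)], where C = C])
  show "(\<lambda>p. \<phi> (x + (s * fst p) *\<^sub>R snd p)) \<in> borel_measurable lborel"
    using avg_integrand_borel[of "\<lambda>_. 1" \<phi> x s] assms(2) by simp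
qed (rule assms(3))

lemma avg_test_integrable:
  assumes "kernel R w" "test_fun \<Omega> \<phi>"
  shows "integrable lborel (\<lambda>p. w p * \<phi> (x + (s * fst p) *\<^sub>R snd p))"
  using assms(2)
  by (rule test_fun_bounded) (auto intro: avg_integrand_integrable[OF assms(1)] test_fun_borel assms(2))

lemma avg_cong_local:
  assumes "kernel R w" "\<bar>s\<bar> \<le> 1" "\<And>y. y \<in> cball x R \<Longrightarrow> \<phi> y = \<psi> y"
  shows "avg s w \<phi> x = avg s w \<psi> x"
  unfolding avg_def
proof (rule Bochner_Integration.integral_cong[OF refl])
  fix p
  show "w p * \<phi> (x + (s * fst p) *\<^sub>R snd p) = w p * \<psi> (x + (s * fst p) *\<^sub>R snd p)"
    using kernel_displacement[OF assms(1,2), of p] assms(3)[of "x + (s * fst p) *\<^sub>R snd p"]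
    by (cases "w p = 0") (auto simp: dist_norm)
qed

lemma avg_const_local:
  assumes "kernel R w" "\<bar>s\<bar> \<le> 1" "\<And>y. y \<in> cball x R \<Longrightarrow> \<phi> y = c"
  shows "avg s w \<phi> x = c * integral\<^sup>L lborel w"
  by (subst avg_cong_local[OF assms]) (auto simp: avg_def)

lemma avg_eq_0:
  assumes "kernel R w" "\<bar>s\<bar> \<le> 1" "\<And>x. x \<notin> K \<Longrightarrow> \<phi> x = 0" "x \<notin> (\<Union>y\<in>K. cball y R)"
  shows "avg s w \<phi> x = 0"
proof -
  have "\<phi> y = 0" if "y \<in> cball x R" for y
    using assms(3)[of y] assms(4) that by (auto simp: dist_commute)
  then show ?thesis
    using avg_const_local[OF assms(1,2), of x \<phi> 0] by simp
qed

lemma avg_sum: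
  assumes "kernel R w" "\<And>i. i \<in> I \<Longrightarrow> test_fun \<Omega> (\<phi> i)"
  shows "avg s w (\<lambda>x. \<Sum>i\<in>I. c i * \<phi> i x) = (\<lambda>x. \<Sum>i\<in>I. c i * avg s w (\<phi> i) x)"
proof
  fix x
  have "avg s w (\<lambda>x. \<Sum>i\<in>I. c i * \<phi> i x) x
      = (\<integral>p. (\<Sum>i\<in>I. c i * (w p * \<phi> i (x + (s * fst p) *\<^sub>R snd p))) \<partial>lborel)"
    unfolding avg_def by (simp add: sum_distrib_left mult_ac)
  also have "\<dots> = (\<Sum>i\<in>I. c i * avg s w (\<phi> i) x)"
    by (subst Bochner_Integration.integral_sum)
      (auto simp: avg_def intro!: avg_test_integrable[OF assms(1) assms(2)])
  finally show "avg s w (\<lambda>x. \<Sum>i\<in>I. c i * \<phi> i x) x = (\<Sum>i\<in>I. c i * avg s w (\<phi> i) x)" .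
qed

text \<open>The Taylor remainder is uniform in the base point, so integrating it against
  \<open>w\<close> multiplies it only by the integral of \<open>\<bar>w\<bar>\<close>.\<close>

lemma avg_has_derivative:
  fixes \<phi> :: "'a::euclidean_space \<Rightarrow> real"
  assumes w: "kernel R w" and \<phi>: "test_fun \<Omega> \<phi>"
  shows "(avg s w \<phi> has_derivative (\<lambda>h. avg s w (dird h \<phi>) x)) (at x)"
proof -
  obtain L where L: "L > 0" "\<And>x h. \<bar>\<phi> (x + h) - \<phi> x - dird h \<phi> x\<bar> \<le> L * (norm h)\<^sup>2"
    using test_fun_taylor[OF \<phi>] by blast
  define W where "W = (\<integral>p. \<bar>w p\<bar> \<partial>lborel)"
  have w_int: "integrable lborel (\<lambda>p. \<bar>w p\<bar>)"
    using kernel_integrable[OF w] by (rule integrable_abs)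
  have expand: "avg s w (dird h \<phi>) x = (\<Sum>i\<in>Basis. (h \<bullet> i) * avg s w (dird i \<phi>) x)" for h
  proof -
    have "dird h \<phi> = (\<lambda>x. \<Sum>i\<in>Basis. (h \<bullet> i) * dird i \<phi> x)"
      by (rule ext, rule dird_expand[OF test_fun_smooth[OF \<phi>]])
    then have "avg s w (dird h \<phi>) x = avg s w (\<lambda>x. \<Sum>i\<in>Basis. (h \<bullet> i) * dird i \<phi> x) x"
      by simp
    also have "\<dots> = (\<Sum>i\<in>Basis. (h \<bullet> i) * avg s w (dird i \<phi>) x)"
      by (subst avg_sum[OF w, where \<Omega> = \<Omega>]) (auto intro: test_fun_dird \<phi>)
    finally show ?thesis .
  qed
  show ?thesis
  proof (rule has_derivativeI_sandwich[where e = 1 and H = "\<lambda>y. L * W * norm (y - x)"])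
    show "bounded_linear (\<lambda>h. avg s w (dird h \<phi>) x)"
      by (subst expand) (intro bounded_linear_sum bounded_linear_mult_const bounded_linear_inner_left)
    show "((\<lambda>y. L * W * norm (y - x)) \<longlongrightarrow> 0) (at x)"
      by (rule tendsto_eq_intros | simp)+
    fix y :: 'a assume "y \<noteq> x"
    define h where "h = y - x"
    have y: "y = x + h" "norm h > 0"
      using \<open>y \<noteq> x\<close> by (auto simp: h_def)
    define z where "z = (\<lambda>p :: real \<times> 'a. (s * fst p) *\<^sub>R snd p)"
    have "avg s w \<phi> y - avg s w \<phi> x - avg s w (dird h \<phi>) x
        = (\<integral>p. w p * (\<phi> (x + z p + h) - \<phi> (x + z p) - dird h \<phi> (x + z p)) \<partial>lborel)"
      using avg_test_integrable[OF w \<phi>, of y s] avg_test_integrable[OF w \<phi>, of x s]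
        avg_test_integrable[OF w test_fun_dird[OF \<phi>, of h], of x s]
      by (simp add: avg_def y(1) z_def algebra_simps)
    also have "\<bar>\<dots>\<bar> \<le> (\<integral>p. \<bar>w p\<bar> * (L * (norm h)\<^sup>2) \<partial>lborel)"
    proof (rule order_trans[OF integral_abs_bound])
      have "integrable lborel (\<lambda>p. w p * (\<phi> (x + z p + h) - \<phi> (x + z p) - dird h \<phi> (x + z p)))"
        using avg_test_integrable[OF w \<phi>, of y s] avg_test_integrable[OF w \<phi>, of x s]
          avg_test_integrable[OF w test_fun_dird[OF \<phi>, of h], of x s]
        by (simp add: right_diff_distrib y(1) z_def ac_simps)
      from integrable_abs[OF this]
      show "(\<integral>p. \<bar>w p * (\<phi> (x + z p + h) - \<phi> (x + z p) - dird h \<phi> (x + z p))\<bar> \<partial>lborel)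
        \<le> (\<integral>p. \<bar>w p\<bar> * (L * (norm h)\<^sup>2) \<partial>lborel)"
        using w_int by (intro integral_mono) (auto simp: abs_mult intro!: mult_left_mono L(2))
    qed
    also have "\<dots> = L * W * (norm h)\<^sup>2"
      by (simp add: W_def mult_ac)
    finally show "norm (avg s w \<phi> y - avg s w \<phi> x - avg s w (dird (y - x) \<phi>) x) / norm (y - x)
        \<le> L * W * norm (y - x)"
      using y(2) by (simp add: h_def[symmetric] divide_le_eq power2_eq_square mult_ac)
  qed auto
qed

lemma dird_avg: "kernel R w \<Longrightarrow> test_fun \<Omega> \<phi> \<Longrightarrow> dird v (avg s w \<phi>) = avg s w (dird v \<phi>)"
  by (rule ext, rule dird_eqI) (rule avg_has_derivative)

text \<open>The averages of test functions form a class closed under derivatives, because the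
  derivative of an average is the average of the derivative.\<close>

lemma smooth_fun_avg:
  assumes w: "kernel R w" and \<phi>: "test_fun \<Omega> \<phi>"
  shows "smooth_fun (avg s w \<phi>)"
proof (rule smooth_fun_coinduct[where P = "\<lambda>\<psi>. \<exists>\<phi>. test_fun \<Omega> \<phi> \<and> \<psi> = avg s w \<phi>"])
  fix \<psi> assume "\<exists>\<phi>. test_fun \<Omega> \<phi> \<and> \<psi> = avg s w \<phi>"
  then obtain \<phi> where "test_fun \<Omega> \<phi>" "\<psi> = avg s w \<phi>"
    by blast
  then show "(\<forall>x. \<psi> differentiable at x) \<and> (\<forall>v. \<exists>\<phi>. test_fun \<Omega> \<phi> \<and> dird v \<psi> = avg s w \<phi>)"
    using avg_has_derivative[OF w] dird_avg[OF w] test_fun_dird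
    unfolding differentiable_def by metis
qed (use \<phi> in auto)

lemma test_fun_avg:
  assumes w: "kernel R w" and s: "\<bar>s\<bar> \<le> 1" and \<phi>: "test_fun \<Omega> \<phi>"
    and K: "compact K" "\<And>x. x \<notin> K \<Longrightarrow> \<phi> x = 0" "(\<Union>x\<in>K. cball x R) \<subseteq> \<Omega>'"
  shows "test_fun \<Omega>' (avg s w \<phi>)"
  by (rule test_funI[OF smooth_fun_avg[OF w \<phi>] compact_UN_cball[OF K(1)] K(3)])
    (rule avg_eq_0[OF w s K(2)])

lemma test_fun_avg_UNIV:
  assumes w: "kernel R w" and s: "\<bar>s\<bar> \<le> 1" and \<phi>: "test_fun \<Omega> \<phi>"
  shows "test_fun UNIV (avg s w \<phi>)"
proof -
  obtain K where "smooth_fun \<phi>" "compact K" "K \<subseteq> \<Omega>" "\<And>x. x \<notin> K \<Longrightarrow> \<phi> x = 0"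
    using \<phi> by (rule test_funE) blast
  then show ?thesis
    by (intro test_fun_avg[OF w s \<phi>, of K]) auto
qed

lemma laplacian_avg:
  assumes w: "kernel R w" and \<phi>: "test_fun \<Omega> \<phi>"
  shows "laplacian (avg s w \<phi>) = avg s w (laplacian \<phi>)"
proof -
  have "laplacian (avg s w \<phi>) = (\<lambda>x. \<Sum>i\<in>Basis. 1 * avg s w (dird i (dird i \<phi>)) x)"
    unfolding laplacian_dird[abs_def]
    by (simp add: dird_avg[OF w \<phi>] dird_avg[OF w test_fun_dird[OF \<phi>]])
  also have "\<dots> = avg s w (laplacian \<phi>)"
    unfolding laplacian_dird[abs_def]
    using avg_sum[OF w, of Basis \<Omega> "\<lambda>i. dird i (dird i \<phi>)" s "\<lambda>_. 1"]
    by (simp add: test_fun_dird \<phi>)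
  finally show ?thesis .
qed

section \<open>Order, integrability and adjoints of averages\<close>

lemma avg_nonneg:
  assumes "\<And>p. 0 \<le> w p" "\<And>x. 0 \<le> \<phi> x"
  shows "0 \<le> avg s w \<phi> x"
  unfolding avg_def using assms by (intro Bochner_Integration.integral_nonneg) auto

lemma avg_kernel_mono:
  assumes "kernel R w" "kernel R w'" "test_fun \<Omega> \<phi>" "\<And>x. 0 \<le> \<phi> x" "\<And>p. w p \<le> c * w' p"
  shows "avg s w \<phi> x \<le> c * avg s w' \<phi> x"
proof -
  have "avg s w \<phi> x \<le> (\<integral>p. c * (w' p * \<phi> (x + (s * fst p) *\<^sub>R snd p)) \<partial>lborel)"
    unfolding avg_def
  proof (intro integral_mono integrable_mult_right)
    fix p
    have "w p * \<phi> (x + (s * fst p) *\<^sub>R snd p) \<le> (c * w' p) * \<phi> (x + (s * fst p) *\<^sub>R snd p)"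
      by (intro mult_right_mono assms(4,5))
    then show "w p * \<phi> (x + (s * fst p) *\<^sub>R snd p) \<le> c * (w' p * \<phi> (x + (s * fst p) *\<^sub>R snd p))"
      by (simp only: mult.assoc)
  qed (auto intro: avg_test_integrable[OF assms(1,3)] avg_test_integrable[OF assms(2,3)])
  then show ?thesis
    by (simp add: avg_def)
qed

text \<open>By translation invariance the inner integral over \<open>x\<close> depends on the
  displacement only through \<open>\<bar>w p\<bar>\<close>, so Fubini applies to merely integrable
  \<open>u\<close>.\<close>

lemma avg_pair_integrable:
  fixes u :: "'a::euclidean_space \<Rightarrow> real"
  assumes w: "kernel R w" and u: "integrable lborel u"
  shows "integrable (lborel \<Otimes>\<^sub>M lborel) (\<lambda>(p, x). w p * u (x + (s * fst p) *\<^sub>R snd p))"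
    and "(\<integral>p. (\<integral>x. \<bar>w p * u (x + (s * fst p) *\<^sub>R snd p)\<bar> \<partial>lborel) \<partial>lborel)
      = (\<integral>p. \<bar>w p\<bar> \<partial>lborel) * (\<integral>x. \<bar>u x\<bar> \<partial>lborel)"
proof -
  have [measurable]: "u \<in> borel_measurable borel" "w \<in> borel_measurable borel"
    using borel_measurable_integrable[OF u] kernel_borel[OF w] by auto
  have inner: "(\<integral>x. \<bar>w p * u (x + a)\<bar> \<partial>lborel) = \<bar>w p\<bar> * (\<integral>x. \<bar>u x\<bar> \<partial>lborel)" for p a
    using lborel_translation(1)[of "\<lambda>x. \<bar>u x\<bar>" a] by (simp add: abs_mult)
  show "integrable (lborel \<Otimes>\<^sub>M lborel) (\<lambda>(p, x). w p * u (x + (s * fst p) *\<^sub>R snd p))"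
  proof (rule lborel_pair.Fubini_integrable)
    have "(\<lambda>q :: (real \<times> 'a) \<times> 'a. snd q + (s * fst (fst q)) *\<^sub>R snd (fst q)) \<in> borel_measurable borel"
      by (intro borel_measurable_continuous_onI continuous_intros)
    then have [measurable]: "(\<lambda>q :: (real \<times> 'a) \<times> 'a. snd q + (s * fst (fst q)) *\<^sub>R snd (fst q))
        \<in> borel_measurable (borel \<Otimes>\<^sub>M borel)"
      by (simp add: borel_prod)
    have "(\<lambda>q :: (real \<times> 'a) \<times> 'a. w (fst q) * u (snd q + (s * fst (fst q)) *\<^sub>R snd (fst q)))
        \<in> borel_measurable (borel \<Otimes>\<^sub>M borel)"
      by measurable
    then show "(\<lambda>(p, x). w p * u (x + (s * fst p) *\<^sub>R snd p)) \<in> borel_measurable (lborel \<Otimes>\<^sub>M lborel)"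
      by (simp add: split_beta')
    show "integrable lborel (\<lambda>p. \<integral>x. norm (case (p, x) of (p, x) \<Rightarrow> w p * u (x + (s * fst p) *\<^sub>R snd p)) \<partial>lborel)"
      using kernel_integrable[OF w] by (simp add: inner)
    show "AE p in lborel. integrable lborel (\<lambda>x. case (p, x) of (p, x) \<Rightarrow> w p * u (x + (s * fst p) *\<^sub>R snd p))"
      using u by (auto intro!: AE_I2 simp: lborel_translation(2))
  qed
  show "(\<integral>p. (\<integral>x. \<bar>w p * u (x + (s * fst p) *\<^sub>R snd p)\<bar> \<partial>lborel) \<partial>lborel)
      = (\<integral>p. \<bar>w p\<bar> \<partial>lborel) * (\<integral>x. \<bar>u x\<bar> \<partial>lborel)"
    by (simp add: inner)
qed

text \<open>For merely integrable \<open>u\<close> the integral that defines the average exists only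
  almost everywhere; at the other points \<open>avg\<close> takes the default value
  \<open>0\<close>, which no integral over \<open>x\<close> notices.\<close>

lemma
  fixes u :: "'a::euclidean_space \<Rightarrow> real"
  assumes w: "kernel R w" and u: "integrable lborel u"
  shows avg_integrable: "integrable lborel (avg s w u)"
    and avg_AE_integrable: "AE x in lborel. integrable lborel (\<lambda>p. w p * u (x + (s * fst p) *\<^sub>R snd p))"
    and avg_L1_bound: "(\<integral>x. \<bar>avg s w u x\<bar> \<partial>lborel) \<le> (\<integral>p. \<bar>w p\<bar> \<partial>lborel) * (\<integral>x. \<bar>u x\<bar> \<partial>lborel)"
proof -
  note int = avg_pair_integrable(1)[OF w u, of s]
  show 1: "integrable lborel (avg s w u)"
    using lborel_pair.integrable_snd[OF int] by (simp add: avg_def[abs_def])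
  show 2: "AE x in lborel. integrable lborel (\<lambda>p. w p * u (x + (s * fst p) *\<^sub>R snd p))"
    using lborel_pair.AE_integrable_snd[OF int] by simp
  have int': "integrable (lborel \<Otimes>\<^sub>M lborel) (\<lambda>(p, x). \<bar>w p * u (x + (s * fst p) *\<^sub>R snd p)\<bar>)"
    using integrable_abs[OF int] by (simp add: split_beta')
  have "(\<integral>x. \<bar>avg s w u x\<bar> \<partial>lborel) \<le> (\<integral>x. (\<integral>p. \<bar>w p * u (x + (s * fst p) *\<^sub>R snd p)\<bar> \<partial>lborel) \<partial>lborel)"
    using lborel_pair.integrable_snd[OF int'] integrable_abs[OF 1]
    by (intro integral_mono) (auto simp: avg_def)
  also have "\<dots> = (\<integral>p. (\<integral>x. \<bar>w p * u (x + (s * fst p) *\<^sub>R snd p)\<bar> \<partial>lborel) \<partial>lborel)"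
    by (rule lborel_pair.Fubini_integral[OF int'])
  also have "\<dots> = (\<integral>p. \<bar>w p\<bar> \<partial>lborel) * (\<integral>x. \<bar>u x\<bar> \<partial>lborel)"
    by (rule avg_pair_integrable(2)[OF w u])
  finally show "(\<integral>x. \<bar>avg s w u x\<bar> \<partial>lborel) \<le> (\<integral>p. \<bar>w p\<bar> \<partial>lborel) * (\<integral>x. \<bar>u x\<bar> \<partial>lborel)" .
qed

text \<open>Fubini, and for each fixed displacement the translation that moves it from
  \<open>\<phi>\<close> to \<open>u\<close> with opposite sign.\<close>

lemma avg_adjoint:
  fixes u \<phi> :: "'a::euclidean_space \<Rightarrow> real"
  assumes w: "kernel R w" and u: "integrable lborel u"
    and [measurable]: "\<phi> \<in> borel_measurable borel" and C: "\<And>x. \<bar>\<phi> x\<bar> \<le> C"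
  shows "(\<integral>x. u x * avg s w \<phi> x \<partial>lborel) = (\<integral>x. avg (- s) w u x * \<phi> x \<partial>lborel)"
proof -
  have [measurable]: "u \<in> borel_measurable borel" "w \<in> borel_measurable borel"
    using borel_measurable_integrable[OF u] kernel_borel[OF w] by auto
  have int: "integrable (lborel \<Otimes>\<^sub>M lborel) (\<lambda>(p, x). w p * u (x + (- s * fst p) *\<^sub>R snd p) * \<phi> x)"
  proof -
    have "integrable (lborel \<Otimes>\<^sub>M lborel) (\<lambda>q. (case q of (p, x) \<Rightarrow> w p * u (x + (- s * fst p) *\<^sub>R snd p)) * \<phi> (snd q))"
      by (rule integrable_mult_bounded[OF avg_pair_integrable(1)[OF w u] _ C]) measurable
    then show ?thesis
      by (simp add: split_beta')
  qed
  have int': "integrable (lborel \<Otimes>\<^sub>M lborel) (\<lambda>(p, x). w p * u x * \<phi> (x + (s * fst p) *\<^sub>R snd p))"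
  proof -
    \<comment> \<open>The displacement factor \<open>0\<close> specialises the previous
      integrability to the untranslated product \<open>w p * u x\<close>.\<close>
    have "integrable (lborel \<Otimes>\<^sub>M lborel) (\<lambda>q :: (real \<times> 'a) \<times> 'a.
        (case q of (p, x) \<Rightarrow> w p * u (x + (0 * fst p) *\<^sub>R snd p))
          * \<phi> (snd q + (s * fst (fst q)) *\<^sub>R snd (fst q)))"
    proof (rule integrable_mult_bounded[OF avg_pair_integrable(1)[OF w u, of 0] _ C])
      have "(\<lambda>q :: (real \<times> 'a) \<times> 'a. snd q + (s * fst (fst q)) *\<^sub>R snd (fst q)) \<in> borel_measurable borel"
        by (intro borel_measurable_continuous_onI continuous_intros)
      then have [measurable]: "(\<lambda>q :: (real \<times> 'a) \<times> 'a. snd q + (s * fst (fst q)) *\<^sub>R snd (fst q))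
          \<in> borel_measurable (borel \<Otimes>\<^sub>M borel)"
        by (simp add: borel_prod)
      have "(\<lambda>q :: (real \<times> 'a) \<times> 'a. \<phi> (snd q + (s * fst (fst q)) *\<^sub>R snd (fst q)))
          \<in> borel_measurable (borel \<Otimes>\<^sub>M borel)"
        by measurable
      then show "(\<lambda>q :: (real \<times> 'a) \<times> 'a. \<phi> (snd q + (s * fst (fst q)) *\<^sub>R snd (fst q)))
          \<in> borel_measurable (lborel \<Otimes>\<^sub>M lborel)"
        by simp
    qed
    then show ?thesis
      by (simp add: split_beta')
  qed
  have "(\<integral>x. u x * avg s w \<phi> x \<partial>lborel)
      = (\<integral>x. (\<integral>p. w p * u x * \<phi> (x + (s * fst p) *\<^sub>R snd p) \<partial>lborel) \<partial>lborel)"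
    unfolding avg_def by (subst integral_mult_right_zero[symmetric]) (simp add: mult_ac)
  also have "\<dots> = (\<integral>p. (\<integral>x. w p * u x * \<phi> (x + (s * fst p) *\<^sub>R snd p) \<partial>lborel) \<partial>lborel)"
    by (rule lborel_pair.Fubini_integral[OF int'])
  also have "\<dots> = (\<integral>p. (\<integral>x. w p * u (x + (- s * fst p) *\<^sub>R snd p) * \<phi> x \<partial>lborel) \<partial>lborel)"
  proof (rule Bochner_Integration.integral_cong[OF refl])
    fix p
    have "(\<integral>x. w p * u (x + (- s * fst p) *\<^sub>R snd p) * \<phi> x \<partial>lborel)
        = (\<integral>x. w p * u (x + (s * fst p) *\<^sub>R snd p + (- s * fst p) *\<^sub>R snd p) * \<phi> (x + (s * fst p) *\<^sub>R snd p) \<partial>lborel)"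
      by (rule lborel_translation(1)[symmetric]) measurable
    then show "(\<integral>x. w p * u x * \<phi> (x + (s * fst p) *\<^sub>R snd p) \<partial>lborel)
        = (\<integral>x. w p * u (x + (- s * fst p) *\<^sub>R snd p) * \<phi> x \<partial>lborel)"
      by simp
  qed
  also have "\<dots> = (\<integral>x. (\<integral>p. w p * u (x + (- s * fst p) *\<^sub>R snd p) * \<phi> x \<partial>lborel) \<partial>lborel)"
    by (rule lborel_pair.Fubini_integral[OF int, symmetric])
  also have "\<dots> = (\<integral>x. avg (- s) w u x * \<phi> x \<partial>lborel)"
    by (simp add: avg_def)
  finally show ?thesis .
qed

lemma avg_adjoint_test:
  assumes "kernel R w" "integrable lborel u" "test_fun \<Omega> \<phi>"
  shows "(\<integral>x. u x * avg s w \<phi> x \<partial>lborel) = (\<integral>x. avg (- s) w u x * \<phi> x \<partial>lborel)"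
  using assms(3)
  by (rule test_fun_bounded) (auto intro: avg_adjoint[OF assms(1,2)] test_fun_borel assms(3))

lemma avg_approx_test:
  assumes w: "kernel R w" "\<And>p. 0 \<le> w p" and "\<bar>s\<bar> \<le> 1" and \<phi>: "test_fun \<Omega> \<phi>"
    and L: "\<And>x h. \<bar>\<phi> (x + h) - \<phi> x\<bar> \<le> L * norm h"
  shows "\<bar>avg s w \<phi> x - integral\<^sup>L lborel w * \<phi> x\<bar> \<le> L * R * integral\<^sup>L lborel w"
proof -
  define z where "z = (\<lambda>p :: real \<times> 'a. (s * fst p) *\<^sub>R snd p)"
  have int: "integrable lborel (\<lambda>p. w p * \<phi> (x + z p))" "integrable lborel (\<lambda>p. w p * \<phi> x)"
    using avg_test_integrable[OF w(1) \<phi>] kernel_integrable[OF w(1)] by (auto simp: z_def)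
  have "avg s w \<phi> x - integral\<^sup>L lborel w * \<phi> x = (\<integral>p. w p * \<phi> (x + z p) - w p * \<phi> x \<partial>lborel)"
    using int by (simp add: avg_def z_def)
  also have "\<bar>\<dots>\<bar> \<le> (\<integral>p. \<bar>w p * \<phi> (x + z p) - w p * \<phi> x\<bar> \<partial>lborel)"
    by (rule integral_abs_bound)
  also have "\<dots> \<le> (\<integral>p. w p * (L * R) \<partial>lborel)"
  proof (intro integral_mono)
    fix p
    show "\<bar>w p * \<phi> (x + z p) - w p * \<phi> x\<bar> \<le> w p * (L * R)"
    proof (cases "w p = 0")
      case False
      \<comment> \<open>The Lipschitz bound at a nonzero displacement forces the sign of
        \<open>L\<close>.\<close>
      have L0: "L \<ge> 0"
      proof -
        obtain b :: 'a where "b \<in> Basis"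
          using nonempty_Basis by blast
        then show ?thesis
          using L[of 0 b] by simp
      qed
      have "\<bar>\<phi> (x + z p) - \<phi> x\<bar> \<le> L * norm (z p)"
        by (rule L)
      also have "\<dots> \<le> L * R"
        unfolding z_def by (rule mult_left_mono[OF kernel_displacement[OF w(1) assms(3) False] L0])
      finally have "w p * \<bar>\<phi> (x + z p) - \<phi> x\<bar> \<le> w p * (L * R)"
        by (rule mult_left_mono[OF _ w(2)])
      moreover have "\<bar>w p * \<phi> (x + z p) - w p * \<phi> x\<bar> = w p * \<bar>\<phi> (x + z p) - \<phi> x\<bar>"
        using w(2)[of p] by (simp add: abs_mult flip: right_diff_distrib)
      ultimately show ?thesis
        by simp
    qed simp
  qed (use int kernel_integrable[OF w(1)] in auto)
  finally show ?thesis
    by (simp add: mult_ac)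
qed

text \<open>The two profiles are related by \<open>\<nabla>zeta(y) = - eta(y) y\<close>.\<close>

definition eta :: "'a::euclidean_space \<Rightarrow> real" where
  "eta y = 2 * flat 2 (1 - (norm y)\<^sup>2) / (\<integral>z. 2 * flat 2 (1 - (norm (z::'a))\<^sup>2) \<partial>lborel)"

definition zeta :: "'a::euclidean_space \<Rightarrow> real" where
  "zeta y = flat 0 (1 - (norm y)\<^sup>2) / (\<integral>z. 2 * flat 2 (1 - (norm (z::'a))\<^sup>2) \<partial>lborel)"

section \<open>The radial profiles\<close>

lemma smooth_fun_flat_norm: "smooth_fun (\<lambda>y::'a::euclidean_space. c * flat k (1 - (norm y)\<^sup>2))"
  using smooth_fun_norm_diff_sq[of "0::'a"]
  by (intro smooth_fun_cmult smooth_fun_flat smooth_fun_diff smooth_fun_const) simp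

lemma test_fun_flat_norm: "test_fun UNIV (\<lambda>y::'a::euclidean_space. c * flat k (1 - (norm y)\<^sup>2))"
proof (rule test_funI[OF smooth_fun_flat_norm compact_cball[of 0 1]])
  fix x :: 'a assume "x \<notin> cball 0 1"
  then have "1 \<le> (norm x)\<^sup>2"
    by (simp add: power2_eq_square mult_ge1_I)
  then show "c * flat k (1 - (norm x)\<^sup>2) = 0"
    by simp
qed simp

lemma norm_sq_gt_1: "norm x > 1 \<Longrightarrow> 1 - (norm x)\<^sup>2 \<le> 0"
  by (simp add: one_le_power)

lemma flat_mass_pos: "(\<integral>z. flat k (1 - (norm (z::'a::euclidean_space))\<^sup>2) \<partial>lborel) > 0"
proof -
  let ?f = "\<lambda>z::'a. flat k (1 - (norm z)\<^sup>2)"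
  have int: "integrable lborel ?f"
    using test_fun_integrable[OF test_fun_flat_norm[of 1 k]] by simp
  have nonneg: "AE z in lborel. 0 \<le> ?f z"
    by (simp add: flat_nonneg)
  have "integral\<^sup>L lborel ?f \<noteq> 0"
  proof
    assume "integral\<^sup>L lborel ?f = 0"
    then have "AE z in lborel. ?f z = 0"
      using integral_nonneg_eq_0_iff_AE[OF int nonneg] by simp
    then have "AE z in lborel. z \<notin> ball (0::'a) 1"
    proof eventually_elim
      case (elim z)
      have "?f z > 0" if "norm z < 1"
        using that by (simp add: flat_pos abs_square_less_1)
      with elim show ?case
        by auto
    qed
    then have "emeasure lborel (ball (0::'a) 1) = 0"
      using AE_iff_null_sets[of "ball (0::'a) 1" lborel] by auto
    then show False
      using content_ball_pos[of 1 "0::'a"] by (simp add: measure_def)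
  qed
  moreover have "integral\<^sup>L lborel ?f \<ge> 0"
    by (intro Bochner_Integration.integral_nonneg) (simp add: flat_nonneg)
  ultimately show ?thesis
    by linarith
qed

lemma eta_mass_pos: "(\<integral>z. 2 * flat 2 (1 - (norm (z::'a::euclidean_space))\<^sup>2) \<partial>lborel) > 0"
  using flat_mass_pos[where 'a = 'a, of 2] by simp

lemma test_fun_eta: "test_fun UNIV (eta :: 'a::euclidean_space \<Rightarrow> real)"
  and test_fun_zeta: "test_fun UNIV (zeta :: 'a::euclidean_space \<Rightarrow> real)"
proof -
  show "test_fun UNIV (eta :: 'a \<Rightarrow> real)"
    using test_fun_flat_norm[of "2 / (\<integral>z. 2 * flat 2 (1 - (norm (z::'a))\<^sup>2) \<partial>lborel)" 2]
    unfolding eta_def[abs_def] by (simp add: field_simps)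
  show "test_fun UNIV (zeta :: 'a \<Rightarrow> real)"
    using test_fun_flat_norm[of "1 / (\<integral>z. 2 * flat 2 (1 - (norm (z::'a))\<^sup>2) \<partial>lborel)" 0]
    unfolding zeta_def[abs_def] by (simp add: field_simps)
qed

lemma eta_eq_0: "norm y > 1 \<Longrightarrow> eta y = 0"
  and zeta_eq_0: "norm y > 1 \<Longrightarrow> zeta y = 0"
  by (simp_all add: eta_def zeta_def norm_sq_gt_1)

lemma eta_nonneg: "eta y \<ge> 0"
  and zeta_nonneg: "zeta y \<ge> 0"
  by (simp_all add: eta_def zeta_def flat_nonneg eta_mass_pos less_imp_le)

lemma integral_eta: "integral\<^sup>L lborel (eta :: 'a::euclidean_space \<Rightarrow> real) = 1"
  using eta_mass_pos[where 'a = 'a] unfolding eta_def[abs_def] by simp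

text \<open>Inside the unit ball the quotient \<open>eta y / zeta y\<close> is
  \<open>2 / (1 - (norm y)\<^sup>2)\<^sup>2\<close>, hence at least \<open>2\<close>. This is half
  of the domination of \<open>green_ker\<close> by \<open>mean_ker\<close>; the other half concerns
  the radial weights.\<close>

lemma zeta_le_eta: "2 * zeta y \<le> eta y"
proof -
  have "flat 0 (1 - (norm y)\<^sup>2) \<le> flat 2 (1 - (norm y)\<^sup>2)"
  proof (cases "1 - (norm y)\<^sup>2 > 0")
    case True
    then have "(1 - (norm y)\<^sup>2)\<^sup>2 \<le> 1"
      by (intro power_le_one) auto
    then show ?thesis
      using True by (simp add: flat_def le_divide_eq)
  qed (simp add: flat_def)
  then show ?thesis
    using eta_mass_pos[where 'a = 'a] by (simp add: eta_def zeta_def divide_right_mono)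
qed

text \<open>For \<open>k = 0\<close> the second term in the derivative of \<open>flat k\<close>
  drops out and \<open>flat 2\<close> remains. The factor \<open>2\<close> in \<open>eta\<close> is
  the one produced by differentiating \<open>(norm y)\<^sup>2\<close>.\<close>

lemma dird_zeta: "dird v zeta y = - ((y \<bullet> v) * eta y)"
proof -
  let ?c = "\<integral>z. 2 * flat 2 (1 - (norm (z::'a))\<^sup>2) \<partial>lborel"
  have "((\<lambda>y::'a. 1 - y \<bullet> y) has_derivative (\<lambda>h. - (2 * (y \<bullet> h)))) (at y)"
    by (auto intro!: derivative_eq_intros simp: inner_commute)
  from DERIV_compose_FDERIV[OF flat_has_real_derivative[of 0 "1 - y \<bullet> y"] this]
  have "((\<lambda>y::'a. flat 0 (1 - y \<bullet> y)) has_derivative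
      (\<lambda>h. - (2 * (y \<bullet> h)) * flat 2 (1 - y \<bullet> y))) (at y)"
    by (simp flip: numeral_2_eq_2)
  then have "(zeta has_derivative (\<lambda>h. - (2 * (y \<bullet> h)) * flat 2 (1 - y \<bullet> y) / ?c)) (at y)"
  proof -
    define c where "c = ?c"
    have z: "(zeta :: 'a \<Rightarrow> real) = (\<lambda>y. flat 0 (1 - y \<bullet> y) / c)" and "c \<noteq> 0"
      using eta_mass_pos[where 'a = 'a] by (auto simp: zeta_def fun_eq_iff dot_square_norm c_def)
    assume "((\<lambda>y::'a. flat 0 (1 - y \<bullet> y)) has_derivative
      (\<lambda>h. - (2 * (y \<bullet> h)) * flat 2 (1 - y \<bullet> y))) (at y)"
    from has_derivative_mult_right[OF this, of "inverse c"]
    show ?thesis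
      unfolding z c_def[symmetric] by (simp add: divide_inverse mult_ac)
  qed
  then have "dird v zeta y = - (2 * (y \<bullet> v)) * flat 2 (1 - y \<bullet> y) / ?c"
    by (rule dird_eqI)
  then show ?thesis
    by (simp add: eta_def dot_square_norm)
qed

section \<open>Product kernels and the mean value formula\<close>

definition wprod :: "real \<Rightarrow> (real \<Rightarrow> real) \<Rightarrow> ('a::euclidean_space \<Rightarrow> real) \<Rightarrow> real \<times> 'a \<Rightarrow> real" where
  "wprod R a b p = indicator {0..R} (fst p) * a (fst p) * b (snd p)"

lemma kernel_wprod:
  fixes b :: "'a::euclidean_space \<Rightarrow> real"
  assumes a: "continuous_on UNIV a" and b: "test_fun UNIV b" "\<And>y. norm y > 1 \<Longrightarrow> b y = 0"
  shows "kernel R (wprod R a b)"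
proof -
  have [measurable]: "a \<in> borel_measurable borel" "b \<in> borel_measurable borel"
    using a b(1) by (auto intro: borel_measurable_continuous_onI test_fun_borel)
  have "wprod R a b \<in> borel_measurable (borel \<Otimes>\<^sub>M borel)"
    unfolding wprod_def by measurable
  moreover have "\<exists>C. \<forall>p. \<bar>wprod R a b p\<bar> \<le> C"
  proof -
    have "bounded (a ` {0..R})"
      by (intro compact_imp_bounded compact_continuous_image continuous_on_subset[OF a]) auto
    then obtain A where A: "A > 0" "\<And>t. t \<in> {0..R} \<Longrightarrow> \<bar>a t\<bar> \<le> A"
      by (auto simp: bounded_pos)
    obtain B where B: "B > 0" "\<And>y. \<bar>b y\<bar> \<le> B"
      using test_fun_bounded[OF b(1)] by blast
    have "\<bar>wprod R a b p\<bar> \<le> A * B" for p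
      using A B by (auto simp: wprod_def indicator_def abs_mult intro!: mult_mono)
    then show ?thesis
      by blast
  qed
  ultimately show ?thesis
    using b(2) unfolding kernel_def by (auto simp: borel_prod wprod_def indicator_def not_le[symmetric] split: if_splits)
qed

text \<open>The first form serves integration by parts in \<open>y\<close> at a fixed radius, the
  second the fundamental theorem of calculus along a ray.\<close>

lemma avg_wprod:
  fixes b :: "'a::euclidean_space \<Rightarrow> real"
  assumes "continuous_on UNIV a" "test_fun UNIV b" "\<And>y. norm y > 1 \<Longrightarrow> b y = 0" and \<phi>: "test_fun \<Omega> \<phi>"
  shows "avg s (wprod R a b) \<phi> x
      = (\<integral>t. indicator {0..R} t * a t * (\<integral>y. b y * \<phi> (x + (s * t) *\<^sub>R y) \<partial>lborel) \<partial>lborel)"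
    and "avg s (wprod R a b) \<phi> x
      = (\<integral>y. b y * (\<integral>t. indicator {0..R} t * a t * \<phi> (x + (s * t) *\<^sub>R y) \<partial>lborel) \<partial>lborel)"
proof -
  have int: "integrable (lborel \<Otimes>\<^sub>M lborel) (\<lambda>p. wprod R a b p * \<phi> (x + (s * fst p) *\<^sub>R snd p))"
    unfolding lborel_prod by (rule avg_test_integrable[OF kernel_wprod[OF assms(1-3)] \<phi>])
  have "avg s (wprod R a b) \<phi> x = (\<integral>t. (\<integral>y. wprod R a b (t, y) * \<phi> (x + (s * t) *\<^sub>R y) \<partial>lborel) \<partial>lborel)"
    using lborel_pair.integral_fst'[OF int] by (simp add: avg_def lborel_prod)
  also have "\<dots> = (\<integral>t. indicator {0..R} t * a t * (\<integral>y. b y * \<phi> (x + (s * t) *\<^sub>R y) \<partial>lborel) \<partial>lborel)"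
    by (simp add: wprod_def mult.assoc)
  finally show *: "avg s (wprod R a b) \<phi> x
      = (\<integral>t. indicator {0..R} t * a t * (\<integral>y. b y * \<phi> (x + (s * t) *\<^sub>R y) \<partial>lborel) \<partial>lborel)" .
  have "avg s (wprod R a b) \<phi> x = (\<integral>y. (\<integral>t. wprod R a b (t, y) * \<phi> (x + (s * t) *\<^sub>R y) \<partial>lborel) \<partial>lborel)"
    using lborel_pair.integral_snd[of "\<lambda>t y. wprod R a b (t, y) * \<phi> (x + (s * t) *\<^sub>R y)"] int
    by (simp add: avg_def lborel_prod split_beta')
  also have "\<dots> = (\<integral>y. b y * (\<integral>t. indicator {0..R} t * a t * \<phi> (x + (s * t) *\<^sub>R y) \<partial>lborel) \<partial>lborel)"
    by (subst integral_mult_right_zero[symmetric]) (simp add: wprod_def mult_ac)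
  finally show "avg s (wprod R a b) \<phi> x
      = (\<integral>y. b y * (\<integral>t. indicator {0..R} t * a t * \<phi> (x + (s * t) *\<^sub>R y) \<partial>lborel) \<partial>lborel)" .
qed

lemma integral_wprod:
  fixes b :: "'a::euclidean_space \<Rightarrow> real"
  assumes "continuous_on UNIV a" "test_fun UNIV b" "\<And>y. norm y > 1 \<Longrightarrow> b y = 0"
  shows "integral\<^sup>L lborel (wprod R a b) = (\<integral>t. indicator {0..R} t * a t \<partial>lborel) * integral\<^sup>L lborel b"
proof -
  have int: "integrable (lborel \<Otimes>\<^sub>M lborel) (wprod R a b)"
    unfolding lborel_prod by (rule kernel_integrable[OF kernel_wprod[OF assms]])
  have "integral\<^sup>L lborel (wprod R a b) = (\<integral>t. (\<integral>y. wprod R a b (t, y) \<partial>lborel) \<partial>lborel)"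
    using lborel_pair.integral_fst'[OF int] by (simp add: lborel_prod)
  then show ?thesis
    by (simp add: wprod_def)
qed

text \<open>The exponent \<open>m\<close> is the weight of the radii \<open>t\<close>: for \<open>m = 0\<close> the kernel \<open>mean_ker\<close> is singular
  enough at the origin to dominate \<open>green_ker\<close>, for \<open>m = DIM('a)\<close> it is bounded.\<close>

definition mean_ker :: "nat \<Rightarrow> real \<Rightarrow> real \<times> 'a::euclidean_space \<Rightarrow> real" where
  "mean_ker m R = wprod R (\<lambda>t. real (Suc m) * t ^ m / R ^ Suc m) eta"

text \<open>The factor \<open>1 - (t / R) ^ Suc m\<close> is the antiderivative of minus the radial
  weight of \<open>mean_ker\<close> that vanishes at \<open>R\<close>. The extra \<open>t\<close> is
  the inner derivative of \<open>y \<mapsto> \<phi> (x + t *\<^sub>R y)\<close>.\<close>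

definition green_ker :: "nat \<Rightarrow> real \<Rightarrow> real \<times> 'a::euclidean_space \<Rightarrow> real" where
  "green_ker m R = wprod R (\<lambda>t. (1 - (t / R) ^ Suc m) * t) zeta"

text \<open>The kernel \<open>green_ker\<close> one integration by parts earlier: it expresses the
  gradient of a \<open>green_ker\<close> average without differentiating the averaged
  function.\<close>

definition grad_ker :: "nat \<Rightarrow> real \<Rightarrow> 'a \<Rightarrow> real \<times> 'a::euclidean_space \<Rightarrow> real" where
  "grad_ker m R i = wprod R (\<lambda>t. 1 - (t / R) ^ Suc m) (\<lambda>y. - dird i zeta y)"

lemma test_fun_minus_dird_zeta: "test_fun UNIV (\<lambda>y. - dird i zeta y)"
  using test_fun_cmult[OF test_fun_dird[OF test_fun_zeta], of "-1"] by simp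

lemma kernel_mean_ker: "R > 0 \<Longrightarrow> kernel R (mean_ker m R)"
  unfolding mean_ker_def by (intro kernel_wprod test_fun_eta) (auto intro!: continuous_intros eta_eq_0)

lemma kernel_green_ker: "R > 0 \<Longrightarrow> kernel R (green_ker m R)"
  unfolding green_ker_def by (intro kernel_wprod test_fun_zeta) (auto intro!: continuous_intros zeta_eq_0)

lemma kernel_grad_ker: "R > 0 \<Longrightarrow> kernel R (grad_ker m R i)"
  unfolding grad_ker_def
  by (intro kernel_wprod test_fun_minus_dird_zeta)
    (auto intro!: continuous_intros simp: dird_zeta eta_eq_0)

lemma mean_ker_nonneg: "R > 0 \<Longrightarrow> 0 \<le> mean_ker m R p"
  by (auto simp: mean_ker_def wprod_def indicator_def simp del: power_Suc of_nat_Suc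
      intro!: mult_nonneg_nonneg divide_nonneg_nonneg eta_nonneg)

lemma green_ker_nonneg: "R > 0 \<Longrightarrow> 0 \<le> green_ker m R p"
  by (auto simp: green_ker_def wprod_def indicator_def intro!: mult_nonneg_nonneg zeta_nonneg power_le_one
      simp del: power_Suc)

text \<open>For \<open>m = 0\<close> the radial weight of \<open>mean_ker\<close> is the constant
  \<open>1 / R\<close>, while that of \<open>green_ker\<close> is at most \<open>R\<close>. The gain
  of \<open>R\<^sup>2\<close> beats any Lipschitz constant once \<open>R\<close> is small.\<close>

lemma green_ker_le_mean_ker:
  assumes "R > 0"
  shows "green_ker 0 R p \<le> (R\<^sup>2 / 2) * mean_ker 0 R p"
proof (cases "0 \<le> fst p \<and> fst p \<le> R")
  case True
  have "(1 - fst p / R) * fst p \<le> 1 * R"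
    using True assms by (intro mult_mono) auto
  then have "((1 - fst p / R) * fst p) * zeta (snd p) \<le> R * (eta (snd p) / 2)"
    using zeta_le_eta[of "snd p"] assms by (intro mult_mono) (auto simp: zeta_nonneg)
  then show ?thesis
    using True assms by (simp add: green_ker_def mean_ker_def wprod_def power2_eq_square)
qed (auto simp: green_ker_def mean_ker_def wprod_def indicator_def)

lemma integral_zeta_pos: "integral\<^sup>L lborel (zeta :: 'a::euclidean_space \<Rightarrow> real) > 0"
  using flat_mass_pos[where 'a = 'a, of 0] eta_mass_pos[where 'a = 'a]
  unfolding zeta_def[abs_def] by simp

lemma integral_green_ker_pos:
  assumes "R > 0"
  shows "integral\<^sup>L lborel (green_ker m R :: real \<times> 'a::euclidean_space \<Rightarrow> real) > 0"
proof -
  \<comment> \<open>An antiderivative of the radial weight; its increment over \<open>{0..R}\<close>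
    is \<open>R\<^sup>2 * (1/2 - 1/(m+3))\<close>.\<close>
  define F where "F = (\<lambda>t. t\<^sup>2 / 2 - t ^ (m + 3) / (real (m + 3) * R ^ Suc m))"
  have "(\<integral>t. ((1 - (t / R) ^ Suc m) * t) * indicator {0..R} t \<partial>lborel) = F R - F 0"
  proof (rule integral_FTC_Icc_real)
    fix t
    have "(F has_real_derivative (t - real (m + 3) * t ^ (m + 2) / (real (m + 3) * R ^ Suc m))) (at t)"
      unfolding F_def using assms by (auto intro!: derivative_eq_intros simp: numeral_eq_Suc simp del: power_Suc of_nat_add)
    moreover have "t - real (m + 3) * t ^ (m + 2) / (real (m + 3) * R ^ Suc m) = (1 - (t / R) ^ Suc m) * t"
      using assms by (simp add: power_divide algebra_simps del: of_nat_add)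
    ultimately show "(F has_real_derivative (1 - (t / R) ^ Suc m) * t) (at t)"
      by simp
  qed (use assms in \<open>auto intro!: continuous_intros\<close>)
  moreover have "F R - F 0 = R\<^sup>2 * (1 / 2 - 1 / (real m + 3))"
  proof -
    have "R ^ (m + 3) = R\<^sup>2 * R ^ Suc m"
      by (simp add: power2_eq_square numeral_eq_Suc)
    then have "R ^ (m + 3) / (real (m + 3) * R ^ Suc m) = R\<^sup>2 / real (m + 3)"
      using assms by (simp del: power_Suc)
    then show ?thesis
      by (simp add: F_def right_diff_distrib)
  qed
  moreover have "1 / 2 - 1 / (real m + 3) > 0"
    by (simp add: field_simps)
  ultimately have "(\<integral>t. indicator {0..R} t * ((1 - (t / R) ^ Suc m) * t) \<partial>lborel) > 0"
    using assms by (simp add: mult.commute)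
  then show ?thesis
    unfolding green_ker_def
    using assms by (subst integral_wprod)
      (auto simp: integral_zeta_pos zeta_eq_0 test_fun_zeta simp del: power_Suc intro!: continuous_intros)
qed

text \<open>The derivative of the product \<open>b y * \<phi> (x + t *\<^sub>R y)\<close> has
  integral zero; the factor \<open>t\<close> is the inner derivative of its second factor.\<close>

lemma integral_parts:
  assumes b: "test_fun \<Omega> b" and \<phi>: "test_fun \<Omega>' \<phi>"
  shows "(\<integral>y. - dird v b y * \<phi> (x + t *\<^sub>R y) \<partial>lborel) = t * (\<integral>y. b y * dird v \<phi> (x + t *\<^sub>R y) \<partial>lborel)"
proof -
  obtain K where K: "compact K" "\<And>y. y \<notin> K \<Longrightarrow> b y = 0"
    using b by (rule test_funE) blast
  note sm = test_fun_smooth[OF b] test_fun_smooth[OF \<phi>]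
  have comp: "smooth_fun \<psi> \<Longrightarrow> continuous_on UNIV (\<lambda>y. \<psi> (x + t *\<^sub>R y))" for \<psi> :: "'a \<Rightarrow> real"
    by (rule continuous_on_compose2[OF smooth_fun_continuous[of _ UNIV]]) (auto intro!: continuous_intros)
  let ?D = "\<lambda>y w. b y * dird (t *\<^sub>R w) \<phi> (x + t *\<^sub>R y) + dird w b y * \<phi> (x + t *\<^sub>R y)"
  have scale: "dird (t *\<^sub>R v) \<phi> z = t * dird v \<phi> z" for z
    using linear_scale[OF has_derivative_linear[OF smooth_fun_has_derivative[OF sm(2)]]] by simp
  have "integral\<^sup>L lborel (\<lambda>y. ?D y v) = 0"
  proof (rule integral_derivative_eq_0[where D = ?D and \<psi> = "\<lambda>y. b y * \<phi> (x + t *\<^sub>R y)" and K = K])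
    fix y
    have "((\<lambda>y. \<phi> (x + t *\<^sub>R y)) has_derivative (\<lambda>w. dird (t *\<^sub>R w) \<phi> (x + t *\<^sub>R y))) (at y)"
      by (rule has_derivative_compose[OF _ smooth_fun_has_derivative[OF sm(2)]])
        (auto intro!: derivative_eq_intros)
    then show "((\<lambda>y. b y * \<phi> (x + t *\<^sub>R y)) has_derivative ?D y) (at y)"
      by (rule has_derivative_mult[OF smooth_fun_has_derivative[OF sm(1)]])
    show "continuous_on UNIV (\<lambda>y. ?D y v)"
      unfolding scale
      by (intro continuous_intros comp smooth_fun_continuous smooth_fun_dird sm)
  qed (use K in auto)
  moreover have "integrable lborel (\<lambda>y. b y * (t * dird v \<phi> (x + t *\<^sub>R y)))"
    "integrable lborel (\<lambda>y. dird v b y * \<phi> (x + t *\<^sub>R y))"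
  proof -
    have *: "integrable lborel (\<lambda>y. \<beta> y * \<psi> (x + t *\<^sub>R y))" if \<beta>: "test_fun \<Omega> \<beta>" and \<psi>: "test_fun \<Omega>' \<psi>" for \<beta> \<psi>
    proof -
      obtain C where "\<And>y. \<bar>\<psi> y\<bar> \<le> C"
        using test_fun_bounded[OF \<psi>] by blast
      then show ?thesis
        using borel_measurable_continuous_onI[OF comp[OF test_fun_smooth[OF \<psi>]]]
        by (intro integrable_mult_bounded[OF test_fun_integrable[OF \<beta>], where C = C]) auto
    qed
    show "integrable lborel (\<lambda>y. b y * (t * dird v \<phi> (x + t *\<^sub>R y)))"
      using *[OF b test_fun_cmult[OF test_fun_dird[OF \<phi>]]] .
    show "integrable lborel (\<lambda>y. dird v b y * \<phi> (x + t *\<^sub>R y))"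
      by (rule *[OF test_fun_dird[OF b] \<phi>])
  qed
  ultimately have "(\<integral>y. b y * (t * dird v \<phi> (x + t *\<^sub>R y)) \<partial>lborel) + (\<integral>y. dird v b y * \<phi> (x + t *\<^sub>R y) \<partial>lborel) = 0"
    unfolding scale by simp
  moreover have "(\<integral>y. b y * (t * dird v \<phi> (x + t *\<^sub>R y)) \<partial>lborel) = t * (\<integral>y. b y * dird v \<phi> (x + t *\<^sub>R y) \<partial>lborel)"
    by (subst integral_mult_right_zero[symmetric]) (simp add: mult_ac)
  ultimately show ?thesis
    by simp
qed

lemma avg_grad_ker:
  fixes \<phi> :: "'a::euclidean_space \<Rightarrow> real"
  assumes "R > 0" and \<phi>: "test_fun \<Omega> \<phi>"
  shows "avg 1 (grad_ker m R i) \<phi> x = avg 1 (green_ker m R) (dird i \<phi>) x"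
proof -
  have "avg 1 (grad_ker m R i) \<phi> x = (\<integral>t. indicator {0..R} t * (1 - (t / R) ^ Suc m)
      * (\<integral>y. - dird i zeta y * \<phi> (x + (1 * t) *\<^sub>R y) \<partial>lborel) \<partial>lborel)"
    unfolding grad_ker_def
    by (rule avg_wprod(1)[OF _ test_fun_minus_dird_zeta _ \<phi>])
      (use assms(1) in \<open>auto intro!: continuous_intros simp: dird_zeta eta_eq_0\<close>)
  also have "\<dots> = (\<integral>t. indicator {0..R} t * ((1 - (t / R) ^ Suc m) * t)
      * (\<integral>y. zeta y * dird i \<phi> (x + (1 * t) *\<^sub>R y) \<partial>lborel) \<partial>lborel)"
    using integral_parts[OF test_fun_zeta \<phi>] by (simp add: mult_ac)
  also have "\<dots> = avg 1 (green_ker m R) (dird i \<phi>) x"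
    unfolding green_ker_def
    by (rule avg_wprod(1)[symmetric, OF _ test_fun_zeta _ test_fun_dird[OF \<phi>]])
      (use assms(1) in \<open>auto intro!: continuous_intros simp: zeta_eq_0\<close>)
  finally show ?thesis .
qed

text \<open>The mean value formula: the fundamental theorem of calculus along the rays
  \<open>t \<mapsto> x + t y\<close>, followed by an integration by parts in \<open>y\<close>.\<close>

lemma avg_mean_ker:
  fixes \<phi> :: "'a::euclidean_space \<Rightarrow> real"
  assumes "R > 0" and \<phi>: "test_fun \<Omega> \<phi>"
  shows "avg 1 (mean_ker m R) \<phi> x = \<phi> x + avg 1 (green_ker m R) (laplacian \<phi>) x"
proof -
  define p where "p = (\<lambda>t. real (Suc m) * t ^ m / R ^ Suc m)"
  define P where "P = (\<lambda>t. 1 - (t / R) ^ Suc m)"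
  note sm = test_fun_smooth[OF \<phi>]
  have p_cont: "continuous_on UNIV p" and P_cont: "continuous_on UNIV P"
    using assms(1) by (auto simp: p_def P_def intro!: continuous_intros)
  have P_deriv: "(P has_real_derivative - p t) (at t)" for t
    unfolding P_def p_def
    using assms(1) by (auto intro!: derivative_eq_intros simp: power_divide simp del: power_Suc)
  have cont: "smooth_fun \<psi> \<Longrightarrow> continuous_on UNIV (\<lambda>t. \<psi> (x + t *\<^sub>R y))" for \<psi> :: "'a \<Rightarrow> real" and y
    by (rule continuous_on_compose2[OF smooth_fun_continuous[of _ UNIV]]) (auto intro!: continuous_intros)
  have set_int: "integrable lborel (\<lambda>t. indicator {0..R} t * f t)" if "continuous_on UNIV f" for f :: "real \<Rightarrow> real"
    using borel_integrable_compact[OF compact_Icc continuous_on_subset[OF that], of 0 R] by simp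
  have p_mass: "(\<integral>t. indicator {0..R} t * p t \<partial>lborel) = 1"
  proof -
    have "(\<integral>t. p t * indicator {0..R} t \<partial>lborel) = - P R - (- P 0)"
      by (rule integral_FTC_Icc_real) (use assms(1) P_deriv p_cont in
        \<open>auto intro!: derivative_eq_intros simp: continuous_on_eq_continuous_at\<close>)
    then show ?thesis
      using assms(1) by (simp add: mult.commute P_def)
  qed
  have line: "(\<integral>t. indicator {0..R} t * p t * \<phi> (x + (1 * t) *\<^sub>R y) \<partial>lborel) - \<phi> x
      = (\<integral>t. indicator {0..R} t * P t * dird y \<phi> (x + t *\<^sub>R y) \<partial>lborel)" for y
  proof -
    have D: "((\<lambda>t. \<phi> (x + t *\<^sub>R y)) has_real_derivative dird y \<phi> (x + t *\<^sub>R y)) (at t)" for t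
    proof -
      have "((\<lambda>t. \<phi> (x + t *\<^sub>R y)) has_derivative (\<lambda>s. dird (s *\<^sub>R y) \<phi> (x + t *\<^sub>R y))) (at t)"
        by (rule has_derivative_compose[OF _ smooth_fun_has_derivative[OF sm]])
          (auto intro!: derivative_eq_intros)
      moreover have "dird (s *\<^sub>R y) \<phi> (x + t *\<^sub>R y) = dird y \<phi> (x + t *\<^sub>R y) * s" for s
        using linear_scale[OF has_derivative_linear[OF smooth_fun_has_derivative[OF sm]]]
        by (simp add: mult.commute)
      ultimately show ?thesis
        by (simp add: has_field_derivative_def fun_eq_iff)
    qed
    let ?f = "\<lambda>t. P t * dird y \<phi> (x + t *\<^sub>R y) + - p t * (\<phi> (x + t *\<^sub>R y) - \<phi> x)"
    \<comment> \<open>Both boundary terms will vanish: \<open>P R = 0\<close>, and the difference of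
      the values of \<open>\<phi>\<close> is \<open>0\<close> at \<open>t = 0\<close>.\<close>
    have "(\<integral>t. ?f t * indicator {0..R} t \<partial>lborel)
        = P R * (\<phi> (x + R *\<^sub>R y) - \<phi> x) - P 0 * (\<phi> (x + 0 *\<^sub>R y) - \<phi> x)"
    proof (rule integral_FTC_Icc_real)
      fix t
      have "((\<lambda>t. \<phi> (x + t *\<^sub>R y) - \<phi> x) has_real_derivative dird y \<phi> (x + t *\<^sub>R y)) (at t)"
        using DERIV_diff[OF D DERIV_const] by simp
      from DERIV_mult[OF P_deriv this]
      show "((\<lambda>t. P t * (\<phi> (x + t *\<^sub>R y) - \<phi> x)) has_real_derivative ?f t) (at t)"
        by (simp add: mult_ac add_ac)
      have "continuous_on UNIV ?f"
        by (intro continuous_intros cont P_cont p_cont smooth_fun_dird sm)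
      then show "isCont ?f t"
        by (simp add: continuous_on_eq_continuous_at)
    qed (use assms(1) in simp)
    then have "(\<integral>t. indicator {0..R} t * (P t * dird y \<phi> (x + t *\<^sub>R y))
        - (indicator {0..R} t * (p t * \<phi> (x + t *\<^sub>R y)) - indicator {0..R} t * p t * \<phi> x) \<partial>lborel) = 0"
      using assms(1) by (simp add: P_def algebra_simps)
    moreover have "integrable lborel (\<lambda>t. indicator {0..R} t * (P t * dird y \<phi> (x + t *\<^sub>R y)))"
      "integrable lborel (\<lambda>t. indicator {0..R} t * (p t * \<phi> (x + t *\<^sub>R y)))"
      "integrable lborel (\<lambda>t. indicator {0..R} t * p t * \<phi> x)"
      by (intro set_int continuous_intros cont P_cont p_cont smooth_fun_dird sm
          Bochner_Integration.integrable_mult_left)+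
    moreover have "(\<integral>t. indicator {0..R} t * (p t * \<phi> x) \<partial>lborel) = \<phi> x"
      using p_mass by (simp add: mult.assoc[symmetric])
    ultimately show ?thesis
      by (simp add: mult.assoc)
  qed
  \<comment> \<open>Since the gradient of \<open>zeta\<close> at \<open>y\<close> is
    \<open>- eta y\<close> times \<open>y\<close>, the derivative along the ray becomes a sum over
    coordinates, and \<open>avg_grad_ker\<close> turns that sum into the Laplacian.\<close>
  have eta_conv: "eta y * dird y \<phi> z = (\<Sum>i\<in>Basis. - dird i zeta y * dird i \<phi> z)" for y z
    by (subst dird_expand[OF sm]) (simp add: dird_zeta sum_distrib_left mult_ac)
  have int_D: "integrable lborel (\<lambda>q :: real \<times> 'a. grad_ker m R i q * dird i \<phi> (x + (1 * fst q) *\<^sub>R snd q))" for i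
    by (rule avg_test_integrable[OF kernel_grad_ker[OF assms(1)] test_fun_dird[OF \<phi>]])
  have "(\<Sum>i\<in>Basis. avg 1 (grad_ker m R i) (dird i \<phi>) x)
      = (\<integral>q. (\<Sum>i\<in>Basis. grad_ker m R i q * dird i \<phi> (x + (1 * fst q) *\<^sub>R snd q)) \<partial>lborel)"
    unfolding avg_def using int_D by (subst Bochner_Integration.integral_sum) auto
  also have "\<dots> = (\<integral>q. indicator {0..R} (fst q) * P (fst q) * (eta (snd q) * dird (snd q) \<phi> (x + fst q *\<^sub>R snd q)) \<partial>lborel)"
    by (intro Bochner_Integration.integral_cong refl)
      (simp add: eta_conv grad_ker_def wprod_def P_def sum_distrib_left mult_ac)
  also have "\<dots> = (\<integral>y. (\<integral>t. indicator {0..R} t * P t * (eta y * dird y \<phi> (x + t *\<^sub>R y)) \<partial>lborel) \<partial>lborel)"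
  proof -
    have "integrable (lborel \<Otimes>\<^sub>M lborel) (\<lambda>q :: real \<times> 'a. \<Sum>i\<in>Basis. grad_ker m R i q * dird i \<phi> (x + (1 * fst q) *\<^sub>R snd q))"
      unfolding lborel_prod using int_D by (intro Bochner_Integration.integrable_sum) auto
    also have "(\<lambda>q :: real \<times> 'a. \<Sum>i\<in>Basis. grad_ker m R i q * dird i \<phi> (x + (1 * fst q) *\<^sub>R snd q))
        = (\<lambda>(t, y). indicator {0..R} t * P t * (eta y * dird y \<phi> (x + t *\<^sub>R y)))"
      by (auto simp: eta_conv grad_ker_def wprod_def P_def sum_distrib_left mult_ac)
    finally show ?thesis
      by (subst lborel_pair.integral_snd) (auto simp: lborel_prod split_beta')
  qed
  also have "\<dots> = (\<integral>y. eta y * ((\<integral>t. indicator {0..R} t * p t * \<phi> (x + (1 * t) *\<^sub>R y) \<partial>lborel) - \<phi> x) \<partial>lborel)"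
    unfolding line by (subst integral_mult_right_zero[symmetric]) (simp add: mult_ac)
  also have "\<dots> = avg 1 (mean_ker m R) \<phi> x - \<phi> x"
  proof -
    have eq: "avg 1 (mean_ker m R) \<phi> x
        = (\<integral>y. eta y * (\<integral>t. indicator {0..R} t * p t * \<phi> (x + (1 * t) *\<^sub>R y) \<partial>lborel) \<partial>lborel)"
      unfolding mean_ker_def p_def[symmetric]
      by (rule avg_wprod(2)[OF p_cont test_fun_eta eta_eq_0 \<phi>])
    have "integrable (lborel \<Otimes>\<^sub>M lborel) (\<lambda>(t, y). mean_ker m R (t, y) * \<phi> (x + (1 * t) *\<^sub>R y))"
      using avg_test_integrable[OF kernel_mean_ker[OF assms(1)] \<phi>, of m x 1]
      by (simp add: lborel_prod split_beta')
    from lborel_pair.integrable_snd[OF this]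
    have "integrable lborel (\<lambda>y. \<integral>t. mean_ker m R (t, y) * \<phi> (x + (1 * t) *\<^sub>R y) \<partial>lborel)"
      by simp
    also have "(\<lambda>y. \<integral>t. mean_ker m R (t, y) * \<phi> (x + (1 * t) *\<^sub>R y) \<partial>lborel)
        = (\<lambda>y. eta y * (\<integral>t. indicator {0..R} t * p t * \<phi> (x + (1 * t) *\<^sub>R y) \<partial>lborel))"
      by (rule ext, subst integral_mult_right_zero[symmetric]) (simp add: mean_ker_def wprod_def p_def mult_ac)
    finally have "integrable lborel (\<lambda>y. eta y * (\<integral>t. indicator {0..R} t * p t * \<phi> (x + (1 * t) *\<^sub>R y) \<partial>lborel))" .
    moreover have "integrable lborel (\<lambda>y. eta y * \<phi> x)"
      using test_fun_integrable[OF test_fun_eta] by (rule Bochner_Integration.integrable_mult_left)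
    ultimately show ?thesis
      unfolding eq right_diff_distrib by (subst Bochner_Integration.integral_diff) (simp_all add: integral_eta)
  qed
  finally have "avg 1 (mean_ker m R) \<phi> x = \<phi> x + (\<Sum>i\<in>Basis. avg 1 (grad_ker m R i) (dird i \<phi>) x)"
    by simp
  also have "(\<Sum>i\<in>Basis. avg 1 (grad_ker m R i) (dird i \<phi>) x) = avg 1 (green_ker m R) (laplacian \<phi>) x"
    unfolding laplacian_dird[abs_def]
    using avg_sum[OF kernel_green_ker[OF assms(1)], of Basis \<Omega> "\<lambda>i. dird i (dird i \<phi>)" 1 m "\<lambda>_. 1"]
    by (simp add: avg_grad_ker[OF assms(1) test_fun_dird[OF \<phi>]] test_fun_dird \<phi> fun_eq_iff)
  finally show ?thesis .
qed

subsection \<open>Distributional subsolutions and Kato's inequality\<close>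

text \<open>Asking for Borel measurability on the whole space permits composition with a continuous
  \<open>g\<close>, products and translations on \<open>lborel\<close> without any
  completion.\<close>

definition L1loc :: "'a::euclidean_space set \<Rightarrow> ('a \<Rightarrow> real) \<Rightarrow> bool" where
  "L1loc \<Omega> u \<longleftrightarrow> u \<in> borel_measurable borel \<and>
    (\<forall>K. compact K \<longrightarrow> K \<subseteq> \<Omega> \<longrightarrow> integrable lborel (\<lambda>x. indicator K x * u x))"

text \<open>This is \<open>F \<le> \<Delta>u\<close> in the sense of distributions; a subsolution of
  the equation is the case where \<open>F\<close> is \<open>g u - f\<close>.\<close>

definition weak_sub :: "'a::euclidean_space set \<Rightarrow> ('a \<Rightarrow> real) \<Rightarrow> ('a \<Rightarrow> real) \<Rightarrow> bool" where
  "weak_sub \<Omega> u F \<longleftrightarrow> (\<forall>\<phi>. test_fun \<Omega> \<phi> \<longrightarrow> (\<forall>x. 0 \<le> \<phi> x) \<longrightarrow>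
     (\<integral>x. F x * \<phi> x \<partial>lborel) \<le> (\<integral>x. u x * laplacian \<phi> x \<partial>lborel))"

definition sublap :: "'a::euclidean_space set \<Rightarrow> ('a \<Rightarrow> real) \<Rightarrow> ('a \<Rightarrow> real) \<Rightarrow> bool" where
  "sublap \<Omega> u F \<longleftrightarrow> L1loc \<Omega> u \<and> L1loc \<Omega> F \<and> weak_sub \<Omega> u F"

lemma L1loc_borel: "L1loc \<Omega> u \<Longrightarrow> u \<in> borel_measurable borel"
  by (simp add: L1loc_def)

lemma L1loc_cut: "L1loc \<Omega> u \<Longrightarrow> compact K \<Longrightarrow> K \<subseteq> \<Omega> \<Longrightarrow> integrable lborel (\<lambda>x. indicator K x * u x)"
  by (simp add: L1loc_def)

lemma integrable_imp_L1loc: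
  assumes "integrable lborel u"
  shows "L1loc \<Omega> u"
  unfolding L1loc_def
proof (intro conjI allI impI)
  show "u \<in> borel_measurable borel"
    using borel_measurable_integrable[OF assms] by simp
  fix K :: "'a set" assume "compact K"
  have "integrable lborel (\<lambda>x. u x * indicator K x)"
    using \<open>compact K\<close>
    by (intro integrable_mult_bounded[OF assms, where C = 1])
      (auto intro!: borel_measurable_indicator borel_closed compact_imp_closed)
  then show "integrable lborel (\<lambda>x. indicator K x * u x)"
    by (simp add: mult.commute)
qed

lemma L1loc_mono: "L1loc \<Omega> u \<Longrightarrow> \<Omega>' \<subseteq> \<Omega> \<Longrightarrow> L1loc \<Omega>' u"
  by (auto simp: L1loc_def)

lemma L1loc_bound:
  assumes v: "L1loc \<Omega> v" and u: "u \<in> borel_measurable borel"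
    and le: "AE x in lborel. x \<in> \<Omega> \<longrightarrow> \<bar>u x\<bar> \<le> \<bar>v x\<bar>"
  shows "L1loc \<Omega> u"
  unfolding L1loc_def
proof (intro conjI allI impI)
  fix K assume K: "compact K" "K \<subseteq> \<Omega>"
  show "integrable lborel (\<lambda>x. indicator K x * u x)"
  proof (rule Bochner_Integration.integrable_bound[OF L1loc_cut[OF v K]])
    show "(\<lambda>x. indicator K x * u x) \<in> borel_measurable lborel"
      using u K(1) by (auto intro!: borel_measurable_times borel_measurable_indicator borel_closed compact_imp_closed)
    show "AE x in lborel. norm (indicator K x * u x) \<le> norm (indicator K x * v x)"
      using le by eventually_elim (use K(2) in \<open>auto simp: indicator_def\<close>)
  qed
qed (rule u)

lemma L1loc_add:
  assumes "L1loc \<Omega> u" "L1loc \<Omega> v"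
  shows "L1loc \<Omega> (\<lambda>x. u x + v x)"
  using assms by (auto simp: L1loc_def distrib_left)

lemma L1loc_cmult:
  assumes "L1loc \<Omega> u"
  shows "L1loc \<Omega> (\<lambda>x. c * u x)"
  using assms by (auto simp: L1loc_def mult.left_commute)

lemma L1loc_diff:
  assumes "L1loc \<Omega> u" "L1loc \<Omega> v"
  shows "L1loc \<Omega> (\<lambda>x. u x - v x)"
  using assms by (auto simp: L1loc_def right_diff_distrib)

lemma L1loc_abs:
  assumes "L1loc \<Omega> u"
  shows "L1loc \<Omega> (\<lambda>x. \<bar>u x\<bar>)"
  by (rule L1loc_bound[OF assms]) (use L1loc_borel[OF assms] in auto)

lemma L1loc_continuous:
  assumes "continuous_on UNIV u"
  shows "L1loc \<Omega> u"
  unfolding L1loc_def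
  using borel_measurable_continuous_onI[OF assms]
    borel_integrable_compact[OF _ continuous_on_subset[OF assms]]
  by auto

lemma L1loc_const: "L1loc \<Omega> (\<lambda>x. c)"
  by (rule L1loc_continuous) auto

lemma L1loc_sandwich:
  assumes v: "L1loc \<Omega> v" "L1loc \<Omega> w" and u: "u \<in> borel_measurable borel"
    and le: "AE x in lborel. x \<in> \<Omega> \<longrightarrow> v x \<le> u x \<and> u x \<le> w x"
  shows "L1loc \<Omega> u"
proof (rule L1loc_bound[OF L1loc_add[OF L1loc_abs[OF v(1)] L1loc_abs[OF v(2)]] u])
  show "AE x in lborel. x \<in> \<Omega> \<longrightarrow> \<bar>u x\<bar> \<le> \<bar>\<bar>v x\<bar> + \<bar>w x\<bar>\<bar>"
    using le by eventually_elim auto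
qed

lemma L1loc_cases:
  assumes "L1loc \<Omega> u" "L1loc \<Omega> v" "{x. P x} \<in> sets borel"
  shows "L1loc \<Omega> (\<lambda>x. if P x then u x else v x)"
proof (rule L1loc_bound[OF L1loc_add[OF L1loc_abs[OF assms(1)] L1loc_abs[OF assms(2)]]])
  show "(\<lambda>x. if P x then u x else v x) \<in> borel_measurable borel"
    using L1loc_borel[OF assms(1)] L1loc_borel[OF assms(2)] assms(3)
    by (intro measurable_If) auto
qed auto

lemma L1loc_max:
  assumes "L1loc \<Omega> u" "L1loc \<Omega> v"
  shows "L1loc \<Omega> (\<lambda>x. max (u x) (v x))"
  using L1loc_borel[OF assms(1)] L1loc_borel[OF assms(2)]
  by (intro L1loc_bound[OF L1loc_add[OF L1loc_abs[OF assms(1)] L1loc_abs[OF assms(2)]]]) auto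

lemma L1loc_test_integrable:
  assumes u: "L1loc \<Omega> u" and \<phi>: "test_fun \<Omega> \<phi>"
  shows "integrable lborel (\<lambda>x. u x * \<phi> x)"
proof -
  obtain K where K: "compact K" "K \<subseteq> \<Omega>" "\<And>x. x \<notin> K \<Longrightarrow> \<phi> x = 0"
    using \<phi> by (rule test_funE) blast
  have "(\<lambda>x. u x * \<phi> x) = (\<lambda>x. (indicator K x * u x) * \<phi> x)"
    using K(3) by (auto simp: fun_eq_iff indicator_def)
  then show ?thesis
    using integrable_mult_test[OF L1loc_cut[OF u K(1,2)] \<phi>] by simp
qed

section \<open>Kato's inequality through averages\<close>

lemma weak_subD:
  "weak_sub \<Omega> u F \<Longrightarrow> test_fun \<Omega> \<phi> \<Longrightarrow> (\<And>x. 0 \<le> \<phi> x) \<Longrightarrow>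
    (\<integral>x. F x * \<phi> x \<partial>lborel) \<le> (\<integral>x. u x * laplacian \<phi> x \<partial>lborel)"
  by (simp add: weak_sub_def)

text \<open>The inequality is tested against \<open>avg 1 (green_ker m R) \<psi>\<close>, whose
  Laplacian is \<open>avg 1 (mean_ker m R) \<psi> - \<psi>\<close> by the mean value formula.
  Passing to adjoints frees \<open>\<psi>\<close>, which is an arbitrary nonnegative test
  function.\<close>

lemma weak_mean_inequality:
  assumes u: "integrable lborel u" and F: "integrable lborel F" and sub: "weak_sub \<Omega> u F"
    and "R > 0" "open \<Omega>'" and \<Omega>': "(\<Union>x\<in>\<Omega>'. cball x R) \<subseteq> \<Omega>"
  shows "AE x in lborel. x \<in> \<Omega>' \<longrightarrow> u x + avg (-1) (green_ker m R) F x \<le> avg (-1) (mean_ker m R) u x"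
proof -
  note K = kernel_green_ker[OF \<open>R > 0\<close>] and M = kernel_mean_ker[OF \<open>R > 0\<close>]
  let ?H = "\<lambda>x. avg (-1) (mean_ker m R) u x - u x - avg (-1) (green_ker m R) F x"
  note int = avg_integrable[OF M[of m] u, of "-1"] avg_integrable[OF K[of m] F, of "-1"] u
  have "AE x in lborel. x \<in> \<Omega>' \<longrightarrow> 0 \<le> ?H x"
  proof (rule AE_nonneg_if_test_nonneg[OF _ \<open>open \<Omega>'\<close>])
    show "integrable lborel ?H"
      by (intro Bochner_Integration.integrable_diff int)
    fix \<psi> assume \<psi>: "test_fun \<Omega>' \<psi>" "\<And>x. 0 \<le> \<psi> x"
    obtain S where S: "compact S" "S \<subseteq> \<Omega>'" "\<And>x. x \<notin> S \<Longrightarrow> \<psi> x = 0"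
      using \<psi>(1) by (rule test_funE) blast
    have "test_fun \<Omega> (avg 1 (green_ker m R) \<psi>)"
      by (rule test_fun_avg[OF K _ \<psi>(1) S(1,3)]) (use S(2) \<Omega>' in auto)
    moreover have "0 \<le> avg 1 (green_ker m R) \<psi> x" for x
      by (intro avg_nonneg green_ker_nonneg \<open>R > 0\<close> \<psi>(2))
    ultimately have "(\<integral>x. F x * avg 1 (green_ker m R) \<psi> x \<partial>lborel)
        \<le> (\<integral>x. u x * laplacian (avg 1 (green_ker m R) \<psi>) x \<partial>lborel)"
      by (rule weak_subD[OF sub])
    also have "\<dots> = (\<integral>x. u x * avg 1 (mean_ker m R) \<psi> x - u x * \<psi> x \<partial>lborel)"
      by (simp add: laplacian_avg[OF K \<psi>(1)] avg_mean_ker[OF \<open>R > 0\<close> \<psi>(1)] algebra_simps)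
    also have "\<dots> = (\<integral>x. u x * avg 1 (mean_ker m R) \<psi> x \<partial>lborel) - (\<integral>x. u x * \<psi> x \<partial>lborel)"
      by (intro Bochner_Integration.integral_diff integrable_mult_test[OF u \<psi>(1)]
          integrable_mult_test[OF u test_fun_avg_UNIV[OF M _ \<psi>(1)]]) auto
    finally have "(\<integral>x. avg (-1) (green_ker m R) F x * \<psi> x \<partial>lborel)
        \<le> (\<integral>x. avg (-1) (mean_ker m R) u x * \<psi> x \<partial>lborel) - (\<integral>x. u x * \<psi> x \<partial>lborel)"
      by (simp add: avg_adjoint_test[OF K F \<psi>(1)] avg_adjoint_test[OF M u \<psi>(1)])
    then show "0 \<le> (\<integral>x. ?H x * \<psi> x \<partial>lborel)"
      using int[THEN integrable_mult_test, OF \<psi>(1)] by (simp add: left_diff_distrib)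
  qed
  then show ?thesis
    by eventually_elim auto
qed

lemma avg_diff_AE:
  assumes w: "kernel R w" and "integrable lborel u" "integrable lborel v"
  shows "AE x in lborel. avg s w (\<lambda>x. u x - v x) x = avg s w u x - avg s w v x"
  using avg_AE_integrable[OF w assms(2), of s] avg_AE_integrable[OF w assms(3), of s]
  by eventually_elim (simp add: avg_def right_diff_distrib)

lemma avg_mono_AE:
  assumes w: "kernel R w" "\<And>p. 0 \<le> w p" and "integrable lborel u" "integrable lborel v" "\<And>x. u x \<le> v x"
  shows "AE x in lborel. avg s w u x \<le> avg s w v x"
  using avg_AE_integrable[OF w(1) assms(3), of s] avg_AE_integrable[OF w(1) assms(4), of s]
  unfolding avg_def
  by eventually_elim (intro integral_mono mult_left_mono assms(5) w(2))

abbreviation mass :: "(real \<times> 'a::euclidean_space \<Rightarrow> real) \<Rightarrow> real" where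
  "mass w \<equiv> integral\<^sup>L lborel w"

text \<open>The error is measured relative to the mass, which itself tends to \<open>0\<close> with
  \<open>R\<close>. For a test function near \<open>F\<close> the Lipschitz bound does it; the
  average and the multiple of the remaining difference cost another third each.\<close>

lemma green_ker_approx_L1:
  fixes F :: "'a::euclidean_space \<Rightarrow> real"
  assumes F: "integrable lborel F" and "e > 0" and s: "\<bar>s\<bar> \<le> 1"
  obtains d where "d > 0" "\<And>R. 0 < R \<Longrightarrow> R < d \<Longrightarrow>
    (\<integral>x. \<bar>avg s (green_ker m R) F x - mass (green_ker m R :: real \<times> 'a \<Rightarrow> real) * F x\<bar> \<partial>lborel)
      \<le> e * mass (green_ker m R :: real \<times> 'a \<Rightarrow> real)"
proof -
  obtain \<phi> where \<phi>: "test_fun UNIV \<phi>" "(\<integral>x. \<bar>F x - \<phi> x\<bar> \<partial>lborel) < e / 3"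
    using test_fun_dense_L1[OF F, of "e/3"] \<open>e > 0\<close> by auto
  obtain K where K: "compact K" "\<And>x. x \<notin> K \<Longrightarrow> \<phi> x = 0"
    using \<phi>(1) by (rule test_funE) blast
  obtain L where L: "L > 0" "\<And>x h. \<bar>\<phi> (x + h) - \<phi> x\<bar> \<le> L * norm h"
    using test_fun_lipschitz[OF \<phi>(1)] by blast
  \<comment> \<open>For \<open>R \<le> 1\<close> the averages of \<open>\<phi>\<close> vanish off
    this set, and its finite measure turns a uniform error into an integrated one.\<close>
  define K1 where "K1 = (\<Union>x\<in>K. cball x 1)"
  define V where "V = measure lborel K1"
  have K1: "compact K1" "K1 \<in> sets borel" "K \<subseteq> K1"
    using compact_UN_cball[OF K(1), of 1] by (auto simp: K1_def intro!: borel_closed compact_imp_closed bexI)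
  have K1_int: "integrable lborel (\<lambda>x. indicator K1 x :: real)"
    using K1 emeasure_bounded_finite[OF compact_imp_bounded[OF K1(1)]]
    by (auto simp: integrable_indicator_iff)
  define d where "d = min 1 (e / (3 * (L * (V + 1))))"
  have V: "V \<ge> 0"
    by (simp add: V_def)
  have "d > 0"
    using \<open>e > 0\<close> L(1) V by (simp add: d_def)
  show thesis
  proof (rule that[OF \<open>d > 0\<close>])
    fix R assume R: "0 < R" "R < d"
    define w :: "real \<times> 'a \<Rightarrow> real" where "w = green_ker m R"
    have w: "kernel R w" "\<And>p. 0 \<le> w p" and c: "mass w > 0"
      using kernel_green_ker[OF R(1)] green_ker_nonneg[OF R(1)] integral_green_ker_pos[OF R(1)] by (auto simp: w_def)
    note \<phi>i = test_fun_integrable[OF \<phi>(1)]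
    have Fi: "integrable lborel (\<lambda>x. F x - \<phi> x)"
      using F \<phi>i by auto
    note ai = avg_integrable[OF w(1) Fi, of s]
    have "(\<integral>x. \<bar>avg s w F x - mass w * F x\<bar> \<partial>lborel)
        \<le> (\<integral>x. \<bar>avg s w (\<lambda>x. F x - \<phi> x) x\<bar> + L * R * mass w * indicator K1 x + mass w * \<bar>F x - \<phi> x\<bar> \<partial>lborel)"
    proof (rule integral_mono_AE)
      show "integrable lborel (\<lambda>x. \<bar>avg s w F x - mass w * F x\<bar>)"
        using avg_integrable[OF w(1) F] F by auto
      show "integrable lborel (\<lambda>x. \<bar>avg s w (\<lambda>x. F x - \<phi> x) x\<bar> + L * R * mass w * indicator K1 x + mass w * \<bar>F x - \<phi> x\<bar>)"
        using ai K1_int Fi by auto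
      show "AE x in lborel. \<bar>avg s w F x - mass w * F x\<bar>
        \<le> \<bar>avg s w (\<lambda>x. F x - \<phi> x) x\<bar> + L * R * mass w * indicator K1 x + mass w * \<bar>F x - \<phi> x\<bar>"
        using avg_diff_AE[OF w(1) F \<phi>i, of s]
      proof eventually_elim
        case (elim x)
        have "\<bar>avg s w \<phi> x - mass w * \<phi> x\<bar> \<le> L * R * mass w * indicator K1 x"
        proof (cases "x \<in> K1")
          case True
          then show ?thesis
            using avg_approx_test[OF w s \<phi>(1) L(2), of x] by simp
        next
          case False
          have "R \<le> 1"
            using R(2) by (simp add: d_def)
          then have "x \<notin> (\<Union>y\<in>K. cball y R)"
            using False by (force simp: K1_def)
          then have "avg s w \<phi> x = 0"
            using avg_eq_0[OF w(1) s, of K \<phi> x] K(2) by blast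
          moreover have "\<phi> x = 0"
            using False K1(3) K(2) by blast
          ultimately show ?thesis
            using False by simp
        qed
        moreover have "\<bar>mass w * \<phi> x - mass w * F x\<bar> = mass w * \<bar>F x - \<phi> x\<bar>"
          using c by (simp add: abs_mult abs_minus_commute flip: right_diff_distrib)
        ultimately show ?case
          using elim by linarith
      qed
    qed
    also have "\<dots> = (\<integral>x. \<bar>avg s w (\<lambda>x. F x - \<phi> x) x\<bar> \<partial>lborel) + L * R * mass w * V
        + mass w * (\<integral>x. \<bar>F x - \<phi> x\<bar> \<partial>lborel)"
      using ai K1_int Fi K1(2) by (simp add: V_def)
    also have "\<dots> \<le> mass w * (e / 3) + mass w * (e / 3) + mass w * (e / 3)"
    proof (intro add_mono)
      have "(\<integral>x. \<bar>avg s w (\<lambda>x. F x - \<phi> x) x\<bar> \<partial>lborel) \<le> mass w * (\<integral>x. \<bar>F x - \<phi> x\<bar> \<partial>lborel)"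
        using avg_L1_bound[OF w(1) Fi, of s] w(2) by simp
      also have "\<dots> \<le> mass w * (e / 3)"
        using \<phi>(2) c by (intro mult_left_mono) auto
      finally show "(\<integral>x. \<bar>avg s w (\<lambda>x. F x - \<phi> x) x\<bar> \<partial>lborel) \<le> mass w * (e / 3)" .
      show "mass w * (\<integral>x. \<bar>F x - \<phi> x\<bar> \<partial>lborel) \<le> mass w * (e / 3)"
        using \<phi>(2) c by (intro mult_left_mono) auto
      have "R < e / (3 * (L * (V + 1)))"
        using R(2) by (simp add: d_def)
      moreover have "3 * (L * (V + 1)) > 0"
        using L(1) V by simp
      ultimately have "R * (3 * (L * (V + 1))) < e"
        by (simp only: pos_less_divide_eq)
      then have "L * R * (V + 1) < e / 3"
        by (simp add: algebra_simps)
      moreover have "L * R * V \<le> L * R * (V + 1)"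
        using L(1) R(1) by simp
      ultimately have "mass w * (L * R * V) \<le> mass w * (e / 3)"
        using c by (intro mult_left_mono) auto
      then show "L * R * mass w * V \<le> mass w * (e / 3)"
        by (simp add: mult_ac)
    qed
    also have "\<dots> = e * mass w"
      by simp
    finally show "(\<integral>x. \<bar>avg s (green_ker m R) F x - mass (green_ker m R :: real \<times> 'a \<Rightarrow> real) * F x\<bar> \<partial>lborel) \<le> e * mass (green_ker m R :: real \<times> 'a \<Rightarrow> real)"
      unfolding w_def .
  qed
qed

text \<open>Where \<open>v \<le> u\<close> the maximum equals \<open>u\<close>, while its average is
  at least that of \<open>u\<close>. So the maximum satisfies the mean value inequality with the
  right-hand side chosen by the larger function at the centre. Dividing by the mass of
  \<open>green_ker\<close> and letting \<open>R\<close> tend to \<open>0\<close> gives the claim,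
  without regularising the maximum.\<close>

lemma Kato_integrable:
  fixes u v F H :: "'a::euclidean_space \<Rightarrow> real"
  assumes u: "integrable lborel u" and v: "integrable lborel v"
    and F: "integrable lborel F" and H: "integrable lborel H"
    and subu: "weak_sub \<Omega> u F" and subv: "weak_sub \<Omega> v H" and "open \<Omega>"
  shows "weak_sub \<Omega> (\<lambda>x. max (u x) (v x)) (\<lambda>x. if v x \<le> u x then F x else H x)"
  unfolding weak_sub_def
proof (intro allI impI)
  fix \<phi> :: "'a \<Rightarrow> real" assume \<phi>: "test_fun \<Omega> \<phi>" and "\<forall>x. 0 \<le> \<phi> x"
  then have \<phi>0: "\<And>x. 0 \<le> \<phi> x"
    by auto
  obtain S where S: "compact S" "S \<subseteq> \<Omega>" "\<And>x. x \<notin> S \<Longrightarrow> \<phi> x = 0"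
    using \<phi> by (rule test_funE) blast
  obtain r where r: "r > 0" "(\<Union>x\<in>S. cball x r) \<subseteq> \<Omega>"
    using compact_inflate[OF S(1) \<open>open \<Omega>\<close> S(2)] .
  define \<Omega>' where "\<Omega>' = (\<Union>x\<in>S. ball x (r/2))"
  have \<Omega>': "open \<Omega>'" "S \<subseteq> \<Omega>'"
    using r(1) by (auto simp: \<Omega>'_def)
  have inflate: "(\<Union>x\<in>\<Omega>'. cball x R) \<subseteq> \<Omega>" if "R < r/2" for R
  proof
    fix z assume "z \<in> (\<Union>x\<in>\<Omega>'. cball x R)"
    then obtain x y where "x \<in> S" "dist x y < r/2" "dist y z \<le> R"
      by (auto simp: \<Omega>'_def)
    then have "dist x z \<le> r"
      using that dist_triangle[of x z y] by linarith
    then show "z \<in> \<Omega>"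
      using \<open>x \<in> S\<close> r(2) by (intro subsetD[OF r(2)] UN_I[of x]) auto
  qed
  have [measurable]: "u \<in> borel_measurable borel" "v \<in> borel_measurable borel"
    "F \<in> borel_measurable borel" "H \<in> borel_measurable borel"
    using u v F H by (auto dest: borel_measurable_integrable)
  define q where "q = (\<lambda>x. max (u x) (v x))"
  have q: "integrable lborel q"
    unfolding q_def by (intro integrable_max u v)
  have if_int: "integrable lborel (\<lambda>x. if v x \<le> u x then A x else B x)"
    if "integrable lborel A" "integrable lborel B" for A B :: "'a \<Rightarrow> real"
  proof (rule Bochner_Integration.integrable_bound)
    show "integrable lborel (\<lambda>x. \<bar>A x\<bar> + \<bar>B x\<bar>)"
      using that by auto
    have [measurable]: "A \<in> borel_measurable borel" "B \<in> borel_measurable borel"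
      using that by (auto dest: borel_measurable_integrable)
    show "(\<lambda>x. if v x \<le> u x then A x else B x) \<in> borel_measurable lborel"
      by measurable
  qed auto
  define G where "G = (\<lambda>x. if v x \<le> u x then F x else H x)"
  have G: "integrable lborel G"
    unfolding G_def by (rule if_int[OF F H])
  obtain C where C: "C > 0" "\<And>x. \<bar>\<phi> x\<bar> \<le> C"
    using test_fun_bounded[OF \<phi>] by blast
  note lap = test_fun_laplacian[OF \<phi>]
  obtain L where L: "L > 0" "\<And>x h. \<bar>laplacian \<phi> (x + h) - laplacian \<phi> x\<bar> \<le> L * norm h"
    using test_fun_lipschitz[OF lap] by blast
  have "(\<integral>x. G x * \<phi> x \<partial>lborel) \<le> (\<integral>x. q x * laplacian \<phi> x \<partial>lborel)"
  proof (rule field_le_epsilon)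
    fix e0 :: real assume "e0 > 0"
    define Q where "Q = (\<integral>x. \<bar>q x\<bar> \<partial>lborel)"
    have "Q \<ge> 0"
      by (simp add: Q_def)
    \<comment> \<open>Half of \<open>e0\<close> pays for replacing the averages of \<open>F\<close>
      and \<open>H\<close> by multiples of \<open>F\<close> and \<open>H\<close>, the other half for
      doing so with the Laplacian of \<open>\<phi>\<close>.\<close>
    define e where "e = e0 / (4 * C)"
    have "e > 0"
      using \<open>e0 > 0\<close> C(1) by (simp add: e_def)
    obtain d1 where d1: "d1 > 0" "\<And>R. 0 < R \<Longrightarrow> R < d1 \<Longrightarrow>
        (\<integral>x. \<bar>avg (-1) (green_ker 0 R) F x - mass (green_ker 0 R :: real \<times> 'a \<Rightarrow> real) * F x\<bar> \<partial>lborel)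
          \<le> e * mass (green_ker 0 R :: real \<times> 'a \<Rightarrow> real)"
      using green_ker_approx_L1[OF F \<open>e > 0\<close>, of "-1" 0] by auto
    obtain d2 where d2: "d2 > 0" "\<And>R. 0 < R \<Longrightarrow> R < d2 \<Longrightarrow>
        (\<integral>x. \<bar>avg (-1) (green_ker 0 R) H x - mass (green_ker 0 R :: real \<times> 'a \<Rightarrow> real) * H x\<bar> \<partial>lborel)
          \<le> e * mass (green_ker 0 R :: real \<times> 'a \<Rightarrow> real)"
      using green_ker_approx_L1[OF H \<open>e > 0\<close>, of "-1" 0] by auto
    define d3 where "d3 = e0 / (2 * L * (Q + 1))"
    have "d3 > 0"
      using \<open>e0 > 0\<close> L(1) \<open>Q \<ge> 0\<close> by (simp add: d3_def)
    define R where "R = min (min (d1/2) (d2/2)) (min (d3/2) (r/4))"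
    have R: "0 < R" "R < d1" "R < d2" "R < d3" "R < r/2"
      using d1(1) d2(1) \<open>d3 > 0\<close> r(1) by (auto simp: R_def min_def)
    define k :: "real \<times> 'a \<Rightarrow> real" where "k = green_ker 0 R"
    define w :: "real \<times> 'a \<Rightarrow> real" where "w = mean_ker 0 R"
    define c where "c = mass k"
    have k: "kernel R k" "\<And>p. 0 \<le> k p" and w: "kernel R w" "\<And>p. 0 \<le> w p" and c: "c > 0"
      using kernel_green_ker[OF R(1)] green_ker_nonneg[OF R(1)] kernel_mean_ker[OF R(1)] mean_ker_nonneg[OF R(1)]
        integral_green_ker_pos[OF R(1)] by (auto simp: k_def w_def c_def)
    \<comment> \<open>The case distinction is made at the centre and not under the average, so that
      it matches the value of \<open>q\<close> at \<open>x\<close>.\<close>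
    define GR where "GR = (\<lambda>x. if v x \<le> u x then avg (-1) k F x else avg (-1) k H x)"
    have GR: "integrable lborel GR"
      unfolding GR_def by (intro if_int avg_integrable[OF k(1)] F H)
    have "(\<integral>x. GR x * \<phi> x \<partial>lborel) \<le> (\<integral>x. (avg (-1) w q x - q x) * \<phi> x \<partial>lborel)"
    proof (rule integral_mono_AE)
      show "integrable lborel (\<lambda>x. GR x * \<phi> x)"
        by (rule integrable_mult_test[OF GR \<phi>])
      show "integrable lborel (\<lambda>x. (avg (-1) w q x - q x) * \<phi> x)"
        by (rule integrable_mult_test[OF _ \<phi>]) (intro Bochner_Integration.integrable_diff avg_integrable[OF w(1)] q)
      have "AE x in lborel. x \<in> \<Omega>' \<longrightarrow> u x + avg (-1) k F x \<le> avg (-1) w u x"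
        unfolding k_def w_def by (rule weak_mean_inequality[OF u F subu R(1) \<Omega>'(1) inflate[OF R(5)]])
      moreover have "AE x in lborel. x \<in> \<Omega>' \<longrightarrow> v x + avg (-1) k H x \<le> avg (-1) w v x"
        unfolding k_def w_def by (rule weak_mean_inequality[OF v H subv R(1) \<Omega>'(1) inflate[OF R(5)]])
      moreover have "AE x in lborel. avg (-1) w u x \<le> avg (-1) w q x"
        by (rule avg_mono_AE[OF w u q]) (simp add: q_def)
      moreover have "AE x in lborel. avg (-1) w v x \<le> avg (-1) w q x"
        by (rule avg_mono_AE[OF w v q]) (simp add: q_def)
      ultimately show "AE x in lborel. GR x * \<phi> x \<le> (avg (-1) w q x - q x) * \<phi> x"
      proof eventually_elim
        case (elim x)
        show ?case
        proof (cases "x \<in> \<Omega>'")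
          case True
          then have "GR x \<le> avg (-1) w q x - q x"
            using elim by (auto simp: GR_def q_def max_def)
          then show ?thesis
            by (rule mult_right_mono[OF _ \<phi>0])
        next
          case False
          then have "\<phi> x = 0"
            using S(3) \<Omega>'(2) by blast
          then show ?thesis
            by simp
        qed
      qed
    qed
    also have "\<dots> = (\<integral>x. avg (-1) w q x * \<phi> x \<partial>lborel) - (\<integral>x. q x * \<phi> x \<partial>lborel)"
      using integrable_mult_test[OF q \<phi>] integrable_mult_test[OF avg_integrable[OF w(1) q] \<phi>]
      by (simp add: left_diff_distrib)
    also have "\<dots> = (\<integral>x. q x * avg 1 w \<phi> x \<partial>lborel) - (\<integral>x. q x * \<phi> x \<partial>lborel)"
      by (simp add: avg_adjoint_test[OF w(1) q \<phi>])
    also have "\<dots> = (\<integral>x. q x * avg 1 w \<phi> x - q x * \<phi> x \<partial>lborel)"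
      by (intro Bochner_Integration.integral_diff[symmetric] integrable_mult_test[OF q \<phi>]
          integrable_mult_test[OF q test_fun_avg_UNIV[OF w(1) _ \<phi>]]) auto
    also have "\<dots> = (\<integral>x. q x * avg 1 k (laplacian \<phi>) x \<partial>lborel)"
      unfolding w_def k_def by (simp add: avg_mean_ker[OF R(1) \<phi>] algebra_simps)
    finally have 1: "(\<integral>x. GR x * \<phi> x \<partial>lborel) \<le> (\<integral>x. q x * avg 1 k (laplacian \<phi>) x \<partial>lborel)" .
    have 2: "(\<integral>x. q x * avg 1 k (laplacian \<phi>) x \<partial>lborel) \<le> c * (\<integral>x. q x * laplacian \<phi> x \<partial>lborel) + L * R * c * Q"
    proof -
      have "(\<integral>x. q x * avg 1 k (laplacian \<phi>) x \<partial>lborel)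
          \<le> (\<integral>x. c * (q x * laplacian \<phi> x) + L * R * c * \<bar>q x\<bar> \<partial>lborel)"
      proof (rule integral_mono)
        show "integrable lborel (\<lambda>x. q x * avg 1 k (laplacian \<phi>) x)"
          by (rule integrable_mult_test[OF q test_fun_avg_UNIV[OF k(1) _ lap]]) simp
        show "integrable lborel (\<lambda>x. c * (q x * laplacian \<phi> x) + L * R * c * \<bar>q x\<bar>)"
          using integrable_mult_test[OF q lap] q by auto
        fix x
        have "\<bar>avg 1 k (laplacian \<phi>) x - c * laplacian \<phi> x\<bar> \<le> L * R * c"
          unfolding c_def by (rule avg_approx_test[OF k _ lap L(2)]) simp
        then have "\<bar>q x\<bar> * \<bar>avg 1 k (laplacian \<phi>) x - c * laplacian \<phi> x\<bar> \<le> \<bar>q x\<bar> * (L * R * c)"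
          by (intro mult_left_mono) auto
        then have "q x * (avg 1 k (laplacian \<phi>) x - c * laplacian \<phi> x) \<le> \<bar>q x\<bar> * (L * R * c)"
          by (simp add: abs_mult[symmetric])
        then show "q x * avg 1 k (laplacian \<phi>) x \<le> c * (q x * laplacian \<phi> x) + L * R * c * \<bar>q x\<bar>"
          by (simp add: algebra_simps)
      qed
      then show ?thesis
        using integrable_mult_test[OF q lap] q by (simp add: Q_def)
    qed
    have 3: "c * (\<integral>x. G x * \<phi> x \<partial>lborel) - 2 * C * e * c \<le> (\<integral>x. GR x * \<phi> x \<partial>lborel)"
    proof -
      define E where "E = (\<lambda>x. \<bar>avg (-1) k F x - c * F x\<bar> + \<bar>avg (-1) k H x - c * H x\<bar>)"
      have E: "integrable lborel (\<lambda>x. \<bar>avg (-1) k F x - c * F x\<bar>)"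
        "integrable lborel (\<lambda>x. \<bar>avg (-1) k H x - c * H x\<bar>)"
        using avg_integrable[OF k(1) F] avg_integrable[OF k(1) H] F H by auto
      have "(\<integral>x. c * (G x * \<phi> x) - C * E x \<partial>lborel) \<le> (\<integral>x. GR x * \<phi> x \<partial>lborel)"
      proof (rule integral_mono)
        show "integrable lborel (\<lambda>x. c * (G x * \<phi> x) - C * E x)"
          using integrable_mult_test[OF G \<phi>] E by (auto simp: E_def)
        show "integrable lborel (\<lambda>x. GR x * \<phi> x)"
          by (rule integrable_mult_test[OF GR \<phi>])
        fix x
        have "\<bar>c * G x - GR x\<bar> \<le> E x"
          by (auto simp: G_def GR_def E_def)
        then have "(c * G x - GR x) * \<phi> x \<le> E x * \<phi> x"
          by (intro mult_right_mono \<phi>0) auto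
        also have "\<dots> \<le> E x * C"
          using C(2)[of x] by (intro mult_left_mono) (auto simp: E_def)
        finally show "c * (G x * \<phi> x) - C * E x \<le> GR x * \<phi> x"
          by (simp add: algebra_simps)
      qed
      moreover have "(\<integral>x. c * (G x * \<phi> x) - C * E x \<partial>lborel)
          = c * (\<integral>x. G x * \<phi> x \<partial>lborel) - C * ((\<integral>x. \<bar>avg (-1) k F x - c * F x\<bar> \<partial>lborel)
              + (\<integral>x. \<bar>avg (-1) k H x - c * H x\<bar> \<partial>lborel))"
        using integrable_mult_test[OF G \<phi>] E by (simp add: E_def)
      moreover have "C * ((\<integral>x. \<bar>avg (-1) k F x - c * F x\<bar> \<partial>lborel)
              + (\<integral>x. \<bar>avg (-1) k H x - c * H x\<bar> \<partial>lborel)) \<le> C * (e * c + e * c)"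
        unfolding k_def c_def using d1(2)[OF R(1,2)] d2(2)[OF R(1,3)] C(1)
        by (intro mult_left_mono add_mono) auto
      ultimately show ?thesis
        by (simp add: algebra_simps)
    qed
    have "L * R * Q \<le> e0 / 2"
    proof -
      have "R * (2 * L * (Q + 1)) \<le> e0"
        using R(4) L(1) \<open>Q \<ge> 0\<close> unfolding d3_def by (simp add: less_divide_eq mult_ac)
      moreover have "L * R * Q \<le> L * R * (Q + 1)"
        using L(1) R(1) by simp
      ultimately show ?thesis
        by (simp add: algebra_simps)
    qed
    moreover have "2 * C * e = e0 / 2"
      using C(1) by (simp add: e_def)
    moreover have "c * (\<integral>x. G x * \<phi> x \<partial>lborel) \<le> c * ((\<integral>x. q x * laplacian \<phi> x \<partial>lborel) + L * R * Q + 2 * C * e)"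
      using 1 2 3 by (simp add: algebra_simps)
    then have "(\<integral>x. G x * \<phi> x \<partial>lborel) \<le> (\<integral>x. q x * laplacian \<phi> x \<partial>lborel) + L * R * Q + 2 * C * e"
      using c by simp
    ultimately show "(\<integral>x. G x * \<phi> x \<partial>lborel) \<le> (\<integral>x. q x * laplacian \<phi> x \<partial>lborel) + e0"
      by linarith
  qed
  then show "(\<integral>x. (if v x \<le> u x then F x else H x) * \<phi> x \<partial>lborel)
      \<le> (\<integral>x. max (u x) (v x) * laplacian \<phi> x \<partial>lborel)"
    by (simp add: G_def q_def)
qed

lemma integral_test_cut:
  assumes "test_fun \<Omega> \<phi>" "\<Omega> \<subseteq> K"
  shows "(\<integral>x. (indicator K x * u x) * \<phi> x \<partial>lborel) = (\<integral>x. u x * \<phi> x \<partial>lborel)"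
  by (intro Bochner_Integration.integral_cong refl)
    (use test_fun_eq_0[OF assms(1)] assms(2) in \<open>auto simp: indicator_def\<close>)

lemma weak_sub_cut:
  assumes "\<Omega>' \<subseteq> K" "\<Omega>' \<subseteq> \<Omega>" "weak_sub \<Omega> u F"
  shows "weak_sub \<Omega>' (\<lambda>x. indicator K x * u x) (\<lambda>x. indicator K x * F x)"
  unfolding weak_sub_def
proof (intro allI impI)
  fix \<phi> :: "'a \<Rightarrow> real" assume \<phi>: "test_fun \<Omega>' \<phi>" "\<forall>x. 0 \<le> \<phi> x"
  then have "(\<integral>x. F x * \<phi> x \<partial>lborel) \<le> (\<integral>x. u x * laplacian \<phi> x \<partial>lborel)"
    using weak_subD[OF assms(3) test_fun_mono[OF \<phi>(1) assms(2)]] by auto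
  then show "(\<integral>x. indicator K x * F x * \<phi> x \<partial>lborel) \<le> (\<integral>x. indicator K x * u x * laplacian \<phi> x \<partial>lborel)"
    by (simp add: integral_test_cut[OF \<phi>(1) assms(1)] integral_test_cut[OF test_fun_laplacian[OF \<phi>(1)] assms(1)])
qed

text \<open>Cutting all functions to a compact neighbourhood of the support of the test function
  makes them globally integrable, as the averages require.\<close>

theorem Kato:
  fixes u v F H :: "'a::euclidean_space \<Rightarrow> real"
  assumes u: "sublap \<Omega> u F" and v: "sublap \<Omega> v H" and "open \<Omega>"
  shows "sublap \<Omega> (\<lambda>x. max (u x) (v x)) (\<lambda>x. if v x \<le> u x then F x else H x)"
proof -
  have l: "L1loc \<Omega> u" "L1loc \<Omega> v" "L1loc \<Omega> F" "L1loc \<Omega> H" and sub: "weak_sub \<Omega> u F" "weak_sub \<Omega> v H"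
    using u v by (auto simp: sublap_def)
  have [measurable]: "u \<in> borel_measurable borel" "v \<in> borel_measurable borel"
    using l by (auto dest: L1loc_borel)
  have "(\<integral>x. (if v x \<le> u x then F x else H x) * \<phi> x \<partial>lborel) \<le> (\<integral>x. max (u x) (v x) * laplacian \<phi> x \<partial>lborel)"
    if \<phi>: "test_fun \<Omega> \<phi>" "\<forall>x. 0 \<le> \<phi> x" for \<phi>
  proof -
    obtain S where S: "smooth_fun \<phi>" "compact S" "S \<subseteq> \<Omega>" "\<And>x. x \<notin> S \<Longrightarrow> \<phi> x = 0"
      using \<phi>(1) by (rule test_funE) blast
    obtain r where r: "r > 0" "(\<Union>x\<in>S. cball x r) \<subseteq> \<Omega>"
      using compact_inflate[OF S(2) \<open>open \<Omega>\<close> S(3)] .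
    define K where "K = (\<Union>x\<in>S. cball x r)"
    define \<Omega>' where "\<Omega>' = (\<Union>x\<in>S. ball x r)"
    have K: "compact K" "K \<subseteq> \<Omega>" "\<Omega>' \<subseteq> K" "open \<Omega>'" "S \<subseteq> \<Omega>'"
      using compact_UN_cball[OF S(2)] r unfolding K_def \<Omega>'_def by (auto intro!: UN_mono)
    have \<phi>': "test_fun \<Omega>' \<phi>"
      by (rule test_funI[OF S(1,2) K(5) S(4)])
    let ?i = "\<lambda>f x. indicator K x * f x :: real"
    have "weak_sub \<Omega>' (\<lambda>x. max (?i u x) (?i v x)) (\<lambda>x. if ?i v x \<le> ?i u x then ?i F x else ?i H x)"
      using K(2,3) by (intro Kato_integrable L1loc_cut[OF l(1)] L1loc_cut[OF l(2)] L1loc_cut[OF l(3)]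
          L1loc_cut[OF l(4)] weak_sub_cut[OF K(3) _ sub(1)] weak_sub_cut[OF K(3) _ sub(2)] K(1,2,4)) auto
    from weak_subD[OF this \<phi>'] \<phi>(2)
    have "(\<integral>x. (if ?i v x \<le> ?i u x then ?i F x else ?i H x) * \<phi> x \<partial>lborel)
        \<le> (\<integral>x. max (?i u x) (?i v x) * laplacian \<phi> x \<partial>lborel)"
      by auto
    moreover have "(\<lambda>x. (if ?i v x \<le> ?i u x then ?i F x else ?i H x)) = ?i (\<lambda>x. if v x \<le> u x then F x else H x)"
      "(\<lambda>x. max (?i u x) (?i v x)) = ?i (\<lambda>x. max (u x) (v x))"
      by (auto simp: indicator_def fun_eq_iff)
    ultimately show ?thesis
      using integral_test_cut[OF \<phi>' K(3), of "\<lambda>x. if v x \<le> u x then F x else H x"]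
        integral_test_cut[OF test_fun_laplacian[OF \<phi>'] K(3), of "\<lambda>x. max (u x) (v x)"]
      by metis
  qed
  moreover have "L1loc \<Omega> (\<lambda>x. if v x \<le> u x then F x else H x)"
    by (intro L1loc_cases l) measurable
  ultimately show ?thesis
    using L1loc_max[OF l(1,2)] by (auto simp: sublap_def weak_sub_def)
qed

section \<open>Stability of distributional subsolutions and essential suprema\<close>

lemma sublapD:
  assumes "sublap \<Omega> u F"
  shows "L1loc \<Omega> u" "L1loc \<Omega> F" "weak_sub \<Omega> u F"
  using assms by (auto simp: sublap_def)

lemma sublap_mono_rhs:
  assumes u: "sublap \<Omega> u F" and F': "L1loc \<Omega> F'"
    and le: "AE x in lborel. x \<in> \<Omega> \<longrightarrow> F' x \<le> F x"
  shows "sublap \<Omega> u F'"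
  unfolding sublap_def weak_sub_def
proof (intro conjI allI impI sublapD(1)[OF u] F')
  fix \<phi> assume \<phi>: "test_fun \<Omega> \<phi>" "\<forall>x. 0 \<le> \<phi> x"
  have "(\<integral>x. F' x * \<phi> x \<partial>lborel) \<le> (\<integral>x. F x * \<phi> x \<partial>lborel)"
  proof (rule integral_mono_AE)
    show "AE x in lborel. F' x * \<phi> x \<le> F x * \<phi> x"
      using le
    proof eventually_elim
      case (elim x)
      then show ?case
        using test_fun_eq_0[OF \<phi>(1), of x] \<phi>(2) by (cases "x \<in> \<Omega>") (auto intro: mult_right_mono)
    qed
  qed (intro L1loc_test_integrable[OF _ \<phi>(1)] F' sublapD(2)[OF u])+
  also have "\<dots> \<le> (\<integral>x. u x * laplacian \<phi> x \<partial>lborel)"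
    using weak_subD[OF sublapD(3)[OF u] \<phi>(1)] \<phi>(2) by auto
  finally show "(\<integral>x. F' x * \<phi> x \<partial>lborel) \<le> (\<integral>x. u x * laplacian \<phi> x \<partial>lborel)" .
qed

lemma integral_test_AE_cong:
  assumes "test_fun \<Omega> \<phi>" "u \<in> borel_measurable borel" "v \<in> borel_measurable borel"
    and "AE x in lborel. x \<in> \<Omega> \<longrightarrow> u x = v x"
  shows "(\<integral>x. u x * \<phi> x \<partial>lborel) = (\<integral>x. v x * \<phi> x \<partial>lborel)"
proof (rule integral_cong_AE)
  show "AE x in lborel. u x * \<phi> x = v x * \<phi> x"
    using assms(4) by eventually_elim (use test_fun_eq_0[OF assms(1)] in auto)
qed (use assms test_fun_borel[OF assms(1)] in measurable)

lemma sublap_subset: "sublap \<Omega> u F \<Longrightarrow> \<Omega>' \<subseteq> \<Omega> \<Longrightarrow> sublap \<Omega>' u F"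
  by (auto simp: sublap_def weak_sub_def intro: L1loc_mono test_fun_mono)

lemma sublap_add:
  assumes u: "sublap \<Omega> u F" and v: "sublap \<Omega> v H"
  shows "sublap \<Omega> (\<lambda>x. u x + v x) (\<lambda>x. F x + H x)"
  unfolding sublap_def weak_sub_def
proof (intro conjI allI impI L1loc_add sublapD(1,2)[OF u] sublapD(1,2)[OF v])
  fix \<phi> assume \<phi>: "test_fun \<Omega> \<phi>" "\<forall>x. 0 \<le> \<phi> x"
  note int = L1loc_test_integrable[OF sublapD(2)[OF u] \<phi>(1)] L1loc_test_integrable[OF sublapD(2)[OF v] \<phi>(1)]
    L1loc_test_integrable[OF sublapD(1)[OF u] test_fun_laplacian[OF \<phi>(1)]]
    L1loc_test_integrable[OF sublapD(1)[OF v] test_fun_laplacian[OF \<phi>(1)]]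
  show "(\<integral>x. (F x + H x) * \<phi> x \<partial>lborel) \<le> (\<integral>x. (u x + v x) * laplacian \<phi> x \<partial>lborel)"
    using weak_subD[OF sublapD(3)[OF u] \<phi>(1)] weak_subD[OF sublapD(3)[OF v] \<phi>(1)] \<phi>(2) int
    by (simp add: distrib_right)
qed

lemma sublap_const: "sublap \<Omega> (\<lambda>x. c) (\<lambda>x. 0)"
  by (auto simp: sublap_def weak_sub_def L1loc_const integral_laplacian_eq_0)

lemma L1loc_integrable_from_test:
  assumes "open \<Omega>" and u: "u \<in> borel_measurable borel"
    and int: "\<And>\<phi>. test_fun \<Omega> \<phi> \<Longrightarrow> (\<And>x. 0 \<le> \<phi> x) \<Longrightarrow> integrable lborel (\<lambda>x. u x * \<phi> x)"
  shows "L1loc \<Omega> u"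
  unfolding L1loc_def
proof (intro conjI allI impI)
  fix K assume K: "compact K" "K \<subseteq> \<Omega>"
  obtain \<kappa> where \<kappa>: "test_fun \<Omega> \<kappa>" "\<And>x. 0 \<le> \<kappa> x" "\<And>x. x \<in> K \<Longrightarrow> \<kappa> x = 1"
    using test_fun_bump[OF K(1) \<open>open \<Omega>\<close> K(2)] by metis
  show "integrable lborel (\<lambda>x. indicator K x * u x)"
  proof (rule Bochner_Integration.integrable_bound[OF int[OF \<kappa>(1,2)]])
    show "(\<lambda>x. indicator K x * u x) \<in> borel_measurable lborel"
      using u K(1) by (auto intro!: borel_measurable_times borel_measurable_indicator borel_closed compact_imp_closed)
  qed (use \<kappa>(3) in \<open>auto simp: indicator_def\<close>)
qed (rule u)

text \<open>Integrability of the limit is part of the conclusion, and only the bounds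
  \<open>c n\<close> have to converge, not the integrals.\<close>

lemma Fatou_real:
  fixes f :: "nat \<Rightarrow> 'a \<Rightarrow> real"
  assumes f: "\<And>n. integrable M (f n)" "\<And>n. AE x in M. 0 \<le> f n x"
    and lim: "AE x in M. (\<lambda>n. f n x) \<longlonglongrightarrow> g x" and g: "g \<in> borel_measurable M"
    and le: "\<And>n. integral\<^sup>L M (f n) \<le> c n" and c: "c \<longlonglongrightarrow> c0"
  shows "integrable M g" "integral\<^sup>L M g \<le> c0"
proof -
  have nn: "AE x in M. \<forall>n. 0 \<le> f n x"
    using f(2) by (simp add: AE_all_countable)
  have g0: "AE x in M. 0 \<le> g x"
    using lim nn by eventually_elim (auto intro: LIMSEQ_le_const)
  have "(\<integral>\<^sup>+ x. ennreal (g x) \<partial>M) = (\<integral>\<^sup>+ x. liminf (\<lambda>n. ennreal (f n x)) \<partial>M)"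
  proof (rule nn_integral_cong_AE)
    show "AE x in M. ennreal (g x) = liminf (\<lambda>n. ennreal (f n x))"
      using lim by eventually_elim (auto intro!: lim_imp_Liminf[symmetric] tendsto_ennrealI)
  qed
  also have "\<dots> \<le> liminf (\<lambda>n. \<integral>\<^sup>+ x. ennreal (f n x) \<partial>M)"
    using f(1) by (intro nn_integral_liminf) auto
  also have "\<dots> = liminf (\<lambda>n. ennreal (integral\<^sup>L M (f n)))"
    using nn_integral_eq_integral[OF f] by simp
  also have "\<dots> \<le> liminf (\<lambda>n. ennreal (c n))"
    by (intro Liminf_mono always_eventually) (auto intro: ennreal_leI le)
  also have "\<dots> = ennreal c0"
    using c by (intro lim_imp_Liminf tendsto_ennrealI) auto
  finally have *: "(\<integral>\<^sup>+ x. ennreal (g x) \<partial>M) \<le> ennreal c0" .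
  then show int: "integrable M g"
    using g g0 by (intro integrableI_nonneg) (auto intro: le_less_trans)
  have "0 \<le> c n" for n
    using integral_nonneg_AE[OF f(2)] le order_trans by blast
  then have "0 \<le> c0"
    using c by (auto intro: LIMSEQ_le_const)
  then show "integral\<^sup>L M g \<le> c0"
    using * nn_integral_eq_integral[OF int g0] by simp
qed

text \<open>The functions \<open>v n\<close> are dominated, so the Laplacian term converges. For
  \<open>\<Gamma> n\<close> there is only a minorant, and Fatou's lemma gives the inequality in the
  direction that a subsolution needs, together with local integrability of the limit.
  \<open>\<Gamma>\<close> is kept apart from \<open>v\<close> because the nonlinearity may itself
  vary with \<open>n\<close>.\<close>

lemma sublap_limit:
  fixes v :: "nat \<Rightarrow> 'a::euclidean_space \<Rightarrow> real"
  assumes sub: "\<And>n. sublap \<Omega> (v n) (\<lambda>x. \<Gamma> n x - f x)" and f: "L1loc \<Omega> f" and "open \<Omega>"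
    and V: "L1loc \<Omega> V" "\<And>n. AE x in lborel. x \<in> \<Omega> \<longrightarrow> \<bar>v n x\<bar> \<le> V x"
    and w: "w \<in> borel_measurable borel" "AE x in lborel. x \<in> \<Omega> \<longrightarrow> (\<lambda>n. v n x) \<longlonglongrightarrow> w x"
    and low: "L1loc \<Omega> low" "\<And>n. AE x in lborel. x \<in> \<Omega> \<longrightarrow> low x \<le> \<Gamma> n x"
    and \<Delta>: "\<Delta> \<in> borel_measurable borel" "AE x in lborel. x \<in> \<Omega> \<longrightarrow> (\<lambda>n. \<Gamma> n x) \<longlonglongrightarrow> \<Delta> x"
  shows "sublap \<Omega> w (\<lambda>x. \<Delta> x - f x)" "L1loc \<Omega> \<Delta>"
proof -
  have \<Gamma>: "L1loc \<Omega> (\<Gamma> n)" for n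
    using L1loc_add[OF sublapD(2)[OF sub[of n]] f] by simp
  have v_borel: "v n \<in> borel_measurable borel" for n
    by (rule L1loc_borel[OF sublapD(1)[OF sub]])
  have wL: "L1loc \<Omega> w"
  proof (rule L1loc_bound[OF V(1) w(1)])
    have "AE x in lborel. \<forall>n. x \<in> \<Omega> \<longrightarrow> \<bar>v n x\<bar> \<le> V x"
      by (subst AE_all_countable) (intro allI V(2))
    then show "AE x in lborel. x \<in> \<Omega> \<longrightarrow> \<bar>w x\<bar> \<le> \<bar>V x\<bar>"
      using w(2)
    proof eventually_elim
      case (elim x)
      show ?case
      proof
        assume "x \<in> \<Omega>"
        then have "(\<lambda>n. \<bar>v n x\<bar>) \<longlonglongrightarrow> \<bar>w x\<bar>" "\<forall>n. \<bar>v n x\<bar> \<le> V x"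
          using elim by (auto intro: tendsto_rabs)
        then have "\<bar>w x\<bar> \<le> V x"
          by (auto intro: LIMSEQ_le_const2)
        then show "\<bar>w x\<bar> \<le> \<bar>V x\<bar>"
          by simp
      qed
    qed
  qed
  have main: "integrable lborel (\<lambda>x. (\<Delta> x - low x) * \<phi> x)"
    "(\<integral>x. (\<Delta> x - low x) * \<phi> x \<partial>lborel) \<le> (\<integral>x. w x * laplacian \<phi> x \<partial>lborel)
      + (\<integral>x. f x * \<phi> x \<partial>lborel) - (\<integral>x. low x * \<phi> x \<partial>lborel)"
    if \<phi>: "test_fun \<Omega> \<phi>" "\<And>x. 0 \<le> \<phi> x" for \<phi>
  proof -
    have [measurable]: "\<phi> \<in> borel_measurable borel" "laplacian \<phi> \<in> borel_measurable borel"
      "low \<in> borel_measurable borel" "w \<in> borel_measurable borel" "\<Delta> \<in> borel_measurable borel"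
      "\<And>n. v n \<in> borel_measurable borel"
      using test_fun_borel[OF \<phi>(1)] test_fun_borel[OF test_fun_laplacian[OF \<phi>(1)]]
        L1loc_borel[OF low(1)] w(1) \<Delta>(1) v_borel by auto
    have lim_v: "(\<lambda>n. \<integral>x. v n x * laplacian \<phi> x \<partial>lborel) \<longlonglongrightarrow> (\<integral>x. w x * laplacian \<phi> x \<partial>lborel)"
    proof (rule integral_dominated_convergence[where w = "\<lambda>x. \<bar>V x * laplacian \<phi> x\<bar>"])
      show "integrable lborel (\<lambda>x. \<bar>V x * laplacian \<phi> x\<bar>)"
        by (intro integrable_abs L1loc_test_integrable[OF V(1)] test_fun_laplacian \<phi>(1))
      show "AE x in lborel. (\<lambda>n. v n x * laplacian \<phi> x) \<longlonglongrightarrow> w x * laplacian \<phi> x"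
        using w(2)
      proof eventually_elim
        case (elim x)
        then show ?case
          using test_fun_eq_0[OF test_fun_laplacian[OF \<phi>(1)], of x]
          by (cases "x \<in> \<Omega>") (auto intro!: tendsto_intros)
      qed
      show "AE x in lborel. norm (v n x * laplacian \<phi> x) \<le> \<bar>V x * laplacian \<phi> x\<bar>" for n
        using V(2)[of n]
      proof eventually_elim
        case (elim x)
        then show ?case
          using test_fun_eq_0[OF test_fun_laplacian[OF \<phi>(1)], of x]
          by (cases "x \<in> \<Omega>") (auto simp: abs_mult intro!: mult_right_mono)
      qed
    qed auto
    have le: "(\<integral>x. (\<Gamma> n x - low x) * \<phi> x \<partial>lborel) \<le> (\<integral>x. v n x * laplacian \<phi> x \<partial>lborel)
      + (\<integral>x. f x * \<phi> x \<partial>lborel) - (\<integral>x. low x * \<phi> x \<partial>lborel)" for n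
      using weak_subD[OF sublapD(3)[OF sub] \<phi>, of n] L1loc_test_integrable[OF \<Gamma> \<phi>(1), of n]
        L1loc_test_integrable[OF low(1) \<phi>(1)] L1loc_test_integrable[OF f \<phi>(1)]
      by (simp add: left_diff_distrib)
    have lim_c: "(\<lambda>n. (\<integral>x. v n x * laplacian \<phi> x \<partial>lborel) + (\<integral>x. f x * \<phi> x \<partial>lborel) - (\<integral>x. low x * \<phi> x \<partial>lborel))
      \<longlonglongrightarrow> (\<integral>x. w x * laplacian \<phi> x \<partial>lborel) + (\<integral>x. f x * \<phi> x \<partial>lborel) - (\<integral>x. low x * \<phi> x \<partial>lborel)"
      by (intro tendsto_intros lim_v)
    have int: "integrable lborel (\<lambda>x. (\<Gamma> n x - low x) * \<phi> x)" for n
      by (intro L1loc_test_integrable[OF L1loc_diff[OF \<Gamma> low(1)] \<phi>(1)])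
    have nonneg: "AE x in lborel. 0 \<le> (\<Gamma> n x - low x) * \<phi> x" for n
      using low(2)[of n]
    proof eventually_elim
      case (elim x)
      then show ?case
        using test_fun_eq_0[OF \<phi>(1), of x] \<phi>(2)[of x] by (cases "x \<in> \<Omega>") auto
    qed
    have lim: "AE x in lborel. (\<lambda>n. (\<Gamma> n x - low x) * \<phi> x) \<longlonglongrightarrow> (\<Delta> x - low x) * \<phi> x"
      using \<Delta>(2)
    proof eventually_elim
      case (elim x)
      then show ?case
        using test_fun_eq_0[OF \<phi>(1), of x] by (cases "x \<in> \<Omega>") (auto intro!: tendsto_intros)
    qed
    have "(\<lambda>x. (\<Delta> x - low x) * \<phi> x) \<in> borel_measurable lborel"
      by measurable
    note * = Fatou_real[OF int nonneg lim this le lim_c]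
    show "integrable lborel (\<lambda>x. (\<Delta> x - low x) * \<phi> x)"
      "(\<integral>x. (\<Delta> x - low x) * \<phi> x \<partial>lborel) \<le> (\<integral>x. w x * laplacian \<phi> x \<partial>lborel)
      + (\<integral>x. f x * \<phi> x \<partial>lborel) - (\<integral>x. low x * \<phi> x \<partial>lborel)"
      by (rule *)+
  qed
  have "L1loc \<Omega> (\<lambda>x. \<Delta> x - low x)"
    by (rule L1loc_integrable_from_test[OF \<open>open \<Omega>\<close> _ main(1)])
      (use \<Delta>(1) L1loc_borel[OF low(1)] in measurable)
  from L1loc_add[OF this low(1)] show \<Delta>L: "L1loc \<Omega> \<Delta>"
    by simp
  show "sublap \<Omega> w (\<lambda>x. \<Delta> x - f x)"
    unfolding sublap_def weak_sub_def
  proof (intro conjI allI impI wL L1loc_diff[OF \<Delta>L f])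
    fix \<phi> assume \<phi>: "test_fun \<Omega> \<phi>" "\<forall>x. 0 \<le> \<phi> x"
    show "(\<integral>x. (\<Delta> x - f x) * \<phi> x \<partial>lborel) \<le> (\<integral>x. w x * laplacian \<phi> x \<partial>lborel)"
      using main(2)[OF \<phi>(1)] \<phi>(2) L1loc_test_integrable[OF \<Delta>L \<phi>(1)]
        L1loc_test_integrable[OF low(1) \<phi>(1)] L1loc_test_integrable[OF f \<phi>(1)]
      by (simp add: left_diff_distrib)
  qed
qed

text \<open>Monotone convergence for \<open>f n - f 0\<close>: the supremum has a finite integral
  and is therefore finite almost everywhere.\<close>

lemma AE_bounded_if_integral_bounded:
  fixes f :: "nat \<Rightarrow> 'a \<Rightarrow> real"
  assumes f: "\<And>n. integrable M (f n)" "\<And>n x. f n x \<le> f (Suc n) x" and C: "\<And>n. integral\<^sup>L M (f n) \<le> C"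
  shows "AE x in M. \<exists>B. \<forall>n. f n x \<le> B"
proof -
  have mono: "f m x \<le> f n x" if "m \<le> n" for m n x
    by (rule lift_Suc_mono_le[of "\<lambda>n. f n x", OF f(2) that])
  let ?g = "\<lambda>n x. ennreal (f n x - f 0 x)"
  have [measurable]: "f n \<in> borel_measurable M" for n
    using f(1) by auto
  have "(\<integral>\<^sup>+ x. (SUP n. ?g n x) \<partial>M) = (SUP n. \<integral>\<^sup>+ x. ?g n x \<partial>M)"
    by (intro nn_integral_monotone_convergence_SUP) (auto simp: incseq_def le_fun_def intro!: ennreal_leI mono)
  also have "\<dots> \<le> ennreal (C - integral\<^sup>L M (f 0))"
  proof (rule SUP_least)
    fix n
    have "(\<integral>\<^sup>+ x. ?g n x \<partial>M) = ennreal (\<integral>x. f n x - f 0 x \<partial>M)"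
      using f(1) mono[of 0 n] by (intro nn_integral_eq_integral) auto
    also have "\<dots> \<le> ennreal (C - integral\<^sup>L M (f 0))"
      using f(1) C[of n] by (intro ennreal_leI) simp
    finally show "(\<integral>\<^sup>+ x. ?g n x \<partial>M) \<le> ennreal (C - integral\<^sup>L M (f 0))" .
  qed
  also have "\<dots> < \<infinity>"
    by simp
  finally have "AE x in M. (SUP n. ?g n x) \<noteq> \<infinity>"
    by (intro nn_integral_PInf_AE) auto
  then show ?thesis
  proof eventually_elim
    case (elim x)
    have "f n x \<le> enn2real (SUP n. ?g n x) + f 0 x" for n
    proof -
      have "?g n x \<le> (SUP n. ?g n x)"
        by (intro SUP_upper) auto
      then have "f n x - f 0 x \<le> enn2real (SUP n. ?g n x)"
        using elim mono[of 0 n x] by (metis enn2real_ennreal enn2real_mono diff_ge_0_iff_ge infinity_ennreal_def less_top le0)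
      then show ?thesis
        by simp
    qed
    then show ?case
      by blast
  qed
qed

text \<open>The pointwise supremum of an uncountable family is replaced by the essential one. A
  sequence in \<open>S\<close> is chosen that maximises a bounded, strictly increasing functional;
  the limit of its running maxima dominates every member almost everywhere.\<close>

theorem Perron_supremum:
  fixes S :: "('a::euclidean_space \<Rightarrow> real) set"
  assumes "open \<Omega>" "S \<noteq> {}" and SL: "\<And>u. u \<in> S \<Longrightarrow> L1loc \<Omega> u"
    and max: "\<And>u v. u \<in> S \<Longrightarrow> v \<in> S \<Longrightarrow> (\<lambda>x. max (u x) (v x)) \<in> S"
    and bdd: "\<And>K. compact K \<Longrightarrow> K \<subseteq> \<Omega> \<Longrightarrow> \<exists>C. \<forall>u\<in>S. (\<integral>x. indicator K x * u x \<partial>lborel) \<le> C"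
  obtains v w where "\<And>n::nat. v n \<in> S" "\<And>n x. v n x \<le> v (Suc n) x" "w \<in> borel_measurable borel"
    "AE x in lborel. x \<in> \<Omega> \<longrightarrow> (\<lambda>n. v n x) \<longlonglongrightarrow> w x" "L1loc \<Omega> w"
    "\<And>u. u \<in> S \<Longrightarrow> AE x in lborel. x \<in> \<Omega> \<longrightarrow> u x \<le> w x"
proof -
  have S_borel: "u \<in> borel_measurable borel" if "u \<in> S" for u
    by (rule L1loc_borel[OF SL[OF that]])
  obtain h :: "'a \<Rightarrow> ennreal" where h: "h \<in> borel_measurable borel" "(\<integral>\<^sup>+ x. h x \<partial>lborel) \<noteq> \<infinity>"
    "\<And>x. 0 < h x" "\<And>x. h x < \<infinity>"
    using sigma_finite_measure.Ex_finite_integrable_function[OF sigma_finite_lborel[where 'a = 'a]] by auto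
  \<comment> \<open>An integrable weight, positive on \<open>\<Omega>\<close>, and the bounded
    function \<open>arctan\<close> make the functional finite; strict monotonicity of
    \<open>arctan\<close> lets it detect inequality on sets of positive measure.\<close>
  define \<rho> where "\<rho> = (\<lambda>x. indicator \<Omega> x * enn2real (h x))"
  have [measurable]: "\<rho> \<in> borel_measurable borel"
    using h(1) \<open>open \<Omega>\<close> unfolding \<rho>_def
    by (intro borel_measurable_times borel_measurable_indicator borel_measurable_enn2real) auto
  have \<rho>_pos: "\<rho> x > 0" if "x \<in> \<Omega>" for x
    using h(3)[of x] h(4)[of x] that by (simp add: \<rho>_def enn2real_positive_iff)
  have \<rho>_nonneg: "\<rho> x \<ge> 0" for x
    by (simp add: \<rho>_def)
  have \<rho>_int: "integrable lborel \<rho>"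
  proof (rule integrableI_nonneg)
    have "(\<integral>\<^sup>+ x. ennreal (\<rho> x) \<partial>lborel) \<le> (\<integral>\<^sup>+ x. h x \<partial>lborel)"
      using h(4) by (intro nn_integral_mono) (auto simp: \<rho>_def indicator_def)
    then show "(\<integral>\<^sup>+ x. ennreal (\<rho> x) \<partial>lborel) < \<infinity>"
      using h(2) by (auto simp: less_top intro: le_less_trans)
  qed (auto simp: \<rho>_nonneg)
  define \<Phi> where "\<Phi> = (\<lambda>u. \<integral>x. \<rho> x * arctan (u x) \<partial>lborel)"
  have arctan_abs: "\<bar>arctan y\<bar> \<le> pi/2" for y
    using arctan_lbound[of y] arctan_ubound[of y] by linarith
  have arctan_int: "integrable lborel (\<lambda>x. \<rho> x * arctan (u x))" if "u \<in> borel_measurable borel" for u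
    using that by (intro integrable_mult_bounded[OF \<rho>_int _ arctan_abs]) auto
  have arctan_le: "\<bar>\<rho> x * arctan y\<bar> \<le> (pi/2) * \<rho> x" for x y
    using \<rho>_nonneg[of x] mult_left_mono[OF arctan_abs[of y] \<rho>_nonneg[of x]]
    by (simp add: abs_mult mult.commute)
  have bdd_\<Phi>: "bdd_above (\<Phi> ` S)"
  proof (rule bdd_aboveI2)
    fix u assume "u \<in> S"
    then show "\<Phi> u \<le> (\<integral>x. (pi/2) * \<rho> x \<partial>lborel)"
      unfolding \<Phi>_def using \<rho>_int
      by (intro integral_mono arctan_int S_borel abs_le_D1[OF arctan_le]) auto
  qed
  define s where "s = (SUP u\<in>S. \<Phi> u)"
  have s_upper: "\<Phi> u \<le> s" if "u \<in> S" for u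
    unfolding s_def by (rule cSUP_upper[OF that bdd_\<Phi>])
  have "\<exists>u\<in>S. s - 1 / real (Suc n) < \<Phi> u" for n
    using less_cSUP_iff[OF \<open>S \<noteq> {}\<close> bdd_\<Phi>, of "s - 1 / real (Suc n)"] by (simp add: s_def)
  then obtain b where b: "\<And>n. b n \<in> S" "\<And>n. s - 1 / real (Suc n) < \<Phi> (b n)"
    by metis
  define v where "v = rec_nat (b 0) (\<lambda>n u x. max (u x) (b (Suc n) x))"
  have v_simps: "v 0 = b 0" "v (Suc n) = (\<lambda>x. max (v n x) (b (Suc n) x))" for n
    by (simp_all add: v_def)
  have vS: "v n \<in> S" for n
    by (induction n) (auto simp: v_simps intro: max b)
  have [measurable]: "v n \<in> borel_measurable borel" for n
    by (rule S_borel[OF vS])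
  have v_Suc: "v n x \<le> v (Suc n) x" for n x
    by (simp add: v_simps)
  have b_le: "b n x \<le> v n x" for n x
    by (cases n) (auto simp: v_simps)
  have v_lower: "s - 1 / real (Suc n) \<le> \<Phi> (v n)" for n
  proof -
    have "\<Phi> (b n) \<le> \<Phi> (v n)"
      unfolding \<Phi>_def using b_le \<rho>_nonneg
      by (intro integral_mono arctan_int S_borel b(1) vS mult_left_mono arctan_monotone') auto
    with b(2)[of n] show ?thesis
      by linarith
  qed
  obtain C :: "nat \<Rightarrow> 'a set" where C: "\<And>n. compact (C n)" "\<And>n. C n \<subseteq> \<Omega>" "\<Union>(range C) = \<Omega>"
    using open_Union_compact_subsets[OF \<open>open \<Omega>\<close>] by metis
  \<comment> \<open>The supremum in the extended reals makes \<open>w\<close> Borel everywhere;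
    where it is infinite, \<open>w\<close> is \<open>0\<close>.\<close>
  define w where "w = (\<lambda>x. real_of_ereal (SUP n. ereal (v n x)))"
  have w_borel[measurable]: "w \<in> borel_measurable borel"
    unfolding w_def by measurable
  have "AE x in lborel. \<exists>B. \<forall>n. indicator (C k) x * v n x \<le> B" for k
  proof -
    obtain B where B: "\<And>u. u \<in> S \<Longrightarrow> (\<integral>x. indicator (C k) x * u x \<partial>lborel) \<le> B"
      using bdd[OF C(1,2)] by metis
    show ?thesis
    proof (rule AE_bounded_if_integral_bounded[where C = B])
      show "integrable lborel (\<lambda>x. indicator (C k) x * v n x)" for n
        by (rule L1loc_cut[OF SL[OF vS] C(1,2)])
    qed (use v_Suc B vS in \<open>auto simp: indicator_def\<close>)
  qed
  then have "AE x in lborel. \<forall>k. \<exists>B. \<forall>n. indicator (C k) x * v n x \<le> B"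
    by (simp add: AE_all_countable)
  then have lim: "AE x in lborel. x \<in> \<Omega> \<longrightarrow> (\<lambda>n. v n x) \<longlonglongrightarrow> w x"
  proof eventually_elim
    case (elim x)
    show ?case
    proof
      assume "x \<in> \<Omega>"
      then obtain k where "x \<in> C k"
        using C(3) by auto
      moreover obtain B where "\<And>n. indicator (C k) x * v n x \<le> B"
        using elim by metis
      ultimately have B: "\<And>n. v n x \<le> B"
        by (simp add: indicator_def)
      have inc: "incseq (\<lambda>n. v n x)"
        by (rule incseq_SucI) (rule v_Suc)
      have "(\<lambda>n. v n x) \<longlonglongrightarrow> (SUP n. v n x)"
        using B by (intro LIMSEQ_incseq_SUP inc bdd_aboveI2)
      then obtain l where l: "(\<lambda>n. v n x) \<longlonglongrightarrow> l"
        by blast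
      then have "(\<lambda>n. ereal (v n x)) \<longlonglongrightarrow> ereal l"
        by simp
      moreover have "(\<lambda>n. ereal (v n x)) \<longlonglongrightarrow> (SUP n. ereal (v n x))"
        using inc by (intro LIMSEQ_SUP) (auto simp: incseq_def)
      ultimately have "(SUP n. ereal (v n x)) = ereal l"
        by (rule LIMSEQ_unique[symmetric])
      with l show "(\<lambda>n. v n x) \<longlonglongrightarrow> w x"
        by (simp add: w_def)
    qed
  qed
  have v0_le: "v 0 x \<le> v n x" for n x
    by (rule lift_Suc_mono_le[of "\<lambda>n. v n x", OF v_Suc]) simp
  have wL: "L1loc \<Omega> w"
    unfolding L1loc_def
  proof (intro conjI allI impI w_borel)
    fix K assume K: "compact K" "K \<subseteq> \<Omega>"
    obtain B where B: "\<And>u. u \<in> S \<Longrightarrow> (\<integral>x. indicator K x * u x \<partial>lborel) \<le> B"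
      using bdd[OF K] by metis
    have [measurable]: "K \<in> sets borel"
      using K(1) by (auto intro: borel_closed compact_imp_closed)
    note int = L1loc_cut[OF SL[OF vS] K]
    have "integrable lborel (\<lambda>x. indicator K x * w x - indicator K x * v 0 x)"
    proof (rule Fatou_real(1))
      show "integrable lborel (\<lambda>x. indicator K x * v n x - indicator K x * v 0 x)" for n
        by (intro Bochner_Integration.integrable_diff int)
      show "AE x in lborel. 0 \<le> indicator K x * v n x - indicator K x * v 0 x" for n
        using v0_le by (auto simp: indicator_def)
      show "AE x in lborel. (\<lambda>n. indicator K x * v n x - indicator K x * v 0 x) \<longlonglongrightarrow> indicator K x * w x - indicator K x * v 0 x"
        using lim
      proof eventually_elim
        case (elim x)
        then show ?case
          using K(2) by (cases "x \<in> K") (auto intro!: tendsto_intros)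
      qed
      show "(\<integral>x. indicator K x * v n x - indicator K x * v 0 x \<partial>lborel) \<le> B - (\<integral>x. indicator K x * v 0 x \<partial>lborel)" for n
        using int B[OF vS] by simp
    qed auto
    from Bochner_Integration.integrable_add[OF this int[of 0]]
    show "integrable lborel (\<lambda>x. indicator K x * w x)"
      by simp
  qed
  have lim_\<Phi>: "(\<lambda>n. \<Phi> (\<lambda>x. max (u x) (v n x))) \<longlonglongrightarrow> \<Phi> (\<lambda>x. max (u x) (w x))"
    if [measurable]: "u \<in> borel_measurable borel" for u
    unfolding \<Phi>_def
  proof (rule integral_dominated_convergence[where w = "\<lambda>x. (pi/2) * \<rho> x"])
    show "AE x in lborel. (\<lambda>n. \<rho> x * arctan (max (u x) (v n x))) \<longlonglongrightarrow> \<rho> x * arctan (max (u x) (w x))"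
      using lim
    proof eventually_elim
      case (elim x)
      then show ?case
        by (cases "x \<in> \<Omega>") (auto simp: \<rho>_def intro!: tendsto_intros tendsto_max)
    qed
  qed (use \<rho>_int arctan_le in auto)
  have s_le: "s \<le> \<Phi> w"
  proof -
    have "(\<lambda>n. \<Phi> (v n)) \<longlonglongrightarrow> \<Phi> w"
      unfolding \<Phi>_def
    proof (rule integral_dominated_convergence[where w = "\<lambda>x. (pi/2) * \<rho> x"])
      show "AE x in lborel. (\<lambda>n. \<rho> x * arctan (v n x)) \<longlonglongrightarrow> \<rho> x * arctan (w x)"
        using lim
      proof eventually_elim
        case (elim x)
        then show ?case
          by (cases "x \<in> \<Omega>") (auto simp: \<rho>_def intro!: tendsto_intros)
      qed
    qed (use \<rho>_int arctan_le in auto)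
    then have "s - 0 \<le> \<Phi> w"
    proof (rule LIMSEQ_le[rotated])
      show "(\<lambda>n. s - 1 / real (Suc n)) \<longlonglongrightarrow> s - 0"
        by (intro tendsto_intros LIMSEQ_Suc[OF lim_1_over_n])
    qed (use v_lower in auto)
    then show ?thesis
      by simp
  qed
  have upper: "AE x in lborel. x \<in> \<Omega> \<longrightarrow> u x \<le> w x" if "u \<in> S" for u
  proof -
    note [measurable] = S_borel[OF that]
    \<comment> \<open>Each \<open>max u (v n)\<close> lies in \<open>S\<close>, so its value is at
      most \<open>s\<close>; the limit inherits this, and \<open>s \<le> \<Phi> w\<close> then
      forces \<open>max u w = w\<close> almost everywhere on \<open>\<Omega>\<close>.\<close>
    have "\<Phi> (\<lambda>x. max (u x) (w x)) \<le> s"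
      using s_upper[OF max[OF that vS]] by (intro LIMSEQ_le_const2[OF lim_\<Phi>]) auto
    then have le: "\<Phi> (\<lambda>x. max (u x) (w x)) - \<Phi> w \<le> 0"
      using s_le by simp
    let ?d = "\<lambda>x. \<rho> x * arctan (max (u x) (w x)) - \<rho> x * arctan (w x)"
    have d_int: "integrable lborel ?d"
      by (intro Bochner_Integration.integrable_diff arctan_int) measurable
    have d_nonneg: "0 \<le> ?d x" for x
      using \<rho>_nonneg[of x] by (auto intro!: mult_left_mono arctan_monotone')
    have "integral\<^sup>L lborel ?d = \<Phi> (\<lambda>x. max (u x) (w x)) - \<Phi> w"
      unfolding \<Phi>_def by (intro Bochner_Integration.integral_diff arctan_int) measurable
    moreover have "integral\<^sup>L lborel ?d \<ge> 0"
      by (intro Bochner_Integration.integral_nonneg d_nonneg)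
    ultimately have "integral\<^sup>L lborel ?d = 0"
      using le by linarith
    then have "AE x in lborel. ?d x = 0"
      using integral_nonneg_eq_0_iff_AE[OF d_int] d_nonneg by auto
    then show ?thesis
    proof eventually_elim
      case (elim x)
      show ?case
      proof
        assume "x \<in> \<Omega>"
        then have "arctan (max (u x) (w x)) = arctan (w x)"
          using elim \<rho>_pos[of x] by simp
        then show "u x \<le> w x"
          by (simp add: arctan_eq_iff max_def split: if_splits)
      qed
    qed
  qed
  show thesis
    by (rule that[OF vS v_Suc w_borel lim wL upper])
qed

text \<open>The distribution \<open>\<Delta>u - G\<close>: nonnegative on nonnegative test functions
  for a subsolution, zero for a solution.\<close>

definition defect :: "('a::euclidean_space \<Rightarrow> real) \<Rightarrow> ('a \<Rightarrow> real) \<Rightarrow> ('a \<Rightarrow> real) \<Rightarrow> real" where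
  "defect u G \<phi> = (\<integral>x. u x * laplacian \<phi> x \<partial>lborel) - (\<integral>x. G x * \<phi> x \<partial>lborel)"

section \<open>The defect of a subsolution and its potential\<close>

context
  fixes \<Omega> :: "'a::euclidean_space set" and u G :: "'a \<Rightarrow> real"
  assumes u: "sublap \<Omega> u G"
begin

lemma defect_add:
  assumes "test_fun \<Omega> \<phi>" "test_fun \<Omega> \<psi>"
  shows "defect u G (\<lambda>x. \<phi> x + \<psi> x) = defect u G \<phi> + defect u G \<psi>"
  using L1loc_test_integrable[OF sublapD(1)[OF u] test_fun_laplacian[OF assms(1)]]
    L1loc_test_integrable[OF sublapD(1)[OF u] test_fun_laplacian[OF assms(2)]]
    L1loc_test_integrable[OF sublapD(2)[OF u] assms(1)] L1loc_test_integrable[OF sublapD(2)[OF u] assms(2)]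
  by (simp add: defect_def laplacian_add test_fun_smooth[OF assms(1)] test_fun_smooth[OF assms(2)] distrib_left)

lemma defect_cmult: "test_fun \<Omega> \<phi> \<Longrightarrow> defect u G (\<lambda>x. c * \<phi> x) = c * defect u G \<phi>"
  by (simp add: defect_def laplacian_cmult[OF test_fun_smooth] mult.left_commute right_diff_distrib)

lemma defect_diff:
  assumes "test_fun \<Omega> \<phi>" "test_fun \<Omega> \<psi>"
  shows "defect u G (\<lambda>x. \<phi> x - \<psi> x) = defect u G \<phi> - defect u G \<psi>"
  using defect_add[OF assms(1) test_fun_cmult[OF assms(2), of "-1"]] defect_cmult[OF assms(2), of "-1"]
  by simp

lemma defect_nonneg:
  "test_fun \<Omega> \<phi> \<Longrightarrow> (\<And>x. 0 \<le> \<phi> x) \<Longrightarrow> 0 \<le> defect u G \<phi>"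
  using weak_subD[OF sublapD(3)[OF u]] by (simp add: defect_def)

lemma defect_mono:
  assumes "test_fun \<Omega> \<phi>" "test_fun \<Omega> \<psi>" "\<And>x. \<phi> x \<le> \<psi> x"
  shows "defect u G \<phi> \<le> defect u G \<psi>"
  using defect_nonneg[OF test_fun_diff[OF assms(2,1)]] assms(3) defect_diff[OF assms(2,1)] by simp

text \<open>The defect is a positive Radon measure; the function \<open>h\<close> below is the potential of its
  restriction to \<open>\<kappa>\<close> with respect to the kernel \<open>green_ker\<close>. Expanding the Laplacian of a product
  writes it in terms of \<open>u\<close> and \<open>G\<close>, without mention of the measure.\<close>

lemma defect_potential:
  assumes \<kappa>: "test_fun \<Omega> \<kappa>" "\<And>x. 0 \<le> \<kappa> x"
    and S: "compact S" "\<And>x. x \<notin> S \<Longrightarrow> \<kappa> x = 0" and "R > 0"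
  obtains h where "integrable lborel h" "\<And>x. 0 \<le> h x"
    "\<And>x. x \<notin> (\<Union>y\<in>S. cball y R) \<Longrightarrow> h x = 0"
    "\<And>\<phi>. test_fun UNIV \<phi> \<Longrightarrow>
      (\<integral>x. h x * \<phi> x \<partial>lborel) = defect u G (\<lambda>x. \<kappa> x * avg 1 (green_ker 0 R) \<phi> x)"
proof -
  let ?k = "green_ker 0 R :: real \<times> 'a \<Rightarrow> real"
  let ?w = "mean_ker 0 R :: real \<times> 'a \<Rightarrow> real"
  let ?d = "\<lambda>i. grad_ker 0 R i :: real \<times> 'a \<Rightarrow> real"
  note k = kernel_green_ker[OF \<open>R > 0\<close>, of 0] and w = kernel_mean_ker[OF \<open>R > 0\<close>, of 0] and d = kernel_grad_ker[OF \<open>R > 0\<close>, of 0]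
  note uL = sublapD(1)[OF u] and GL = sublapD(2)[OF u]
  define a where "a = (\<lambda>x. u x * \<kappa> x)"
  define b where "b = (\<lambda>i x. u x * dird i \<kappa> x)"
  define c where "c = (\<lambda>x. u x * laplacian \<kappa> x)"
  define e where "e = (\<lambda>x. G x * \<kappa> x)"
  have a: "integrable lborel a" and b: "integrable lborel (b i)" and c: "integrable lborel c"
    and e: "integrable lborel e" for i
    unfolding a_def b_def c_def e_def
    by (intro L1loc_test_integrable[OF uL] L1loc_test_integrable[OF GL] \<kappa> test_fun_dird test_fun_laplacian)+
  have supp: "x \<notin> S \<Longrightarrow> a x = 0" "x \<notin> S \<Longrightarrow> b i x = 0" "x \<notin> S \<Longrightarrow> c x = 0" "x \<notin> S \<Longrightarrow> e x = 0" for x i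
    using S(2) dird_eq_0[OF compact_imp_closed[OF S(1)] S(2)] laplacian_eq_0[OF compact_imp_closed[OF S(1)] S(2)]
    by (auto simp: a_def b_def c_def e_def)
  \<comment> \<open>With \<open>\<psi>\<close> the \<open>green_ker\<close> average of a test
    function, the Laplacian of \<open>\<kappa> * \<psi>\<close> is
    \<open>\<kappa> * \<Delta>\<psi>\<close> plus twice the product of the gradients plus
    \<open>\<psi> * \<Delta>\<kappa>\<close>. Here \<open>\<Delta>\<psi>\<close> is a
    \<open>mean_ker\<close> average minus the function itself and the gradient is a
    \<open>grad_ker\<close> average. Moving all of these operators to the factors \<open>a\<close>,
    \<open>b\<close>, \<open>c\<close>, \<open>e\<close> gives the terms of
    \<open>h0\<close>.\<close>
  define h0 where "h0 = (\<lambda>x. avg (-1) ?w a x - a x + 2 * (\<Sum>i\<in>Basis. avg (-1) (?d i) (b i) x)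
      + avg (-1) ?k c x - avg (-1) ?k e x)"
  note ints = avg_integrable[OF w a, of "-1"] a avg_integrable[OF d b, of "-1"]
    avg_integrable[OF k c, of "-1"] avg_integrable[OF k e, of "-1"]
  have h0_int: "integrable lborel h0"
    unfolding h0_def
    by (intro Bochner_Integration.integrable_diff Bochner_Integration.integrable_add
        integrable_mult_right Bochner_Integration.integrable_sum ints)
  have h0_supp: "h0 x = 0" if x: "x \<notin> (\<Union>y\<in>S. cball y R)" for x
  proof -
    have "x \<notin> S"
      using x \<open>R > 0\<close> by force
    moreover have "avg (-1) ?w a x = 0" "avg (-1) (?d i) (b i) x = 0" "avg (-1) ?k c x = 0" "avg (-1) ?k e x = 0" for i
      using avg_eq_0[OF w _ _ x, of "-1" a] avg_eq_0[OF d _ _ x, of "-1" "b i" i]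
        avg_eq_0[OF k _ _ x, of "-1" c] avg_eq_0[OF k _ _ x, of "-1" e] supp by auto
    ultimately show ?thesis
      by (simp add: h0_def supp)
  qed
  have h0_test: "(\<integral>x. h0 x * \<phi> x \<partial>lborel) = defect u G (\<lambda>x. \<kappa> x * avg 1 ?k \<phi> x)" if \<phi>: "test_fun UNIV \<phi>" for \<phi>
  proof -
    define \<psi> where "\<psi> = avg 1 ?k \<phi>"
    have \<psi>: "test_fun UNIV \<psi>" "smooth_fun \<psi>"
      unfolding \<psi>_def using test_fun_avg_UNIV[OF k _ \<phi>] smooth_fun_avg[OF k \<phi>] by auto
    have lap_\<psi>: "laplacian \<psi> x = avg 1 ?w \<phi> x - \<phi> x" for x
      unfolding \<psi>_def laplacian_avg[OF k \<phi>] using avg_mean_ker[OF \<open>R > 0\<close> \<phi>, of 0 x] by simp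
    have dird_\<psi>: "dird i \<psi> x = avg 1 (?d i) \<phi> x" for i x
      unfolding \<psi>_def dird_avg[OF k \<phi>] using avg_grad_ker[OF \<open>R > 0\<close> \<phi>, of 0 i x] by simp
    note test = \<phi> \<psi>(1) test_fun_avg_UNIV[OF w _ \<phi>, of 1] test_fun_avg_UNIV[OF d _ \<phi>, of 1]
    have i: "integrable lborel (\<lambda>x. a x * avg 1 ?w \<phi> x)" "integrable lborel (\<lambda>x. a x * \<phi> x)"
      "integrable lborel (\<lambda>x. b i x * avg 1 (?d i) \<phi> x)" "integrable lborel (\<lambda>x. c x * \<psi> x)"
      "integrable lborel (\<lambda>x. e x * \<psi> x)" for i
      using test by (auto intro!: integrable_mult_test a b c e)
    have "(\<integral>x. u x * laplacian (\<lambda>x. \<kappa> x * \<psi> x) x \<partial>lborel)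
        = (\<integral>x. a x * avg 1 ?w \<phi> x - a x * \<phi> x + 2 * (\<Sum>i\<in>Basis. b i x * avg 1 (?d i) \<phi> x) + c x * \<psi> x \<partial>lborel)"
      by (rule Bochner_Integration.integral_cong[OF refl])
        (simp add: laplacian_mult[OF test_fun_smooth[OF \<kappa>(1)] \<psi>(2)] lap_\<psi> dird_\<psi> a_def b_def c_def
          algebra_simps sum_distrib_left)
    also have "\<dots> = (\<integral>x. a x * avg 1 ?w \<phi> x \<partial>lborel) - (\<integral>x. a x * \<phi> x \<partial>lborel)
        + 2 * (\<Sum>i\<in>Basis. \<integral>x. b i x * avg 1 (?d i) \<phi> x \<partial>lborel) + (\<integral>x. c x * \<psi> x \<partial>lborel)"
      using i by (simp add: Bochner_Integration.integral_sum)
    finally have "defect u G (\<lambda>x. \<kappa> x * \<psi> x) = (\<integral>x. a x * avg 1 ?w \<phi> x \<partial>lborel) - (\<integral>x. a x * \<phi> x \<partial>lborel)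
        + 2 * (\<Sum>i\<in>Basis. \<integral>x. b i x * avg 1 (?d i) \<phi> x \<partial>lborel) + (\<integral>x. c x * \<psi> x \<partial>lborel)
        - (\<integral>x. e x * \<psi> x \<partial>lborel)"
      by (simp add: defect_def e_def mult.assoc)
    also have "\<dots> = (\<integral>x. avg (-1) ?w a x * \<phi> x \<partial>lborel) - (\<integral>x. a x * \<phi> x \<partial>lborel)
        + 2 * (\<Sum>i\<in>Basis. \<integral>x. avg (-1) (?d i) (b i) x * \<phi> x \<partial>lborel) + (\<integral>x. avg (-1) ?k c x * \<phi> x \<partial>lborel)
        - (\<integral>x. avg (-1) ?k e x * \<phi> x \<partial>lborel)"
      unfolding \<psi>_def
      by (simp add: avg_adjoint_test[OF w a \<phi>] avg_adjoint_test[OF d b \<phi>] avg_adjoint_test[OF k c \<phi>]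
          avg_adjoint_test[OF k e \<phi>])
    also have "\<dots> = (\<integral>x. h0 x * \<phi> x \<partial>lborel)"
    proof -
      note j = ints[THEN integrable_mult_test, OF \<phi>]
      have "(\<lambda>x. h0 x * \<phi> x) = (\<lambda>x. avg (-1) ?w a x * \<phi> x - a x * \<phi> x
          + 2 * (\<Sum>i\<in>Basis. avg (-1) (?d i) (b i) x * \<phi> x) + avg (-1) ?k c x * \<phi> x - avg (-1) ?k e x * \<phi> x)"
        by (simp add: h0_def fun_eq_iff algebra_simps sum_distrib_left sum_distrib_right)
      then show ?thesis
        using j by (simp add: Bochner_Integration.integral_sum)
    qed
    finally show ?thesis
      by (simp add: \<psi>_def)
  qed
  \<comment> \<open>Tested against a nonnegative function, \<open>h0\<close> gives the defect of a
    nonnegative test function. Replacing it by its positive part makes the sign hold everywhere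
    without changing an integral.\<close>
  have "AE x in lborel. x \<in> UNIV \<longrightarrow> 0 \<le> h0 x"
  proof (rule AE_nonneg_if_test_nonneg[OF h0_int open_UNIV])
    fix \<phi> :: "'a \<Rightarrow> real" assume \<phi>: "test_fun UNIV \<phi>" "\<And>x. 0 \<le> \<phi> x"
    have "0 \<le> defect u G (\<lambda>x. \<kappa> x * avg 1 ?k \<phi> x)"
      by (intro defect_nonneg test_fun_mult_right smooth_fun_avg[OF k \<phi>(1)] \<kappa> mult_nonneg_nonneg
          avg_nonneg green_ker_nonneg \<open>R > 0\<close> \<phi>(2))
    then show "0 \<le> (\<integral>x. h0 x * \<phi> x \<partial>lborel)"
      by (simp add: h0_test[OF \<phi>(1)])
  qed
  then have h0_AE: "AE x in lborel. max (h0 x) 0 = h0 x"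
    by eventually_elim auto
  have "h0 \<in> borel_measurable borel"
    using borel_measurable_integrable[OF h0_int] by simp
  then have "(\<integral>x. max (h0 x) 0 * \<phi> x \<partial>lborel) = (\<integral>x. h0 x * \<phi> x \<partial>lborel)" if "test_fun UNIV \<phi>" for \<phi>
    using h0_AE by (intro integral_test_AE_cong[OF that]) auto
  then show thesis
    using h0_int h0_supp h0_test by (intro that[of "\<lambda>x. max (h0 x) 0"]) auto
qed

text \<open>The last conclusion is the reason for perturbing: where maximality leaves no room for
  \<open>h\<close>, the defect vanishes on test functions that live where
  \<open>\<kappa> = 1\<close>.\<close>

lemma perturbation:
  assumes \<kappa>: "test_fun \<Omega> \<kappa>" "\<And>x. 0 \<le> \<kappa> x" "\<And>x. \<kappa> x \<le> 1" "test_fun B \<kappa>"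
    and "open B" and L: "L > 0"
  obtains h where "integrable lborel h" "\<And>x. 0 \<le> h x" "\<forall>x. x \<notin> B \<longrightarrow> h x = 0"
    "sublap \<Omega> (\<lambda>x. u x + h x) (\<lambda>x. G x + L * h x)"
    "\<forall>\<xi>. (AE x in lborel. h x = 0) \<longrightarrow> test_fun \<Omega> \<xi> \<longrightarrow> (\<forall>x. 0 \<le> \<xi> x) \<longrightarrow>
      (\<forall>x. \<xi> x \<noteq> 0 \<longrightarrow> \<kappa> x = 1) \<longrightarrow> defect u G \<xi> = 0"
proof -
  obtain S where S: "compact S" "S \<subseteq> B" "\<And>x. x \<notin> S \<Longrightarrow> \<kappa> x = 0"
    using \<kappa>(4) by (rule test_funE) blast
  obtain r where r: "r > 0" "(\<Union>x\<in>S. cball x r) \<subseteq> B"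
    using compact_inflate[OF S(1) \<open>open B\<close> S(2)] .
  \<comment> \<open>\<open>R \<le> r\<close> keeps the support of \<open>h\<close> in
    \<open>B\<close>; \<open>R \<le> 1\<close> and \<open>R \<le> 1 / L\<close> give
    \<open>L * (R\<^sup>2 / 2) \<le> 1\<close>, so that \<open>L * green_ker\<close> lies below
    \<open>mean_ker\<close>.\<close>
  define R where "R = min (min r 1) (1 / L)"
  have R: "R > 0" "R \<le> r" "R \<le> 1" "R \<le> 1 / L"
    using r(1) L by (auto simp: R_def)
  have LR: "L * (R\<^sup>2 / 2) \<le> 1"
  proof -
    have "R * R \<le> (1 / L) * 1"
      using R L by (intro mult_mono) auto
    then show ?thesis
      using L by (simp add: power2_eq_square field_simps)
  qed
  let ?k = "green_ker 0 R :: real \<times> 'a \<Rightarrow> real"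
  let ?w = "mean_ker 0 R :: real \<times> 'a \<Rightarrow> real"
  note k = kernel_green_ker[OF R(1), of 0] and w = kernel_mean_ker[OF R(1), of 0]
  obtain h where h: "integrable lborel h" "\<And>x. 0 \<le> h x" "\<And>x. x \<notin> (\<Union>y\<in>S. cball y R) \<Longrightarrow> h x = 0"
    "\<And>\<phi>. test_fun UNIV \<phi> \<Longrightarrow> (\<integral>x. h x * \<phi> x \<partial>lborel) = defect u G (\<lambda>x. \<kappa> x * avg 1 ?k \<phi> x)"
    using defect_potential[OF \<kappa>(1,2) S(1,3) R(1)] by blast
  show thesis
  proof (rule that[OF h(1,2)])
    have "(\<Union>y\<in>S. cball y R) \<subseteq> B"
      using r(2) R(2) by force
    then show "\<forall>x. x \<notin> B \<longrightarrow> h x = 0"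
      using h(3) by blast
    have hL: "L1loc \<Omega> h"
      by (rule integrable_imp_L1loc[OF h(1)])
    show "sublap \<Omega> (\<lambda>x. u x + h x) (\<lambda>x. G x + L * h x)"
      unfolding sublap_def weak_sub_def
    proof (intro conjI allI impI L1loc_add L1loc_cmult hL sublapD(1,2)[OF u])
      fix \<phi> assume \<phi>: "test_fun \<Omega> \<phi>" "\<forall>x. 0 \<le> \<phi> x"
      note \<phi>' = test_fun_mono[OF \<phi>(1) subset_UNIV]
      have t: "test_fun \<Omega> (\<lambda>x. \<kappa> x * avg 1 ?w \<phi> x)" "test_fun \<Omega> (\<lambda>x. \<kappa> x * avg 1 ?k \<phi> x)"
        "test_fun \<Omega> (\<lambda>x. \<kappa> x * \<phi> x)"
        using smooth_fun_avg[OF k \<phi>(1)] smooth_fun_avg[OF w \<phi>(1)] test_fun_smooth[OF \<phi>(1)] \<kappa>(1)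
        by (auto intro: test_fun_mult_right)
      have "(\<integral>x. h x * laplacian \<phi> x \<partial>lborel) = defect u G (\<lambda>x. \<kappa> x * avg 1 ?k (laplacian \<phi>) x)"
        by (rule h(4)[OF test_fun_laplacian[OF \<phi>']])
      also have "(\<lambda>x. \<kappa> x * avg 1 ?k (laplacian \<phi>) x) = (\<lambda>x. \<kappa> x * avg 1 ?w \<phi> x - \<kappa> x * \<phi> x)"
        using avg_mean_ker[OF R(1) \<phi>(1), of 0] by (simp add: fun_eq_iff right_diff_distrib[symmetric])
      finally have 1: "(\<integral>x. h x * laplacian \<phi> x \<partial>lborel)
          = defect u G (\<lambda>x. \<kappa> x * avg 1 ?w \<phi> x) - defect u G (\<lambda>x. \<kappa> x * \<phi> x)"
        by (simp add: defect_diff[OF t(1,3)])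
      \<comment> \<open>Because \<open>\<kappa> \<le> 1\<close>, the defect already present in
        \<open>u\<close> pays for the localised part that \<open>h\<close> removes.\<close>
      have 2: "defect u G (\<lambda>x. \<kappa> x * \<phi> x) \<le> defect u G \<phi>"
        using \<kappa>(3) \<phi>(2) by (intro defect_mono t \<phi>(1)) (simp add: mult_left_le_one_le \<kappa>(2))
      have 3: "L * defect u G (\<lambda>x. \<kappa> x * avg 1 ?k \<phi> x) \<le> defect u G (\<lambda>x. \<kappa> x * avg 1 ?w \<phi> x)"
      proof -
        have "L * (\<kappa> x * avg 1 ?k \<phi> x) \<le> \<kappa> x * avg 1 ?w \<phi> x" for x
        proof -
          have "L * avg 1 ?k \<phi> x \<le> L * (R\<^sup>2 / 2 * avg 1 ?w \<phi> x)"
            using L by (intro mult_left_mono avg_kernel_mono[OF k w \<phi>(1)] green_ker_le_mean_ker[OF R(1)]) (use \<phi>(2) in auto)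
          also have "\<dots> = (L * (R\<^sup>2 / 2)) * avg 1 ?w \<phi> x"
            by simp
          also have "\<dots> \<le> 1 * avg 1 ?w \<phi> x"
            by (intro mult_right_mono LR avg_nonneg mean_ker_nonneg[OF R(1)]) (use \<phi>(2) in auto)
          finally have "\<kappa> x * (L * avg 1 ?k \<phi> x) \<le> \<kappa> x * avg 1 ?w \<phi> x"
            by (intro mult_left_mono \<kappa>(2)) simp
          then show ?thesis
            by (simp add: mult.left_commute)
        qed
        from defect_mono[OF test_fun_cmult[OF t(2)] t(1) this] show ?thesis
          by (simp add: defect_cmult[OF t(2)])
      qed
      note int = L1loc_test_integrable[OF sublapD(2)[OF u] \<phi>(1)] L1loc_test_integrable[OF hL \<phi>(1)]
        L1loc_test_integrable[OF sublapD(1)[OF u] test_fun_laplacian[OF \<phi>(1)]]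
        L1loc_test_integrable[OF hL test_fun_laplacian[OF \<phi>(1)]]
      have "(\<integral>x. (G x + L * h x) * \<phi> x \<partial>lborel) = (\<integral>x. G x * \<phi> x \<partial>lborel) + L * (\<integral>x. h x * \<phi> x \<partial>lborel)"
        using int by (simp add: distrib_right mult.assoc)
      also have "\<dots> \<le> (\<integral>x. u x * laplacian \<phi> x \<partial>lborel) + (\<integral>x. h x * laplacian \<phi> x \<partial>lborel)"
        using 1 2 3 h(4)[OF \<phi>'] by (simp add: defect_def[of u G \<phi>])
      also have "\<dots> = (\<integral>x. (u x + h x) * laplacian \<phi> x \<partial>lborel)"
        using int by (simp add: distrib_right)
      finally show "(\<integral>x. (G x + L * h x) * \<phi> x \<partial>lborel) \<le> (\<integral>x. (u x + h x) * laplacian \<phi> x \<partial>lborel)" .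
    qed
    have "defect u G \<xi> = 0" if h0: "AE x in lborel. h x = 0"
      and \<xi>: "test_fun \<Omega> \<xi>" "\<And>x. 0 \<le> \<xi> x" "\<And>x. \<xi> x \<noteq> 0 \<Longrightarrow> \<kappa> x = 1" for \<xi>
    proof -
      obtain S' where S': "compact S'" "\<And>x. x \<notin> S' \<Longrightarrow> \<xi> x = 0"
        using \<xi>(1) by (rule test_funE) blast
      \<comment> \<open>With \<open>\<phi> = 1\<close> on the \<open>R\<close>-neighbourhood of
        \<open>S'\<close>, its average is the full mass of the kernel on \<open>S'\<close>. Hence
        \<open>\<xi>\<close> lies below a multiple of \<open>\<kappa>\<close> times this average,
        whose defect is the integral of \<open>h * \<phi>\<close>.\<close>
      obtain \<phi> where \<phi>: "test_fun UNIV \<phi>" "\<And>x. 0 \<le> \<phi> x" "\<And>x. x \<in> (\<Union>y\<in>S'. cball y R) \<Longrightarrow> \<phi> x = 1"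
        using test_fun_bump[OF compact_UN_cball[OF S'(1)] open_UNIV subset_UNIV] by metis
      obtain C where C: "C > 0" "\<And>x. \<bar>\<xi> x\<bar> \<le> C"
        using test_fun_bounded[OF \<xi>(1)] by blast
      have t: "test_fun \<Omega> (\<lambda>x. \<kappa> x * avg 1 ?k \<phi> x)"
        by (intro test_fun_mult_right smooth_fun_avg[OF k \<phi>(1)] \<kappa>(1))
      have "\<xi> x \<le> (C / mass ?k) * (\<kappa> x * avg 1 ?k \<phi> x)" for x
      proof (cases "\<xi> x = 0")
        case True
        then show ?thesis
          using C(1) integral_green_ker_pos[OF R(1), of 0, where 'a = 'a]
          by (auto intro!: mult_nonneg_nonneg divide_nonneg_nonneg avg_nonneg green_ker_nonneg R(1) \<phi>(2) \<kappa>(2))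
      next
        case False
        then have "x \<in> S'" "\<kappa> x = 1"
          using S'(2) \<xi>(3) by auto
        moreover have "avg 1 ?k \<phi> x = 1 * mass ?k"
          by (rule avg_const_local[OF k]) (use \<phi>(3) \<open>x \<in> S'\<close> in auto)
        ultimately show ?thesis
          using C(2)[of x] integral_green_ker_pos[OF R(1), of 0, where 'a = 'a] by simp
      qed
      from defect_mono[OF \<xi>(1) test_fun_cmult[OF t] this]
      have "defect u G \<xi> \<le> (C / mass ?k) * defect u G (\<lambda>x. \<kappa> x * avg 1 ?k \<phi> x)"
        unfolding defect_cmult[OF t] .
      also have "defect u G (\<lambda>x. \<kappa> x * avg 1 ?k \<phi> x) = (\<integral>x. h x * \<phi> x \<partial>lborel)"
        by (simp add: h(4)[OF \<phi>(1)])
      also have "\<dots> = 0"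
        by (rule integral_eq_zero_AE) (use h0 in \<open>eventually_elim, auto\<close>)
      finally show ?thesis
        using defect_nonneg[OF \<xi>(1,2)] by simp
    qed
    then show "\<forall>\<xi>. (AE x in lborel. h x = 0) \<longrightarrow> test_fun \<Omega> \<xi> \<longrightarrow> (\<forall>x. 0 \<le> \<xi> x) \<longrightarrow>
        (\<forall>x. \<xi> x \<noteq> 0 \<longrightarrow> \<kappa> x = 1) \<longrightarrow> defect u G \<xi> = 0"
      by blast
  qed
qed

end

subsection \<open>The Keller--Osserman barrier\<close>

context
  fixes g :: "real \<Rightarrow> real"
  assumes g_cont: "continuous_on UNIV g" and g_mono: "mono g" and g0: "g 0 \<ge> 0"
    and KO: "keller_osserman g"
begin

lemma g_nonneg: "t \<ge> 0 \<Longrightarrow> g t \<ge> 0"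
  using g0 monoD[OF g_mono, of 0 t] by simp

definition prim :: "real \<Rightarrow> real" where
  "prim t = integral {0..t} g"

lemma g_integrable_on: "g integrable_on {a..b}"
  by (intro integrable_continuous_interval continuous_on_subset[OF g_cont]) auto

lemma prim_mono: "0 \<le> s \<Longrightarrow> s \<le> t \<Longrightarrow> prim s \<le> prim t"
  unfolding prim_def by (intro integral_subset_le g_integrable_on) (auto intro: g_nonneg)

lemma prim_le: "0 \<le> t \<Longrightarrow> prim t \<le> t * g t"
proof -
  assume "0 \<le> t"
  have "prim t \<le> integral {0..t} (\<lambda>_. g t)"
    unfolding prim_def by (intro integral_le g_integrable_on) (auto intro: monoD[OF g_mono])
  then show ?thesis
    using \<open>0 \<le> t\<close> by simp
qed

lemma prim_has_derivative:
  assumes "t > 0"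
  shows "(prim has_real_derivative g t) (at t)"
proof -
  have "(prim has_real_derivative g t) (at t within {0..t+1})"
    unfolding prim_def[abs_def] using assms
    by (intro integral_has_real_derivative continuous_on_subset[OF g_cont]) auto
  then show ?thesis
    using assms by (simp add: at_within_Icc_at)
qed

lemma KO_finite: "a > 0 \<Longrightarrow> (\<integral>\<^sup>+ t. indicator {a..} t *
        (if prim t > 0 then ennreal (1 / sqrt (prim t)) else \<infinity>) \<partial>lborel) < \<infinity>"
  using KO unfolding keller_osserman_def prim_def by simp

text \<open>The integrand in \<open>keller_osserman\<close> is \<open>\<infinity>\<close> where the
  primitive is not positive. If that happened at \<open>t\<close>, it would happen on all of
  \<open>{t/2..t}\<close> and make the integral infinite.\<close>

lemma prim_pos: 
  assumes "t > 0"
  shows "prim t > 0"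
proof (rule ccontr)
  assume neg: "\<not> prim t > 0"
  have "(\<integral>\<^sup>+ s. \<infinity> * indicator {t/2..t} s \<partial>lborel)
      \<le> (\<integral>\<^sup>+ s. indicator {t/2..} s * (if prim s > 0 then ennreal (1 / sqrt (prim s)) else \<infinity>) \<partial>lborel)"
  proof (intro nn_integral_mono)
    fix s
    have "\<not> prim s > 0" if "t/2 \<le> s" "s \<le> t"
      using prim_mono[of s t] that neg assms by auto
    then show "\<infinity> * indicator {t/2..t} s
        \<le> indicator {t/2..} s * (if prim s > 0 then ennreal (1 / sqrt (prim s)) else \<infinity>)"
      by (auto simp: indicator_def)
  qed
  also have "\<dots> < \<infinity>"
    using KO_finite[of "t/2"] assms by simp
  finally have "(\<integral>\<^sup>+ s. \<infinity> * indicator {t/2..t} s \<partial>lborel) \<noteq> \<infinity>"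
    by (rule less_imp_neq)
  moreover have "(\<integral>\<^sup>+ s. \<infinity> * indicator {t/2..t} s \<partial>lborel) = \<infinity> * emeasure lborel {t/2..t}"
    by (rule nn_integral_cmult_indicator) simp
  moreover have "emeasure lborel {t/2..t} = ennreal (t/2)"
    using assms by simp
  ultimately show False
    using assms by (simp add: ennreal_top_mult)
qed

definition slope :: "real \<Rightarrow> real" where
  "slope t = 1 / sqrt (prim t)"

lemma slope_pos: "t > 0 \<Longrightarrow> slope t > 0"
  by (simp add: slope_def prim_pos)

lemma slope_antimono: "0 < s \<Longrightarrow> s \<le> t \<Longrightarrow> slope t \<le> slope s"
  using prim_pos[of s] prim_mono[of s t] unfolding slope_def
  by (intro divide_left_mono) auto

lemma slope_cont: "0 < a \<Longrightarrow> continuous_on {a..b} slope"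
proof -
  assume "0 < a"
  have "continuous_on {a..b} prim"
    by (intro DERIV_continuous_on[where D = g] has_field_derivative_at_within[OF prim_has_derivative])
      (use \<open>0 < a\<close> in auto)
  moreover have "sqrt (prim t) \<noteq> 0" if "t \<in> {a..b}" for t
    using prim_pos[of t] that \<open>0 < a\<close> by simp
  ultimately show ?thesis
    unfolding slope_def[abs_def] by (intro continuous_on_divide continuous_on_real_sqrt continuous_on_const) auto
qed

lemma slope_integrable_on: "0 < a \<Longrightarrow> slope integrable_on {a..b}"
  by (intro integrable_continuous_interval slope_cont)

lemma slope_integral_bound:
  assumes "a > 0"
  obtains J where "\<And>b. integral {a..b} slope \<le> J"
proof
  fix b
  let ?n = "\<integral>\<^sup>+ t. indicator {a..} t * (if prim t > 0 then ennreal (1 / sqrt (prim t)) else \<infinity>) \<partial>lborel"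
  have nonneg: "0 \<le> slope t" if "t \<in> {a..b}" for t
    using that assms slope_pos[of t] by auto
  have si: "set_integrable lborel {a..b} slope"
    by (rule borel_integrable_atLeastAtMost'[OF slope_cont[OF assms]])
  have "integral {a..b} slope = (\<integral>t. indicator {a..b} t * slope t \<partial>lborel)"
    using set_borel_integral_eq_integral(2)[OF si] by (simp add: set_lebesgue_integral_def)
  also have "ennreal \<dots> = (\<integral>\<^sup>+ t. ennreal (indicator {a..b} t * slope t) \<partial>lborel)"
    using si nonneg unfolding set_integrable_def
    by (intro nn_integral_eq_integral[symmetric]) (auto simp: indicator_def)
  also have "\<dots> \<le> ?n"
    using assms prim_pos by (intro nn_integral_mono) (auto simp: indicator_def slope_def)
  finally have "ennreal (integral {a..b} slope) \<le> ?n" .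
  moreover have "0 \<le> integral {a..b} slope"
    using nonneg by (intro Henstock_Kurzweil_Integration.integral_nonneg slope_integrable_on assms) auto
  ultimately show "integral {a..b} slope \<le> enn2real ?n"
    using KO_finite[OF assms] by (metis enn2real_ennreal enn2real_mono infinity_ennreal_def)
qed

lemma slope_integral_mono: "0 < a \<Longrightarrow> b \<le> c \<Longrightarrow> integral {a..b} slope \<le> integral {a..c} slope"
  by (intro integral_subset_le slope_integrable_on) (auto intro!: less_imp_le[OF slope_pos])

text \<open>The integral of \<open>slope\<close> over \<open>{t/2..t}\<close> is a piece of the tail
  of a bounded integral, hence below \<open>1/2\<close> for large \<open>t\<close>. As
  \<open>slope\<close> decreases, \<open>t / 2 * slope t < 1/2\<close>, which is
  \<open>t < sqrt (prim t)\<close>.\<close>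

lemma prim_ge_square: "\<exists>a>0. \<forall>t\<ge>a. t\<^sup>2 \<le> prim t"
proof -
  obtain J where J: "\<And>b. integral {1..b} slope \<le> J"
    using slope_integral_bound[of 1] by auto
  define s where "s = (SUP b. integral {1..b} slope)"
  have bdd: "bdd_above (range (\<lambda>b. integral {1..b} slope))"
    by (rule bdd_aboveI2[of _ _ J]) (rule J)
  obtain A where A: "s - 1/2 < integral {1..A} slope"
    using less_cSUP_iff[OF _ bdd, of "s - 1/2"] by (auto simp: s_def)
  have "t\<^sup>2 \<le> prim t" if "t \<ge> 2 * max A 1" for t
  proof -
    have t: "t \<ge> 2" "A \<le> t/2" "t > 0"
      using that by auto
    have "integral {1..t} slope \<le> s"
      unfolding s_def by (intro cSUP_upper bdd) auto
    moreover have "s - 1/2 < integral {1..t/2} slope"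
      using A slope_integral_mono[of 1 A "t/2"] t by simp
    moreover have "integral {1..t/2} slope + integral {t/2..t} slope = integral {1..t} slope"
      using t by (intro Henstock_Kurzweil_Integration.integral_combine slope_integrable_on) auto
    moreover have "integral {t/2..t} (\<lambda>_. slope t) \<le> integral {t/2..t} slope"
      using t by (intro integral_le slope_integrable_on) (auto intro: slope_antimono)
    ultimately have "(t/2) * slope t < 1/2"
      using t by simp
    then have "t < sqrt (prim t)"
      using prim_pos[OF t(3)] by (simp add: slope_def field_simps)
    then have "t\<^sup>2 < (sqrt (prim t))\<^sup>2"
      using t by (intro power_strict_mono) auto
    then show ?thesis
      using prim_pos[OF t(3)] by simp
  qed
  then show ?thesis
    by (intro exI[of _ "2 * max A 1"]) auto
qed

text \<open>\<open>\<theta>\<close> is the inverse of the tail integral of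
  \<open>1 / sqrt (prim t)\<close>. It satisfies \<open>\<theta>' = - sqrt (prim \<theta>)\<close>
  and hence \<open>\<theta>'' = g \<theta> / 2\<close>, and finiteness of the tail makes it blow up
  at the finite point \<open>s = 0\<close>. The other half of \<open>g \<theta>\<close> is kept to
  cover the constant \<open>c\<close>.\<close>

lemma KO_profile:
  obtains S \<theta> \<theta>1 \<theta>2 where "S > (0::real)"
    "\<And>s. 0 < s \<Longrightarrow> s < S \<Longrightarrow> (\<theta> has_real_derivative \<theta>1 s) (at s)"
    "\<And>s. 0 < s \<Longrightarrow> s < S \<Longrightarrow> (\<theta>1 has_real_derivative \<theta>2 s) (at s)"
    "\<And>s. 0 < s \<Longrightarrow> s < S \<Longrightarrow> isCont \<theta>2 s"
    "\<And>s. 0 < s \<Longrightarrow> s < S \<Longrightarrow> \<bar>\<theta>1 s\<bar> \<le> 2 * \<theta>2 s"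
    "\<And>s. 0 < s \<Longrightarrow> s < S \<Longrightarrow> \<theta>2 s + c \<le> g (\<theta> s)"
    "\<And>s. 0 < s \<Longrightarrow> s < S \<Longrightarrow> \<theta> s \<ge> 0"
    "\<And>M. \<exists>d>0. \<forall>s. 0 < s \<longrightarrow> s < d \<longrightarrow> \<theta> s > M"
proof -
  obtain a0 where a0: "a0 > 0" "\<And>t. t \<ge> a0 \<Longrightarrow> t\<^sup>2 \<le> prim t"
    using prim_ge_square by blast
  \<comment> \<open>Beyond \<open>a0\<close> the bound \<open>t\<^sup>2 \<le> prim t\<close> gives
    \<open>t \<le> g t\<close>; beyond \<open>2 * \<bar>c\<bar>\<close> this makes
    \<open>g t / 2\<close> at least \<open>c\<close>.\<close>
  define a where "a = max a0 (2 * \<bar>c\<bar>)"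
  have a: "a > 0" "a \<ge> a0" "a \<ge> 2 * \<bar>c\<bar>"
    using a0(1) by (auto simp: a_def)
  have gt: "t \<le> g t" "sqrt (prim t) \<le> g t" if "t \<ge> a" for t
  proof -
    have "t > 0" "t * t \<le> prim t" "prim t \<le> t * g t"
      using that a a0(2)[of t] prim_le[of t] by (auto simp: power2_eq_square)
    then have "t * t \<le> t * g t"
      by linarith
    then show *: "t \<le> g t"
      using \<open>t > 0\<close> by simp
    have "prim t \<le> g t * g t"
      using \<open>prim t \<le> t * g t\<close> * \<open>t > 0\<close> by (meson mult_right_mono order_trans less_imp_le)
    then show "sqrt (prim t) \<le> g t"
      using * \<open>t > 0\<close> by (intro real_le_lsqrt) (auto simp: power2_eq_square)
  qed
  \<comment> \<open>Starting at \<open>a / 2\<close> puts \<open>a\<close> into the interior of the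
    interval, so that \<open>I\<close> has a two-sided derivative there.\<close>
  define I where "I = (\<lambda>t. integral {a/2..t} slope)"
  have a2: "a / 2 > 0"
    using a(1) by simp
  have I_deriv: "(I has_real_derivative slope t) (at t)" if "t \<ge> a" for t
  proof -
    have "(I has_real_derivative slope t) (at t within {a/2..t+1})"
      unfolding I_def using that a(1) by (intro integral_has_real_derivative slope_cont a2) auto
    then show ?thesis
      using that a(1) by (simp add: at_within_Icc_at)
  qed
  have I_strict: "I s < I t" if "a \<le> s" "s < t" for s t
    by (rule DERIV_pos_imp_increasing[OF that(2)]) (use I_deriv slope_pos that a(1) in \<open>meson order_trans less_le_trans\<close>)
  have I_cont: "isCont I t" if "t \<ge> a" for t
    by (rule DERIV_isCont[OF I_deriv[OF that]])
  obtain J where J: "\<And>t. I t \<le> J"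
    using slope_integral_bound[OF a2] unfolding I_def by metis
  define Z where "Z = (SUP t\<in>{a..}. I t)"
  have bdd: "bdd_above (I ` {a..})"
    by (rule bdd_aboveI2[of _ _ J]) (rule J)
  have I_less: "I t < Z" if "t \<ge> a" for t
  proof -
    have "I t < I (t + 1)"
      using I_strict that by simp
    also have "\<dots> \<le> Z"
      unfolding Z_def using that by (intro cSUP_upper bdd) auto
    finally show ?thesis .
  qed
  \<comment> \<open>The integral of \<open>slope\<close> over \<open>{a..}\<close>, the length of
    the interval on which the profile lives.\<close>
  define S where "S = Z - I a"
  have ex: "\<exists>t>a. I t = Z - s" if s: "0 < s" "s < S" for s
  proof -
    obtain b where b: "b \<ge> a" "Z - s < I b"
      using less_cSUP_iff[OF _ bdd, of "Z - s"] s(1) by (auto simp: Z_def)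
    have "\<exists>t. a \<le> t \<and> t \<le> b \<and> I t = Z - s"
      using b s(2) I_cont by (intro IVT) (auto simp: S_def)
    then obtain t where "a \<le> t" "I t = Z - s"
      by blast
    moreover have "t \<noteq> a"
      using calculation s(2) by (auto simp: S_def)
    ultimately show ?thesis
      by (intro exI[of _ t]) auto
  qed
  define \<theta> where "\<theta> = (\<lambda>s. SOME t. t > a \<and> I t = Z - s)"
  have \<theta>: "\<theta> s > a" "I (\<theta> s) = Z - s" if "0 < s" "s < S" for s
    using someI_ex[OF ex[OF that], folded \<theta>_def] unfolding \<theta>_def by auto
  have \<theta>_I: "\<theta> (Z - I t) = t" if "t > a" for t
  proof -
    have "0 < Z - I t" "Z - I t < S"
      using I_less[of t] I_strict[of a t] that by (auto simp: S_def)
    note * = \<theta>[OF this]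
    then show ?thesis
      using I_strict[of t "\<theta> (Z - I t)"] I_strict[of "\<theta> (Z - I t)" t] that
      by (metis diff_diff_eq2 add_diff_cancel_left' linorder_neqE_linordered_idom less_imp_le order_less_irrefl)
  qed
  have \<theta>_cont: "isCont \<theta> s" if s: "0 < s" "s < S" for s
  proof -
    note t = \<theta>[OF s]
    have "isCont \<theta> (Z - I (\<theta> s))"
    proof (rule isCont_inverse_function[where f = "\<lambda>t. Z - I t" and d = "(\<theta> s - a) / 2"])
      show "0 < (\<theta> s - a) / 2"
        using t(1) by simp
      fix z assume "\<bar>z - \<theta> s\<bar> \<le> (\<theta> s - a) / 2"
      then have "z > a"
        using t(1) abs_ge_minus_self[of "z - \<theta> s"] by (simp add: field_simps)
      then show "\<theta> (Z - I z) = z" "isCont (\<lambda>t. Z - I t) z"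
        using \<theta>_I I_cont by (auto intro!: continuous_intros)
    qed
    then show ?thesis
      by (simp add: t(2))
  qed
  have \<theta>_deriv: "(\<theta> has_real_derivative - sqrt (prim (\<theta> s))) (at s)" if s: "0 < s" "s < S" for s
  proof -
    note t = \<theta>[OF s]
    have pos: "prim (\<theta> s) > 0"
      using t(1) a(1) by (intro prim_pos) auto
    have "(\<theta> has_real_derivative inverse (0 - slope (\<theta> s))) (at s)"
    proof (rule DERIV_inverse_function[where f = "\<lambda>t. Z - I t" and a = 0 and b = S])
      show "((\<lambda>t. Z - I t) has_real_derivative 0 - slope (\<theta> s)) (at (\<theta> s))"
        by (intro DERIV_diff DERIV_const I_deriv) (use t in auto)
      show "Z - I (\<theta> y) = y" if "0 < y" "y < S" for y
        using \<theta>(2)[OF that] by simp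
      show "0 - slope (\<theta> s) \<noteq> 0"
        using slope_pos[of "\<theta> s"] t(1) a(1) by auto
    qed (use s \<theta>_cont[OF s] in auto)
    then show ?thesis
      by (simp add: slope_def)
  qed
  show thesis
  proof (rule that[of S \<theta> "\<lambda>s. - sqrt (prim (\<theta> s))" "\<lambda>s. g (\<theta> s) / 2"])
    show "S > 0"
      using I_less[of a] by (simp add: S_def)
    fix s assume s: "0 < s" "s < S"
    note t = \<theta>[OF s]
    have pos: "prim (\<theta> s) > 0" "\<theta> s > 0"
      using t(1) a(1) by (auto intro!: prim_pos)
    show "(\<theta> has_real_derivative - sqrt (prim (\<theta> s))) (at s)"
      by (rule \<theta>_deriv[OF s])
    have "((\<lambda>s. prim (\<theta> s)) has_real_derivative g (\<theta> s) * - sqrt (prim (\<theta> s))) (at s)"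
      by (rule DERIV_chain2[OF prim_has_derivative[OF pos(2)] \<theta>_deriv[OF s]])
    from DERIV_minus[OF DERIV_chain2[OF DERIV_real_sqrt[OF pos(1)] this]]
    show "((\<lambda>s. - sqrt (prim (\<theta> s))) has_real_derivative g (\<theta> s) / 2) (at s)"
      using pos(1) by (simp add: field_simps)
    have "isCont g (\<theta> s)"
      using g_cont by (simp add: continuous_on_eq_continuous_at)
    then show "isCont (\<lambda>s. g (\<theta> s) / 2) s"
      using \<theta>_cont[OF s] by (intro continuous_intros isCont_o2[of s \<theta> g]) auto
    show "\<bar>- sqrt (prim (\<theta> s))\<bar> \<le> 2 * (g (\<theta> s) / 2)"
      using gt(2)[of "\<theta> s"] t(1) pos by simp
    show "g (\<theta> s) / 2 + c \<le> g (\<theta> s)"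
      using gt(1)[of "\<theta> s"] t(1) a(3) by simp
    show "\<theta> s \<ge> 0"
      using pos by simp
  next
    fix M
    define b where "b = max M a + 1"
    have b: "b > a" "b > M"
      by (auto simp: b_def)
    have "\<theta> s > M" if "0 < s" "s < min S (Z - I b)" for s
    proof -
      note t = \<theta>[of s]
      have "I b < I (\<theta> s)"
        using that t by auto
      then have "\<not> \<theta> s \<le> b"
        using I_strict[of "\<theta> s" b] that t b(1) by (metis less_imp_le min_less_iff_conj not_less order_le_less order_less_asym)
      then show ?thesis
        using b(2) by simp
    qed
    moreover have "min S (Z - I b) > 0"
      using I_less[of b] I_less[of a] b(1) by (simp add: S_def)
    ultimately show "\<exists>d>0. \<forall>s. 0 < s \<longrightarrow> s < d \<longrightarrow> \<theta> s > M"
      by blast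
  qed
qed

end

section \<open>A barrier that blows up on the boundary of a ball\<close>

lemma L1loc_continuous_on:
  assumes "u \<in> borel_measurable borel" "continuous_on B u"
  shows "L1loc B u"
  unfolding L1loc_def
  using assms(1) borel_integrable_compact[OF _ continuous_on_subset[OF assms(2)]] by auto

text \<open>Both integrations by parts are done at once:
  \<open>U * dird i \<phi> - U' i * \<phi>\<close> has compact support, its derivative in direction
  \<open>i\<close> has integral zero, and the mixed terms cancel.\<close>

lemma integral_classical_laplacian:
  fixes U :: "'a::euclidean_space \<Rightarrow> real"
  assumes "open B"
    and U: "\<And>x. x \<in> B \<Longrightarrow> (U has_derivative U' x) (at x)"
    and V: "\<And>x i. x \<in> B \<Longrightarrow> i \<in> Basis \<Longrightarrow> ((\<lambda>x. U' x i) has_derivative V i x) (at x)"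
    and V_cont: "\<And>i. i \<in> Basis \<Longrightarrow> continuous_on B (\<lambda>x. V i x i)"
    and \<phi>: "test_fun B \<phi>"
  shows "(\<integral>x. U x * laplacian \<phi> x \<partial>lborel) = (\<integral>x. (\<Sum>i\<in>Basis. V i x i) * \<phi> x \<partial>lborel)"
proof -
  obtain K where K: "smooth_fun \<phi>" "compact K" "K \<subseteq> B" "\<And>x. x \<notin> K \<Longrightarrow> \<phi> x = 0"
    using \<phi> by (rule test_funE) blast
  note Kc = compact_imp_closed[OF K(2)]
  have d0: "dird v \<phi> x = 0" "dird v (dird i \<phi>) x = 0" if "x \<notin> K" for x v i
    using dird_eq_0[OF Kc K(4) that] dird_eq_0[OF Kc dird_eq_0[OF Kc K(4)] that] by auto
  have U_cont: "continuous_on B U"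
    using U by (intro continuous_at_imp_continuous_on) (auto intro: has_derivative_continuous)
  have int: "integrable lborel (\<lambda>x. a x * b x)"
    if "continuous_on B a" "smooth_fun b" "\<And>x. x \<notin> K \<Longrightarrow> b x = 0" for a b
  proof -
    have "integrable lborel (\<lambda>x. indicator K x *\<^sub>R (a x * b x))"
      by (intro borel_integrable_compact K(2) continuous_on_mult smooth_fun_continuous that(2)
          continuous_on_subset[OF that(1) K(3)])
    also have "(\<lambda>x. indicator K x *\<^sub>R (a x * b x)) = (\<lambda>x. a x * b x)"
      using that(3) by (auto simp: indicator_def fun_eq_iff)
    finally show ?thesis .
  qed
  have eq: "(\<integral>x. U x * dird i (dird i \<phi>) x \<partial>lborel) = (\<integral>x. V i x i * \<phi> x \<partial>lborel)" if i: "i \<in> Basis" for i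
  proof -
    let ?\<psi> = "\<lambda>x. U x * dird i \<phi> x - U' x i * \<phi> x"
    let ?F = "\<lambda>x h. (U x * dird h (dird i \<phi>) x + U' x h * dird i \<phi> x)
        - (U' x i * dird h \<phi> x + V i x h * \<phi> x)"
    \<comment> \<open>Nothing is known about \<open>U\<close> off \<open>B\<close>, but there
      \<open>\<phi>\<close> vanishes in a neighbourhood of each point and the derivative is
      \<open>0\<close>.\<close>
    define D where "D = (\<lambda>x h. if x \<in> B then ?F x h else 0)"
    have "integral\<^sup>L lborel (\<lambda>x. D x i) = 0"
    proof (rule integral_derivative_eq_0[where \<psi> = ?\<psi> and D = D and K = K])
      show "(?\<psi> has_derivative D x) (at x)" for x
      proof (cases "x \<in> B")
        case True
        have "(?\<psi> has_derivative ?F x) (at x)"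
          by (intro has_derivative_diff has_derivative_mult U V i True smooth_fun_has_derivative
              smooth_fun_dird K(1))
        then show ?thesis
          using True by (simp add: D_def)
      next
        case False
        have "(?\<psi> has_derivative (\<lambda>h. 0)) (at x)"
        proof (rule has_derivative_transform_within_open[OF has_derivative_const[of 0]])
          show "open (- K)" "x \<in> - K"
            using Kc False K(3) by auto
        qed (simp add: d0 K(4))
        then show ?thesis
          using False by (simp add: D_def)
      qed
      have "continuous_on (B \<union> - K) (\<lambda>x. D x i)"
      proof (rule continuous_on_open_Un)
        have "continuous_on B (\<lambda>x. U x * dird i (dird i \<phi>) x - V i x i * \<phi> x)"
          by (intro continuous_intros U_cont V_cont i smooth_fun_continuous smooth_fun_dird K(1))
        then show "continuous_on B (\<lambda>x. D x i)"
          by (rule continuous_on_eq) (simp add: D_def)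
        show "continuous_on (- K) (\<lambda>x. D x i)"
          by (rule continuous_on_eq[OF continuous_on_const[of _ 0]]) (simp add: D_def d0 K(4))
      qed (use \<open>open B\<close> Kc in auto)
      moreover have "B \<union> - K = UNIV"
        using K(3) by auto
      ultimately show "continuous_on UNIV (\<lambda>x. D x i)"
        by simp
    qed (use K(2,4) d0 in auto)
    moreover have "(\<lambda>x. D x i) = (\<lambda>x. U x * dird i (dird i \<phi>) x - V i x i * \<phi> x)"
      using d0 K(3,4) by (fastforce simp: D_def fun_eq_iff)
    moreover have "integrable lborel (\<lambda>x. U x * dird i (dird i \<phi>) x)" "integrable lborel (\<lambda>x. V i x i * \<phi> x)"
      using int[OF U_cont smooth_fun_dird[OF smooth_fun_dird[OF K(1)]] d0(2)] int[OF V_cont[OF i] K(1) K(4)] by auto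
    ultimately show ?thesis
      by simp
  qed
  have "(\<integral>x. U x * laplacian \<phi> x \<partial>lborel) = (\<Sum>i\<in>Basis. \<integral>x. U x * dird i (dird i \<phi>) x \<partial>lborel)"
    unfolding laplacian_dird sum_distrib_left
    by (intro Bochner_Integration.integral_sum int[OF U_cont] smooth_fun_dird K(1) d0(2))
  also have "\<dots> = (\<Sum>i\<in>Basis. \<integral>x. V i x i * \<phi> x \<partial>lborel)"
    by (intro sum.cong refl eq)
  also have "\<dots> = (\<integral>x. (\<Sum>i\<in>Basis. V i x i) * \<phi> x \<partial>lborel)"
    unfolding sum_distrib_right
    by (intro Bochner_Integration.integral_sum[symmetric] int[OF V_cont] K(1,4))
  finally show ?thesis .
qed

text \<open>\<open>\<sigma>\<close> is positive in the ball and zero on its boundary, so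
  \<open>\<theta> (\<sigma> x)\<close> blows up there. As
  \<open>\<bar>\<theta>1\<bar> \<le> 2 * \<theta>2\<close>, the Laplacian is at most
  \<open>(4 * (l * R)\<^sup>2 + 4 * (l * N)) * \<theta>2\<close>, and a small \<open>l\<close>
  brings the factor below \<open>1\<close>.\<close>

lemma KO_barrier:
  fixes x0 :: "'a::euclidean_space"
  assumes g_cont: "continuous_on UNIV g" and "mono g" "g 0 \<ge> 0" "keller_osserman g" and "R > 0"
  obtains U where "sublap (ball x0 R) (\<lambda>x. - U x) (\<lambda>x. c - g (U x))" "\<And>x. U x \<ge> 0"
    "\<And>M. \<exists>r<R. \<forall>x\<in>ball x0 R. r < dist x0 x \<longrightarrow> M < U x"
proof -
  obtain S \<theta> \<theta>1 \<theta>2 where S: "S > (0::real)"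
    and \<theta>: "\<And>s. 0 < s \<Longrightarrow> s < S \<Longrightarrow> (\<theta> has_real_derivative \<theta>1 s) (at s)"
    and \<theta>1: "\<And>s. 0 < s \<Longrightarrow> s < S \<Longrightarrow> (\<theta>1 has_real_derivative \<theta>2 s) (at s)"
    and \<theta>2: "\<And>s. 0 < s \<Longrightarrow> s < S \<Longrightarrow> isCont \<theta>2 s"
    and le: "\<And>s. 0 < s \<Longrightarrow> s < S \<Longrightarrow> \<bar>\<theta>1 s\<bar> \<le> 2 * \<theta>2 s"
    and gle: "\<And>s. 0 < s \<Longrightarrow> s < S \<Longrightarrow> \<theta>2 s + c \<le> g (\<theta> s)"
    and nonneg: "\<And>s. 0 < s \<Longrightarrow> s < S \<Longrightarrow> \<theta> s \<ge> 0"
    and blowup: "\<And>M. \<exists>d>0. \<forall>s. 0 < s \<longrightarrow> s < d \<longrightarrow> \<theta> s > M"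
    using KO_profile[OF assms(1-4), of c] by blast
  define B where "B = ball x0 R"
  define N where "N = real DIM('a)"
  have N: "N > 0"
    by (simp add: N_def)
  \<comment> \<open>The three bounds keep \<open>\<sigma>\<close> below \<open>S\<close> and make
    the two parts of the factor at most \<open>1/4\<close> and \<open>1/2\<close>.\<close>
  define l where "l = min (min (S / (2 * R\<^sup>2)) (1 / (4 * R))) (1 / (8 * N))"
  have l: "l > 0" "l * R\<^sup>2 < S" "l * R \<le> 1/4" "l * N \<le> 1/8"
  proof -
    show "l > 0"
      using S \<open>R > 0\<close> N by (simp add: l_def)
    have "l \<le> S / (2 * R\<^sup>2)" "l \<le> 1 / (4 * R)" "l \<le> 1 / (8 * N)"
      by (auto simp: l_def)
    then have "l * (2 * R\<^sup>2) \<le> S" "l * (4 * R) \<le> 1" "l * (8 * N) \<le> 1"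
      using \<open>R > 0\<close> N by (simp_all add: pos_le_divide_eq)
    then show "l * R\<^sup>2 < S" "l * R \<le> 1/4" "l * N \<le> 1/8"
      using S by auto
  qed
  define \<sigma> where "\<sigma> = (\<lambda>x. l * (R\<^sup>2 - (x - x0) \<bullet> (x - x0)))"
  have \<sigma>: "0 < \<sigma> x" "\<sigma> x < S" if "x \<in> B" for x
  proof -
    have "(norm (x - x0))\<^sup>2 < R\<^sup>2"
      using that \<open>R > 0\<close> by (intro power_strict_mono) (auto simp: B_def dist_norm norm_minus_commute)
    then show "0 < \<sigma> x"
      using l(1) by (simp add: \<sigma>_def dot_square_norm)
    have "\<sigma> x \<le> l * R\<^sup>2"
      using l(1) by (simp add: \<sigma>_def)
    then show "\<sigma> x < S"
      using l(2) by simp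
  qed
  have \<sigma>_deriv: "(\<sigma> has_derivative (\<lambda>h. - (2 * l * ((x - x0) \<bullet> h)))) (at x)" for x
    unfolding \<sigma>_def by (auto intro!: derivative_eq_intros simp: inner_commute algebra_simps)
  define U where "U = (\<lambda>x. if x \<in> B then \<theta> (\<sigma> x) else 0)"
  define U' where "U' = (\<lambda>x h. - (2 * l * ((x - x0) \<bullet> h)) * \<theta>1 (\<sigma> x))"
  define V where "V = (\<lambda>i x h. - (2 * l * ((x - x0) \<bullet> i)) * (- (2 * l * ((x - x0) \<bullet> h)) * \<theta>2 (\<sigma> x))
      + - (2 * l * (h \<bullet> i)) * \<theta>1 (\<sigma> x))"
  have openB: "open B"
    by (simp add: B_def)
  have U: "(U has_derivative U' x) (at x)" if "x \<in> B" for x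
  proof -
    have "((\<lambda>x. \<theta> (\<sigma> x)) has_derivative U' x) (at x)"
      using DERIV_compose_FDERIV[OF \<theta>[OF \<sigma>[OF that]] \<sigma>_deriv] by (simp add: U'_def)
    then show ?thesis
      by (rule has_derivative_transform_within_open[OF _ openB that]) (simp add: U_def)
  qed
  have V: "((\<lambda>x. U' x i) has_derivative V i x) (at x)" if "x \<in> B" for x i
  proof -
    have "((\<lambda>x. - (2 * l * ((x - x0) \<bullet> i))) has_derivative (\<lambda>h. - (2 * l * (h \<bullet> i)))) (at x)"
      by (auto intro!: derivative_eq_intros)
    from has_derivative_mult[OF this DERIV_compose_FDERIV[OF \<theta>1[OF \<sigma>[OF that]] \<sigma>_deriv]]
    show ?thesis
      by (simp add: U'_def V_def)
  qed
  have \<sigma>_cont: "continuous_on B \<sigma>"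
    unfolding \<sigma>_def by (intro continuous_intros)
  have cont: "continuous_on B (\<lambda>x. h (\<sigma> x))" if "\<And>s. 0 < s \<Longrightarrow> s < S \<Longrightarrow> isCont h s" for h
    by (rule continuous_on_compose2[OF _ \<sigma>_cont, of "{0<..<S}"])
      (use that \<sigma> in \<open>auto simp: continuous_on_eq_continuous_at\<close>)
  have V_cont: "continuous_on B (\<lambda>x. V i x i)" for i
    unfolding V_def by (intro continuous_intros cont \<theta>2 DERIV_isCont[OF \<theta>1])
  have U_cont: "continuous_on B U"
    using U by (intro continuous_at_imp_continuous_on) (auto intro: has_derivative_continuous)
  have [measurable]: "U \<in> borel_measurable borel"
  proof -
    have "(\<lambda>x. indicator B x *\<^sub>R U x) \<in> borel_measurable borel"
      by (rule borel_measurable_continuous_on_indicator[OF _ U_cont]) (simp add: openB)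
    also have "(\<lambda>x. indicator B x *\<^sub>R U x) = U"
      by (auto simp: U_def indicator_def fun_eq_iff)
    finally show ?thesis .
  qed
  have [measurable]: "g \<in> borel_measurable borel"
    by (rule borel_measurable_continuous_onI[OF g_cont])
  have gU: "L1loc B (\<lambda>x. c - g (U x))"
    by (intro L1loc_continuous_on continuous_intros continuous_on_compose2[OF g_cont U_cont]) auto
  have lap: "(\<Sum>i\<in>Basis. V i x i) \<le> g (U x) - c" if "x \<in> B" for x
  proof -
    note s = \<sigma>[OF that]
    have "\<theta>2 (\<sigma> x) \<ge> 0"
      using le[OF s] by linarith
    have "(\<Sum>i\<in>Basis. V i x i) = (\<Sum>i\<in>Basis. (4 * l\<^sup>2 * \<theta>2 (\<sigma> x)) * (((x - x0) \<bullet> i) * ((x - x0) \<bullet> i)) - 2 * l * \<theta>1 (\<sigma> x))"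
      by (intro sum.cong refl) (simp add: V_def power2_eq_square inner_same_Basis algebra_simps)
    also have "\<dots> = (4 * l\<^sup>2 * \<theta>2 (\<sigma> x)) * ((x - x0) \<bullet> (x - x0)) - N * (2 * l * \<theta>1 (\<sigma> x))"
      by (subst euclidean_inner[of "x - x0" "x - x0"]) (simp add: sum_subtractf sum_distrib_left N_def)
    also have "\<dots> \<le> (4 * l\<^sup>2 * \<theta>2 (\<sigma> x)) * R\<^sup>2 + N * (2 * l * (2 * \<theta>2 (\<sigma> x)))"
    proof -
      have "(x - x0) \<bullet> (x - x0) \<le> R\<^sup>2"
        using s(1) l(1) by (simp add: \<sigma>_def zero_less_mult_iff)
      then have "(4 * l\<^sup>2 * \<theta>2 (\<sigma> x)) * ((x - x0) \<bullet> (x - x0)) \<le> (4 * l\<^sup>2 * \<theta>2 (\<sigma> x)) * R\<^sup>2"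
        using \<open>\<theta>2 (\<sigma> x) \<ge> 0\<close> by (intro mult_left_mono) auto
      moreover have "N * (2 * l * - \<theta>1 (\<sigma> x)) \<le> N * (2 * l * (2 * \<theta>2 (\<sigma> x)))"
        using le[OF s] N l(1) by (intro mult_left_mono) auto
      ultimately show ?thesis
        by simp
    qed
    also have "\<dots> = (4 * (l * R)\<^sup>2 + 4 * (l * N)) * \<theta>2 (\<sigma> x)"
      by (simp add: power_mult_distrib algebra_simps)
    also have "\<dots> \<le> 1 * \<theta>2 (\<sigma> x)"
    proof (rule mult_right_mono[OF _ \<open>\<theta>2 (\<sigma> x) \<ge> 0\<close>])
      have "(l * R)\<^sup>2 \<le> (1/4)\<^sup>2"
        using l(1,3) \<open>R > 0\<close> by (intro power_mono) auto
      then show "4 * (l * R)\<^sup>2 + 4 * (l * N) \<le> 1"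
        using l(4) by (simp add: power2_eq_square)
    qed
    also have "\<dots> \<le> g (U x) - c"
      using gle[OF s] that by (simp add: U_def)
    finally show ?thesis .
  qed
  show thesis
  proof (rule that[of U, folded B_def])
    show "sublap B (\<lambda>x. - U x) (\<lambda>x. c - g (U x))"
      unfolding sublap_def weak_sub_def
    proof (intro conjI allI impI gU)
      show "L1loc B (\<lambda>x. - U x)"
        by (intro L1loc_continuous_on continuous_intros U_cont) measurable
      fix \<phi> assume \<phi>: "test_fun B \<phi>" "\<forall>x. 0 \<le> \<phi> x"
      have VL: "L1loc B (\<lambda>x. indicator B x * (\<Sum>i\<in>Basis. V i x i))"
      proof (rule L1loc_continuous_on)
        have c: "continuous_on B (\<lambda>x. \<Sum>i\<in>Basis. V i x i)"
          by (intro continuous_on_sum V_cont)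
        show "continuous_on B (\<lambda>x. indicator B x * (\<Sum>i\<in>Basis. V i x i))"
          by (rule continuous_on_eq[OF c]) simp
        show "(\<lambda>x. indicator B x * (\<Sum>i\<in>Basis. V i x i)) \<in> borel_measurable borel"
          using borel_measurable_continuous_on_indicator[OF _ c] openB by simp
      qed
      have "(\<integral>x. U x * laplacian \<phi> x \<partial>lborel) = (\<integral>x. (\<Sum>i\<in>Basis. V i x i) * \<phi> x \<partial>lborel)"
        by (rule integral_classical_laplacian[OF openB U V V_cont \<phi>(1)])
      also have "\<dots> = (\<integral>x. (indicator B x * (\<Sum>i\<in>Basis. V i x i)) * \<phi> x \<partial>lborel)"
        using integral_test_cut[OF \<phi>(1), of B "\<lambda>x. \<Sum>i\<in>Basis. V i x i"] by simp
      also have "\<dots> \<le> (\<integral>x. - ((c - g (U x)) * \<phi> x) \<partial>lborel)"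
      proof (rule integral_mono)
        show "integrable lborel (\<lambda>x. (indicator B x * (\<Sum>i\<in>Basis. V i x i)) * \<phi> x)"
          by (rule L1loc_test_integrable[OF VL \<phi>(1)])
        show "integrable lborel (\<lambda>x. - ((c - g (U x)) * \<phi> x))"
          using L1loc_test_integrable[OF gU \<phi>(1)] by simp
        fix x
        show "indicator B x * (\<Sum>i\<in>Basis. V i x i) * \<phi> x \<le> - ((c - g (U x)) * \<phi> x)"
        proof (cases "x \<in> B")
          case True
          have "(\<Sum>i\<in>Basis. V i x i) * \<phi> x \<le> (g (U x) - c) * \<phi> x"
            using lap[OF True] \<phi>(2) by (intro mult_right_mono) auto
          then show ?thesis
            using True by (simp add: algebra_simps)
        next
          case False
          then show ?thesis
            using test_fun_eq_0[OF \<phi>(1)] by simp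
        qed
      qed
      finally show "(\<integral>x. (c - g (U x)) * \<phi> x \<partial>lborel) \<le> (\<integral>x. - U x * laplacian \<phi> x \<partial>lborel)"
        by simp
    qed
    show "U x \<ge> 0" for x
      using nonneg \<sigma> by (simp add: U_def)
    fix M
    obtain d where d: "d > 0" "\<And>s. 0 < s \<Longrightarrow> s < d \<Longrightarrow> \<theta> s > M"
      using blowup by blast
    define r where "r = sqrt (max 0 (R\<^sup>2 - d / l))"
    have "r < R"
    proof -
      have "max 0 (R\<^sup>2 - d / l) < R\<^sup>2"
        using d(1) l(1) \<open>R > 0\<close> by simp
      then have "r < sqrt (R\<^sup>2)"
        unfolding r_def by (rule real_sqrt_less_mono)
      then show ?thesis
        using \<open>R > 0\<close> by simp
    qed
    moreover have "M < U x" if "x \<in> B" "r < dist x0 x" for x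
    proof -
      have "r\<^sup>2 < (norm (x - x0))\<^sup>2"
        using that(2) by (intro power_strict_mono) (auto simp: r_def dist_norm norm_minus_commute)
      then have "R\<^sup>2 - d / l < (norm (x - x0))\<^sup>2"
        by (simp add: r_def)
      then have "R\<^sup>2 - (norm (x - x0))\<^sup>2 < d / l"
        by simp
      then have "\<sigma> x < d"
        using l(1) by (simp add: \<sigma>_def dot_square_norm pos_less_divide_eq mult.commute)
      then show ?thesis
        using d(2)[OF \<sigma>(1)[OF that(1)]] that(1) by (simp add: U_def)
    qed
    ultimately show "\<exists>r<R. \<forall>x\<in>B. r < dist x0 x \<longrightarrow> M < U x"
      by blast
  qed
qed

text \<open>For \<open>m = DIM('a)\<close> the radial weight cancels the Jacobian
  \<open>t ^ DIM('a)\<close> of \<open>y \<mapsto> x + (s * t) *\<^sub>R y\<close>, so at every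
  radius the integral over \<open>y\<close> is at most a constant times the integral of
  \<open>u\<close>.\<close>

lemma avg_mean_ker_bounded:
  fixes u :: "'a::euclidean_space \<Rightarrow> real"
  assumes "R > 0"
  obtains C where "C \<ge> 0" "\<And>u x s. integrable lborel u \<Longrightarrow> (\<And>x::'a. 0 \<le> u x) \<Longrightarrow> \<bar>s\<bar> = 1 \<Longrightarrow>
    avg s (mean_ker DIM('a) R) u x \<le> C * integral\<^sup>L lborel u"
proof -
  define N where "N = DIM('a)"
  obtain E where E: "E > 0" "\<And>y::'a. \<bar>eta y\<bar> \<le> E"
    using test_fun_bounded[OF test_fun_eta] by blast
  define A where "A = real (Suc N) / R ^ Suc N * E"
  have A: "A \<ge> 0"
    using assms E(1) by (simp add: A_def)
  have "avg s (mean_ker N R) u x \<le> (R * A) * integral\<^sup>L lborel u"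
    if u: "integrable lborel u" and u0: "\<And>x. 0 \<le> u x" and s: "\<bar>s\<bar> = 1" for u :: "'a \<Rightarrow> real" and x s
  proof -
    have [measurable]: "u \<in> borel_measurable borel"
      using borel_measurable_integrable[OF u] by simp
    let ?U = "integral\<^sup>L lborel u"
    have U0: "?U \<ge> 0"
      by (intro Bochner_Integration.integral_nonneg u0)
    let ?f = "\<lambda>p. mean_ker N R p * u (x + (s * fst p) *\<^sub>R snd p)"
    have f_borel: "?f \<in> borel_measurable borel"
      by (rule avg_integrand_borel[OF kernel_borel[OF kernel_mean_ker[OF assms]]]) measurable
    have inner: "(\<integral>\<^sup>+ y. ennreal (?f (t, y)) \<partial>lborel) \<le> indicator {0..R} t * ennreal (A * ?U)" for t
    proof (cases "0 < t \<and> t \<le> R")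
      case True
      then have "s * t \<noteq> 0" "\<bar>s * t\<bar> = t"
        using s by (auto simp: abs_mult)
      have "(\<integral>\<^sup>+ y. ennreal (u y) \<partial>lborel)
          = (\<integral>\<^sup>+ y. ennreal (u y) \<partial>(density (distr lborel borel (\<lambda>y. x + (s * t) *\<^sub>R y)) (\<lambda>_. \<bar>s * t\<bar> ^ DIM('a))))"
        using lborel_affine[OF \<open>s * t \<noteq> 0\<close>, of x] by simp
      also have "\<dots> = ennreal (t ^ N) * (\<integral>\<^sup>+ y. ennreal (u (x + (s * t) *\<^sub>R y)) \<partial>lborel)"
        using \<open>\<bar>s * t\<bar> = t\<close> by (simp add: nn_integral_density nn_integral_distr nn_integral_cmult N_def)
      finally have scale: "ennreal (t ^ N) * (\<integral>\<^sup>+ y. ennreal (u (x + (s * t) *\<^sub>R y)) \<partial>lborel) = ennreal ?U"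
        using nn_integral_eq_integral[OF u] u0 by simp
      have "(\<integral>\<^sup>+ y. ennreal (?f (t, y)) \<partial>lborel)
          \<le> (\<integral>\<^sup>+ y. ennreal A * (ennreal (t ^ N) * ennreal (u (x + (s * t) *\<^sub>R y))) \<partial>lborel)"
      proof (intro nn_integral_mono)
        fix y
        have "?f (t, y) = (real (Suc N) / R ^ Suc N * eta y) * (t ^ N * u (x + (s * t) *\<^sub>R y))"
          using True by (simp add: mean_ker_def wprod_def del: power_Suc of_nat_Suc)
        also have "\<dots> \<le> A * (t ^ N * u (x + (s * t) *\<^sub>R y))"
          unfolding A_def using True assms E(2)[of y] u0
          by (intro mult_right_mono mult_left_mono) (auto simp del: power_Suc of_nat_Suc)
        finally have "ennreal (?f (t, y)) \<le> ennreal (A * (t ^ N * u (x + (s * t) *\<^sub>R y)))"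
          by (rule ennreal_leI)
        also have "\<dots> = ennreal A * (ennreal (t ^ N) * ennreal (u (x + (s * t) *\<^sub>R y)))"
          using A True u0 by (simp add: ennreal_mult)
        finally show "ennreal (?f (t, y)) \<le> ennreal A * (ennreal (t ^ N) * ennreal (u (x + (s * t) *\<^sub>R y)))" .
      qed
      also have "\<dots> = ennreal A * (ennreal (t ^ N) * (\<integral>\<^sup>+ y. ennreal (u (x + (s * t) *\<^sub>R y)) \<partial>lborel))"
        by (simp add: nn_integral_cmult)
      also have "\<dots> = ennreal (A * ?U)"
        using A U0 by (simp add: scale ennreal_mult)
      finally show ?thesis
        using True by simp
    next
      case False
      then have "(mean_ker N R :: real \<times> 'a \<Rightarrow> real) (t, y) = 0" for y
        by (auto simp: mean_ker_def wprod_def N_def indicator_def not_less)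
      then show ?thesis
        by simp
    qed
    have "(\<integral>\<^sup>+ p. ennreal (?f p) \<partial>lborel) = (\<integral>\<^sup>+ t. (\<integral>\<^sup>+ y. ennreal (?f (t, y)) \<partial>lborel) \<partial>lborel)"
      using lborel.nn_integral_fst[of "\<lambda>p. ennreal (?f p)" lborel] f_borel
      by (simp add: lborel_prod)
    also have "\<dots> \<le> (\<integral>\<^sup>+ t. ennreal (A * ?U) * indicator {0..R} t \<partial>lborel)"
      using inner by (intro nn_integral_mono) (simp add: mult.commute)
    also have "\<dots> = ennreal (A * ?U) * ennreal R"
      using assms by (simp add: nn_integral_cmult_indicator)
    also have "\<dots> = ennreal (R * A * ?U)"
      using A U0 assms by (simp add: ennreal_mult mult_ac)
    finally have "enn2real (\<integral>\<^sup>+ p. ennreal (?f p) \<partial>lborel) \<le> R * A * ?U"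
      using A U0 assms by (intro enn2real_leI) auto
    then show ?thesis
      unfolding avg_def
      using f_borel
      by (subst integral_eq_nn_integral) (auto intro!: AE_I2 mult_nonneg_nonneg mean_ker_nonneg assms u0)
  qed
  then show thesis
    using A assms by (intro that[of "R * A"]) (auto simp: N_def)
qed

text \<open>With the bounded kernel the mean value inequality becomes a pointwise bound by the
  integral of \<open>\<bar>u\<bar>\<close> over a neighbourhood; the constant lower bound on the
  Laplacian costs at most \<open>\<bar>b\<bar>\<close> times the mass of
  \<open>green_ker\<close>.\<close>

lemma subharmonic_bounded_above:
  fixes u :: "'a::euclidean_space \<Rightarrow> real"
  assumes u: "sublap \<Omega> u (\<lambda>_. - b)" and K: "compact K" "K \<subseteq> \<Omega>" and "open \<Omega>"
  obtains m where "AE x in lborel. x \<in> K \<longrightarrow> u x \<le> m"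
proof -
  obtain r where r: "r > 0" "(\<Union>x\<in>K. cball x r) \<subseteq> \<Omega>"
    using compact_inflate[OF K(1) \<open>open \<Omega>\<close> K(2)] .
  define K' where "K' = (\<Union>x\<in>K. cball x r)"
  define O1 where "O1 = (\<Union>x\<in>K. ball x r)"
  define O2 where "O2 = (\<Union>x\<in>K. ball x (r/2))"
  have K': "compact K'" "K' \<subseteq> \<Omega>" "O1 \<subseteq> K'" "K \<subseteq> O2" "open O2"
    using compact_UN_cball[OF K(1), of r] r unfolding K'_def O1_def O2_def by (auto intro!: UN_mono)
  have O2: "(\<Union>x\<in>O2. cball x (r/4)) \<subseteq> O1"
  proof
    fix z assume "z \<in> (\<Union>x\<in>O2. cball x (r/4))"
    then obtain x y where "x \<in> K" "dist x y < r/2" "dist y z \<le> r/4"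
      by (auto simp: O2_def)
    moreover from this have "dist x z < r"
      using dist_triangle[of x z y] r(1) by linarith
    ultimately show "z \<in> O1"
      by (auto simp: O1_def)
  qed
  define v where "v = (\<lambda>x. indicator K' x * u x)"
  define F where "F = (\<lambda>x. indicator K' x * - b)"
  have v: "integrable lborel v" and F: "integrable lborel F"
    unfolding v_def F_def by (intro L1loc_cut[OF sublapD(1)[OF u] K'(1,2)] L1loc_cut[OF sublapD(2)[OF u] K'(1,2)])+
  have sub: "weak_sub O1 v F"
    unfolding v_def F_def by (rule weak_sub_cut[OF K'(3) _ sublapD(3)[OF u]]) (use K' in auto)
  let ?k = "green_ker DIM('a) (r/4) :: real \<times> 'a \<Rightarrow> real"
  let ?w = "mean_ker DIM('a) (r/4) :: real \<times> 'a \<Rightarrow> real"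
  have r4: "r/4 > 0"
    using r(1) by simp
  obtain C where C: "\<And>u x s. integrable lborel u \<Longrightarrow> (\<And>x::'a. 0 \<le> u x) \<Longrightarrow> \<bar>s\<bar> = 1 \<Longrightarrow>
      avg s ?w u x \<le> C * integral\<^sup>L lborel u"
    using avg_mean_ker_bounded[OF r4, where 'a = 'a] by metis
  define m where "m = C * (\<integral>x. \<bar>v x\<bar> \<partial>lborel) + \<bar>b\<bar> * mass ?k"
  have "AE x in lborel. x \<in> O2 \<longrightarrow> v x + avg (-1) ?k F x \<le> avg (-1) ?w v x"
    by (rule weak_mean_inequality[OF v F sub r4 K'(5) O2])
  moreover have "AE x in lborel. avg (-1) ?w v x \<le> avg (-1) ?w (\<lambda>x. \<bar>v x\<bar>) x"
    by (rule avg_mono_AE[OF kernel_mean_ker[OF r4] mean_ker_nonneg[OF r4] v]) (use v in auto)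
  moreover have "AE x in lborel. integrable lborel (\<lambda>p. ?k p * F (x + (- 1 * fst p) *\<^sub>R snd p))"
    by (rule avg_AE_integrable[OF kernel_green_ker[OF r4] F])
  ultimately have "AE x in lborel. x \<in> K \<longrightarrow> u x \<le> m"
  proof eventually_elim
    case (elim x)
    show ?case
    proof
      assume "x \<in> K"
      have "(\<integral>p. ?k p * - \<bar>b\<bar> \<partial>lborel) \<le> avg (-1) ?k F x"
        unfolding avg_def
        using elim(3) kernel_integrable[OF kernel_green_ker[OF r4], of "DIM('a)", where 'a = 'a] green_ker_nonneg[OF r4]
        by (intro integral_mono mult_left_mono) (auto simp: F_def indicator_def)
      then have "- (\<bar>b\<bar> * mass ?k) \<le> avg (-1) ?k F x"
        by (simp add: mult.commute)
      moreover have "avg (-1) ?w (\<lambda>x. \<bar>v x\<bar>) x \<le> C * (\<integral>x. \<bar>v x\<bar> \<partial>lborel)"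
        by (rule C) (use v in auto)
      moreover have "x \<in> O2" "x \<in> K'"
        using \<open>x \<in> K\<close> K'(4) r(1) by (auto simp: K'_def intro!: bexI[of _ x])
      ultimately show "u x \<le> m"
        using elim(1,2) by (simp add: m_def v_def)
    qed
  qed
  then show thesis
    by (rule that)
qed

text \<open>\<open>\<psi>\<close> and \<open>H\<close> are the \<open>green_ker\<close> and
  \<open>mean_ker\<close> averages of \<open>F\<close> at radius \<open>1\<close>, and the mean
  value formula reads \<open>\<Delta>\<psi> = H - F\<close>. So \<open>\<psi>\<close> is a potential
  of \<open>F\<close> up to an error bounded above, enough for a comparison.\<close>

lemma local_potential:
  fixes F :: "'a::euclidean_space \<Rightarrow> real"
  assumes F: "integrable lborel F" "\<And>x. 0 \<le> F x"
  obtains \<psi> H b where "integrable lborel \<psi>" "\<And>x. 0 \<le> \<psi> x" "integrable lborel H" "\<And>x. H x \<le> b"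
    "sublap UNIV (\<lambda>x. - \<psi> x) (\<lambda>x. F x - H x)"
proof -
  let ?k = "green_ker DIM('a) 1 :: real \<times> 'a \<Rightarrow> real"
  let ?w = "mean_ker DIM('a) 1 :: real \<times> 'a \<Rightarrow> real"
  have one: "(1::real) > 0"
    by simp
  note k = kernel_green_ker[OF one, of "DIM('a)"] and w = kernel_mean_ker[OF one, of "DIM('a)"]
  obtain C where C: "\<And>u x s. integrable lborel u \<Longrightarrow> (\<And>x::'a. 0 \<le> u x) \<Longrightarrow> \<bar>s\<bar> = 1 \<Longrightarrow>
      avg s ?w u x \<le> C * integral\<^sup>L lborel u"
    using avg_mean_ker_bounded[OF one, where 'a = 'a] by metis
  have int: "integrable lborel (avg (-1) ?k F)" "integrable lborel (avg (-1) ?w F)"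
    by (intro avg_integrable[OF k] avg_integrable[OF w] F(1))+
  show thesis
  proof (rule that[OF int(1) avg_nonneg[OF green_ker_nonneg[OF one] F(2)] int(2), of "C * integral\<^sup>L lborel F"])
    show "avg (-1) ?w F x \<le> C * integral\<^sup>L lborel F" for x
      by (rule C[OF F]) auto
    show "sublap UNIV (\<lambda>x. - avg (-1) ?k F x) (\<lambda>x. F x - avg (-1) ?w F x)"
      unfolding sublap_def weak_sub_def
    proof (intro conjI allI impI integrable_imp_L1loc Bochner_Integration.integrable_diff Bochner_Integration.integrable_minus int F(1))
      fix \<phi> :: "'a \<Rightarrow> real" assume \<phi>: "test_fun UNIV \<phi>" "\<forall>x. 0 \<le> \<phi> x"
      note lap = test_fun_laplacian[OF \<phi>(1)]
      have "(\<integral>x. avg (-1) ?k F x * laplacian \<phi> x \<partial>lborel) = (\<integral>x. F x * avg 1 ?k (laplacian \<phi>) x \<partial>lborel)"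
        by (simp add: avg_adjoint_test[OF k F(1) lap])
      also have "\<dots> = (\<integral>x. F x * avg 1 ?w \<phi> x - F x * \<phi> x \<partial>lborel)"
        by (simp add: avg_mean_ker[OF one \<phi>(1)] right_diff_distrib[symmetric])
      also have "\<dots> = (\<integral>x. F x * avg 1 ?w \<phi> x \<partial>lborel) - (\<integral>x. F x * \<phi> x \<partial>lborel)"
        by (intro Bochner_Integration.integral_diff integrable_mult_test[OF F(1) \<phi>(1)]
            integrable_mult_test[OF F(1) test_fun_avg_UNIV[OF w _ \<phi>(1)]]) auto
      also have "(\<integral>x. F x * avg 1 ?w \<phi> x \<partial>lborel) = (\<integral>x. avg (-1) ?w F x * \<phi> x \<partial>lborel)"
        by (simp add: avg_adjoint_test[OF w F(1) \<phi>(1)])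
      finally show "(\<integral>x. (F x - avg (-1) ?w F x) * \<phi> x \<partial>lborel) \<le> (\<integral>x. - avg (-1) ?k F x * laplacian \<phi> x \<partial>lborel)"
        using integrable_mult_test[OF F(1) \<phi>(1)] integrable_mult_test[OF int(2) \<phi>(1)]
        by (simp add: left_diff_distrib)
    qed
  qed
qed

lemma laplacian_cong_open:
  assumes "open U" "x \<in> U" "\<And>y. y \<in> U \<Longrightarrow> \<phi> y = \<psi> y" "smooth_fun \<phi>" "smooth_fun \<psi>"
  shows "laplacian \<phi> x = laplacian \<psi> x"
proof -
  have "laplacian (\<lambda>y. \<phi> y - \<psi> y) x = 0"
    by (rule laplacian_eq_0[of "- U"]) (use assms in auto)
  then show ?thesis
    by (simp add: laplacian_diff[OF assms(4,5)])
qed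

text \<open>Tested against a cut-off of \<open>R\<^sup>2 - (norm (x - x0))\<^sup>2\<close>, whose
  Laplacian is the constant \<open>- 2 * DIM('a)\<close> on the support of \<open>D\<close>,
  subharmonicity makes the integral of the nonnegative \<open>D\<close> nonpositive.\<close>

lemma compactly_supported_subharmonic:
  fixes D :: "'a::euclidean_space \<Rightarrow> real"
  assumes D: "sublap (ball x0 R) D (\<lambda>_. 0)" "\<And>x. 0 \<le> D x" and "r < R"
    and supp: "AE x in lborel. x \<in> ball x0 R \<longrightarrow> r < dist x0 x \<longrightarrow> D x = 0"
  shows "AE x in lborel. x \<in> ball x0 R \<longrightarrow> D x = 0"
proof -
  \<comment> \<open>The cut-off has to be \<open>1\<close> on an open set containing all points of
    the ball within distance \<open>r\<close>, so that its derivatives do not enter.\<close>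
  define r1 where "r1 = (r + R) / 2"
  have r1: "r < r1" "r1 < R"
    using \<open>r < R\<close> by (auto simp: r1_def)
  have "cball x0 r1 \<subseteq> ball x0 R"
    using r1 by auto
  then obtain \<kappa> where \<kappa>: "test_fun (ball x0 R) \<kappa>" "\<And>x. 0 \<le> \<kappa> x" "\<And>x. x \<in> cball x0 r1 \<Longrightarrow> \<kappa> x = 1"
    using test_fun_bump[OF compact_cball open_ball, of x0 r1 x0 R] by metis
  define q where "q = (\<lambda>x. R\<^sup>2 - (norm (x - x0))\<^sup>2)"
  have q: "smooth_fun q"
    unfolding q_def by (intro smooth_fun_diff smooth_fun_const smooth_fun_norm_diff_sq)
  define \<phi> where "\<phi> = (\<lambda>x. q x * \<kappa> x)"
  have \<phi>: "test_fun (ball x0 R) \<phi>"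
    unfolding \<phi>_def by (rule test_fun_mult[OF q \<kappa>(1)])
  have \<phi>0: "0 \<le> \<phi> x" for x
  proof (cases "x \<in> ball x0 R")
    case True
    then have "(norm (x - x0))\<^sup>2 \<le> R\<^sup>2"
      by (intro power_mono) (auto simp: dist_norm norm_minus_commute)
    then show ?thesis
      using \<kappa>(2) by (simp add: \<phi>_def q_def)
  qed (use test_fun_eq_0[OF \<phi>] in simp)
  have lap: "laplacian \<phi> x = - (2 * real DIM('a))" if "x \<in> ball x0 r1" for x
  proof -
    have "laplacian \<phi> x = laplacian q x"
      by (rule laplacian_cong_open[of "ball x0 r1"]) (use that \<kappa>(3) test_fun_smooth[OF \<phi>] q in \<open>auto simp: \<phi>_def\<close>)
    also have "laplacian q = (\<lambda>x. laplacian (\<lambda>_. R\<^sup>2) x - 2 * real DIM('a))"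
      unfolding q_def by (subst laplacian_diff) (simp_all add: smooth_fun_const smooth_fun_norm_diff_sq laplacian_norm_sq)
    finally show ?thesis
      by (simp add: laplacian_dird dird_const)
  qed
  have "(\<integral>x. 0 * \<phi> x \<partial>lborel) \<le> (\<integral>x. D x * laplacian \<phi> x \<partial>lborel)"
    by (rule weak_subD[OF sublapD(3)[OF D(1)] \<phi> \<phi>0])
  then have "0 \<le> (\<integral>x. D x * laplacian \<phi> x \<partial>lborel)"
    by simp
  also have "(\<integral>x. D x * laplacian \<phi> x \<partial>lborel) = (\<integral>x. - (2 * real DIM('a)) * (indicator (cball x0 r1) x * D x) \<partial>lborel)"
  proof (rule integral_cong_AE)
    have [measurable]: "D \<in> borel_measurable borel" "laplacian \<phi> \<in> borel_measurable borel"
      using L1loc_borel[OF sublapD(1)[OF D(1)]] test_fun_borel[OF test_fun_laplacian[OF \<phi>]] by auto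
    show "(\<lambda>x. D x * laplacian \<phi> x) \<in> borel_measurable lborel"
      by measurable
    show "(\<lambda>x. - (2 * real DIM('a)) * (indicator (cball x0 r1) x * D x)) \<in> borel_measurable lborel"
      by (intro borel_measurable_times borel_measurable_const borel_measurable_indicator) auto
    show "AE x in lborel. D x * laplacian \<phi> x = - (2 * real DIM('a)) * (indicator (cball x0 r1) x * D x)"
      using supp
    proof eventually_elim
      case (elim x)
      consider "x \<in> ball x0 r1" | "x \<in> ball x0 R" "x \<notin> ball x0 r1" | "x \<notin> ball x0 R"
        by blast
      then show ?case
      proof cases
        case 1
        then show ?thesis
          by (simp add: lap)
      next
        case 2
        then have "D x = 0"
          using elim r1 by simp
        then show ?thesis
          by simp
      next
        case 3
        then show ?thesis
          using test_fun_eq_0[OF test_fun_laplacian[OF \<phi>], of x] r1 by (simp add: indicator_def)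
      qed
    qed
  qed
  finally have le: "(\<integral>x. indicator (cball x0 r1) x * D x \<partial>lborel) \<le> 0"
    by (simp add: mult_le_0_iff)
  have int: "integrable lborel (\<lambda>x. indicator (cball x0 r1) x * D x)"
    by (rule L1loc_cut[OF sublapD(1)[OF D(1)]]) (use r1 in auto)
  moreover have "(\<integral>x. indicator (cball x0 r1) x * D x \<partial>lborel) \<ge> 0"
    using D(2) by (intro Bochner_Integration.integral_nonneg) simp
  ultimately have "(\<integral>x. indicator (cball x0 r1) x * D x \<partial>lborel) = 0"
    using le by linarith
  then have "AE x in lborel. indicator (cball x0 r1) x * D x = 0"
    using D(2) by (subst (asm) integral_nonneg_eq_0_iff_AE[OF int]) auto
  with supp show ?thesis
    by eventually_elim (use r1 in \<open>auto simp: indicator_def split: if_splits\<close>)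
qed

section \<open>Local bounds common to all subsolutions\<close>

context
  fixes g :: "real \<Rightarrow> real"
  assumes g_cont: "continuous_on UNIV g" and g_mono: "mono g" and g0: "g 0 \<ge> 0"
    and KO: "keller_osserman g"
begin

text \<open>The twofold ball gives room to bound \<open>u - \<psi>\<close> from above in the smaller
  one. The barrier then exceeds it near the boundary, so the positive part of
  \<open>u - \<psi> - U\<close> is subharmonic and vanishes there, hence vanishes
  throughout.\<close>

lemma KO_ball_bound:
  fixes f :: "'a::euclidean_space \<Rightarrow> real"
  assumes "R > 0" "cball x0 (2 * R) \<subseteq> \<Omega>" "open \<Omega>" and f: "L1loc \<Omega> f" "\<And>x. 0 \<le> f x"
  obtains \<Psi> where "L1loc (ball x0 R) \<Psi>"
    "\<And>u. sublap \<Omega> u (\<lambda>x. g (u x) - f x) \<Longrightarrow> AE x in lborel. x \<in> ball x0 R \<longrightarrow> u x \<le> \<Psi> x"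
proof -
  define F where "F = (\<lambda>x. indicator (cball x0 (2 * R)) x * f x)"
  have F: "integrable lborel F" "\<And>x. 0 \<le> F x"
    unfolding F_def by (rule L1loc_cut[OF f(1)]) (use assms f in auto)
  obtain \<psi> H b where \<psi>: "integrable lborel \<psi>" "\<And>x. 0 \<le> \<psi> x" "integrable lborel H" "\<And>x. H x \<le> b"
    "sublap UNIV (\<lambda>x. - \<psi> x) (\<lambda>x. F x - H x)"
    using local_potential[OF F] by metis
  \<comment> \<open>The constant \<open>b\<close> in the barrier absorbs the error \<open>H\<close>
    left by the potential.\<close>
  obtain U where U: "sublap (ball x0 R) (\<lambda>x. - U x) (\<lambda>x. b - g (U x))" "\<And>x. U x \<ge> 0"
    "\<And>M. \<exists>r<R. \<forall>x\<in>ball x0 R. r < dist x0 x \<longrightarrow> M < U x"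
    using KO_barrier[OF g_cont g_mono g0 KO \<open>R > 0\<close>, of x0 b] by metis
  have [measurable]: "g \<in> borel_measurable borel"
    by (rule borel_measurable_continuous_onI[OF g_cont])
  have B2: "ball x0 (2 * R) \<subseteq> \<Omega>" "ball x0 R \<subseteq> \<Omega>"
    using assms(1,2) by (auto intro: order_trans[OF _ assms(2)] simp: subset_iff)
  have UL: "L1loc (ball x0 R) U"
    using L1loc_cmult[OF sublapD(1)[OF U(1)], of "-1"] by simp
  show thesis
  proof (rule that[of "\<lambda>x. \<psi> x + U x"])
    show "L1loc (ball x0 R) (\<lambda>x. \<psi> x + U x)"
      by (intro L1loc_add integrable_imp_L1loc \<psi>(1) UL)
    fix u assume u: "sublap \<Omega> u (\<lambda>x. g (u x) - f x)"
    have [measurable]: "u \<in> borel_measurable borel" "f \<in> borel_measurable borel"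
      by (rule L1loc_borel[OF sublapD(1)[OF u]], rule L1loc_borel[OF f(1)])
    have guL: "L1loc \<Omega> (\<lambda>x. g (u x))"
      using L1loc_add[OF sublapD(2)[OF u] f(1)] by simp
    \<comment> \<open>Passing to the positive part removes the region where \<open>g (u x)\<close>
      may be negative; what remains is bounded below by \<open>- f\<close>.\<close>
    have "sublap \<Omega> (\<lambda>x. max (u x) 0) (\<lambda>x. if 0 \<le> u x then g (u x) - f x else 0)"
      by (rule Kato[OF u sublap_const \<open>open \<Omega>\<close>])
    then have "sublap \<Omega> (\<lambda>x. max (u x) 0) (\<lambda>x. - f x)"
    proof (rule sublap_mono_rhs)
      show "L1loc \<Omega> (\<lambda>x. - f x)"
        using L1loc_cmult[OF f(1), of "-1"] by simp
      have "0 \<le> g t" if "0 \<le> t" for t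
        using g0 monoD[OF g_mono that] by simp
      then show "AE x in lborel. x \<in> \<Omega> \<longrightarrow> - f x \<le> (if 0 \<le> u x then g (u x) - f x else 0)"
        using f(2) by auto
    qed
    from sublap_add[OF sublap_subset[OF this B2(1)] sublap_subset[OF \<psi>(5) subset_UNIV]]
    have "sublap (ball x0 (2 * R)) (\<lambda>x. max (u x) 0 + - \<psi> x) (\<lambda>x. - f x + (F x - H x))" .
    then have "sublap (ball x0 (2 * R)) (\<lambda>x. max (u x) 0 + - \<psi> x) (\<lambda>x. - b)"
    proof (rule sublap_mono_rhs)
      show "AE x in lborel. x \<in> ball x0 (2 * R) \<longrightarrow> - b \<le> - f x + (F x - H x)"
        using \<psi>(4) by (auto simp: F_def)
    qed (rule L1loc_const)
    moreover have "cball x0 R \<subseteq> ball x0 (2 * R)"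
      using \<open>R > 0\<close> by auto
    \<comment> \<open>\<open>m\<close>, and with it the radius \<open>r\<close> below, depends on
      \<open>u\<close>; the final bound \<open>\<psi> + U\<close> does not.\<close>
    ultimately obtain m where m: "AE x in lborel. x \<in> cball x0 R \<longrightarrow> max (u x) 0 + - \<psi> x \<le> m"
      using subharmonic_bounded_above[OF _ compact_cball _ open_ball] by blast
    obtain r where r: "r < R" "\<And>x. x \<in> ball x0 R \<Longrightarrow> r < dist x0 x \<Longrightarrow> m < U x"
      using U(3) by blast
    define d where "d = (\<lambda>x. u x + (- \<psi> x + - U x))"
    have "sublap (ball x0 R) d (\<lambda>x. g (u x) - f x + ((F x - H x) + (b - g (U x))))"
      unfolding d_def
      by (intro sublap_add sublap_subset[OF u B2(2)] sublap_subset[OF \<psi>(5) subset_UNIV] U(1))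
    from Kato[OF this sublap_const[of _ 0] open_ball]
    have "sublap (ball x0 R) (\<lambda>x. max (d x) 0)
        (\<lambda>x. if 0 \<le> d x then g (u x) - f x + ((F x - H x) + (b - g (U x))) else 0)" .
    then have D: "sublap (ball x0 R) (\<lambda>x. max (d x) 0) (\<lambda>_. 0)"
    proof (rule sublap_mono_rhs)
      show "AE x in lborel. x \<in> ball x0 R \<longrightarrow>
          0 \<le> (if 0 \<le> d x then g (u x) - f x + ((F x - H x) + (b - g (U x))) else 0)"
      proof (intro AE_I2 impI)
        fix x assume "x \<in> ball x0 R"
        then have "F x = f x"
          using \<open>R > 0\<close> by (simp add: F_def)
        \<comment> \<open>Here \<open>u \<ge> U + \<psi>\<close> with \<open>\<psi> \<ge> 0\<close>;
          monotonicity of \<open>g\<close> is what makes the positive part of \<open>d\<close>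
          subharmonic.\<close>
        moreover have "g (U x) \<le> g (u x)" if "0 \<le> d x"
          by (rule monoD[OF g_mono]) (use that \<psi>(2)[of x] in \<open>simp add: d_def\<close>)
        ultimately show "0 \<le> (if 0 \<le> d x then g (u x) - f x + ((F x - H x) + (b - g (U x))) else 0)"
          using \<psi>(4)[of x] by auto
      qed
    qed (rule L1loc_const)
    have "AE x in lborel. x \<in> ball x0 R \<longrightarrow> max (d x) 0 = 0"
    proof (rule compactly_supported_subharmonic[OF D _ r(1)])
      show "AE x in lborel. x \<in> ball x0 R \<longrightarrow> r < dist x0 x \<longrightarrow> max (d x) 0 = 0"
        using m
      proof eventually_elim
        case (elim x)
        show ?case
        proof (intro impI)
          assume "x \<in> ball x0 R" "r < dist x0 x"
          with r(2)[of x] elim show "max (d x) 0 = 0"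
            by (auto simp: d_def)
        qed
      qed
    qed simp
    then show "AE x in lborel. x \<in> ball x0 R \<longrightarrow> u x \<le> \<psi> x + U x"
      by eventually_elim (auto simp: d_def max_def split: if_splits)
  qed
qed

lemma KO_integral_bound:
  fixes f :: "'a::euclidean_space \<Rightarrow> real"
  assumes "open \<Omega>" and f: "L1loc \<Omega> f" "\<And>x. 0 \<le> f x" and K: "compact K" "K \<subseteq> \<Omega>"
  shows "\<exists>C. \<forall>u. sublap \<Omega> u (\<lambda>x. g (u x) - f x) \<longrightarrow> (\<integral>x. indicator K x * u x \<partial>lborel) \<le> C"
proof -
  define P where "P = (\<lambda>x r \<Psi>. r > 0 \<and> L1loc (ball x r) \<Psi> \<and>
      (\<forall>u. sublap \<Omega> u (\<lambda>x. g (u x) - f x) \<longrightarrow> (AE y in lborel. y \<in> ball x r \<longrightarrow> u y \<le> \<Psi> y)))"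
  have "\<exists>r \<Psi>. P x r \<Psi>" if "x \<in> K" for x
  proof -
    have "x \<in> \<Omega>"
      using K(2) \<open>x \<in> K\<close> by blast
    then obtain e where "e > 0" "cball x e \<subseteq> \<Omega>"
      using open_contains_cball[THEN iffD1, OF \<open>open \<Omega>\<close>] by blast
    then have e: "e / 2 > 0" "cball x (2 * (e/2)) \<subseteq> \<Omega>"
      by auto
    obtain \<Psi> where "L1loc (ball x (e/2)) \<Psi>"
      "\<And>u. sublap \<Omega> u (\<lambda>x. g (u x) - f x) \<Longrightarrow> AE y in lborel. y \<in> ball x (e/2) \<longrightarrow> u y \<le> \<Psi> y"
      using KO_ball_bound[OF e assms(1) f] by blast
    with e(1) have "P x (e/2) \<Psi>"
      by (simp add: P_def)
    then show ?thesis
      by blast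
  qed
  then obtain r \<Psi> where "\<And>x. x \<in> K \<Longrightarrow> P x (r x) (\<Psi> x)"
    by metis
  then have r: "x \<in> K \<Longrightarrow> r x > 0" "x \<in> K \<Longrightarrow> L1loc (ball x (r x)) (\<Psi> x)"
    "x \<in> K \<Longrightarrow> sublap \<Omega> u (\<lambda>x. g (u x) - f x) \<Longrightarrow> AE y in lborel. y \<in> ball x (r x) \<longrightarrow> u y \<le> \<Psi> x y" for x u
    unfolding P_def by blast+
  \<comment> \<open>Half radii, because \<open>\<Psi> x\<close> is integrable only on compact
    subsets of its open ball.\<close>
  obtain X where X: "finite X" "X \<subseteq> K" "K \<subseteq> (\<Union>x\<in>X. ball x (r x / 2))"
  proof (rule compactE_image[OF K(1), of K "\<lambda>x. ball x (r x / 2)"])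
    show "K \<subseteq> (\<Union>x\<in>K. ball x (r x / 2))"
      using r(1) by force
  qed auto
  define \<Xi> where "\<Xi> = (\<lambda>y. \<Sum>x\<in>X. \<bar>indicator (cball x (r x / 2)) y * \<Psi> x y\<bar>)"
  have int: "integrable lborel (\<lambda>y. indicator (cball x (r x / 2)) y * \<Psi> x y)" if "x \<in> X" for x
    by (rule L1loc_cut[OF r(2)]) (use that X(2) r(1)[of x] in auto)
  have \<Xi>: "integrable lborel \<Xi>"
    unfolding \<Xi>_def by (intro Bochner_Integration.integrable_sum integrable_abs int)
  have "(\<integral>x. indicator K x * u x \<partial>lborel) \<le> integral\<^sup>L lborel \<Xi>"
    if u: "sublap \<Omega> u (\<lambda>x. g (u x) - f x)" for u
  proof (rule integral_mono_AE[OF L1loc_cut[OF sublapD(1)[OF u] K] \<Xi>])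
    have "AE y in lborel. \<forall>x\<in>X. y \<in> ball x (r x) \<longrightarrow> u y \<le> \<Psi> x y"
      using r(3)[OF _ u] X(1,2) by (intro AE_finite_allI) auto
    then show "AE y in lborel. indicator K y * u y \<le> \<Xi> y"
    proof eventually_elim
      case (elim y)
      have nonneg: "0 \<le> \<Xi> y"
        unfolding \<Xi>_def by (intro sum_nonneg) simp
      show ?case
      proof (cases "y \<in> K")
        case True
        then obtain x where x: "x \<in> X" "y \<in> ball x (r x / 2)"
          using X(3) by blast
        then have "u y \<le> \<Psi> x y"
          using elim X(2) r(1)[of x] by auto
        also have "\<dots> \<le> \<bar>indicator (cball x (r x / 2)) y * \<Psi> x y\<bar>"
          using x(2) by simp
        also have "\<dots> \<le> \<Xi> y"
          unfolding \<Xi>_def by (rule member_le_sum[OF x(1) _ X(1)]) simp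
        finally show ?thesis
          using True by simp
      qed (use nonneg in simp)
    qed
  qed
  then show ?thesis
    by blast
qed

end

subsection \<open>The maximal subsolution\<close>

context
  fixes g :: "real \<Rightarrow> real"
  assumes g_cont: "continuous_on UNIV g" and g_mono: "mono g"
begin

section \<open>Lipschitz approximations truncated from below\<close>

lemma g_borel: "g \<in> borel_measurable borel"
  by (rule borel_measurable_continuous_onI[OF g_cont])

text \<open>The largest function of \<open>t\<close> below \<open>\<lambda>t. g (max a t)\<close> that is Lipschitz with constant \<open>n\<close>.\<close>

definition lip :: "real \<Rightarrow> real \<Rightarrow> real \<Rightarrow> real" where
  "lip n a t = (INF r\<in>{0..}. g (max a (t - r)) + n * r)"

lemma lip_lower_bound: "0 \<le> n \<Longrightarrow> 0 \<le> r \<Longrightarrow> g a \<le> g (max a (t - r)) + n * r"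
  using monoD[OF g_mono, of a "max a (t - r)"] mult_nonneg_nonneg[of n r] by linarith

lemma lip_bdd_below: "0 \<le> n \<Longrightarrow> bdd_below ((\<lambda>r. g (max a (t - r)) + n * r) ` {0..})"
  by (rule bdd_belowI2[of _ "g a"]) (simp add: lip_lower_bound)

text \<open>With \<open>a = u x\<close> this is a minorant of the nonlinear terms that depends
  neither on \<open>n\<close> nor on the subsolution.\<close>

lemma lip_ge: "0 \<le> n \<Longrightarrow> g a \<le> lip n a t"
  unfolding lip_def by (rule cINF_greatest) (auto simp: lip_lower_bound)

lemma lip_le: "0 \<le> n \<Longrightarrow> 0 \<le> r \<Longrightarrow> lip n a t \<le> g (max a (t - r)) + n * r"
  unfolding lip_def by (rule cINF_lower[OF lip_bdd_below]) auto

lemma lip_le_g: "0 \<le> n \<Longrightarrow> a \<le> t \<Longrightarrow> lip n a t \<le> g t"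
  using lip_le[of n 0 a t] by (simp add: max_def)

text \<open>With \<open>a = u x\<close> this keeps \<open>u\<close> a subsolution for every
  approximate equation.\<close>

lemma lip_self: "0 \<le> n \<Longrightarrow> lip n a a = g a"
  using lip_le_g[of n a a] lip_ge[of n a a] by simp

lemma lip_mono: "0 \<le> n \<Longrightarrow> s \<le> t \<Longrightarrow> lip n a s \<le> lip n a t"
  unfolding lip_def[of n a t]
proof (rule cINF_greatest)
  fix r :: real assume n: "0 \<le> n" "s \<le> t" and "r \<in> {0..}"
  then have "lip n a s \<le> g (max a (s - r)) + n * r"
    by (intro lip_le) auto
  also have "\<dots> \<le> g (max a (t - r)) + n * r"
    using n by (intro add_right_mono monoD[OF g_mono]) auto
  finally show "lip n a s \<le> g (max a (t - r)) + n * r" .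
qed simp

lemma lip_lipschitz:
  assumes "0 \<le> n" "0 \<le> d"
  shows "lip n a (t + d) \<le> lip n a t + n * d"
proof -
  have "lip n a (t + d) - n * d \<le> lip n a t"
    unfolding lip_def[of n a t]
  proof (rule cINF_greatest)
    fix r :: real assume "r \<in> {0..}"
    then have "lip n a (t + d) \<le> g (max a (t + d - (r + d))) + n * (r + d)"
      using assms by (intro lip_le) auto
    then show "lip n a (t + d) - n * d \<le> g (max a (t - r)) + n * r"
      by (simp add: algebra_simps)
  qed simp
  then show ?thesis
    by simp
qed

lemma lip_mono_n: "0 \<le> n \<Longrightarrow> n \<le> n' \<Longrightarrow> lip n a t \<le> lip n' a t"
  unfolding lip_def[of n' a t]
proof (rule cINF_greatest)
  fix r :: real assume n: "0 \<le> n" "n \<le> n'" and "r \<in> {0..}"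
  then have "lip n a t \<le> g (max a (t - r)) + n * r"
    by (intro lip_le) auto
  also have "\<dots> \<le> g (max a (t - r)) + n' * r"
    using n \<open>r \<in> {0..}\<close> by (intro add_left_mono mult_right_mono) auto
  finally show "lip n a t \<le> g (max a (t - r)) + n' * r" .
qed simp

lemma lip_tendsto_fixed:
  assumes n: "0 \<le> n" and X: "X \<longlonglongrightarrow> t"
  shows "(\<lambda>k. lip n a (X k)) \<longlonglongrightarrow> lip n a t"
proof -
  have "\<bar>lip n a s - lip n a t\<bar> \<le> n * \<bar>s - t\<bar>" for s
  proof (cases "s \<le> t")
    case True
    then show ?thesis
      using lip_lipschitz[OF n, of "t - s" a s] lip_mono[OF n, of s t a] by simp
  next
    case False
    then show ?thesis
      using lip_lipschitz[OF n, of "s - t" a t] lip_mono[OF n, of t s a] by simp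
  qed
  then have "\<forall>\<^sub>F k in sequentially. norm (lip n a (X k) - lip n a t) \<le> n * \<bar>X k - t\<bar>"
    by (intro always_eventually) simp
  moreover have "(\<lambda>k. n * \<bar>X k - t\<bar>) \<longlonglongrightarrow> 0"
    using X by (intro tendsto_mult_right_zero tendsto_rabs_zero) (simp add: LIM_zero)
  ultimately have "(\<lambda>k. lip n a (X k) - lip n a t) \<longlonglongrightarrow> 0"
    by (rule Lim_null_comparison)
  then show ?thesis
    by (simp add: LIM_zero_iff)
qed

text \<open>The Lipschitz constant and the argument vary together. From above the terms are bounded
  by \<open>g (X k)\<close>; from below monotonicity replaces \<open>X k\<close> by
  \<open>t\<close>, for which the approach from above is required.\<close>

lemma lip_tendsto:
  assumes X: "X \<longlonglongrightarrow> t" "\<And>k. t \<le> X k" and "a \<le> t"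
  shows "(\<lambda>k. lip (real (Suc k)) a (X k)) \<longlonglongrightarrow> g t"
proof (rule tendsto_sandwich[where h = "\<lambda>k. g (X k)" and f = "\<lambda>k. lip (real (Suc k)) a t"])
  have "isCont g t"
    using g_cont by (simp add: continuous_on_eq_continuous_at)
  then show "(\<lambda>k. g (X k)) \<longlonglongrightarrow> g t"
    by (rule isCont_tendsto_compose[OF _ X(1)])
  show "\<forall>\<^sub>F k in sequentially. lip (real (Suc k)) a (X k) \<le> g (X k)"
    using X(2) \<open>a \<le> t\<close> by (intro always_eventually allI lip_le_g) (auto intro: order_trans)
  show "\<forall>\<^sub>F k in sequentially. lip (real (Suc k)) a t \<le> lip (real (Suc k)) a (X k)"
    by (intro always_eventually allI lip_mono X(2)) simp
  show "(\<lambda>k. lip (real (Suc k)) a t) \<longlonglongrightarrow> g t"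
  proof (rule LIMSEQ_I)
    fix e :: real assume "e > 0"
    obtain d where d: "d > 0" "\<And>s. \<bar>s - t\<bar> < d \<Longrightarrow> \<bar>g s - g t\<bar> < e / 2"
      using \<open>isCont g t\<close> \<open>e > 0\<close> unfolding isCont_def LIM_eq
      by (metis abs_0 diff_self half_gt_zero real_norm_def zero_less_divide_iff)
    \<comment> \<open>From here on a shift \<open>r > d / 2\<close> costs at least
      \<open>g t - g a\<close> and cannot push the infimum below \<open>g t\<close>; smaller shifts
      are covered by continuity of \<open>g\<close>.\<close>
    obtain N where N: "real N > (g t - g a) / (d / 2)"
      using reals_Archimedean2 by blast
    have "norm (lip (real (Suc k)) a t - g t) < e" if "k \<ge> N" for k
    proof -
      have "g t - e / 2 \<le> lip (real (Suc k)) a t"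
        unfolding lip_def
      proof (rule cINF_greatest)
        fix r :: real assume "r \<in> {0..}"
        then have r: "r \<ge> 0"
          by simp
        show "g t - e / 2 \<le> g (max a (t - r)) + real (Suc k) * r"
        proof (cases "r \<le> d / 2")
          case True
          then have "\<bar>max a (t - r) - t\<bar> < d"
            using r d(1) \<open>a \<le> t\<close> by (auto simp: max_def)
          then have "\<bar>g (max a (t - r)) - g t\<bar> < e / 2"
            by (rule d(2))
          moreover have "real (Suc k) * r \<ge> 0"
            using r by simp
          ultimately show ?thesis
            by linarith
        next
          case False
          have "(g t - g a) / (d / 2) \<le> real (Suc k)"
            using N that by linarith
          then have "g t - g a \<le> real (Suc k) * (d / 2)"
            using d(1) by (subst (asm) pos_divide_le_eq) auto
          also have "\<dots> \<le> real (Suc k) * r"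
            using False by (intro mult_left_mono) auto
          finally show ?thesis
            using monoD[OF g_mono, of a "max a (t - r)"] \<open>e > 0\<close> by simp
        qed
      qed simp
      moreover have "lip (real (Suc k)) a t \<le> g t"
        using \<open>a \<le> t\<close> by (intro lip_le_g) auto
      ultimately show ?thesis
        using \<open>e > 0\<close> by (simp add: abs_less_iff)
    qed
    then show "\<exists>N. \<forall>k\<ge>N. norm (lip (real (Suc k)) a t - g t) < e"
      by blast
  qed
qed

text \<open>As an infimum of continuous functions, \<open>lip n\<close> is upper semicontinuous.\<close>

lemma lip_measurable:
  assumes "0 \<le> n" and [measurable]: "u \<in> borel_measurable M" "v \<in> borel_measurable M"
  shows "(\<lambda>x. lip n (u x) (v x)) \<in> borel_measurable M"
proof -
  have "(\<lambda>p. lip n (fst p) (snd p)) \<in> borel_measurable (borel :: (real \<times> real) measure)"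
  proof (rule borel_measurable_iff_less[THEN iffD2], rule allI)
    fix c
    have "open {p. g (max (fst p) (snd p - r)) + n * r < c}" for r
      by (intro open_Collect_less continuous_intros continuous_on_compose2[OF g_cont]) auto
    then have "open (\<Union>r\<in>{0..}. {p. g (max (fst p) (snd p - r)) + n * r < c})"
      by auto
    also have "(\<Union>r\<in>{0..}. {p. g (max (fst p) (snd p - r)) + n * r < c}) = {p. lip n (fst p) (snd p) < c}"
      unfolding lip_def using cINF_less_iff[OF _ lip_bdd_below[OF assms(1)]] by auto
    finally show "{p \<in> space borel. lip n (fst p) (snd p) < c} \<in> sets borel"
      by simp
  qed
  from measurable_compose[OF _ this, of "\<lambda>x. (u x, v x)" M] show ?thesis
    by (simp add: borel_prod[symmetric])
qed

context
  fixes \<Omega> :: "'a::euclidean_space set" and f :: "'a \<Rightarrow> real"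
  assumes \<Omega>: "open \<Omega>" and f: "L1loc \<Omega> f"
begin

text \<open>The right-hand side that Kato's inequality selects is \<open>g\<close> of the maximum,
  so subsolutions are closed under maxima. Along the increasing sequence \<open>g (v 0 x)\<close> is
  the minorant for the passage to the limit.\<close>

lemma maximal_subsolution_ex:
  assumes "g 0 \<ge> 0" "keller_osserman g" "\<And>x. 0 \<le> f x" and w: "sublap \<Omega> w (\<lambda>x. g (w x) - f x)"
  obtains u where "sublap \<Omega> u (\<lambda>x. g (u x) - f x)"
    "\<And>v. sublap \<Omega> v (\<lambda>x. g (v x) - f x) \<Longrightarrow> AE x in lborel. x \<in> \<Omega> \<longrightarrow> v x \<le> u x"
proof -
  define S where "S = {u. sublap \<Omega> u (\<lambda>x. g (u x) - f x)}"
  obtain v u where v: "\<And>n::nat. v n \<in> S" "\<And>n x. v n x \<le> v (Suc n) x" and u: "u \<in> borel_measurable borel"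
    "AE x in lborel. x \<in> \<Omega> \<longrightarrow> (\<lambda>n. v n x) \<longlonglongrightarrow> u x" "L1loc \<Omega> u"
    "\<And>z. z \<in> S \<Longrightarrow> AE x in lborel. x \<in> \<Omega> \<longrightarrow> z x \<le> u x"
  proof (rule Perron_supremum[OF \<Omega>, of S])
    show "S \<noteq> {}"
      using w by (auto simp: S_def)
    show "L1loc \<Omega> z" if "z \<in> S" for z
      using that by (auto simp: S_def dest: sublapD)
    show "(\<lambda>x. max (y x) (z x)) \<in> S" if "y \<in> S" "z \<in> S" for y z
    proof -
      have "sublap \<Omega> (\<lambda>x. max (y x) (z x)) (\<lambda>x. if z x \<le> y x then g (y x) - f x else g (z x) - f x)"
        using that by (intro Kato \<Omega>) (auto simp: S_def)
      also have "(\<lambda>x. if z x \<le> y x then g (y x) - f x else g (z x) - f x) = (\<lambda>x. g (max (y x) (z x)) - f x)"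
        by (auto simp: max_def fun_eq_iff)
      finally show ?thesis
        by (simp add: S_def)
    qed
    show "\<exists>C. \<forall>z\<in>S. (\<integral>x. indicator K x * z x \<partial>lborel) \<le> C" if "compact K" "K \<subseteq> \<Omega>" for K
      using KO_integral_bound[OF g_cont g_mono assms(1,2) \<Omega> f assms(3) that] by (auto simp: S_def)
  qed blast
  have sub: "sublap \<Omega> (v n) (\<lambda>x. g (v n x) - f x)" for n
    using v(1)[of n] by (simp add: S_def)
  have v0: "v 0 x \<le> v n x" for n x
    by (rule lift_Suc_mono_le[of "\<lambda>n. v n x", OF v(2)]) simp
  have low: "L1loc \<Omega> (\<lambda>x. g (v 0 x))"
    using L1loc_add[OF sublapD(2)[OF sub[of 0]] f] by simp
  have gu: "(\<lambda>x. g (u x)) \<in> borel_measurable borel"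
    by (rule measurable_compose[OF u(1) g_borel])
  have "sublap \<Omega> u (\<lambda>x. g (u x) - f x)"
  proof (rule sublap_limit(1)[OF sub f \<Omega> _ _ u(1,2) low _ gu])
    show "L1loc \<Omega> (\<lambda>x. \<bar>v 0 x\<bar> + \<bar>u x\<bar>)"
      by (intro L1loc_add L1loc_abs u(3) sublapD(1)[OF sub])
    show "AE x in lborel. x \<in> \<Omega> \<longrightarrow> \<bar>v n x\<bar> \<le> \<bar>v 0 x\<bar> + \<bar>u x\<bar>" for n
      using u(4)[OF v(1), of n]
    proof eventually_elim
      case (elim x)
      then show ?case
        using v0[of x n] by auto
    qed
    show "AE x in lborel. x \<in> \<Omega> \<longrightarrow> g (v 0 x) \<le> g (v n x)" for n
      using v0 by (auto intro: monoD[OF g_mono])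
    show "AE x in lborel. x \<in> \<Omega> \<longrightarrow> (\<lambda>n. g (v n x)) \<longlonglongrightarrow> g (u x)"
      using u(2)
    proof eventually_elim
      case (elim x)
      have "isCont g (u x)"
        using g_cont by (simp add: continuous_on_eq_continuous_at)
      then show ?case
        using elim by (auto intro: isCont_tendsto_compose)
    qed
  qed
  then show thesis
    using u(4) by (intro that[of u]) (auto simp: S_def)
qed

section \<open>Lifting a subsolution inside a relatively compact set\<close>

context
  fixes u B \<xi> \<kappa>
  assumes u: "sublap \<Omega> u (\<lambda>x. g (u x) - f x)"
    and B: "open B" "bounded B" "closure B \<subseteq> \<Omega>"
    and \<kappa>: "test_fun B \<kappa>" "\<And>x. 0 \<le> \<kappa> x" "\<And>x. \<kappa> x \<le> 1"
    and \<xi>: "test_fun \<Omega> \<xi>" "\<And>x. 0 \<le> \<xi> x" "\<And>x. \<xi> x \<noteq> 0 \<Longrightarrow> \<kappa> x = 1"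
begin

text \<open>Prescribing the values off \<open>B\<close> takes the place of the Keller--Osserman
  bound, which is lost because \<open>lip n\<close> grows at most linearly.\<close>

definition lift_class :: "real \<Rightarrow> ('a \<Rightarrow> real) set" where
  "lift_class n = {v. (\<forall>x. u x \<le> v x) \<and> (\<forall>x. x \<notin> B \<longrightarrow> v x = u x) \<and>
     sublap \<Omega> v (\<lambda>x. lip n (u x) (v x) - f x)}"

lemma gu_L1loc: "L1loc \<Omega> (\<lambda>x. g (u x))"
  using L1loc_add[OF sublapD(2)[OF u] f] by simp

text \<open>A test function with Laplacian \<open>- 2 * N\<close> on \<open>B\<close>, where alone
  \<open>v\<close> differs from \<open>u\<close>, turns the subsolution inequality into a bound for
  the integral of \<open>v - u\<close>. The nonlinear term is bounded below by
  \<open>g (u x)\<close>, independently of \<open>v\<close>.\<close>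

lemma lift_class_integral_bound:
  assumes n: "0 \<le> n"
  obtains C where "\<And>v. v \<in> lift_class n \<Longrightarrow> (\<integral>x. v x - u x \<partial>lborel) \<le> C"
    "\<And>v. v \<in> lift_class n \<Longrightarrow> integrable lborel (\<lambda>x. v x - u x)"
proof -
  define N where "N = real DIM('a)"
  have N: "N > 0"
    by (simp add: N_def)
  have cB: "compact (closure B)"
    using B(2) by (simp add: compact_closure)
  obtain \<rho> where \<rho>: "closure B \<subseteq> ball 0 \<rho>"
    using bounded_subset_ballD[OF bounded_closure[OF B(2)], of 0] by blast
  obtain \<beta> where \<beta>: "test_fun (\<Omega> \<inter> ball 0 \<rho>) \<beta>" "\<And>x. 0 \<le> \<beta> x" "\<And>x. x \<in> closure B \<Longrightarrow> \<beta> x = 1"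
    using test_fun_bump[OF cB, of "\<Omega> \<inter> ball 0 \<rho>"] \<Omega> B(3) \<rho> by (metis Int_greatest open_Int open_ball)
  define q where "q = (\<lambda>x::'a. \<rho>\<^sup>2 - (norm (x - 0))\<^sup>2)"
  have q: "smooth_fun q"
    unfolding q_def by (intro smooth_fun_diff smooth_fun_const smooth_fun_norm_diff_sq)
  define \<phi> where "\<phi> = (\<lambda>x. q x * \<beta> x)"
  have \<phi>': "test_fun (\<Omega> \<inter> ball 0 \<rho>) \<phi>"
    unfolding \<phi>_def by (rule test_fun_mult[OF q \<beta>(1)])
  have \<phi>: "test_fun \<Omega> \<phi>"
    by (rule test_fun_mono[OF \<phi>']) auto
  have \<phi>0: "0 \<le> \<phi> x" for x
  proof (cases "x \<in> ball 0 \<rho>")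
    case True
    then have "(norm x)\<^sup>2 \<le> \<rho>\<^sup>2"
      by (intro power_mono) auto
    then show ?thesis
      using \<beta>(2) by (simp add: \<phi>_def q_def)
  qed (use test_fun_eq_0[OF \<phi>'] in simp)
  have lap: "laplacian \<phi> x = - (2 * N)" if "x \<in> B" for x
  proof -
    have "laplacian \<phi> x = laplacian q x"
      by (rule laplacian_cong_open[OF B(1) that])
        (use \<beta>(3) closure_subset[of B] test_fun_smooth[OF \<phi>] q in \<open>auto simp: \<phi>_def\<close>)
    also have "laplacian q = (\<lambda>x. laplacian (\<lambda>_. \<rho>\<^sup>2) x - 2 * N)"
      unfolding q_def N_def
      by (subst laplacian_diff) (simp_all only: smooth_fun_const smooth_fun_norm_diff_sq laplacian_norm_sq of_nat_mult of_nat_numeral)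
    finally show ?thesis
      by (simp add: laplacian_dird dird_const)
  qed
  note lap_test = test_fun_laplacian[OF \<phi>]
  define C where "C = (\<integral>x. u x * laplacian \<phi> x \<partial>lborel) - (\<integral>x. (g (u x) - f x) * \<phi> x \<partial>lborel)"
  have main: "integrable lborel (\<lambda>x. v x - u x)" "(\<integral>x. v x - u x \<partial>lborel) \<le> C / (2 * N)" if "v \<in> lift_class n" for v
  proof -
    have v: "\<And>x. u x \<le> v x" "\<And>x. x \<notin> B \<Longrightarrow> v x = u x" "sublap \<Omega> v (\<lambda>x. lip n (u x) (v x) - f x)"
      using that by (auto simp: lift_class_def)
    have "integrable lborel (\<lambda>x. indicator (closure B) x * (v x - u x))"
      by (intro L1loc_cut[OF L1loc_diff[OF sublapD(1)[OF v(3)] sublapD(1)[OF u]]] cB B(3))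
    also have "(\<lambda>x. indicator (closure B) x * (v x - u x)) = (\<lambda>x. v x - u x)"
    proof
      fix x show "indicator (closure B) x * (v x - u x) = v x - u x"
        using v(2)[of x] closure_subset[of B] by (cases "x \<in> closure B") auto
    qed
    finally show int: "integrable lborel (\<lambda>x. v x - u x)" .
    have "(\<integral>x. (g (u x) - f x) * \<phi> x \<partial>lborel) \<le> (\<integral>x. (lip n (u x) (v x) - f x) * \<phi> x \<partial>lborel)"
      using lip_ge[OF n] \<phi>0
      by (intro integral_mono L1loc_test_integrable[OF sublapD(2)[OF u] \<phi>]
          L1loc_test_integrable[OF sublapD(2)[OF v(3)] \<phi>] mult_right_mono) auto
    also have "\<dots> \<le> (\<integral>x. v x * laplacian \<phi> x \<partial>lborel)"
      by (rule weak_subD[OF sublapD(3)[OF v(3)] \<phi> \<phi>0])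
    also have "\<dots> = (\<integral>x. u x * laplacian \<phi> x + - (2 * N) * (v x - u x) \<partial>lborel)"
    proof (rule Bochner_Integration.integral_cong[OF refl])
      fix x
      show "v x * laplacian \<phi> x = u x * laplacian \<phi> x + - (2 * N) * (v x - u x)"
        using lap[of x] v(2)[of x] by (cases "x \<in> B") (auto simp: algebra_simps)
    qed
    also have "\<dots> = (\<integral>x. u x * laplacian \<phi> x \<partial>lborel) + - (2 * N) * (\<integral>x. v x - u x \<partial>lborel)"
      using L1loc_test_integrable[OF sublapD(1)[OF u] lap_test] int by simp
    finally have "(\<integral>x. v x - u x \<partial>lborel) * (2 * N) \<le> C"
      by (simp add: C_def mult.commute)
    then show "(\<integral>x. v x - u x \<partial>lborel) \<le> C / (2 * N)"
      using N by (subst pos_le_divide_eq) auto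
  qed
  then show thesis
    by (intro that[of "C / (2 * N)"])
qed

text \<open>A maximal element of \<open>lift_class n\<close> solves the equation with \<open>lip n\<close> inside \<open>B\<close>: otherwise
  the perturbation lemma would enlarge it.\<close>

lemma lift_ex:
  assumes n: "0 < n"
  obtains v where "v \<in> lift_class n"
    "\<And>z. z \<in> lift_class n \<Longrightarrow> AE x in lborel. x \<in> \<Omega> \<longrightarrow> z x \<le> v x"
    "defect v (\<lambda>x. lip n (u x) (v x) - f x) \<xi> = 0"
proof -
  have n0: "0 \<le> n"
    using n by simp
  have u_borel[measurable]: "u \<in> borel_measurable borel"
    by (rule L1loc_borel[OF sublapD(1)[OF u]])
  have L1loc_lift: "L1loc \<Omega> z" if "z \<in> lift_class n" for z
    using that by (auto simp: lift_class_def dest: sublapD)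
  obtain C where C: "\<And>v. v \<in> lift_class n \<Longrightarrow> (\<integral>x. v x - u x \<partial>lborel) \<le> C"
    "\<And>v. v \<in> lift_class n \<Longrightarrow> integrable lborel (\<lambda>x. v x - u x)"
    using lift_class_integral_bound[OF n0] by blast
  obtain z w where z: "\<And>k::nat. z k \<in> lift_class n" "\<And>k x. z k x \<le> z (Suc k) x"
    and w: "w \<in> borel_measurable borel" "AE x in lborel. x \<in> \<Omega> \<longrightarrow> (\<lambda>k. z k x) \<longlonglongrightarrow> w x"
      "L1loc \<Omega> w" "\<And>y. y \<in> lift_class n \<Longrightarrow> AE x in lborel. x \<in> \<Omega> \<longrightarrow> y x \<le> w x"
  proof (rule Perron_supremum[OF \<Omega>, of "lift_class n"])
    have "u \<in> lift_class n"
      using u by (simp add: lift_class_def lip_self[OF n0])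
    then show "lift_class n \<noteq> {}"
      by auto
    show "(\<lambda>x. max (y x) (z x)) \<in> lift_class n" if "y \<in> lift_class n" "z \<in> lift_class n" for y z
    proof -
      have "sublap \<Omega> (\<lambda>x. max (y x) (z x))
          (\<lambda>x. if z x \<le> y x then lip n (u x) (y x) - f x else lip n (u x) (z x) - f x)"
        using that by (intro Kato \<Omega>) (auto simp: lift_class_def)
      also have "(\<lambda>x. if z x \<le> y x then lip n (u x) (y x) - f x else lip n (u x) (z x) - f x)
          = (\<lambda>x. lip n (u x) (max (y x) (z x)) - f x)"
        by (auto simp: max_def fun_eq_iff)
      finally show ?thesis
        using that by (auto simp: lift_class_def max_def)
    qed
    show "\<exists>C. \<forall>y\<in>lift_class n. (\<integral>x. indicator K x * y x \<partial>lborel) \<le> C" if K: "compact K" "K \<subseteq> \<Omega>" for K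
    proof (intro exI ballI)
      fix y assume y: "y \<in> lift_class n"
      have int: "integrable lborel (\<lambda>x. indicator K x * (y x - u x))"
        by (intro L1loc_cut[OF L1loc_diff[OF L1loc_lift[OF y] sublapD(1)[OF u]] K])
      have "(\<integral>x. indicator K x * y x \<partial>lborel) = (\<integral>x. indicator K x * u x + indicator K x * (y x - u x) \<partial>lborel)"
        by (simp add: algebra_simps)
      also have "\<dots> = (\<integral>x. indicator K x * u x \<partial>lborel) + (\<integral>x. indicator K x * (y x - u x) \<partial>lborel)"
        by (intro Bochner_Integration.integral_add L1loc_cut[OF sublapD(1)[OF u] K] int)
      also have "(\<integral>x. indicator K x * (y x - u x) \<partial>lborel) \<le> (\<integral>x. y x - u x \<partial>lborel)"
        using y by (intro integral_mono int C(2)) (auto simp: lift_class_def indicator_def)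
      also have "\<dots> \<le> C"
        by (rule C(1)[OF y])
      finally show "(\<integral>x. indicator K x * y x \<partial>lborel) \<le> (\<integral>x. indicator K x * u x \<partial>lborel) + C"
        by simp
    qed
  qed (use L1loc_lift in blast)+
  \<comment> \<open>\<open>w\<close> is determined only up to null sets, whereas
    \<open>lift_class\<close> asks for \<open>u \<le> v\<close> everywhere and \<open>v = u\<close>
    at every point off \<open>B\<close>; this version of the limit has both.\<close>
  define v where "v = (\<lambda>x. if x \<in> B then max (w x) (u x) else u x)"
  have z': "u x \<le> z k x" "x \<notin> B \<Longrightarrow> z k x = u x" "sublap \<Omega> (z k) (\<lambda>x. lip n (u x) (z k x) - f x)" for k x
    using z(1)[of k] by (auto simp: lift_class_def)
  have v_borel[measurable]: "v \<in> borel_measurable borel"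
    unfolding v_def using w(1) B(1) by (intro measurable_If borel_measurable_max u_borel) auto
  have lim: "AE x in lborel. x \<in> \<Omega> \<longrightarrow> (\<lambda>k. z k x) \<longlonglongrightarrow> v x"
    using w(2)
  proof eventually_elim
    case (elim x)
    show ?case
    proof
      assume "x \<in> \<Omega>"
      with elim have *: "(\<lambda>k. z k x) \<longlonglongrightarrow> w x"
        by simp
      then have "u x \<le> w x"
        by (rule LIMSEQ_le_const) (use z'(1) in auto)
      then show "(\<lambda>k. z k x) \<longlonglongrightarrow> v x"
        using * z'(2) by (cases "x \<in> B") (auto simp: v_def)
    qed
  qed
  have v_eq: "AE x in lborel. x \<in> \<Omega> \<longrightarrow> v x = w x"
    using lim w(2) by eventually_elim (auto intro: LIMSEQ_unique)
  have vL: "L1loc \<Omega> v"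
    by (rule L1loc_bound[OF w(3) v_borel]) (use v_eq in \<open>eventually_elim, auto\<close>)
  have v_upper: "AE x in lborel. x \<in> \<Omega> \<longrightarrow> y x \<le> v x" if "y \<in> lift_class n" for y
    using w(4)[OF that] v_eq by eventually_elim auto
  have v_sub: "sublap \<Omega> v (\<lambda>x. lip n (u x) (v x) - f x)"
  proof (rule sublap_limit(1)[OF z'(3) f \<Omega> _ _ v_borel lim gu_L1loc])
    show "L1loc \<Omega> (\<lambda>x. \<bar>u x\<bar> + \<bar>v x\<bar>)"
      by (intro L1loc_add L1loc_abs vL sublapD(1)[OF u])
    show "AE x in lborel. x \<in> \<Omega> \<longrightarrow> \<bar>z k x\<bar> \<le> \<bar>u x\<bar> + \<bar>v x\<bar>" for k
      using v_upper[OF z(1), of k]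
    proof eventually_elim
      case (elim x)
      then show ?case
        using z'(1)[of x k] by auto
    qed
    show "AE x in lborel. x \<in> \<Omega> \<longrightarrow> g (u x) \<le> lip n (u x) (z k x)" for k
      using lip_ge[OF n0] by simp
    show "(\<lambda>x. lip n (u x) (v x)) \<in> borel_measurable borel"
      by (rule lip_measurable[OF n0 u_borel v_borel])
    show "AE x in lborel. x \<in> \<Omega> \<longrightarrow> (\<lambda>k. lip n (u x) (z k x)) \<longlonglongrightarrow> lip n (u x) (v x)"
      using lim by eventually_elim (auto intro: lip_tendsto_fixed[OF n0])
  qed
  have v_class: "v \<in> lift_class n"
    using v_sub by (auto simp: lift_class_def v_def)
  have \<kappa>\<Omega>: "test_fun \<Omega> \<kappa>"
    using \<kappa>(1) by (rule test_fun_mono) (use B(3) closure_subset[of B] in auto)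
  obtain h where h: "integrable lborel h" "\<And>x. 0 \<le> h x" "\<forall>x. x \<notin> B \<longrightarrow> h x = 0"
    "sublap \<Omega> (\<lambda>x. v x + h x) (\<lambda>x. (lip n (u x) (v x) - f x) + n * h x)"
    "\<forall>\<xi>. (AE x in lborel. h x = 0) \<longrightarrow> test_fun \<Omega> \<xi> \<longrightarrow> (\<forall>x. 0 \<le> \<xi> x) \<longrightarrow>
      (\<forall>x. \<xi> x \<noteq> 0 \<longrightarrow> \<kappa> x = 1) \<longrightarrow> defect v (\<lambda>x. lip n (u x) (v x) - f x) \<xi> = 0"
    using perturbation[OF v_sub \<kappa>\<Omega> \<kappa>(2,3,1) B(1) n] by blast
  have [measurable]: "h \<in> borel_measurable borel" "f \<in> borel_measurable borel"
    using borel_measurable_integrable[OF h(1)] L1loc_borel[OF f] by auto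
  have uv: "u x \<le> v x" for x
    by (simp add: v_def)
  \<comment> \<open>The term \<open>n * h x\<close> covers the growth of \<open>lip n\<close> under
    the increment \<open>h x\<close>, so \<open>v + h\<close> is again in the class and maximality
    forces \<open>h = 0\<close>.\<close>
  have "sublap \<Omega> (\<lambda>x. v x + h x) (\<lambda>x. lip n (u x) (v x + h x) - f x)"
  proof (rule sublap_mono_rhs[OF h(4)])
    have le: "lip n (u x) (v x + h x) - f x \<le> lip n (u x) (v x) - f x + n * h x" for x
      using lip_lipschitz[OF n0 h(2), of "u x" "v x" x] by simp
    then show "AE x in lborel. x \<in> \<Omega> \<longrightarrow> lip n (u x) (v x + h x) - f x \<le> lip n (u x) (v x) - f x + n * h x"
      by simp
    show "L1loc \<Omega> (\<lambda>x. lip n (u x) (v x + h x) - f x)"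
    proof (rule L1loc_sandwich[OF sublapD(2)[OF u] sublapD(2)[OF h(4)]])
      have "(\<lambda>x. lip n (u x) (v x + h x)) \<in> borel_measurable borel"
        by (intro lip_measurable[OF n0]) measurable
      then show "(\<lambda>x. lip n (u x) (v x + h x) - f x) \<in> borel_measurable borel"
        by measurable
    qed (use le lip_ge[OF n0] in auto)
  qed
  then have "(\<lambda>x. v x + h x) \<in> lift_class n"
    using uv h(2,3) v_class by (auto simp: lift_class_def add_increasing2)
  from v_upper[OF this] have "AE x in lborel. h x = 0"
  proof eventually_elim
    case (elim x)
    show ?case
    proof (cases "x \<in> B")
      case True
      then have "x \<in> \<Omega>"
        using B(3) closure_subset by blast
      then show ?thesis
        using elim h(2)[of x] by simp
    qed (use h(3) in blast)
  qed
  then have "defect v (\<lambda>x. lip n (u x) (v x) - f x) \<xi> = 0"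
    using h(5) \<xi> by blast
  then show thesis
    by (intro that[OF v_class v_upper])
qed

end

end

end

text \<open>The defect is nonnegative already, so only an upper bound for the limit \<open>A\<close>
  of the integrals of \<open>\<Gamma> k * \<xi>\<close> is needed; \<open>A\<close> is determined by
  the equations for \<open>v k\<close>. Below the level \<open>g M\<close> the nonlinear terms
  converge by domination, above it they contribute at most \<open>\<tau> M\<close>, uniformly in
  \<open>k\<close>.\<close>

lemma maximal_subsolution_defect_eq_0:
  fixes \<Omega> :: "'a::euclidean_space set"
  assumes g: "continuous_on UNIV g" "mono g" and g0: "g 0 \<ge> 0" and \<Omega>: "open \<Omega>" and f: "L1loc \<Omega> f"
    and u: "sublap \<Omega> u (\<lambda>x. g (u x) - f x)"
    and max: "\<And>v. sublap \<Omega> v (\<lambda>x. g (v x) - f x) \<Longrightarrow> AE x in lborel. x \<in> \<Omega> \<longrightarrow> v x \<le> u x"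
    and \<xi>: "test_fun \<Omega> \<xi>" "\<And>x. 0 \<le> \<xi> x"
  shows "defect u (\<lambda>x. g (u x) - f x) \<xi> = 0"
proof -
  note gb[measurable] = g_borel[OF g]
  note lip_ge' = lip_ge[OF g] and lip_le_g' = lip_le_g[OF g]
  obtain K where K: "smooth_fun \<xi>" "compact K" "K \<subseteq> \<Omega>" "\<And>x. x \<notin> K \<Longrightarrow> \<xi> x = 0"
    using \<xi>(1) by (rule test_funE) blast
  obtain r where r: "r > 0" "(\<Union>x\<in>K. cball x r) \<subseteq> \<Omega>"
    using compact_inflate[OF K(2) \<Omega> K(3)] .
  define B where "B = (\<Union>x\<in>K. ball x r)"
  note c = compact_UN_cball[OF K(2), of r]
  have sub: "B \<subseteq> (\<Union>x\<in>K. cball x r)"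
    by (auto simp: B_def)
  have "closure B \<subseteq> (\<Union>x\<in>K. cball x r)" "bounded B"
    by (rule closure_minimal[OF sub compact_imp_closed[OF c]],
        rule bounded_subset[OF compact_imp_bounded[OF c] sub])
  then have B: "open B" "bounded B" "closure B \<subseteq> \<Omega>" "K \<subseteq> B"
    using r by (auto simp: B_def)
  obtain \<kappa> where \<kappa>: "test_fun B \<kappa>" "\<And>x. 0 \<le> \<kappa> x" "\<And>x. \<kappa> x \<le> 1" "\<And>x. x \<in> K \<Longrightarrow> \<kappa> x = 1"
    using test_fun_bump[OF K(2) B(1,4)] by metis
  have \<xi>\<kappa>: "\<kappa> x = 1" if "\<xi> x \<noteq> 0" for x
    using that K(4) \<kappa>(4) by blast
  note ctx = g \<Omega> f u B(1-3) \<kappa>(1-3) \<xi> \<xi>\<kappa>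
  have guL: "L1loc \<Omega> (\<lambda>x. g (u x))"
    using L1loc_add[OF sublapD(2)[OF u] f] by simp
  define LC where "LC = (\<lambda>n. {v. (\<forall>x. u x \<le> v x) \<and> (\<forall>x. x \<notin> B \<longrightarrow> v x = u x) \<and>
     sublap \<Omega> v (\<lambda>x. lip g n (u x) (v x) - f x)})"
  have LC: "lift_class g \<Omega> f u B n = LC n" for n
    unfolding LC_def by (rule lift_class_def[OF ctx])
  define Q where "Q = (\<lambda>k v. v \<in> LC (real (Suc k)) \<and>
      (\<forall>z. z \<in> LC (real (Suc k)) \<longrightarrow> (AE x in lborel. x \<in> \<Omega> \<longrightarrow> z x \<le> v x)) \<and>
      defect v (\<lambda>x. lip g (real (Suc k)) (u x) (v x) - f x) \<xi> = 0)"
  have "\<exists>v. Q k v" for k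
  proof -
    have pos: "0 < real (Suc k)"
      by simp
    show ?thesis
    proof (rule lift_ex[OF ctx pos, unfolded LC])
      fix v
      assume v: "v \<in> LC (real (Suc k))"
        "\<And>z. z \<in> LC (real (Suc k)) \<Longrightarrow> AE x in lborel. x \<in> \<Omega> \<longrightarrow> z x \<le> v x"
        "defect v (\<lambda>x. lip g (real (Suc k)) (u x) (v x) - f x) \<xi> = 0"
      show ?thesis
        unfolding Q_def by (intro exI[of _ v] conjI allI impI v)
    qed
  qed
  then obtain v where "\<And>k. Q k (v k)"
    by metis
  then have v: "v k \<in> LC (real (Suc k))"
    "z \<in> LC (real (Suc k)) \<Longrightarrow> AE x in lborel. x \<in> \<Omega> \<longrightarrow> z x \<le> v k x"
    "defect (v k) (\<lambda>x. lip g (real (Suc k)) (u x) (v k x) - f x) \<xi> = 0" for k z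
    unfolding Q_def by blast+
  define \<Gamma> where "\<Gamma> = (\<lambda>k x. lip g (real (Suc k)) (u x) (v k x))"
  have v_defect: "defect (v k) (\<lambda>x. \<Gamma> k x - f x) \<xi> = 0" for k
    using v(3)[of k] by (simp only: \<Gamma>_def)
  have uv: "u x \<le> v k x" and v_sub: "sublap \<Omega> (v k) (\<lambda>x. \<Gamma> k x - f x)" for k x
    using v(1)[of k] by (auto simp: LC_def \<Gamma>_def)
  have [measurable]: "u \<in> borel_measurable borel" "\<And>k. v k \<in> borel_measurable borel" "f \<in> borel_measurable borel"
    using L1loc_borel[OF sublapD(1)[OF u]] L1loc_borel[OF sublapD(1)[OF v_sub]] L1loc_borel[OF f] by auto
  have \<Gamma>_borel[measurable]: "\<Gamma> k \<in> borel_measurable borel" for k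
    unfolding \<Gamma>_def by (rule lip_measurable[OF g]) auto
  have \<Gamma>_ge: "g (u x) \<le> \<Gamma> k x" and \<Gamma>_le: "\<Gamma> k x \<le> g (v k x)" for k x
    unfolding \<Gamma>_def using uv by (auto intro: lip_ge' lip_le_g')
  have \<Gamma>L: "L1loc \<Omega> (\<Gamma> k)" for k
    using L1loc_add[OF sublapD(2)[OF v_sub[of k]] f] by simp
  \<comment> \<open>\<open>lip\<close> increases with its Lipschitz constant, so the lift for
    \<open>k + 1\<close> also competes for \<open>k\<close>, and maximality of \<open>v k\<close>
    gives the order.\<close>
  have dec: "AE x in lborel. x \<in> \<Omega> \<longrightarrow> v (Suc k) x \<le> v k x" for k
  proof (rule v(2))
    let ?l = "\<lambda>x. lip g (real (Suc k)) (u x) (v (Suc k) x)"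
    have l_le: "?l x \<le> \<Gamma> (Suc k) x" for x
      unfolding \<Gamma>_def by (rule lip_mono_n[OF g]) auto
    have "sublap \<Omega> (v (Suc k)) (\<lambda>x. ?l x - f x)"
    proof (rule sublap_mono_rhs[OF v_sub])
      show "L1loc \<Omega> (\<lambda>x. ?l x - f x)"
      proof (rule L1loc_diff[OF L1loc_sandwich[OF guL \<Gamma>L] f])
        show "?l \<in> borel_measurable borel"
          by (rule lip_measurable[OF g]) auto
        show "AE x in lborel. x \<in> \<Omega> \<longrightarrow> g (u x) \<le> ?l x \<and> ?l x \<le> \<Gamma> (Suc k) x"
          using l_le lip_ge'[of "real (Suc k)"] by (intro AE_I2) auto
      qed
    qed (use l_le in simp)
    then show "v (Suc k) \<in> LC (real (Suc k))"
      using v(1)[of "Suc k"] by (simp add: LC_def)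
  qed
  then have dec_all: "AE x in lborel. \<forall>k. x \<in> \<Omega> \<longrightarrow> v (Suc k) x \<le> v k x"
    by (subst AE_all_countable) auto
  define w where "w = (\<lambda>x. lim (\<lambda>k. v k x))"
  have w_borel: "w \<in> borel_measurable borel"
    unfolding w_def by (rule borel_measurable_lim_metric) auto
  have lim_w: "AE x in lborel. x \<in> \<Omega> \<longrightarrow> (\<lambda>k. v k x) \<longlonglongrightarrow> w x \<and> (\<forall>k. w x \<le> v k x \<and> v k x \<le> v 0 x)"
    using dec_all
  proof eventually_elim
    case (elim x)
    show ?case
    proof
      assume "x \<in> \<Omega>"
      then have d: "decseq (\<lambda>k. v k x)"
        using elim by (intro decseq_SucI) auto
      then obtain l where "(\<lambda>k. v k x) \<longlonglongrightarrow> l"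
        using decseq_convergent[OF d, of "u x"] uv by metis
      then have "(\<lambda>k. v k x) \<longlonglongrightarrow> w x"
        by (simp add: w_def limI)
      then show "(\<lambda>k. v k x) \<longlonglongrightarrow> w x \<and> (\<forall>k. w x \<le> v k x \<and> v k x \<le> v 0 x)"
        using decseq_ge[OF d] decseqD[OF d, of 0] by auto
    qed
  qed
  define V where "V = (\<lambda>x. \<bar>u x\<bar> + \<bar>v 0 x\<bar>)"
  have VL: "L1loc \<Omega> V"
    unfolding V_def by (intro L1loc_add L1loc_abs sublapD(1)[OF u] sublapD(1)[OF v_sub])
  have v_le_V: "AE x in lborel. x \<in> \<Omega> \<longrightarrow> \<bar>v k x\<bar> \<le> V x" for k
    using lim_w
  proof eventually_elim
    case (elim x)
    then have "x \<in> \<Omega> \<Longrightarrow> v k x \<le> v 0 x"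
      by blast
    then show ?case
      using uv[of x k] by (auto simp: V_def)
  qed
  have "sublap \<Omega> w (\<lambda>x. g (w x) - f x)"
  proof (rule sublap_limit(1)[OF v_sub f \<Omega> VL v_le_V w_borel _ guL])
    show "AE x in lborel. x \<in> \<Omega> \<longrightarrow> (\<lambda>k. v k x) \<longlonglongrightarrow> w x"
      using lim_w by eventually_elim auto
    show "AE x in lborel. x \<in> \<Omega> \<longrightarrow> g (u x) \<le> \<Gamma> k x" for k
      using \<Gamma>_ge by simp
    show "(\<lambda>x. g (w x)) \<in> borel_measurable borel"
      by (rule measurable_compose[OF w_borel gb])
    show "AE x in lborel. x \<in> \<Omega> \<longrightarrow> (\<lambda>k. \<Gamma> k x) \<longlonglongrightarrow> g (w x)"
      using lim_w
    proof eventually_elim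
      case (elim x)
      show ?case
      proof
        assume "x \<in> \<Omega>"
        with elim have *: "(\<lambda>k. v k x) \<longlonglongrightarrow> w x" "\<And>k. w x \<le> v k x"
          by auto
        have "u x \<le> w x"
          by (rule LIMSEQ_le_const[OF *(1)]) (use uv in auto)
        then show "(\<lambda>k. \<Gamma> k x) \<longlonglongrightarrow> g (w x)"
          unfolding \<Gamma>_def by (rule lip_tendsto[OF g *])
      qed
    qed
  qed
  from max[OF this] have lim_u: "AE x in lborel. x \<in> \<Omega> \<longrightarrow> (\<lambda>k. v k x) \<longlonglongrightarrow> u x"
    using lim_w
  proof eventually_elim
    case (elim x)
    show ?case
    proof
      assume "x \<in> \<Omega>"
      with elim have *: "(\<lambda>k. v k x) \<longlonglongrightarrow> w x" "w x \<le> u x"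
        by auto
      have "u x \<le> w x"
        by (rule LIMSEQ_le_const[OF *(1)]) (use uv in auto)
      with * show "(\<lambda>k. v k x) \<longlonglongrightarrow> u x"
        by simp
    qed
  qed
  note lap = test_fun_laplacian[OF \<xi>(1)]
  have [measurable]: "\<xi> \<in> borel_measurable borel" "laplacian \<xi> \<in> borel_measurable borel"
    using test_fun_borel[OF \<xi>(1)] test_fun_borel[OF lap] by auto
  obtain C where C: "C > 0" "\<And>x. \<bar>laplacian \<xi> x\<bar> \<le> C"
    using test_fun_bounded[OF lap] by blast
  define A where "A = (\<integral>x. u x * laplacian \<xi> x \<partial>lborel) + (\<integral>x. f x * \<xi> x \<partial>lborel)"
  have lim_A: "(\<lambda>k. \<integral>x. \<Gamma> k x * \<xi> x \<partial>lborel) \<longlonglongrightarrow> A"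
  proof -
    have "(\<integral>x. \<Gamma> k x * \<xi> x \<partial>lborel) = (\<integral>x. v k x * laplacian \<xi> x \<partial>lborel) + (\<integral>x. f x * \<xi> x \<partial>lborel)" for k
      using v_defect[of k] L1loc_test_integrable[OF \<Gamma>L \<xi>(1), of k] L1loc_test_integrable[OF f \<xi>(1)]
      by (simp add: defect_def left_diff_distrib)
    moreover have "(\<lambda>k. \<integral>x. v k x * laplacian \<xi> x \<partial>lborel) \<longlonglongrightarrow> (\<integral>x. u x * laplacian \<xi> x \<partial>lborel)"
    proof (rule integral_dominated_convergence[where w = "\<lambda>x. \<bar>V x * laplacian \<xi> x\<bar>"])
      show "integrable lborel (\<lambda>x. \<bar>V x * laplacian \<xi> x\<bar>)"
        by (intro integrable_abs L1loc_test_integrable[OF VL lap])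
      show "AE x in lborel. (\<lambda>k. v k x * laplacian \<xi> x) \<longlonglongrightarrow> u x * laplacian \<xi> x"
        using lim_u
      proof eventually_elim
        case (elim x)
        then show ?case
          using test_fun_eq_0[OF lap, of x] by (cases "x \<in> \<Omega>") (auto intro!: tendsto_intros)
      qed
      show "AE x in lborel. norm (v k x * laplacian \<xi> x) \<le> \<bar>V x * laplacian \<xi> x\<bar>" for k
        using v_le_V[of k]
      proof eventually_elim
        case (elim x)
        then show ?case
          using test_fun_eq_0[OF lap, of x] by (cases "x \<in> \<Omega>") (auto simp: abs_mult intro!: mult_right_mono)
      qed
    qed auto
    ultimately show ?thesis
      unfolding A_def by (auto intro!: tendsto_intros)
  qed
  text \<open>Kato's inequality for \<open>max (v k) M\<close> bounds the contribution of \<open>{v k \<ge> M}\<close> uniformly in \<open>k\<close>.\<close>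
  define \<tau> where "\<tau> = (\<lambda>M. (\<integral>x. (if M \<le> v 0 x then 1 else 0) * ((\<bar>f x\<bar> + \<bar>g (u x)\<bar>) * \<xi> x) \<partial>lborel)
      + C * (\<integral>x. indicator K x * max (v 0 x - M) 0 \<partial>lborel))"
  have F_int: "integrable lborel (\<lambda>x. (\<bar>f x\<bar> + \<bar>g (u x)\<bar>) * \<xi> x)"
    by (intro L1loc_test_integrable[OF _ \<xi>(1)] L1loc_add L1loc_abs f guL)
  have cut_int: "integrable lborel (\<lambda>x. (if P x then 1 else 0) * h x)"
    if "integrable lborel h" "{x. P x} \<in> sets borel" for P and h :: "'a \<Rightarrow> real"
  proof (rule Bochner_Integration.integrable_bound[OF that(1)])
    show "(\<lambda>x. (if P x then 1 else 0) * h x) \<in> borel_measurable lborel"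
      using that borel_measurable_integrable[OF that(1)] by (intro borel_measurable_times measurable_If) auto
  qed auto
  have tail: "(\<integral>x. max (\<Gamma> k x - g M) 0 * \<xi> x \<partial>lborel) \<le> \<tau> M" if "M \<ge> 0" for k M
  proof -
    have gM: "g M \<ge> 0"
      using g0 monoD[OF g(2) that] by simp
    let ?i = "\<lambda>x. if M \<le> v k x then 1 else 0 :: real"
    have i_meas: "{x. M \<le> v k x} \<in> sets borel"
      by measurable
    have "L1loc \<Omega> (\<lambda>x. max (\<Gamma> k x - g M) 0)"
      by (intro L1loc_max L1loc_diff \<Gamma>L L1loc_const)
    note int = L1loc_test_integrable[OF this \<xi>(1)]
    note j1 = L1loc_test_integrable[OF L1loc_diff[OF \<Gamma>L f] \<xi>(1), of k]
    have "(\<integral>x. max (\<Gamma> k x - g M) 0 * \<xi> x \<partial>lborel)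
        \<le> (\<integral>x. ?i x * ((\<Gamma> k x - f x) * \<xi> x) + ?i x * ((\<bar>f x\<bar> + \<bar>g (u x)\<bar>) * \<xi> x) \<partial>lborel)"
    proof (rule integral_mono[OF int])
      show "integrable lborel (\<lambda>x. ?i x * ((\<Gamma> k x - f x) * \<xi> x) + ?i x * ((\<bar>f x\<bar> + \<bar>g (u x)\<bar>) * \<xi> x))"
        by (intro Bochner_Integration.integrable_add cut_int j1 F_int i_meas)
      fix x
      \<comment> \<open>Where \<open>M \<le> v k\<close>, the added terms cancel \<open>- f\<close>
        and keep the bracket nonnegative because \<open>\<Gamma> k \<ge> g u\<close>; elsewhere
        \<open>\<Gamma> k \<le> g (v k) \<le> g M\<close>.\<close>
      have "max (\<Gamma> k x - g M) 0 \<le> ?i x * (\<Gamma> k x - f x + (\<bar>f x\<bar> + \<bar>g (u x)\<bar>))"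
      proof (cases "M \<le> v k x")
        case True
        then show ?thesis
          using gM \<Gamma>_ge[of x k] by auto
      next
        case False
        then have "\<Gamma> k x \<le> g M"
          using \<Gamma>_le[of k x] monoD[OF g(2), of "v k x" M] by simp
        then show ?thesis
          using False by simp
      qed
      from mult_right_mono[OF this \<xi>(2)[of x]]
      show "max (\<Gamma> k x - g M) 0 * \<xi> x \<le> ?i x * ((\<Gamma> k x - f x) * \<xi> x) + ?i x * ((\<bar>f x\<bar> + \<bar>g (u x)\<bar>) * \<xi> x)"
        by (simp add: algebra_simps)
    qed
    also have "\<dots> = (\<integral>x. ?i x * ((\<Gamma> k x - f x) * \<xi> x) \<partial>lborel) + (\<integral>x. ?i x * ((\<bar>f x\<bar> + \<bar>g (u x)\<bar>) * \<xi> x) \<partial>lborel)"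
      by (intro Bochner_Integration.integral_add cut_int j1 F_int i_meas)
    also have "(\<integral>x. ?i x * ((\<bar>f x\<bar> + \<bar>g (u x)\<bar>) * \<xi> x) \<partial>lborel)
        \<le> (\<integral>x. (if M \<le> v 0 x then 1 else 0) * ((\<bar>f x\<bar> + \<bar>g (u x)\<bar>) * \<xi> x) \<partial>lborel)"
    proof (rule integral_mono_AE)
      show "AE x in lborel. ?i x * ((\<bar>f x\<bar> + \<bar>g (u x)\<bar>) * \<xi> x)
          \<le> (if M \<le> v 0 x then 1 else 0) * ((\<bar>f x\<bar> + \<bar>g (u x)\<bar>) * \<xi> x)"
        using lim_w
      proof eventually_elim
        case (elim x)
        then have "x \<in> \<Omega> \<Longrightarrow> v k x \<le> v 0 x"
          by auto
        then show ?case
          using test_fun_eq_0[OF \<xi>(1), of x] \<xi>(2)[of x] by (cases "x \<in> \<Omega>") auto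
      qed
    qed (intro cut_int F_int; measurable)+
    also have "(\<integral>x. ?i x * ((\<Gamma> k x - f x) * \<xi> x) \<partial>lborel) \<le> C * (\<integral>x. indicator K x * max (v 0 x - M) 0 \<partial>lborel)"
    proof -
      have "sublap \<Omega> (\<lambda>x. max (v k x) M) (\<lambda>x. if M \<le> v k x then \<Gamma> k x - f x else 0)"
        by (rule Kato[OF v_sub sublap_const \<Omega>])
      from weak_subD[OF sublapD(3)[OF this] \<xi>]
      have "(\<integral>x. ?i x * ((\<Gamma> k x - f x) * \<xi> x) \<partial>lborel) \<le> (\<integral>x. max (v k x) M * laplacian \<xi> x \<partial>lborel)"
        by (simp add: if_distrib[of "\<lambda>y. y * _"] cong: if_cong)
      \<comment> \<open>The Laplacian of a test function has integral zero, so \<open>M\<close> may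
        be subtracted and only the part of \<open>v k\<close> above \<open>M\<close> counts.\<close>
      also have "\<dots> = (\<integral>x. max (v k x) M * laplacian \<xi> x \<partial>lborel) - M * (\<integral>x. laplacian \<xi> x \<partial>lborel)"
        by (simp add: integral_laplacian_eq_0[OF \<xi>(1)])
      also have "\<dots> = (\<integral>x. max (v k x) M * laplacian \<xi> x - M * laplacian \<xi> x \<partial>lborel)"
        using L1loc_test_integrable[OF L1loc_max[OF sublapD(1)[OF v_sub] L1loc_const] lap, of k M]
          test_fun_integrable[OF lap] by simp
      also have "\<dots> \<le> (\<integral>x. C * (indicator K x * max (v 0 x - M) 0) \<partial>lborel)"
      proof (rule integral_mono_AE)
        show "integrable lborel (\<lambda>x. max (v k x) M * laplacian \<xi> x - M * laplacian \<xi> x)"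
          using L1loc_test_integrable[OF L1loc_max[OF sublapD(1)[OF v_sub] L1loc_const] lap, of k M]
            test_fun_integrable[OF lap] by simp
        show "integrable lborel (\<lambda>x. C * (indicator K x * max (v 0 x - M) 0))"
          by (intro integrable_mult_right L1loc_cut[OF _ K(2,3)] L1loc_max L1loc_diff sublapD(1)[OF v_sub] L1loc_const)
        show "AE x in lborel. max (v k x) M * laplacian \<xi> x - M * laplacian \<xi> x \<le> C * (indicator K x * max (v 0 x - M) 0)"
          using lim_w
        proof eventually_elim
          case (elim x)
          show ?case
          proof (cases "x \<in> K")
            case True
            then have "v k x \<le> v 0 x"
              using elim K(3) by auto
            have "max (v k x) M * laplacian \<xi> x - M * laplacian \<xi> x = max (v k x - M) 0 * laplacian \<xi> x"
              by (auto simp: max_def algebra_simps)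
            also have "\<dots> \<le> max (v k x - M) 0 * C"
              using C(2)[of x] by (intro mult_left_mono) auto
            also have "\<dots> \<le> max (v 0 x - M) 0 * C"
              using \<open>v k x \<le> v 0 x\<close> C(1) by (intro mult_right_mono) auto
            finally show ?thesis
              using True by (simp add: mult.commute)
          next
            case False
            then show ?thesis
              using laplacian_eq_0[OF compact_imp_closed[OF K(2)] K(4) False] by simp
          qed
        qed
      qed
      finally show ?thesis
        by simp
    qed
    finally show ?thesis
      by (simp add: \<tau>_def)
  qed
  have \<tau>_lim: "(\<lambda>m. \<tau> (real m)) \<longlonglongrightarrow> 0"
  proof -
    have ev: "\<forall>\<^sub>F m in sequentially. v 0 x < real m" for x
      using eventually_gt_at_top[of "nat \<lceil>v 0 x\<rceil>"] by eventually_elim linarith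
    have 1: "(\<lambda>m. \<integral>x. (if real m \<le> v 0 x then 1 else 0) * ((\<bar>f x\<bar> + \<bar>g (u x)\<bar>) * \<xi> x) \<partial>lborel)
        \<longlonglongrightarrow> integral\<^sup>L lborel (\<lambda>x::'a. 0 :: real)"
    proof (rule integral_dominated_convergence[where w = "\<lambda>x. \<bar>(\<bar>f x\<bar> + \<bar>g (u x)\<bar>) * \<xi> x\<bar>"])
      show "AE x in lborel. (\<lambda>m. (if real m \<le> v 0 x then 1 else 0) * ((\<bar>f x\<bar> + \<bar>g (u x)\<bar>) * \<xi> x)) \<longlonglongrightarrow> 0"
      proof (intro AE_I2 tendsto_eventually)
        fix x
        show "\<forall>\<^sub>F m in sequentially. (if real m \<le> v 0 x then 1 else 0) * ((\<bar>f x\<bar> + \<bar>g (u x)\<bar>) * \<xi> x) = 0"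
          using ev[of x] by eventually_elim simp
      qed
    qed (use F_int in auto)
    have 2: "(\<lambda>m. \<integral>x. indicator K x * max (v 0 x - real m) 0 \<partial>lborel) \<longlonglongrightarrow> integral\<^sup>L lborel (\<lambda>x::'a. 0 :: real)"
    proof (rule integral_dominated_convergence[where w = "\<lambda>x. \<bar>indicator K x * v 0 x\<bar>"])
      show "integrable lborel (\<lambda>x. \<bar>indicator K x * v 0 x\<bar>)"
        by (intro integrable_abs L1loc_cut[OF sublapD(1)[OF v_sub] K(2,3)])
      show "AE x in lborel. (\<lambda>m. indicator K x * max (v 0 x - real m) 0) \<longlonglongrightarrow> 0"
      proof (intro AE_I2 tendsto_eventually)
        fix x
        show "\<forall>\<^sub>F m in sequentially. indicator K x * max (v 0 x - real m) 0 = 0"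
          using ev[of x] by eventually_elim simp
      qed
      show "(\<lambda>x. indicator K x * max (v 0 x - real m) 0) \<in> borel_measurable lborel" for m
        using K(2) by (intro borel_measurable_times borel_measurable_indicator)
          (auto intro: borel_closed compact_imp_closed)
    qed (auto simp: indicator_def max_def)
    have "(\<lambda>m. \<tau> (real m)) \<longlonglongrightarrow> integral\<^sup>L lborel (\<lambda>x::'a. 0 :: real) + C * integral\<^sup>L lborel (\<lambda>x::'a. 0 :: real)"
      unfolding \<tau>_def by (intro tendsto_intros 1 2)
    then show ?thesis
      by simp
  qed
  have bound: "A \<le> (\<integral>x. g (u x) * \<xi> x \<partial>lborel) + \<tau> M" if "M \<ge> 0" for M
  proof -
    have gM: "g M \<ge> 0"
      using g0 monoD[OF g(2) that] by simp
    note m_int = L1loc_test_integrable[OF L1loc_add[OF L1loc_abs[OF guL] L1loc_const] \<xi>(1)]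
    have lim: "(\<lambda>k. \<integral>x. min (\<Gamma> k x) (g M) * \<xi> x \<partial>lborel) \<longlonglongrightarrow> (\<integral>x. min (g (u x)) (g M) * \<xi> x \<partial>lborel)"
    proof (rule integral_dominated_convergence[where w = "\<lambda>x. (\<bar>g (u x)\<bar> + g M) * \<xi> x", OF _ _ m_int])
      show "AE x in lborel. (\<lambda>k. min (\<Gamma> k x) (g M) * \<xi> x) \<longlonglongrightarrow> min (g (u x)) (g M) * \<xi> x"
        using lim_u
      proof eventually_elim
        case (elim x)
        show ?case
        proof (cases "x \<in> \<Omega>")
          case True
          then have "(\<lambda>k. \<Gamma> k x) \<longlonglongrightarrow> g (u x)"
            unfolding \<Gamma>_def using elim uv by (intro lip_tendsto[OF g]) auto
          then show ?thesis
            by (intro tendsto_intros)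
        qed (simp add: test_fun_eq_0[OF \<xi>(1)])
      qed
      show "AE x in lborel. norm (min (\<Gamma> k x) (g M) * \<xi> x) \<le> (\<bar>g (u x)\<bar> + g M) * \<xi> x" for k
      proof (rule AE_I2)
        fix x
        have "\<bar>min (\<Gamma> k x) (g M)\<bar> \<le> \<bar>g (u x)\<bar> + g M"
          using gM \<Gamma>_ge[of x k] by (auto simp: min_def)
        then show "norm (min (\<Gamma> k x) (g M) * \<xi> x) \<le> (\<bar>g (u x)\<bar> + g M) * \<xi> x"
          using \<xi>(2)[of x] by (simp add: abs_mult mult_right_mono)
      qed
    qed auto
    have "(\<integral>x. \<Gamma> k x * \<xi> x \<partial>lborel) \<le> (\<integral>x. min (\<Gamma> k x) (g M) * \<xi> x \<partial>lborel) + \<tau> M" for k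
    proof -
      have "L1loc \<Omega> (\<lambda>x. min (\<Gamma> k x) (g M))"
        by (rule L1loc_bound[OF L1loc_add[OF L1loc_abs[OF \<Gamma>L[of k]] L1loc_const[of _ "g M"]]])
          (use gM in \<open>auto simp: min_def\<close>)
      note i1 = L1loc_test_integrable[OF this \<xi>(1)]
      note i2 = L1loc_test_integrable[OF L1loc_max[OF L1loc_diff[OF \<Gamma>L[of k] L1loc_const[of _ "g M"]] L1loc_const[of _ 0]] \<xi>(1)]
      have "(\<integral>x. \<Gamma> k x * \<xi> x \<partial>lborel) = (\<integral>x. min (\<Gamma> k x) (g M) * \<xi> x + max (\<Gamma> k x - g M) 0 * \<xi> x \<partial>lborel)"
        by (intro Bochner_Integration.integral_cong refl) (auto simp: min_def max_def algebra_simps)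
      also have "\<dots> = (\<integral>x. min (\<Gamma> k x) (g M) * \<xi> x \<partial>lborel) + (\<integral>x. max (\<Gamma> k x - g M) 0 * \<xi> x \<partial>lborel)"
        by (rule Bochner_Integration.integral_add[OF i1 i2])
      finally show ?thesis
        using tail[OF that, of k] by simp
    qed
    then have "A \<le> (\<integral>x. min (g (u x)) (g M) * \<xi> x \<partial>lborel) + \<tau> M"
      by (intro LIMSEQ_le[OF lim_A tendsto_add[OF lim tendsto_const]]) auto
    also have "(\<integral>x. min (g (u x)) (g M) * \<xi> x \<partial>lborel) \<le> (\<integral>x. g (u x) * \<xi> x \<partial>lborel)"
    proof (rule integral_mono)
      have "L1loc \<Omega> (\<lambda>x. min (g (u x)) (g M))"
        by (rule L1loc_bound[OF L1loc_add[OF L1loc_abs[OF guL] L1loc_const[of _ "g M"]]])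
          (use gM in \<open>auto simp: min_def\<close>)
      from L1loc_test_integrable[OF this \<xi>(1)]
      show "integrable lborel (\<lambda>x. min (g (u x)) (g M) * \<xi> x)" .
    qed (use L1loc_test_integrable[OF guL \<xi>(1)] \<xi>(2) in \<open>auto intro: mult_right_mono\<close>)
    finally show ?thesis
      by simp
  qed
  have "A \<le> (\<integral>x. g (u x) * \<xi> x \<partial>lborel) + 0"
    by (rule LIMSEQ_le_const[OF tendsto_add[OF tendsto_const \<tau>_lim]]) (use bound in auto)
  then have "defect u (\<lambda>x. g (u x) - f x) \<xi> \<le> 0"
    using L1loc_test_integrable[OF guL \<xi>(1)] L1loc_test_integrable[OF f \<xi>(1)]
    by (simp add: defect_def A_def left_diff_distrib)
  then show ?thesis
    using defect_nonneg[OF u \<xi>] by simp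
qed

text \<open>Adding a large multiple of a bump makes any test function nonnegative, and the defect is
  additive.\<close>

lemma defect_eq_0_if_nonneg:
  fixes \<Omega> :: "'a::euclidean_space set"
  assumes u: "sublap \<Omega> u G" and \<Omega>: "open \<Omega>"
    and 0: "\<And>\<xi>. test_fun \<Omega> \<xi> \<Longrightarrow> (\<And>x. 0 \<le> \<xi> x) \<Longrightarrow> defect u G \<xi> = 0"
    and \<phi>: "test_fun \<Omega> \<phi>"
  shows "defect u G \<phi> = 0"
proof -
  obtain K where K: "compact K" "K \<subseteq> \<Omega>" "\<And>x. x \<notin> K \<Longrightarrow> \<phi> x = 0"
    using \<phi> by (rule test_funE) blast
  obtain \<kappa> where \<kappa>: "test_fun \<Omega> \<kappa>" "\<And>x. 0 \<le> \<kappa> x" "\<And>x. x \<in> K \<Longrightarrow> \<kappa> x = 1"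
    using test_fun_bump[OF K(1) \<Omega> K(2)] by metis
  obtain C where C: "C > 0" "\<And>x. \<bar>\<phi> x\<bar> \<le> C"
    using test_fun_bounded[OF \<phi>] by blast
  note C\<kappa> = test_fun_cmult[OF \<kappa>(1), of C]
  have nonneg: "0 \<le> \<phi> x + C * \<kappa> x" for x
    using C(2)[of x] K(3)[of x] \<kappa>(2,3)[of x] C(1) by (cases "x \<in> K") auto
  have "defect u G \<phi> + defect u G (\<lambda>x. C * \<kappa> x) = 0"
    using 0[OF test_fun_add[OF \<phi> C\<kappa>] nonneg] by (simp add: defect_add[OF u \<phi> C\<kappa>])
  moreover have "defect u G (\<lambda>x. C * \<kappa> x) = 0"
    using C(1) \<kappa>(2) by (intro 0 C\<kappa>) simp
  ultimately show ?thesis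
    by simp
qed

subsection \<open>From Lebesgue to Borel functions\<close>

text \<open>An exhaustion by compact sets makes the function, cut to \<open>\<Omega>\<close>,
  Lebesgue measurable as a whole, so one Borel representative serves for all compact sets.\<close>

lemma loc_integrable_borel_representative:
  fixes u :: "'a::euclidean_space \<Rightarrow> real"
  assumes u: "loc_integrable \<Omega> u" and "open \<Omega>"
  obtains u' where "L1loc \<Omega> u'" "AE x in lborel. x \<in> \<Omega> \<longrightarrow> u' x = u x"
proof -
  have int: "integrable lebesgue (\<lambda>x. indicator K x * u x)" if "compact K" "K \<subseteq> \<Omega>" for K
    using u that by (simp add: loc_integrable_def set_integrable_def)
  obtain C :: "nat \<Rightarrow> 'a set" where C: "\<And>n. compact (C n)" "\<And>n. C n \<subseteq> \<Omega>"
    "\<And>n. C n \<subseteq> interior (C (Suc n))" "\<Union>(range C) = \<Omega>"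
    using open_Union_compact_subsets[OF \<open>open \<Omega>\<close>] by metis
  have "C n \<subseteq> C (Suc n)" for n
    using C(3)[of n] interior_subset by blast
  then have C_mono: "C m \<subseteq> C n" if "m \<le> n" for m n
    by (rule lift_Suc_mono_le[OF _ that])
  have "(\<lambda>x. indicator \<Omega> x * u x) \<in> borel_measurable lebesgue"
  proof (rule borel_measurable_LIMSEQ_real)
    show "(\<lambda>x. indicator (C n) x * u x) \<in> borel_measurable lebesgue" for n
      using int[OF C(1,2)] by (rule borel_measurable_integrable)
    fix x
    show "(\<lambda>n. indicator (C n) x * u x) \<longlonglongrightarrow> indicator \<Omega> x * u x"
    proof (cases "x \<in> \<Omega>")
      case True
      then obtain m where "x \<in> C m"
        using C(4) by auto
      then have "indicator (C n) x * u x = indicator \<Omega> x * u x" if "n \<ge> m" for n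
        using C_mono[OF that] True by (auto simp: indicator_def)
      then show ?thesis
        by (intro tendsto_eventually) (auto simp: eventually_sequentially)
    next
      case False
      then have "x \<notin> C n" for n
        using C(2) by blast
      with False show ?thesis
        by simp
    qed
  qed
  from completion_ex_borel_measurable_real[OF this]
  obtain u' where u': "u' \<in> borel_measurable borel" "AE x in lborel. indicator \<Omega> x * u x = u' x"
    by auto
  have eq: "AE x in lborel. x \<in> \<Omega> \<longrightarrow> u' x = u x"
    using u'(2) by eventually_elim auto
  have "L1loc \<Omega> u'"
    unfolding L1loc_def
  proof (intro conjI allI impI u'(1))
    fix K assume K: "compact K" "K \<subseteq> \<Omega>"
    have borel: "(\<lambda>x. indicator K x * u' x) \<in> borel_measurable lborel"
      using u'(1) K(1) by (auto intro!: borel_measurable_times borel_measurable_indicator borel_closed compact_imp_closed)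
    have "integrable lebesgue (\<lambda>x. indicator K x * u' x)"
    proof (rule integrable_cong_AE_imp[OF int[OF K]])
      show "(\<lambda>x. indicator K x * u' x) \<in> borel_measurable lebesgue"
        by (rule measurable_completion[OF borel])
      show "AE x in lebesgue. indicator K x * u x = indicator K x * u' x"
        using AE_completion[OF eq] by eventually_elim (use K(2) in \<open>auto simp: indicator_def\<close>)
    qed
    then show "integrable lborel (\<lambda>x. indicator K x * u' x)"
      by (simp only: integrable_completion[OF borel])
  qed
  with eq show thesis
    by (rule that[rotated])
qed

lemma L1loc_loc_integrable:
  assumes "L1loc \<Omega> u"
  shows "loc_integrable \<Omega> u"
  unfolding loc_integrable_def set_integrable_def
proof (intro allI impI)
  fix K assume "compact K \<and> K \<subseteq> \<Omega>"
  then have "integrable lborel (\<lambda>x. indicator K x *\<^sub>R u x)"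
    using assms by (simp add: L1loc_def)
  then show "integrable lebesgue (\<lambda>x. indicator K x *\<^sub>R u x)"
    by (simp only: integrable_completion[OF borel_measurable_integrable])
qed

lemma lebesgue_test_integral:
  fixes u u' :: "'a::euclidean_space \<Rightarrow> real"
  assumes u: "loc_integrable \<Omega> u" and u': "L1loc \<Omega> u'"
    and eq: "AE x in lborel. x \<in> \<Omega> \<longrightarrow> u' x = u x" and \<phi>: "test_fun \<Omega> \<phi>"
  shows "integrable lebesgue (\<lambda>x. u x * \<phi> x)"
    and "(\<integral>x. u x * \<phi> x \<partial>lebesgue) = (\<integral>x. u' x * \<phi> x \<partial>lborel)"
proof -
  obtain K where K: "compact K" "K \<subseteq> \<Omega>" "\<And>x. x \<notin> K \<Longrightarrow> \<phi> x = 0"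
    using \<phi> by (rule test_funE) blast
  obtain C where C: "\<And>x. \<bar>\<phi> x\<bar> \<le> C"
    using test_fun_bounded[OF \<phi>] by blast
  have \<phi>b: "\<phi> \<in> borel_measurable lborel"
    using test_fun_borel[OF \<phi>] by simp
  have "integrable lebesgue (\<lambda>x. indicator K x * u x)"
    using u K(1,2) by (simp add: loc_integrable_def set_integrable_def)
  from integrable_mult_bounded[OF this measurable_completion[OF \<phi>b] C]
  have "integrable lebesgue (\<lambda>x. indicator K x * u x * \<phi> x)" .
  also have "(\<lambda>x. indicator K x * u x * \<phi> x) = (\<lambda>x. u x * \<phi> x)"
    using K(3) by (auto simp: indicator_def fun_eq_iff)
  finally show int: "integrable lebesgue (\<lambda>x. u x * \<phi> x)" .
  have borel: "(\<lambda>x. u' x * \<phi> x) \<in> borel_measurable lborel"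
    using L1loc_test_integrable[OF u' \<phi>] by (rule borel_measurable_integrable)
  have "(\<integral>x. u x * \<phi> x \<partial>lebesgue) = (\<integral>x. u' x * \<phi> x \<partial>lebesgue)"
  proof (rule integral_cong_AE[OF borel_measurable_integrable[OF int] measurable_completion[OF borel]])
    show "AE x in lebesgue. u x * \<phi> x = u' x * \<phi> x"
      using AE_completion[OF eq] by eventually_elim (use test_fun_eq_0[OF \<phi>] in auto)
  qed
  also have "\<dots> = (\<integral>x. u' x * \<phi> x \<partial>lborel)"
    by (rule integral_completion[OF borel])
  finally show "(\<integral>x. u x * \<phi> x \<partial>lebesgue) = (\<integral>x. u' x * \<phi> x \<partial>lborel)" .
qed

text \<open>\<open>g (u' x)\<close> is Borel because \<open>u'\<close> is, and a Borel
  representative of \<open>g (u x)\<close> dominates it. The distributional conditions thereby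
  become conditions on \<open>defect\<close>, with the opposite sign.\<close>

lemma admissible_representative:
  fixes u :: "'a::euclidean_space \<Rightarrow> real"
  assumes u: "admissible \<Omega> g u" and "open \<Omega>" and g: "continuous_on UNIV g"
    and f: "loc_integrable \<Omega> f" and f': "L1loc \<Omega> f'" "AE x in lborel. x \<in> \<Omega> \<longrightarrow> f' x = f x"
  obtains u' where "L1loc \<Omega> u'" "L1loc \<Omega> (\<lambda>x. g (u' x))" "AE x in lborel. x \<in> \<Omega> \<longrightarrow> u' x = u x"
    "\<forall>\<phi>. test_fun \<Omega> \<phi> \<longrightarrow> op_pair g f u \<phi> = - defect u' (\<lambda>x. g (u' x) - f' x) \<phi>"
proof -
  have uL: "loc_integrable \<Omega> u" and guL: "loc_integrable \<Omega> (\<lambda>x. g (u x))"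
    using u by (auto simp: admissible_def)
  obtain u' where u': "L1loc \<Omega> u'" "AE x in lborel. x \<in> \<Omega> \<longrightarrow> u' x = u x"
    using loc_integrable_borel_representative[OF uL \<open>open \<Omega>\<close>] .
  obtain h where h: "L1loc \<Omega> h" "AE x in lborel. x \<in> \<Omega> \<longrightarrow> h x = g (u x)"
    using loc_integrable_borel_representative[OF guL \<open>open \<Omega>\<close>] .
  have gu': "L1loc \<Omega> (\<lambda>x. g (u' x))"
  proof (rule L1loc_bound[OF h(1)])
    show "(\<lambda>x. g (u' x)) \<in> borel_measurable borel"
      by (rule measurable_compose[OF L1loc_borel[OF u'(1)] borel_measurable_continuous_onI[OF g]])
    show "AE x in lborel. x \<in> \<Omega> \<longrightarrow> \<bar>g (u' x)\<bar> \<le> \<bar>h x\<bar>"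
      using u'(2) h(2) by eventually_elim auto
  qed
  have gu'_eq: "AE x in lborel. x \<in> \<Omega> \<longrightarrow> g (u' x) = g (u x)"
    using u'(2) by eventually_elim auto
  have "op_pair g f u \<phi> = - defect u' (\<lambda>x. g (u' x) - f' x) \<phi>" if \<phi>: "test_fun \<Omega> \<phi>" for \<phi>
  proof -
    note a = lebesgue_test_integral[OF uL u'(1,2) test_fun_laplacian[OF \<phi>]]
    note b = lebesgue_test_integral[OF guL gu' gu'_eq \<phi>]
    note c = lebesgue_test_integral[OF f f' \<phi>]
    have "op_pair g f u \<phi> = - (\<integral>x. u x * laplacian \<phi> x \<partial>lebesgue) + (\<integral>x. g (u x) * \<phi> x \<partial>lebesgue)
        - (\<integral>x. f x * \<phi> x \<partial>lebesgue)"
      using a(1) b(1) c(1) by (simp add: op_pair_def)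
    then show ?thesis
      using L1loc_test_integrable[OF gu' \<phi>] L1loc_test_integrable[OF f'(1) \<phi>]
      by (simp add: a(2) b(2) c(2) defect_def left_diff_distrib)
  qed
  with u' gu' show thesis
    by (intro that[of u']) auto
qed

lemma sublap_from_defect:
  assumes "L1loc \<Omega> u" "L1loc \<Omega> G"
    and "\<And>\<phi>. test_fun \<Omega> \<phi> \<Longrightarrow> (\<And>x. 0 \<le> \<phi> x) \<Longrightarrow> 0 \<le> defect u G \<phi>"
  shows "sublap \<Omega> u G"
  using assms by (auto simp: sublap_def weak_sub_def defect_def)

theorem theoremI:
  fixes \<Omega> :: "'a::euclidean_space set" and g :: "real \<Rightarrow> real"
  assumes "DIM('a) \<ge> 2"
    and "open \<Omega>" and "connected \<Omega>"
    and "continuous_on UNIV g" and "mono g" and "g 0 \<ge> 0"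
    and "keller_osserman g"
    and "\<exists>w. is_subsolution \<Omega> g (\<lambda>_. 0) w"
  shows "\<forall>f. loc_integrable \<Omega> f \<and> (AE x in lebesgue. x \<in> \<Omega> \<longrightarrow> f x \<ge> 0) \<longrightarrow>
           (\<exists>ubar. is_solution \<Omega> g f ubar \<and>
              (\<forall>U. is_solution \<Omega> g f U \<longrightarrow> (AE x in lebesgue. x \<in> \<Omega> \<longrightarrow> U x \<le> ubar x)))"
proof (intro allI impI, elim conjE)
  fix f :: "'a \<Rightarrow> real"
  assume f: "loc_integrable \<Omega> f" and f_nonneg: "AE x in lebesgue. x \<in> \<Omega> \<longrightarrow> f x \<ge> 0"
  note \<Omega> = \<open>open \<Omega>\<close> and g = \<open>continuous_on UNIV g\<close> \<open>mono g\<close>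
  obtain f0 where f0: "L1loc \<Omega> f0" "AE x in lborel. x \<in> \<Omega> \<longrightarrow> f0 x = f x"
    using loc_integrable_borel_representative[OF f \<Omega>] .
  \<comment> \<open>\<open>f\<close> is nonnegative only almost everywhere in
    \<open>\<Omega>\<close>, whereas the local bounds ask for it at every point.\<close>
  define f' where "f' = (\<lambda>x. max (f0 x) 0)"
  have f': "L1loc \<Omega> f'" "\<And>x. 0 \<le> f' x"
    unfolding f'_def by (intro L1loc_max f0(1) L1loc_const) simp
  have f'_eq: "AE x in lborel. x \<in> \<Omega> \<longrightarrow> f' x = f x"
    using f0(2) f_nonneg[unfolded AE_completion_iff] by eventually_elim (auto simp: f'_def)
  obtain w where w: "is_subsolution \<Omega> g (\<lambda>_. 0) w"
    using assms(8) by blast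
  have z: "loc_integrable \<Omega> (\<lambda>_. 0)" "L1loc \<Omega> (\<lambda>_. 0)" "AE x in lborel. x \<in> \<Omega> \<longrightarrow> (0::real) = 0"
    by (auto simp: L1loc_const intro: L1loc_loc_integrable)
  have w_adm: "admissible \<Omega> g w"
    using w by (simp add: is_subsolution_def)
  obtain w' where w': "L1loc \<Omega> w'" "L1loc \<Omega> (\<lambda>x. g (w' x))" "AE x in lborel. x \<in> \<Omega> \<longrightarrow> w' x = w x"
    "\<forall>\<phi>. test_fun \<Omega> \<phi> \<longrightarrow> op_pair g (\<lambda>_. 0) w \<phi> = - defect w' (\<lambda>x. g (w' x) - 0) \<phi>"
    by (rule admissible_representative[OF w_adm \<Omega> g(1) z])
  have "sublap \<Omega> w' (\<lambda>x. g (w' x) - 0)"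
    using w w' by (intro sublap_from_defect) (auto simp: is_subsolution_def)
  \<comment> \<open>The given subsolution belongs to the right-hand side \<open>0\<close>;
    subtracting \<open>f' \<ge> 0\<close> only weakens the inequality.\<close>
  then have w'_sub: "sublap \<Omega> w' (\<lambda>x. g (w' x) - f' x)"
    by (rule sublap_mono_rhs) (use f' L1loc_diff[OF w'(2) f'(1)] in auto)
  obtain u where u: "sublap \<Omega> u (\<lambda>x. g (u x) - f' x)"
    "\<And>v. sublap \<Omega> v (\<lambda>x. g (v x) - f' x) \<Longrightarrow> AE x in lborel. x \<in> \<Omega> \<longrightarrow> v x \<le> u x"
    using maximal_subsolution_ex[OF g \<Omega> f'(1) assms(6,7) f'(2) w'_sub] by blast
  have defect_u: "defect u (\<lambda>x. g (u x) - f' x) \<phi> = 0" if "test_fun \<Omega> \<phi>" for \<phi>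
    by (rule defect_eq_0_if_nonneg[OF u(1) \<Omega> _ that])
      (rule maximal_subsolution_defect_eq_0[OF g assms(6) \<Omega> f'(1) u])
  have guL: "L1loc \<Omega> (\<lambda>x. g (u x))"
    using L1loc_add[OF sublapD(2)[OF u(1)] f'(1)] by simp
  have adm: "admissible \<Omega> g u"
    unfolding admissible_def by (intro conjI L1loc_loc_integrable sublapD(1)[OF u(1)] guL)
  have "op_pair g f u \<phi> = 0" if \<phi>: "test_fun \<Omega> \<phi>" for \<phi>
  proof -
    note a = lebesgue_test_integral[OF L1loc_loc_integrable[OF sublapD(1)[OF u(1)]] sublapD(1)[OF u(1)] _ test_fun_laplacian[OF \<phi>]]
    note b = lebesgue_test_integral[OF L1loc_loc_integrable[OF guL] guL _ \<phi>]
    note c = lebesgue_test_integral[OF f f'(1) f'_eq \<phi>]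
    have "op_pair g f u \<phi> = - (\<integral>x. u x * laplacian \<phi> x \<partial>lebesgue) + (\<integral>x. g (u x) * \<phi> x \<partial>lebesgue)
        - (\<integral>x. f x * \<phi> x \<partial>lebesgue)"
      using a(1) b(1) c(1) by (simp add: op_pair_def)
    also have "\<dots> = - defect u (\<lambda>x. g (u x) - f' x) \<phi>"
      using L1loc_test_integrable[OF guL \<phi>] L1loc_test_integrable[OF f'(1) \<phi>]
      by (simp add: a(2) b(2) c(2) defect_def left_diff_distrib)
    finally show ?thesis
      by (simp add: defect_u[OF \<phi>])
  qed
  then have sol: "is_solution \<Omega> g f u"
    using adm by (simp add: is_solution_def)
  have "AE x in lebesgue. x \<in> \<Omega> \<longrightarrow> U x \<le> u x" if U: "is_solution \<Omega> g f U" for U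
  proof -
    have U_adm: "admissible \<Omega> g U"
      using U by (simp add: is_solution_def)
    obtain U' where U': "L1loc \<Omega> U'" "L1loc \<Omega> (\<lambda>x. g (U' x))" "AE x in lborel. x \<in> \<Omega> \<longrightarrow> U' x = U x"
      "\<forall>\<phi>. test_fun \<Omega> \<phi> \<longrightarrow> op_pair g f U \<phi> = - defect U' (\<lambda>x. g (U' x) - f' x) \<phi>"
      by (rule admissible_representative[OF U_adm \<Omega> g(1) f f'(1) f'_eq])
    \<comment> \<open>A solution is in particular a subsolution, so the largest subsolution bounds
      all solutions.\<close>
    have "sublap \<Omega> U' (\<lambda>x. g (U' x) - f' x)"
      using U U'(4) by (intro sublap_from_defect L1loc_diff U'(1,2) f'(1)) (auto simp: is_solution_def)
    from u(2)[OF this] U'(3) have "AE x in lborel. x \<in> \<Omega> \<longrightarrow> U x \<le> u x"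
      by eventually_elim auto
    then show ?thesis
      by (rule AE_completion)
  qed
  with sol show "\<exists>ubar. is_solution \<Omega> g f ubar \<and>
      (\<forall>U. is_solution \<Omega> g f U \<longrightarrow> (AE x in lebesgue. x \<in> \<Omega> \<longrightarrow> U x \<le> ubar x))"
    by blast
qed

end
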